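(* Let $\Lambda$ be a ring with identity and let $T$ be a tilting complex in $K^b(\mathrm{proj}\text{-}\Lambda)$. Then the operation $\Theta\colon C(\mathrm{Sum}\text{-}T)\to C(\mathbb{Z}_+\mathrm{Proj}\text{-}\Lambda)$ induces a triangle functor from $K(\mathrm{Sum}\text{-}T)$ to $K_\eta(\mathbb{Z}_+\mathrm{Proj}\text{-}\Lambda)$.
   Context: $\mathrm{Proj}\text{-}\Lambda$ is the category of projective $\Lambda$-modules and $\mathrm{proj}\text{-}\Lambda$ that of finitely generated projective $\Lambda$-modules. $C(-)$, $K(-)$, $K^b(-)$ denote the category of complexes, the homotopy category of unbounded complexes, and the homotopy category of bounded complexes. A tilting complex is an object $T$ of $K^b(\mathrm{proj}\text{-}\Lambda)$ with (i) $\mathrm{Hom}_{K^b(\mathrm{proj}\text{-}\Lambda)}(T,T[n])=0$ for all $n\ne0$, and (ii) $\mathrm{add}\text{-}T$ (direct summands of finite direct sums of copies of $T$) generates $K^b(\mathrm{proj}\text{-}\Lambda)$ as a triangulated category. $\mathrm{Sum}\text{-}T$ is the full subcategory of $K(\mathrm{Proj}\text{-}\Lambda)$ whose objects are the (arbitrary) direct sums of copies of $T$. The category $\mathbb{Z}_+\mathcal{A}$ (for an additive category $\mathcal{A}$): objects are $\mathbb{Z}$-graded objects $X^\bullet=(X^j)_{j\in\mathbb{Z}}$ of $\mathcal{A}$; a morphism $f\colon X^\bullet\to Y^\bullet$ is a collection $f=\{f_0,f_1,\dots\}$ with $f_n=(f_n^j\colon X^j\to Y^{j+n})_{j}$; composition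 is $(gf)_n^j=\sum_{k=0}^ng_{n-k}^{j+k}f_k^j$. The automorphism $(1)$ is $(X^\bullet(1))^j=X^{j+1}$, $(f(1))_n^j=f_n^{j+1}$, and $\eta\colon(1)\to\mathrm{Id}$ is $\eta_{X^\bullet}=\{0,\mathrm{Id},0,0,\dots\}$, whose degree-one component $(X^\bullet(1))^j=X^{j+1}\to X^{j+1}$ is the identity. An object of $C(\mathbb{Z}_+\mathcal{A})$ is a bigraded object $X^{\bullet\bullet}$ with morphisms $d_n^{ij}\colon X^{ij}\to X^{i+1,j+n}$ ($n\ge0$) such that $\sum_{p+q=n}d_pd_q=0$ for all $n\ge0$; a morphism is a collection $f_n^{ij}\colon X^{ij}\to Y^{i,j+n}$ ($n\ge0$) with $\sum_{p+q=n}f_pd_{X,q}=\sum_{p+q=n}d_{Y,p}f_q$. The functor $(1)$ and the transformation $\eta$ extend termwise to $C(\mathbb{Z}_+\mathcal{A})$. The shift is $(X[1])^n=X^{n+1}$, $d_{X[1]}^n=-d_X^{n+1}$, and the cone $\mathrm{Con}(f)$ of $f\colon X\to Y$ has terms $X^{n+1}\oplus Y^n$ and differential $\begin{pmatrix}-d_X^{n+1}&0\\ f^{n+1}&d_Y^n\end{pmatrix}$. $K_\eta(\mathbb{Z}_+\mathcal{A})$ is the stable category of the Frobenius category $(C(\mathbb{Z}_+\mathcal{A}),\mathcal{E}_\eta)$, where $\mathcal{E}_\eta$ consists of the kernel-cokernel pairs isomorphic to $Y\xrightarrow{\binom01}\mathrm{Con}(f)\xrightarrow{(1\ 0)}X[1]$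 for a chain map $f\colon X\to Y$ factoring through $\eta_Y\colon Y(1)\to Y$; its morphisms are chain maps modulo those factoring through an injective object. It is triangulated with translation functor $(1)[1]$, and each chain map $f\colon X\to Y$ gives a standard triangle $X\xrightarrow{\overline f}Y\xrightarrow{\binom01}\mathrm{Con}(f\eta_X)\xrightarrow{(1\ 0)}X(1)[1]$. Objects of $C(\mathrm{Sum}\text{-}T)$: an object is written $X=(X^{\bullet\bullet},\delta_0,\delta_1)$, where for each $j$ the complex $X^{\bullet,j}$ with differential $\delta_0^{ij}\colon X^{ij}\to X^{i+1,j}$ lies in $\mathrm{Sum}\text{-}T$, and $\delta_1^{\bullet,j}\colon X^{\bullet,j}\to X^{\bullet,j+1}$ is a chain map (representing the differential of $X$) with $\delta_1\delta_1$ null-homotopic. Morphisms are likewise families of chain maps $\alpha^{\bullet,j}\colon X^{\bullet,j}\to Y^{\bullet,j}$ representing homotopy classes. The operation $\Theta$: by results of Rickard, for each object $X$ of $C(\mathrm{Sum}\text{-}T)$ there is an object $(\Theta(X),d_n\colon n\ge0)$ of $C(\mathbb{Z}_+\mathrm{Proj}\text{-}\Lambda)$ with $(\Theta(X))^{ij}=X^{i-j,j}$, $d_0^{ij}=\delta_0^{i-j,j}$, $d_1^{ij}=(-1)^i\delta_1^{i-j,j}$, and for each morphism $\alpha\colon X\to Y$ in $C(\mathrm{Sum}\text{-}T)$ there is a morphism $\Theta(\alpha)=\{f_0,f_1,\dots\}\colon\Theta(X)\to\Theta(Y)$ with $f_0^{ij}=\alpha^{i-j,j}$. $\Theta$ denotes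 a fixed choice of such objects and morphisms (it need not be a functor before passing to $K_\eta$). *)

theory Defs
  imports "HOL-Algebra.Module"
begin

section \<open>Additive categories\<close>

text \<open>
  Arrows do not carry their source and target, so every operation takes the objects involved as
  arguments: \<open>ccomp C X Y Z g f\<close> is the composite of \<open>f : X \<rightarrow> Y\<close> and \<open>g : Y \<rightarrow> Z\<close>. All data are
  relevant only on objects in \<open>Ob C\<close> and arrows in the hom-sets. The additive structure,
  including a choice of binary direct sums \<open>csum\<close> with their injections and projections, is part
  of the record.
\<close>

record ('o, 'm) cat =
  Ob :: "'o set"
  Hom :: "'o \<Rightarrow> 'o \<Rightarrow> 'm set"
  cid :: "'o \<Rightarrow> 'm"
  ccomp :: "'o \<Rightarrow> 'o \<Rightarrow> 'o \<Rightarrow> 'm \<Rightarrow> 'm \<Rightarrow> 'm"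
  czero :: "'o \<Rightarrow> 'o \<Rightarrow> 'm"
  cadd :: "'o \<Rightarrow> 'o \<Rightarrow> 'm \<Rightarrow> 'm \<Rightarrow> 'm"
  cneg :: "'o \<Rightarrow> 'o \<Rightarrow> 'm \<Rightarrow> 'm"
  csum :: "'o \<Rightarrow> 'o \<Rightarrow> 'o"
  cin1 :: "'o \<Rightarrow> 'o \<Rightarrow> 'm"
  cin2 :: "'o \<Rightarrow> 'o \<Rightarrow> 'm"
  cpr1 :: "'o \<Rightarrow> 'o \<Rightarrow> 'm"
  cpr2 :: "'o \<Rightarrow> 'o \<Rightarrow> 'm"

definition cat_iso :: "('o, 'm, 'z) cat_scheme \<Rightarrow> 'o \<Rightarrow> 'o \<Rightarrow> 'm \<Rightarrow> bool" where
  "cat_iso C X Y f \<longleftrightarrow> f \<in> Hom C X Y \<and>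
     (\<exists>g \<in> Hom C Y X. ccomp C X Y X g f = cid C X \<and> ccomp C Y X Y f g = cid C Y)"

definition isomorphic :: "('o, 'm, 'z) cat_scheme \<Rightarrow> 'o \<Rightarrow> 'o \<Rightarrow> bool" where
  "isomorphic C X Y \<longleftrightarrow> (\<exists>f. cat_iso C X Y f)"

definition zero_object :: "('o, 'm, 'z) cat_scheme \<Rightarrow> 'o \<Rightarrow> bool" where
  "zero_object C X \<longleftrightarrow> cid C X = czero C X X"

definition full_sub :: "('o, 'm, 'z) cat_scheme \<Rightarrow> 'o set \<Rightarrow> ('o, 'm, 'z) cat_scheme" where
  "full_sub C S = C\<lparr>Ob := Ob C \<inter> S\<rparr>"

text \<open>The arrow \<open>A \<oplus> B \<rightarrow> A' \<oplus> B'\<close> with matrix \<open>(a b; c d)\<close>, acting on columns.\<close>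

definition cmat ::
  "('o, 'm) cat \<Rightarrow> 'o \<Rightarrow> 'o \<Rightarrow> 'o \<Rightarrow> 'o \<Rightarrow> 'm \<Rightarrow> 'm \<Rightarrow> 'm \<Rightarrow> 'm \<Rightarrow> 'm" where
  "cmat C A B A' B' a b c d =
    (let U = csum C A B; V = csum C A' B';
         i1 = cin1 C A' B'; i2 = cin2 C A' B'; p1 = cpr1 C A B; p2 = cpr2 C A B
     in cadd C U V
          (cadd C U V
            (ccomp C U A V (ccomp C A A' V i1 a) p1)
            (ccomp C U B V (ccomp C B A' V i1 b) p2))
          (cadd C U V
            (ccomp C U A V (ccomp C A B' V i2 c) p1)
            (ccomp C U B V (ccomp C B B' V i2 d) p2)))"

primrec cat_sum_upto :: "('o, 'm) cat \<Rightarrow> 'o \<Rightarrow> 'o \<Rightarrow> (nat \<Rightarrow> 'm) \<Rightarrow> nat \<Rightarrow> 'm" where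
  "cat_sum_upto C X Y f 0 = f 0"
| "cat_sum_upto C X Y f (Suc n) = cadd C X Y (cat_sum_upto C X Y f n) (f (Suc n))"

text \<open>The sign \<open>(-1)\<^sup>i f\<close> for an integer \<open>i\<close>.\<close>

definition cat_sgn :: "('o, 'm) cat \<Rightarrow> 'o \<Rightarrow> 'o \<Rightarrow> int \<Rightarrow> 'm \<Rightarrow> 'm" where
  "cat_sgn C X Y i f = (if even i then f else cneg C X Y f)"

subsection \<open>Quotients by an ideal of arrows\<close>

definition cat_cls ::
  "('o, 'm) cat \<Rightarrow> ('o \<Rightarrow> 'o \<Rightarrow> 'm \<Rightarrow> bool) \<Rightarrow> 'o \<Rightarrow> 'o \<Rightarrow> 'm \<Rightarrow> 'm set" where
  "cat_cls C N X Y f = {g \<in> Hom C X Y. N X Y (cadd C X Y f (cneg C X Y g))}"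

definition quot_cat ::
  "('o, 'm) cat \<Rightarrow> ('o \<Rightarrow> 'o \<Rightarrow> 'm \<Rightarrow> bool) \<Rightarrow> ('o, 'm set) cat" where
  "quot_cat C N =
    \<lparr>Ob = Ob C,
     Hom = (\<lambda>X Y. cat_cls C N X Y ` Hom C X Y),
     cid = (\<lambda>X. cat_cls C N X X (cid C X)),
     ccomp = (\<lambda>X Y Z G F. \<Union>g\<in>G. \<Union>f\<in>F. cat_cls C N X Z (ccomp C X Y Z g f)),
     czero = (\<lambda>X Y. cat_cls C N X Y (czero C X Y)),
     cadd = (\<lambda>X Y F G. \<Union>f\<in>F. \<Union>g\<in>G. cat_cls C N X Y (cadd C X Y f g)),
     cneg = (\<lambda>X Y F. \<Union>f\<in>F. cat_cls C N X Y (cneg C X Y f)),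
     csum = csum C,
     cin1 = (\<lambda>X Y. cat_cls C N X (csum C X Y) (cin1 C X Y)),
     cin2 = (\<lambda>X Y. cat_cls C N Y (csum C X Y) (cin2 C X Y)),
     cpr1 = (\<lambda>X Y. cat_cls C N (csum C X Y) X (cpr1 C X Y)),
     cpr2 = (\<lambda>X Y. cat_cls C N (csum C X Y) Y (cpr2 C X Y))\<rparr>"

section \<open>Complexes\<close>

datatype ('o, 'm) cplx = Cplx (trm: "int \<Rightarrow> 'o") (dif: "int \<Rightarrow> 'm")

definition Cx :: "('o, 'm) cat \<Rightarrow> (('o, 'm) cplx, int \<Rightarrow> 'm) cat" where
  "Cx A =
    \<lparr>Ob = {X. \<forall>n. trm X n \<in> Ob A \<and> dif X n \<in> Hom A (trm X n) (trm X (n+1)) \<and>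
              ccomp A (trm X n) (trm X (n+1)) (trm X (n+2)) (dif X (n+1)) (dif X n)
                = czero A (trm X n) (trm X (n+2))},
     Hom = (\<lambda>X Y. {f. \<forall>n. f n \<in> Hom A (trm X n) (trm Y n) \<and>
              ccomp A (trm X n) (trm X (n+1)) (trm Y (n+1)) (f (n+1)) (dif X n)
                = ccomp A (trm X n) (trm Y n) (trm Y (n+1)) (dif Y n) (f n)}),
     cid = (\<lambda>X n. cid A (trm X n)),
     ccomp = (\<lambda>X Y Z g f n. ccomp A (trm X n) (trm Y n) (trm Z n) (g n) (f n)),
     czero = (\<lambda>X Y n. czero A (trm X n) (trm Y n)),
     cadd = (\<lambda>X Y f g n. cadd A (trm X n) (trm Y n) (f n) (g n)),
     cneg = (\<lambda>X Y f n. cneg A (trm X n) (trm Y n) (f n)),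
     csum = (\<lambda>X Y. Cplx (\<lambda>n. csum A (trm X n) (trm Y n))
              (\<lambda>n. cmat A (trm X n) (trm Y n) (trm X (n+1)) (trm Y (n+1))
                (dif X n) (czero A (trm Y n) (trm X (n+1)))
                (czero A (trm X n) (trm Y (n+1))) (dif Y n))),
     cin1 = (\<lambda>X Y n. cin1 A (trm X n) (trm Y n)),
     cin2 = (\<lambda>X Y n. cin2 A (trm X n) (trm Y n)),
     cpr1 = (\<lambda>X Y n. cpr1 A (trm X n) (trm Y n)),
     cpr2 = (\<lambda>X Y n. cpr2 A (trm X n) (trm Y n))\<rparr>"

definition bounded_cplx :: "('o, 'm) cat \<Rightarrow> ('o, 'm) cplx \<Rightarrow> bool" where
  "bounded_cplx A X \<longleftrightarrow> (\<exists>N. \<forall>n. \<bar>n\<bar> > N \<longrightarrow> zero_object A (trm X n))"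

definition null_homotopic ::
  "('o, 'm) cat \<Rightarrow> ('o, 'm) cplx \<Rightarrow> ('o, 'm) cplx \<Rightarrow> (int \<Rightarrow> 'm) \<Rightarrow> bool" where
  "null_homotopic A X Y f \<longleftrightarrow>
    (\<exists>h. \<forall>n. h n \<in> Hom A (trm X n) (trm Y (n-1)) \<and>
       f n = cadd A (trm X n) (trm Y n)
               (ccomp A (trm X n) (trm Y (n-1)) (trm Y n) (dif Y (n-1)) (h n))
               (ccomp A (trm X n) (trm X (n+1)) (trm Y n) (h (n+1)) (dif X n)))"

text \<open>The shift \<open>X[k]\<close>; on chain maps it acts by \<open>(f[1])\<^sup>n = f\<^sup>n\<^sup>+\<^sup>1\<close>.\<close>

definition shift :: "('o, 'm) cat \<Rightarrow> int \<Rightarrow> ('o, 'm) cplx \<Rightarrow> ('o, 'm) cplx" where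
  "shift A k X = Cplx (\<lambda>n. trm X (n+k))
     (\<lambda>n. cat_sgn A (trm X (n+k)) (trm X (n+k+1)) k (dif X (n+k)))"

definition shift_map :: "(int \<Rightarrow> 'm) \<Rightarrow> int \<Rightarrow> 'm" where
  "shift_map f = (\<lambda>n. f (n+1))"

definition cone ::
  "('o, 'm) cat \<Rightarrow> ('o, 'm) cplx \<Rightarrow> ('o, 'm) cplx \<Rightarrow> (int \<Rightarrow> 'm) \<Rightarrow> ('o, 'm) cplx" where
  "cone A X Y f = Cplx (\<lambda>n. csum A (trm X (n+1)) (trm Y n))
     (\<lambda>n. cmat A (trm X (n+1)) (trm Y n) (trm X (n+2)) (trm Y (n+1))
        (cneg A (trm X (n+1)) (trm X (n+2)) (dif X (n+1))) (czero A (trm Y n) (trm X (n+2)))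
        (f (n+1)) (dif Y n))"

definition cone_in :: "('o, 'm) cat \<Rightarrow> ('o, 'm) cplx \<Rightarrow> ('o, 'm) cplx \<Rightarrow> int \<Rightarrow> 'm" where
  "cone_in A X Y = (\<lambda>n. cin2 A (trm X (n+1)) (trm Y n))"

definition cone_pr :: "('o, 'm) cat \<Rightarrow> ('o, 'm) cplx \<Rightarrow> ('o, 'm) cplx \<Rightarrow> int \<Rightarrow> 'm" where
  "cone_pr A X Y = (\<lambda>n. cpr1 A (trm X (n+1)) (trm Y n))"

section \<open>Triangulated structures and triangle functors\<close>

text \<open>A category with a translation functor and a class of distinguished triangles
  \<open>(X, Y, Z, u, v, w)\<close>, standing for \<open>X \<rightarrow> Y \<rightarrow> Z \<rightarrow> \<Sigma>X\<close>.\<close>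

record ('o, 'm) tricat = "('o, 'm) cat" +
  Sus :: "'o \<Rightarrow> 'o"
  SusM :: "'o \<Rightarrow> 'o \<Rightarrow> 'm \<Rightarrow> 'm"
  Tri :: "('o \<times> 'o \<times> 'o \<times> 'm \<times> 'm \<times> 'm) set"

definition mk_tricat ::
  "('o, 'm) cat \<Rightarrow> ('o \<Rightarrow> 'o) \<Rightarrow> ('o \<Rightarrow> 'o \<Rightarrow> 'm \<Rightarrow> 'm)
    \<Rightarrow> ('o \<times> 'o \<times> 'o \<times> 'm \<times> 'm \<times> 'm) set \<Rightarrow> ('o, 'm) tricat" where
  "mk_tricat C S s St = cat.extend C
    \<lparr>Sus = S, SusM = s,
     Tri = {(X, Y, Z, u, v, w).
        X \<in> Ob C \<and> Y \<in> Ob C \<and> Z \<in> Ob C \<and> u \<in> Hom C X Y \<and> v \<in> Hom C Y Z \<and> w \<in> Hom C Z (S X) \<and>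
        (\<exists>X' Y' Z' u' v' w' a b c. (X', Y', Z', u', v', w') \<in> St \<and>
          cat_iso C X X' a \<and> cat_iso C Y Y' b \<and> cat_iso C Z Z' c \<and>
          ccomp C X Y Y' b u = ccomp C X X' Y' u' a \<and>
          ccomp C Y Z Z' c v = ccomp C Y Y' Z' v' b \<and>
          ccomp C Z (S X) (S X') (s X X' a) w = ccomp C Z Z' (S X') w' c)}\<rparr>"

definition additive_functor ::
  "('o, 'm, 'y) cat_scheme \<Rightarrow> ('p, 'n, 'z) cat_scheme
    \<Rightarrow> ('o \<Rightarrow> 'p) \<Rightarrow> ('o \<Rightarrow> 'o \<Rightarrow> 'm \<Rightarrow> 'n) \<Rightarrow> bool" where
  "additive_functor C D F Fm \<longleftrightarrow>
    (\<forall>X \<in> Ob C. F X \<in> Ob D \<and> Fm X X (cid C X) = cid D (F X)) \<and>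
    (\<forall>X \<in> Ob C. \<forall>Y \<in> Ob C. \<forall>f \<in> Hom C X Y. Fm X Y f \<in> Hom D (F X) (F Y)) \<and>
    (\<forall>X \<in> Ob C. \<forall>Y \<in> Ob C. \<forall>Z \<in> Ob C. \<forall>f \<in> Hom C X Y. \<forall>g \<in> Hom C Y Z.
       Fm X Z (ccomp C X Y Z g f) = ccomp D (F X) (F Y) (F Z) (Fm Y Z g) (Fm X Y f)) \<and>
    (\<forall>X \<in> Ob C. \<forall>Y \<in> Ob C. \<forall>f \<in> Hom C X Y. \<forall>g \<in> Hom C X Y.
       Fm X Y (cadd C X Y f g) = cadd D (F X) (F Y) (Fm X Y f) (Fm X Y g))"

definition triangle_functor ::
  "('o, 'm) tricat \<Rightarrow> ('p, 'n) tricat \<Rightarrow> ('o \<Rightarrow> 'p) \<Rightarrow> ('o \<Rightarrow> 'o \<Rightarrow> 'm \<Rightarrow> 'n) \<Rightarrow> bool" where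
  "triangle_functor C D F Fm \<longleftrightarrow> additive_functor C D F Fm \<and>
    (\<exists>\<phi>. (\<forall>X \<in> Ob C. cat_iso D (F (Sus C X)) (Sus D (F X)) (\<phi> X)) \<and>
         (\<forall>X \<in> Ob C. \<forall>Y \<in> Ob C. \<forall>f \<in> Hom C X Y.
            ccomp D (F (Sus C X)) (F (Sus C Y)) (Sus D (F Y))
              (\<phi> Y) (Fm (Sus C X) (Sus C Y) (SusM C X Y f))
            = ccomp D (F (Sus C X)) (Sus D (F X)) (Sus D (F Y))
              (SusM D (F X) (F Y) (Fm X Y f)) (\<phi> X)) \<and>
         (\<forall>X Y Z u v w. (X, Y, Z, u, v, w) \<in> Tri C \<longrightarrow>
            (F X, F Y, F Z, Fm X Y u, Fm Y Z v,
             ccomp D (F Z) (F (Sus C X)) (Sus D (F X)) (\<phi> X) (Fm Z (Sus C X) w)) \<in> Tri D))"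

subsection \<open>The homotopy category\<close>

definition htp_cls ::
  "('o, 'm) cat \<Rightarrow> ('o, 'm) cplx \<Rightarrow> ('o, 'm) cplx \<Rightarrow> (int \<Rightarrow> 'm) \<Rightarrow> (int \<Rightarrow> 'm) set" where
  "htp_cls A = cat_cls (Cx A) (null_homotopic A)"

definition K_cat :: "('o, 'm) cat \<Rightarrow> (('o, 'm) cplx, (int \<Rightarrow> 'm) set) cat" where
  "K_cat A = quot_cat (Cx A) (null_homotopic A)"

definition K_tri :: "('o, 'm) cat \<Rightarrow> (('o, 'm) cplx, (int \<Rightarrow> 'm) set) tricat" where
  "K_tri A = mk_tricat (K_cat A) (shift A 1) (\<lambda>X Y F. shift_map ` F)
     {(X, Y, Z, u, v, w). X \<in> Ob (Cx A) \<and> Y \<in> Ob (Cx A) \<and>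
        (\<exists>f \<in> Hom (Cx A) X Y. Z = cone A X Y f \<and> u = htp_cls A X Y f \<and>
          v = htp_cls A Y Z (cone_in A X Y) \<and> w = htp_cls A Z (shift A 1 X) (cone_pr A X Y))}"

section \<open>The category \<open>\<int>\<^sub>+A\<close> and its complexes\<close>

text \<open>An arrow \<open>f\<close> has components \<open>f n j : X\<^sup>j \<rightarrow> Y\<^sup>j\<^sup>+\<^sup>n\<close>.\<close>

definition deg0 ::
  "('o, 'm) cat \<Rightarrow> (int \<Rightarrow> 'o) \<Rightarrow> (int \<Rightarrow> 'o) \<Rightarrow> (int \<Rightarrow> 'm) \<Rightarrow> nat \<Rightarrow> int \<Rightarrow> 'm" where
  "deg0 A X Y f = (\<lambda>n j. if n = 0 then f j else czero A (X j) (Y (j + int n)))"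

definition Zplus :: "('o, 'm) cat \<Rightarrow> (int \<Rightarrow> 'o, nat \<Rightarrow> int \<Rightarrow> 'm) cat" where
  "Zplus A =
    \<lparr>Ob = {X. \<forall>j. X j \<in> Ob A},
     Hom = (\<lambda>X Y. {f. \<forall>n j. f n j \<in> Hom A (X j) (Y (j + int n))}),
     cid = (\<lambda>X. deg0 A X X (\<lambda>j. cid A (X j))),
     ccomp = (\<lambda>X Y Z g f n j. cat_sum_upto A (X j) (Z (j + int n))
        (\<lambda>k. ccomp A (X j) (Y (j + int k)) (Z (j + int n)) (g (n - k) (j + int k)) (f k j)) n),
     czero = (\<lambda>X Y n j. czero A (X j) (Y (j + int n))),
     cadd = (\<lambda>X Y f g n j. cadd A (X j) (Y (j + int n)) (f n j) (g n j)),
     cneg = (\<lambda>X Y f n j. cneg A (X j) (Y (j + int n)) (f n j)),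
     csum = (\<lambda>X Y j. csum A (X j) (Y j)),
     cin1 = (\<lambda>X Y. deg0 A X (\<lambda>j. csum A (X j) (Y j)) (\<lambda>j. cin1 A (X j) (Y j))),
     cin2 = (\<lambda>X Y. deg0 A Y (\<lambda>j. csum A (X j) (Y j)) (\<lambda>j. cin2 A (X j) (Y j))),
     cpr1 = (\<lambda>X Y. deg0 A (\<lambda>j. csum A (X j) (Y j)) X (\<lambda>j. cpr1 A (X j) (Y j))),
     cpr2 = (\<lambda>X Y. deg0 A (\<lambda>j. csum A (X j) (Y j)) Y (\<lambda>j. cpr2 A (X j) (Y j)))\<rparr>"

text \<open>A complex \<open>X\<close> over \<open>Zplus A\<close> has \<open>trm X i j\<close> for its bigraded terms \<open>X\<^sup>i\<^sup>j\<close> and \<open>dif X i n j\<close>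
  for \<open>d\<^sub>n : X\<^sup>i\<^sup>j \<rightarrow> X\<^sup>i\<^sup>+\<^sup>1\<^sup>,\<^sup>j\<^sup>+\<^sup>n\<close>. The functor \<open>(1)\<close> moves the second grading only.\<close>

type_synonym ('o, 'm) zcplx = "(int \<Rightarrow> 'o, nat \<Rightarrow> int \<Rightarrow> 'm) cplx"
type_synonym 'm zmap = "int \<Rightarrow> nat \<Rightarrow> int \<Rightarrow> 'm"

definition twist_map :: "'m zmap \<Rightarrow> 'm zmap" where
  "twist_map f = (\<lambda>i n j. f i n (j+1))"

definition twist :: "('o, 'm) zcplx \<Rightarrow> ('o, 'm) zcplx" where
  "twist X = Cplx (\<lambda>i j. trm X i (j+1)) (twist_map (dif X))"

definition eta :: "('o, 'm) cat \<Rightarrow> ('o, 'm) zcplx \<Rightarrow> 'm zmap" where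
  "eta A X = (\<lambda>i n j. if n = 1 then cid A (trm X i (j+1))
                      else czero A (trm X i (j+1)) (trm X i (j + int n)))"

text \<open>The exact structure. The sequences \<open>Y \<rightarrow> Con(f) \<rightarrow> X[1]\<close> are termwise split, so whatever is
  isomorphic to one of them is automatically a kernel-cokernel pair.\<close>

definition eta_conflation ::
  "('o, 'm) cat \<Rightarrow> ('o, 'm) zcplx \<Rightarrow> ('o, 'm) zcplx \<Rightarrow> ('o, 'm) zcplx
    \<Rightarrow> 'm zmap \<Rightarrow> 'm zmap \<Rightarrow> bool" where
  "eta_conflation A P Q S i p \<longleftrightarrow>
    (let C = Cx (Zplus A) in
      P \<in> Ob C \<and> Q \<in> Ob C \<and> S \<in> Ob C \<and> i \<in> Hom C P Q \<and> p \<in> Hom C Q S \<and>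
      (\<exists>X \<in> Ob C. \<exists>Y \<in> Ob C. \<exists>g \<in> Hom C X (twist Y). \<exists>f a b c.
         f = ccomp C X (twist Y) Y (eta A Y) g \<and>
         cat_iso C P Y a \<and>
         cat_iso C Q (cone (Zplus A) X Y f) b \<and>
         cat_iso C S (shift (Zplus A) 1 X) c \<and>
         ccomp C P Q (cone (Zplus A) X Y f) b i
           = ccomp C P Y (cone (Zplus A) X Y f) (cone_in (Zplus A) X Y) a \<and>
         ccomp C Q S (shift (Zplus A) 1 X) c p
           = ccomp C Q (cone (Zplus A) X Y f) (shift (Zplus A) 1 X) (cone_pr (Zplus A) X Y) b))"

definition eta_injective :: "('o, 'm) cat \<Rightarrow> ('o, 'm) zcplx \<Rightarrow> bool" where
  "eta_injective A I \<longleftrightarrow>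
    (let C = Cx (Zplus A) in
      I \<in> Ob C \<and>
      (\<forall>P Q S i p. eta_conflation A P Q S i p \<longrightarrow>
         (\<forall>f \<in> Hom C P I. \<exists>g \<in> Hom C Q I. ccomp C P Q I g i = f)))"

definition eta_null ::
  "('o, 'm) cat \<Rightarrow> ('o, 'm) zcplx \<Rightarrow> ('o, 'm) zcplx \<Rightarrow> 'm zmap \<Rightarrow> bool" where
  "eta_null A X Y f \<longleftrightarrow>
    (let C = Cx (Zplus A) in
      \<exists>I. eta_injective A I \<and> (\<exists>a \<in> Hom C X I. \<exists>b \<in> Hom C I Y. f = ccomp C X I Y b a))"

definition eta_cls ::
  "('o, 'm) cat \<Rightarrow> ('o, 'm) zcplx \<Rightarrow> ('o, 'm) zcplx \<Rightarrow> 'm zmap \<Rightarrow> 'm zmap set" where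
  "eta_cls A = cat_cls (Cx (Zplus A)) (eta_null A)"

definition K_eta :: "('o, 'm) cat \<Rightarrow> (('o, 'm) zcplx, 'm zmap set) tricat" where
  "K_eta A = mk_tricat (quot_cat (Cx (Zplus A)) (eta_null A))
     (\<lambda>X. shift (Zplus A) 1 (twist X)) (\<lambda>X Y F. (shift_map \<circ> twist_map) ` F)
     {(X, Y, Z, u, v, w). X \<in> Ob (Cx (Zplus A)) \<and> Y \<in> Ob (Cx (Zplus A)) \<and>
        (\<exists>f \<in> Hom (Cx (Zplus A)) X Y.
          Z = cone (Zplus A) (twist X) Y (ccomp (Cx (Zplus A)) (twist X) X Y f (eta A X)) \<and>
          u = eta_cls A X Y f \<and>
          v = eta_cls A Y Z (cone_in (Zplus A) (twist X) Y) \<and>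
          w = eta_cls A Z (shift (Zplus A) 1 (twist X)) (cone_pr (Zplus A) (twist X) Y))}"

section \<open>Modules over a ring\<close>

text \<open>
  The universe in which the carriers of modules live: it contains the ring elements and the elements
  of an arbitrary type \<open>'b\<close>, and is closed under pairing, so that direct sums of two modules exist on
  the nose. Letting \<open>'b\<close> vary, every set of modules lies, up to isomorphism, in such a universe.
  Because the universe contains the ring, it contains a free cover of each of its modules.
\<close>

datatype ('a, 'b) elem = Scalar 'a | Atom 'b | Pair "('a, 'b) elem" "('a, 'b) elem"

primrec pfst :: "('a, 'b) elem \<Rightarrow> ('a, 'b) elem" where
  "pfst (Scalar a) = undefined" | "pfst (Atom b) = undefined" | "pfst (Pair x y) = x"

primrec psnd :: "('a, 'b) elem \<Rightarrow> ('a, 'b) elem" where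
  "psnd (Scalar a) = undefined" | "psnd (Atom b) = undefined" | "psnd (Pair x y) = y"

type_synonym ('a, 'b) mdl = "('a, ('a, 'b) elem) module"
type_synonym ('a, 'b) mmap = "('a, 'b) elem \<Rightarrow> ('a, 'b) elem"
type_synonym ('a, 'b) mcplx = "(('a, 'b) mdl, ('a, 'b) mmap) cplx"
type_synonym ('a, 'b) mcmap = "int \<Rightarrow> ('a, 'b) mmap"

text \<open>Right modules: \<open>a \<odot>\<^bsub>M\<^esub> x\<close> is read as \<open>x a\<close>. The multiplicative part of the record type
  \<open>module\<close> is irrelevant.\<close>

definition right_module :: "'a ring \<Rightarrow> ('a, 'm) module \<Rightarrow> bool" where
  "right_module R M \<longleftrightarrow> abelian_group M \<and>
    (\<forall>a \<in> carrier R. \<forall>x \<in> carrier M. a \<odot>\<^bsub>M\<^esub> x \<in> carrier M) \<and>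
    (\<forall>a \<in> carrier R. \<forall>b \<in> carrier R. \<forall>x \<in> carrier M.
       (a \<oplus>\<^bsub>R\<^esub> b) \<odot>\<^bsub>M\<^esub> x = a \<odot>\<^bsub>M\<^esub> x \<oplus>\<^bsub>M\<^esub> b \<odot>\<^bsub>M\<^esub> x) \<and>
    (\<forall>a \<in> carrier R. \<forall>x \<in> carrier M. \<forall>y \<in> carrier M.
       a \<odot>\<^bsub>M\<^esub> (x \<oplus>\<^bsub>M\<^esub> y) = a \<odot>\<^bsub>M\<^esub> x \<oplus>\<^bsub>M\<^esub> a \<odot>\<^bsub>M\<^esub> y) \<and>
    (\<forall>a \<in> carrier R. \<forall>b \<in> carrier R. \<forall>x \<in> carrier M.
       (a \<otimes>\<^bsub>R\<^esub> b) \<odot>\<^bsub>M\<^esub> x = b \<odot>\<^bsub>M\<^esub> (a \<odot>\<^bsub>M\<^esub> x)) \<and>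
    (\<forall>x \<in> carrier M. \<one>\<^bsub>R\<^esub> \<odot>\<^bsub>M\<^esub> x = x)"

definition mod_hom :: "'a ring \<Rightarrow> ('a, 'm) module \<Rightarrow> ('a, 'm) module \<Rightarrow> ('m \<Rightarrow> 'm) set" where
  "mod_hom R M N = {f \<in> carrier M \<rightarrow>\<^sub>E carrier N.
     (\<forall>x \<in> carrier M. \<forall>y \<in> carrier M. f (x \<oplus>\<^bsub>M\<^esub> y) = f x \<oplus>\<^bsub>N\<^esub> f y) \<and>
     (\<forall>a \<in> carrier R. \<forall>x \<in> carrier M. f (a \<odot>\<^bsub>M\<^esub> x) = a \<odot>\<^bsub>N\<^esub> f x)}"

definition mod_sum :: "('a, 'b) mdl \<Rightarrow> ('a, 'b) mdl \<Rightarrow> ('a, 'b) mdl" where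
  "mod_sum M N =
    \<lparr>carrier = case_prod Pair ` (carrier M \<times> carrier N),
     mult = undefined, one = undefined,
     zero = Pair \<zero>\<^bsub>M\<^esub> \<zero>\<^bsub>N\<^esub>,
     add = (\<lambda>x y. Pair (pfst x \<oplus>\<^bsub>M\<^esub> pfst y) (psnd x \<oplus>\<^bsub>N\<^esub> psnd y)),
     smult = (\<lambda>a x. Pair (a \<odot>\<^bsub>M\<^esub> pfst x) (a \<odot>\<^bsub>N\<^esub> psnd x))\<rparr>"

definition Mod :: "'a ring \<Rightarrow> (('a, 'b) mdl, ('a, 'b) mmap) cat" where
  "Mod R =
    \<lparr>Ob = {M. right_module R M},
     Hom = mod_hom R,
     cid = (\<lambda>M. \<lambda>x\<in>carrier M. x),
     ccomp = (\<lambda>L M N g f. compose (carrier L) g f),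
     czero = (\<lambda>M N. \<lambda>x\<in>carrier M. \<zero>\<^bsub>N\<^esub>),
     cadd = (\<lambda>M N f g. \<lambda>x\<in>carrier M. f x \<oplus>\<^bsub>N\<^esub> g x),
     cneg = (\<lambda>M N f. \<lambda>x\<in>carrier M. \<ominus>\<^bsub>N\<^esub> f x),
     csum = mod_sum,
     cin1 = (\<lambda>M N. \<lambda>x\<in>carrier M. Pair x \<zero>\<^bsub>N\<^esub>),
     cin2 = (\<lambda>M N. \<lambda>y\<in>carrier N. Pair \<zero>\<^bsub>M\<^esub> y),
     cpr1 = (\<lambda>M N. \<lambda>z\<in>carrier (mod_sum M N). pfst z),
     cpr2 = (\<lambda>M N. \<lambda>z\<in>carrier (mod_sum M N). psnd z)\<rparr>"

definition projective_module :: "'a ring \<Rightarrow> ('a, 'b) mdl \<Rightarrow> bool" where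
  "projective_module R P \<longleftrightarrow> right_module R P \<and>
    (\<forall>M N g f. right_module R M \<and> right_module R N \<and>
       g \<in> mod_hom R M N \<and> g ` carrier M = carrier N \<and> f \<in> mod_hom R P N \<longrightarrow>
       (\<exists>h \<in> mod_hom R P M. compose (carrier P) g h = f))"

definition fg_module :: "'a ring \<Rightarrow> ('a, 'b) mdl \<Rightarrow> bool" where
  "fg_module R M \<longleftrightarrow>
    (\<exists>B. finite B \<and> B \<subseteq> carrier M \<and>
       (\<forall>x \<in> carrier M. \<exists>c \<in> B \<rightarrow> carrier R. x = (\<Oplus>\<^bsub>M\<^esub>b\<in>B. c b \<odot>\<^bsub>M\<^esub> b)))"

definition Proj :: "'a ring \<Rightarrow> (('a, 'b) mdl, ('a, 'b) mmap) cat" where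
  "Proj R = full_sub (Mod R) {P. projective_module R P}"

definition proj_fg :: "'a ring \<Rightarrow> (('a, 'b) mdl, ('a, 'b) mmap) cat" where
  "proj_fg R = full_sub (Proj R) {P. fg_module R P}"

definition Kb_proj :: "'a ring \<Rightarrow> (('a, 'b) mcplx, ('a, 'b) mcmap set) tricat" where
  "Kb_proj R = full_sub (K_tri (proj_fg R)) {X. bounded_cplx (proj_fg R) X}"

section \<open>Tilting complexes\<close>

primrec copies :: "('o, 'm, 'z) cat_scheme \<Rightarrow> 'o \<Rightarrow> nat \<Rightarrow> 'o" where
  "copies C X 0 = X"
| "copies C X (Suc n) = csum C X (copies C X n)"

text \<open>\<open>copies C X n\<close> is the sum of \<open>n + 1\<close> copies of \<open>X\<close>; the empty sum is a summand of \<open>X\<close>.\<close>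

definition add_closure :: "('o, 'm, 'z) cat_scheme \<Rightarrow> 'o \<Rightarrow> 'o set" where
  "add_closure C X = {Y \<in> Ob C. \<exists>Z \<in> Ob C. \<exists>n. isomorphic C (csum C Y Z) (copies C X n)}"

definition triangulated_subcat :: "('o, 'm) tricat \<Rightarrow> 'o set \<Rightarrow> bool" where
  "triangulated_subcat C S \<longleftrightarrow> S \<subseteq> Ob C \<and>
    (\<exists>X \<in> S. zero_object C X) \<and>
    (\<forall>X \<in> S. \<forall>Y \<in> Ob C. isomorphic C X Y \<longrightarrow> Y \<in> S) \<and>
    (\<forall>X \<in> Ob C. X \<in> S \<longleftrightarrow> Sus C X \<in> S) \<and>
    (\<forall>X Y Z u v w. (X, Y, Z, u, v, w) \<in> Tri C \<and> Z \<in> Ob C \<and> X \<in> S \<and> Y \<in> S \<longrightarrow> Z \<in> S)"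

definition tilting_complex :: "'a ring \<Rightarrow> ('a, 'b) mcplx \<Rightarrow> bool" where
  "tilting_complex R T \<longleftrightarrow> T \<in> Ob (Kb_proj R) \<and>
    (\<forall>n. n \<noteq> 0 \<longrightarrow> Hom (Kb_proj R) T (shift (proj_fg R) n T)
                    = {czero (Kb_proj R) T (shift (proj_fg R) n T)}) \<and>
    (\<forall>S. triangulated_subcat (Kb_proj R) S \<and> add_closure (Kb_proj R) T \<subseteq> S
           \<longrightarrow> S = Ob (Kb_proj R))"

section \<open>Direct sums of copies of a complex\<close>

text \<open>\<open>M\<close> is the (internal) direct sum of copies of \<open>N\<close> along the maps \<open>\<iota> i : N \<rightarrow> M\<close>, \<open>i \<in> I\<close>.\<close>

definition is_mod_direct_sum ::
  "'a ring \<Rightarrow> ('a, 'm) module \<Rightarrow> 'i set \<Rightarrow> ('i \<Rightarrow> 'm \<Rightarrow> 'm) \<Rightarrow> ('a, 'm) module \<Rightarrow> bool" where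
  "is_mod_direct_sum R N I \<iota> M \<longleftrightarrow>
    (\<forall>i \<in> I. \<iota> i \<in> mod_hom R N M) \<and>
    (\<forall>x \<in> carrier M. \<exists>!t. t \<in> I \<rightarrow>\<^sub>E carrier N \<and> finite {i \<in> I. t i \<noteq> \<zero>\<^bsub>N\<^esub>} \<and>
       x = (\<Oplus>\<^bsub>M\<^esub>i\<in>{i \<in> I. t i \<noteq> \<zero>\<^bsub>N\<^esub>}. \<iota> i (t i)))"

text \<open>Coproducts in the homotopy category are formed termwise, and they are determined only up to
  isomorphism there. The index sets may be taken inside the universe, since for a nonzero module the
  maps into a direct sum of copies of it send a given nonzero element to different elements.\<close>

definition is_direct_sum_of_copies :: "'a ring \<Rightarrow> ('a, 'b) mcplx \<Rightarrow> ('a, 'b) mcplx \<Rightarrow> bool" where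
  "is_direct_sum_of_copies R T X \<longleftrightarrow>
    (\<exists>(I :: ('a, 'b) elem set) \<iota>. (\<forall>i \<in> I. \<iota> i \<in> Hom (Cx (Proj R)) T X) \<and>
       (\<forall>n. is_mod_direct_sum R (trm T n) I (\<lambda>i. \<iota> i n) (trm X n)))"

definition SumT :: "'a ring \<Rightarrow> ('a, 'b) mcplx \<Rightarrow> (('a, 'b) mcplx, ('a, 'b) mcmap set) cat" where
  "SumT R T = full_sub (K_cat (Proj R))
     {X. \<exists>X' \<in> Ob (K_cat (Proj R)).
           is_direct_sum_of_copies R T X' \<and> isomorphic (K_cat (Proj R)) X X'}"

section \<open>The operation \<open>\<Theta>\<close>\<close>

text \<open>
  A complex over \<open>SumT R T\<close> has terms \<open>trm X j\<close>, the complexes \<open>X\<^sup>\<bullet>\<^sup>,\<^sup>j\<close>, and differentials \<open>dif X j\<close>,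
  which are homotopy classes of chain maps; thus \<open>X\<^sup>i\<^sup>j\<close> is \<open>trm (trm X j) i\<close> and \<open>\<delta>\<^sub>0\<^sup>i\<^sup>j\<close> is
  \<open>dif (trm X j) i\<close>. The representative \<open>\<delta>\<^sub>1\<^sup>\<bullet>\<^sup>j \<in> dif X j\<close> is part of the choice made by \<open>\<Theta>\<close>, and so
  are the representatives of the components of morphisms.
\<close>

type_synonym ('a, 'b) scplx = "(('a, 'b) mcplx, ('a, 'b) mcmap set) cplx"
type_synonym ('a, 'b) smap = "int \<Rightarrow> ('a, 'b) mcmap set"

definition is_Theta_object ::
  "'a ring \<Rightarrow> ('a, 'b) scplx \<Rightarrow> (('a, 'b) mdl, ('a, 'b) mmap) zcplx \<Rightarrow> bool" where
  "is_Theta_object R X D \<longleftrightarrow> D \<in> Ob (Cx (Zplus (Proj R))) \<and>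
    (\<forall>i j. trm D i j = trm (trm X j) (i-j)) \<and>
    (\<forall>i j. dif D i 0 j = dif (trm X j) (i-j)) \<and>
    (\<exists>\<delta>. (\<forall>j. \<delta> j \<in> dif X j) \<and>
       (\<forall>i j. dif D i 1 j = cat_sgn (Proj R) (trm (trm X j) (i-j)) (trm (trm X (j+1)) (i-j)) i
                              (\<delta> j (i-j))))"

definition is_Theta_map ::
  "'a ring \<Rightarrow> (('a, 'b) mdl, ('a, 'b) mmap) zcplx \<Rightarrow> (('a, 'b) mdl, ('a, 'b) mmap) zcplx
    \<Rightarrow> ('a, 'b) smap \<Rightarrow> ('a, 'b) mmap zmap \<Rightarrow> bool" where
  "is_Theta_map R D E \<alpha> f \<longleftrightarrow> f \<in> Hom (Cx (Zplus (Proj R))) D E \<and>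
    (\<exists>a. (\<forall>j. a j \<in> \<alpha> j) \<and> (\<forall>i j. f i 0 j = a j (i-j)))"

definition is_Theta ::
  "'a ring \<Rightarrow> ('a, 'b) mcplx
    \<Rightarrow> (('a, 'b) scplx \<Rightarrow> (('a, 'b) mdl, ('a, 'b) mmap) zcplx)
    \<Rightarrow> (('a, 'b) scplx \<Rightarrow> ('a, 'b) scplx \<Rightarrow> ('a, 'b) smap \<Rightarrow> ('a, 'b) mmap zmap) \<Rightarrow> bool" where
  "is_Theta R T Th Thm \<longleftrightarrow>
    (\<forall>X \<in> Ob (Cx (SumT R T)). is_Theta_object R X (Th X)) \<and>
    (\<forall>X \<in> Ob (Cx (SumT R T)). \<forall>Y \<in> Ob (Cx (SumT R T)). \<forall>\<alpha> \<in> Hom (Cx (SumT R T)) X Y.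
       is_Theta_map R (Th X) (Th Y) \<alpha> (Thm X Y \<alpha>))"

end

theory Submission
  imports Defs
begin

text \<open>
  A chain map \<open>f\<close> over \<open>\<int>\<^sub>+A\<close> vanishes in the stable category if and only if \<open>f \<circ> \<eta>\<close> is
  null-homotopic, that is, if \<open>f\<close> has a null homotopy whose components start in degree \<open>-1\<close>.
  The leading component \<open>f\<^sub>0\<close> consists of chain maps between the rows \<open>(D\<^sup>\<bullet>\<^sup>j, d\<^sub>0)\<close>. For
  \<open>D = \<Theta>(X)\<close> the row \<open>j\<close> is \<open>X\<^sup>j[-j]\<close> with \<open>X\<^sup>j\<close> in \<open>Sum-T\<close>, and since \<open>T\<close> is compact and has no
  self-extensions, every chain map between rows of different degrees is null-homotopic. So the
  first two components of a chain map, or of a null homotopy, extend to all others as soon as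
  they satisfy the first two equations. It follows that \<open>f\<close> is determined in the stable category by
  the homotopy classes of the rows of \<open>f\<^sub>0\<close>, and that a null homotopy of \<open>\<alpha>\<close> gives, as the component of
  degree \<open>-1\<close>, one of \<open>\<Theta>(\<alpha>)\<close>. The isomorphisms \<open>\<Theta>(X[1]) \<cong> \<Theta>(X)(1)[1]\<close> and
  \<open>\<Theta>(Con \<alpha>) \<cong> Con(\<Theta>(\<alpha>)\<eta>)\<close> extend the row maps \<open>(-1)\<^sup>i\<close> and \<open>diag((-1)\<^sup>i, 1)\<close>, and all
  compatibilities are checked on rows.
\<close>

section \<open>Additive categories\<close>

text \<open>The degree in which vanishing fails dictates which data must be supplied by hand. The
  obstruction in component n to extending a family to a chain map is a class in Hom(X^j,
  Y^{j+n}[1-n]); for a null homotopy of a composite with \<eta> it is a class in Hom(X^{j+1},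
  Y^{j+n}[1-n]). Both groups vanish for n \<ge> 2, but n = 1 gives maps between unshifted objects of
  Sum-T, which need not be zero. There the obstruction is killed explicitly, by the homotopy that
  relates two representatives of one homotopy class. Since \<Theta> chooses representatives
  independently for every object and every morphism, such homotopies are always at hand, and strict
  equalities between chosen maps never are; hence comparison takes place only after passing to
  stable classes.

  The sign (-1)^i in d_1 turns the commutation of \<delta>_1 with \<delta>_0 into the
  anticommutation that dd = 0 demands. This sign and the sign of the shifted differential are the
  origin of every sign in the homotopies and in the isomorphisms of rows.\<close>

locale additive_cat =
  fixes C :: "('o, 'm) cat"
  assumes id_in [simp]: "X \<in> Ob C \<Longrightarrow> cid C X \<in> Hom C X X"
    and comp_in [simp]: "\<lbrakk>X \<in> Ob C; Y \<in> Ob C; Z \<in> Ob C; f \<in> Hom C X Y; g \<in> Hom C Y Z\<rbrakk>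
      \<Longrightarrow> ccomp C X Y Z g f \<in> Hom C X Z"
    and id_left [simp]: "\<lbrakk>X \<in> Ob C; Y \<in> Ob C; f \<in> Hom C X Y\<rbrakk> \<Longrightarrow> ccomp C X Y Y (cid C Y) f = f"
    and id_right [simp]: "\<lbrakk>X \<in> Ob C; Y \<in> Ob C; f \<in> Hom C X Y\<rbrakk> \<Longrightarrow> ccomp C X X Y f (cid C X) = f"
    and comp_assoc: "\<lbrakk>W \<in> Ob C; X \<in> Ob C; Y \<in> Ob C; Z \<in> Ob C;
        f \<in> Hom C W X; g \<in> Hom C X Y; h \<in> Hom C Y Z\<rbrakk>
      \<Longrightarrow> ccomp C W X Z (ccomp C X Y Z h g) f = ccomp C W Y Z h (ccomp C W X Y g f)"
    and zero_in [simp]: "\<lbrakk>X \<in> Ob C; Y \<in> Ob C\<rbrakk> \<Longrightarrow> czero C X Y \<in> Hom C X Y"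
    and add_in [simp]: "\<lbrakk>X \<in> Ob C; Y \<in> Ob C; f \<in> Hom C X Y; g \<in> Hom C X Y\<rbrakk>
      \<Longrightarrow> cadd C X Y f g \<in> Hom C X Y"
    and neg_in [simp]: "\<lbrakk>X \<in> Ob C; Y \<in> Ob C; f \<in> Hom C X Y\<rbrakk> \<Longrightarrow> cneg C X Y f \<in> Hom C X Y"
    and add_assoc: "\<lbrakk>X \<in> Ob C; Y \<in> Ob C; f \<in> Hom C X Y; g \<in> Hom C X Y; h \<in> Hom C X Y\<rbrakk>
      \<Longrightarrow> cadd C X Y (cadd C X Y f g) h = cadd C X Y f (cadd C X Y g h)"
    and add_comm: "\<lbrakk>X \<in> Ob C; Y \<in> Ob C; f \<in> Hom C X Y; g \<in> Hom C X Y\<rbrakk>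
      \<Longrightarrow> cadd C X Y f g = cadd C X Y g f"
    and add_zero_left [simp]: "\<lbrakk>X \<in> Ob C; Y \<in> Ob C; f \<in> Hom C X Y\<rbrakk>
      \<Longrightarrow> cadd C X Y (czero C X Y) f = f"
    and add_neg_left [simp]: "\<lbrakk>X \<in> Ob C; Y \<in> Ob C; f \<in> Hom C X Y\<rbrakk>
      \<Longrightarrow> cadd C X Y (cneg C X Y f) f = czero C X Y"
    and comp_add_left: "\<lbrakk>X \<in> Ob C; Y \<in> Ob C; Z \<in> Ob C; f \<in> Hom C X Y; g \<in> Hom C Y Z; h \<in> Hom C Y Z\<rbrakk>
      \<Longrightarrow> ccomp C X Y Z (cadd C Y Z g h) f = cadd C X Z (ccomp C X Y Z g f) (ccomp C X Y Z h f)"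
    and comp_add_right: "\<lbrakk>X \<in> Ob C; Y \<in> Ob C; Z \<in> Ob C; f \<in> Hom C X Y; g \<in> Hom C X Y; h \<in> Hom C Y Z\<rbrakk>
      \<Longrightarrow> ccomp C X Y Z h (cadd C X Y f g) = cadd C X Z (ccomp C X Y Z h f) (ccomp C X Y Z h g)"
    and sum_ob [simp]: "\<lbrakk>X \<in> Ob C; Y \<in> Ob C\<rbrakk> \<Longrightarrow> csum C X Y \<in> Ob C"
    and in1_in [simp]: "\<lbrakk>X \<in> Ob C; Y \<in> Ob C\<rbrakk> \<Longrightarrow> cin1 C X Y \<in> Hom C X (csum C X Y)"
    and in2_in [simp]: "\<lbrakk>X \<in> Ob C; Y \<in> Ob C\<rbrakk> \<Longrightarrow> cin2 C X Y \<in> Hom C Y (csum C X Y)"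
    and pr1_in [simp]: "\<lbrakk>X \<in> Ob C; Y \<in> Ob C\<rbrakk> \<Longrightarrow> cpr1 C X Y \<in> Hom C (csum C X Y) X"
    and pr2_in [simp]: "\<lbrakk>X \<in> Ob C; Y \<in> Ob C\<rbrakk> \<Longrightarrow> cpr2 C X Y \<in> Hom C (csum C X Y) Y"
    and pr1_in1 [simp]: "\<lbrakk>X \<in> Ob C; Y \<in> Ob C\<rbrakk>
      \<Longrightarrow> ccomp C X (csum C X Y) X (cpr1 C X Y) (cin1 C X Y) = cid C X"
    and pr2_in2 [simp]: "\<lbrakk>X \<in> Ob C; Y \<in> Ob C\<rbrakk>
      \<Longrightarrow> ccomp C Y (csum C X Y) Y (cpr2 C X Y) (cin2 C X Y) = cid C Y"
    and pr1_in2 [simp]: "\<lbrakk>X \<in> Ob C; Y \<in> Ob C\<rbrakk>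
      \<Longrightarrow> ccomp C Y (csum C X Y) X (cpr1 C X Y) (cin2 C X Y) = czero C Y X"
    and pr2_in1 [simp]: "\<lbrakk>X \<in> Ob C; Y \<in> Ob C\<rbrakk>
      \<Longrightarrow> ccomp C X (csum C X Y) Y (cpr2 C X Y) (cin1 C X Y) = czero C X Y"
    and in_pr: "\<lbrakk>X \<in> Ob C; Y \<in> Ob C\<rbrakk>
      \<Longrightarrow> cadd C (csum C X Y) (csum C X Y)
            (ccomp C (csum C X Y) X (csum C X Y) (cin1 C X Y) (cpr1 C X Y))
            (ccomp C (csum C X Y) Y (csum C X Y) (cin2 C X Y) (cpr2 C X Y)) = cid C (csum C X Y)"
begin

subsection \<open>Hom-groups and bilinearity\<close>

lemma add_left_comm:
  assumes "X \<in> Ob C" "Y \<in> Ob C" "f \<in> Hom C X Y" "g \<in> Hom C X Y" "h \<in> Hom C X Y"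
  shows "cadd C X Y f (cadd C X Y g h) = cadd C X Y g (cadd C X Y f h)"
  using assms by (metis add_assoc add_comm)

lemmas add_ac = add_assoc add_comm add_left_comm

lemma add_zero_right [simp]:
  "\<lbrakk>X \<in> Ob C; Y \<in> Ob C; f \<in> Hom C X Y\<rbrakk> \<Longrightarrow> cadd C X Y f (czero C X Y) = f"
  by (metis add_comm add_zero_left zero_in)

lemma add_neg_right [simp]:
  "\<lbrakk>X \<in> Ob C; Y \<in> Ob C; f \<in> Hom C X Y\<rbrakk> \<Longrightarrow> cadd C X Y f (cneg C X Y f) = czero C X Y"
  by (metis add_comm add_neg_left neg_in)

lemma add_neg_cancel1 [simp]:
  "\<lbrakk>X \<in> Ob C; Y \<in> Ob C; f \<in> Hom C X Y; g \<in> Hom C X Y\<rbrakk>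
    \<Longrightarrow> cadd C X Y f (cadd C X Y (cneg C X Y f) g) = g"
  by (metis add_assoc add_neg_right add_zero_left neg_in)

lemma add_neg_cancel2 [simp]:
  "\<lbrakk>X \<in> Ob C; Y \<in> Ob C; f \<in> Hom C X Y; g \<in> Hom C X Y\<rbrakk>
    \<Longrightarrow> cadd C X Y (cneg C X Y f) (cadd C X Y f g) = g"
  by (metis add_assoc add_neg_left add_zero_left neg_in)

lemma neg_unique:
  assumes "X \<in> Ob C" "Y \<in> Ob C" "f \<in> Hom C X Y" "g \<in> Hom C X Y" "cadd C X Y f g = czero C X Y"
  shows "g = cneg C X Y f"
  by (metis assms add_neg_cancel2 add_zero_right neg_in)

lemma neg_neg [simp]:
  "\<lbrakk>X \<in> Ob C; Y \<in> Ob C; f \<in> Hom C X Y\<rbrakk> \<Longrightarrow> cneg C X Y (cneg C X Y f) = f"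
  by (metis add_neg_left neg_in neg_unique)

lemma neg_zero [simp]: "\<lbrakk>X \<in> Ob C; Y \<in> Ob C\<rbrakk> \<Longrightarrow> cneg C X Y (czero C X Y) = czero C X Y"
  by (metis add_zero_left neg_unique zero_in)

lemma neg_add [simp]:
  assumes "X \<in> Ob C" "Y \<in> Ob C" "f \<in> Hom C X Y" "g \<in> Hom C X Y"
  shows "cneg C X Y (cadd C X Y f g) = cadd C X Y (cneg C X Y f) (cneg C X Y g)"
  by (rule neg_unique [symmetric]) (use assms in \<open>simp_all add: add_ac\<close>)

lemma comp_zero_left [simp]:
  assumes "X \<in> Ob C" "Y \<in> Ob C" "Z \<in> Ob C" "f \<in> Hom C X Y"
  shows "ccomp C X Y Z (czero C Y Z) f = czero C X Z"
proof -
  let ?z = "ccomp C X Y Z (czero C Y Z) f"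
  have "cadd C X Z ?z ?z = ?z"
    using assms comp_add_left[of X Y Z f "czero C Y Z" "czero C Y Z"] by simp
  then show ?thesis
    by (metis assms add_neg_cancel2 add_neg_left comp_in zero_in)
qed

lemma comp_zero_right [simp]:
  assumes "X \<in> Ob C" "Y \<in> Ob C" "Z \<in> Ob C" "f \<in> Hom C Y Z"
  shows "ccomp C X Y Z f (czero C X Y) = czero C X Z"
proof -
  let ?z = "ccomp C X Y Z f (czero C X Y)"
  have "cadd C X Z ?z ?z = ?z"
    using assms comp_add_right[of X Y Z "czero C X Y" "czero C X Y" f] by simp
  then show ?thesis
    by (metis assms add_neg_cancel2 add_neg_left comp_in zero_in)
qed

lemma comp_neg_left [simp]:
  assumes "X \<in> Ob C" "Y \<in> Ob C" "Z \<in> Ob C" "f \<in> Hom C X Y" "g \<in> Hom C Y Z"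
  shows "ccomp C X Y Z (cneg C Y Z g) f = cneg C X Z (ccomp C X Y Z g f)"
  by (rule neg_unique) (use assms in \<open>simp_all flip: comp_add_left\<close>)

lemma comp_neg_right [simp]:
  assumes "X \<in> Ob C" "Y \<in> Ob C" "Z \<in> Ob C" "f \<in> Hom C X Y" "g \<in> Hom C Y Z"
  shows "ccomp C X Y Z g (cneg C X Y f) = cneg C X Z (ccomp C X Y Z g f)"
  by (rule neg_unique) (use assms in \<open>simp_all flip: comp_add_right\<close>)

lemmas comp_distrib = comp_assoc comp_add_left comp_add_right

lemma sgn_in [simp]:
  "\<lbrakk>X \<in> Ob C; Y \<in> Ob C; f \<in> Hom C X Y\<rbrakk> \<Longrightarrow> cat_sgn C X Y i f \<in> Hom C X Y"
  by (simp add: cat_sgn_def)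

lemma sgn_comp_left [simp]:
  "\<lbrakk>X \<in> Ob C; Y \<in> Ob C; Z \<in> Ob C; f \<in> Hom C X Y; g \<in> Hom C Y Z\<rbrakk>
    \<Longrightarrow> ccomp C X Y Z (cat_sgn C Y Z i g) f = cat_sgn C X Z i (ccomp C X Y Z g f)"
  by (simp add: cat_sgn_def)

lemma sgn_comp_right [simp]:
  "\<lbrakk>X \<in> Ob C; Y \<in> Ob C; Z \<in> Ob C; f \<in> Hom C X Y; g \<in> Hom C Y Z\<rbrakk>
    \<Longrightarrow> ccomp C X Y Z g (cat_sgn C X Y i f) = cat_sgn C X Z i (ccomp C X Y Z g f)"
  by (simp add: cat_sgn_def)

lemma sgn_sgn [simp]:
  "\<lbrakk>X \<in> Ob C; Y \<in> Ob C; f \<in> Hom C X Y\<rbrakk> \<Longrightarrow> cat_sgn C X Y i (cat_sgn C X Y i f) = f"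
  by (simp add: cat_sgn_def)

lemma sgn_zero [simp]: "\<lbrakk>X \<in> Ob C; Y \<in> Ob C\<rbrakk> \<Longrightarrow> cat_sgn C X Y i (czero C X Y) = czero C X Y"
  by (simp add: cat_sgn_def)

lemma sgn_add [simp]:
  "\<lbrakk>X \<in> Ob C; Y \<in> Ob C; f \<in> Hom C X Y; g \<in> Hom C X Y\<rbrakk>
    \<Longrightarrow> cat_sgn C X Y i (cadd C X Y f g) = cadd C X Y (cat_sgn C X Y i f) (cat_sgn C X Y i g)"
  by (simp add: cat_sgn_def)

lemma sgn_neg [simp]:
  "cat_sgn C X Y i (cneg C X Y f) = cneg C X Y (cat_sgn C X Y i f)"
  by (simp add: cat_sgn_def)

lemma sgn_Suc [simp]:
  "\<lbrakk>X \<in> Ob C; Y \<in> Ob C; f \<in> Hom C X Y\<rbrakk>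
    \<Longrightarrow> cat_sgn C X Y (i + 1) f = cneg C X Y (cat_sgn C X Y i f)"
  by (simp add: cat_sgn_def)

lemma sgn_minus1 [simp]:
  "\<lbrakk>X \<in> Ob C; Y \<in> Ob C; f \<in> Hom C X Y\<rbrakk>
    \<Longrightarrow> cat_sgn C X Y (i - 1) f = cneg C X Y (cat_sgn C X Y i f)"
  by (simp add: cat_sgn_def)

subsection \<open>Biproducts and matrices\<close>

text \<open>Each arrow out of the sum is recovered from its two restrictions by composing it with
  the decomposition \<open>in_pr\<close> of the identity.\<close>

lemma from_sum_eqI:
  assumes ob: "U \<in> Ob C" "X \<in> Ob C" "Y \<in> Ob C" and f: "f \<in> Hom C (csum C X Y) U"
    and g: "g \<in> Hom C (csum C X Y) U"
    and 1: "ccomp C X (csum C X Y) U f (cin1 C X Y) = ccomp C X (csum C X Y) U g (cin1 C X Y)"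
    and 2: "ccomp C Y (csum C X Y) U f (cin2 C X Y) = ccomp C Y (csum C X Y) U g (cin2 C X Y)"
  shows "f = g"
proof -
  let ?S = "csum C X Y"
  have *: "h = cadd C ?S U (ccomp C ?S X U (ccomp C X ?S U h (cin1 C X Y)) (cpr1 C X Y))
                 (ccomp C ?S Y U (ccomp C Y ?S U h (cin2 C X Y)) (cpr2 C X Y))"
    if "h \<in> Hom C ?S U" for h
  proof -
    have "ccomp C ?S ?S U h (cadd C ?S ?S (ccomp C ?S X ?S (cin1 C X Y) (cpr1 C X Y))
            (ccomp C ?S Y ?S (cin2 C X Y) (cpr2 C X Y))) = h"
      using ob that by (simp add: in_pr)
    then show ?thesis using ob that by (simp add: comp_distrib)
  qed
  show ?thesis using *[OF f] *[OF g] 1 2 by simp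
qed

lemma pr1_in1_assoc [simp]:
  "\<lbrakk>X \<in> Ob C; Y \<in> Ob C; W \<in> Ob C; f \<in> Hom C W X\<rbrakk>
    \<Longrightarrow> ccomp C W (csum C X Y) X (cpr1 C X Y) (ccomp C W X (csum C X Y) (cin1 C X Y) f) = f"
  by (simp flip: comp_assoc)

lemma pr2_in2_assoc [simp]:
  "\<lbrakk>X \<in> Ob C; Y \<in> Ob C; W \<in> Ob C; f \<in> Hom C W Y\<rbrakk>
    \<Longrightarrow> ccomp C W (csum C X Y) Y (cpr2 C X Y) (ccomp C W Y (csum C X Y) (cin2 C X Y) f) = f"
  by (simp flip: comp_assoc)

lemma pr1_in2_assoc [simp]:
  "\<lbrakk>X \<in> Ob C; Y \<in> Ob C; W \<in> Ob C; f \<in> Hom C W Y\<rbrakk>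
    \<Longrightarrow> ccomp C W (csum C X Y) X (cpr1 C X Y) (ccomp C W Y (csum C X Y) (cin2 C X Y) f) = czero C W X"
  by (simp flip: comp_assoc)

lemma pr2_in1_assoc [simp]:
  "\<lbrakk>X \<in> Ob C; Y \<in> Ob C; W \<in> Ob C; f \<in> Hom C W X\<rbrakk>
    \<Longrightarrow> ccomp C W (csum C X Y) Y (cpr2 C X Y) (ccomp C W X (csum C X Y) (cin1 C X Y) f) = czero C W Y"
  by (simp flip: comp_assoc)

context
  fixes A B A' B' :: 'o and a b c d :: 'm
  assumes ob: "A \<in> Ob C" "B \<in> Ob C" "A' \<in> Ob C" "B' \<in> Ob C"
    and ar: "a \<in> Hom C A A'" "b \<in> Hom C B A'" "c \<in> Hom C A B'" "d \<in> Hom C B B'"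
begin

lemma cmat_in [simp]: "cmat C A B A' B' a b c d \<in> Hom C (csum C A B) (csum C A' B')"
  using ob ar by (simp add: cmat_def Let_def)

lemma pr1_cmat: "ccomp C (csum C A B) (csum C A' B') A' (cpr1 C A' B') (cmat C A B A' B' a b c d)
    = cadd C (csum C A B) A' (ccomp C (csum C A B) A A' a (cpr1 C A B))
        (ccomp C (csum C A B) B A' b (cpr2 C A B))"
  using ob ar by (simp add: cmat_def Let_def comp_distrib)

lemma pr2_cmat: "ccomp C (csum C A B) (csum C A' B') B' (cpr2 C A' B') (cmat C A B A' B' a b c d)
    = cadd C (csum C A B) B' (ccomp C (csum C A B) A B' c (cpr1 C A B))
        (ccomp C (csum C A B) B B' d (cpr2 C A B))"
  using ob ar by (simp add: cmat_def Let_def comp_distrib)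

lemma cmat_in1: "ccomp C A (csum C A B) (csum C A' B') (cmat C A B A' B' a b c d) (cin1 C A B)
    = cadd C A (csum C A' B') (ccomp C A A' (csum C A' B') (cin1 C A' B') a)
        (ccomp C A B' (csum C A' B') (cin2 C A' B') c)"
  using ob ar by (simp add: cmat_def Let_def comp_distrib)

lemma cmat_in2: "ccomp C B (csum C A B) (csum C A' B') (cmat C A B A' B' a b c d) (cin2 C A B)
    = cadd C B (csum C A' B') (ccomp C B A' (csum C A' B') (cin1 C A' B') b)
        (ccomp C B B' (csum C A' B') (cin2 C A' B') d)"
  using ob ar by (simp add: cmat_def Let_def comp_distrib)

lemma cmat_neg: "cneg C (csum C A B) (csum C A' B') (cmat C A B A' B' a b c d)
    = cmat C A B A' B' (cneg C A A' a) (cneg C B A' b) (cneg C A B' c) (cneg C B B' d)"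
  using ob ar by (simp add: cmat_def Let_def)

end

lemma cmat_add:
  assumes "A \<in> Ob C" "B \<in> Ob C" "A' \<in> Ob C" "B' \<in> Ob C"
    "a \<in> Hom C A A'" "b \<in> Hom C B A'" "c \<in> Hom C A B'" "d \<in> Hom C B B'"
    "a' \<in> Hom C A A'" "b' \<in> Hom C B A'" "c' \<in> Hom C A B'" "d' \<in> Hom C B B'"
  shows "cadd C (csum C A B) (csum C A' B') (cmat C A B A' B' a b c d)
      (cmat C A B A' B' a' b' c' d')
    = cmat C A B A' B' (cadd C A A' a a') (cadd C B A' b b') (cadd C A B' c c') (cadd C B B' d d')"
  using assms by (simp add: cmat_def Let_def comp_distrib add_ac)

lemma cmat_comp:
  assumes "A \<in> Ob C" "B \<in> Ob C" "A' \<in> Ob C" "B' \<in> Ob C" "A'' \<in> Ob C" "B'' \<in> Ob C"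
    "a \<in> Hom C A A'" "b \<in> Hom C B A'" "c \<in> Hom C A B'" "d \<in> Hom C B B'"
    "a' \<in> Hom C A' A''" "b' \<in> Hom C B' A''" "c' \<in> Hom C A' B''" "d' \<in> Hom C B' B''"
  shows "ccomp C (csum C A B) (csum C A' B') (csum C A'' B'')
      (cmat C A' B' A'' B'' a' b' c' d') (cmat C A B A' B' a b c d)
    = cmat C A B A'' B''
        (cadd C A A'' (ccomp C A A' A'' a' a) (ccomp C A B' A'' b' c))
        (cadd C B A'' (ccomp C B A' A'' a' b) (ccomp C B B' A'' b' d))
        (cadd C A B'' (ccomp C A A' B'' c' a) (ccomp C A B' B'' d' c))
        (cadd C B B'' (ccomp C B A' B'' c' b) (ccomp C B B' B'' d' d))"
  using assms by (simp add: cmat_def Let_def comp_distrib add_ac)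

lemma cmat_zero [simp]:
  assumes "A \<in> Ob C" "B \<in> Ob C" "A' \<in> Ob C" "B' \<in> Ob C"
  shows "cmat C A B A' B' (czero C A A') (czero C B A') (czero C A B') (czero C B B')
    = czero C (csum C A B) (csum C A' B')"
  using assms by (simp add: cmat_def Let_def)

lemma cmat_id [simp]:
  assumes "A \<in> Ob C" "B \<in> Ob C"
  shows "cmat C A B A B (cid C A) (czero C B A) (czero C A B) (cid C B) = cid C (csum C A B)"
  using assms by (simp add: cmat_def Let_def in_pr)

lemma cat_isoE:
  assumes "cat_iso C X Y f"
  obtains g where "f \<in> Hom C X Y" "g \<in> Hom C Y X" "ccomp C X Y X g f = cid C X"
    "ccomp C Y X Y f g = cid C Y"
  using assms unfolding cat_iso_def by blast

lemma cat_isoI: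
  assumes "f \<in> Hom C X Y" "g \<in> Hom C Y X" "ccomp C X Y X g f = cid C X" "ccomp C Y X Y f g = cid C
      Y"
  shows "cat_iso C X Y f"
  using assms unfolding cat_iso_def by blast

lemma cat_iso_comp:
  assumes ob: "X \<in> Ob C" "Y \<in> Ob C" "Z \<in> Ob C" and f: "cat_iso C X Y f" and g: "cat_iso C Y Z g"
  shows "cat_iso C X Z (ccomp C X Y Z g f)"
proof -
  obtain f' where f': "f \<in> Hom C X Y" "f' \<in> Hom C Y X" "ccomp C X Y X f' f = cid C X"
    "ccomp C Y X Y f f' = cid C Y" using f by (rule cat_isoE)
  obtain g' where g': "g \<in> Hom C Y Z" "g' \<in> Hom C Z Y" "ccomp C Y Z Y g' g = cid C Y"
    "ccomp C Z Y Z g g' = cid C Z" using g by (rule cat_isoE)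
  have 1: "ccomp C X Z X (ccomp C Z Y X f' g') (ccomp C X Y Z g f) = cid C X"
  proof -
    have "ccomp C X Z X (ccomp C Z Y X f' g') (ccomp C X Y Z g f)
        = ccomp C X Y X f' (ccomp C X Y Y (ccomp C Y Z Y g' g) f)"
      using ob f'(1,2) g'(1,2) by (simp add: comp_assoc)
    then show ?thesis using ob f' g' by simp
  qed
  have 2: "ccomp C Z X Z (ccomp C X Y Z g f) (ccomp C Z Y X f' g') = cid C Z"
  proof -
    have "ccomp C Z X Z (ccomp C X Y Z g f) (ccomp C Z Y X f' g')
        = ccomp C Z Y Z g (ccomp C Z Y Y (ccomp C Y X Y f f') g')"
      using ob f'(1,2) g'(1,2) by (simp add: comp_assoc)
    then show ?thesis using ob f' g' by simp
  qed
  show ?thesis by (rule cat_isoI[OF _ _ 1 2]) (use ob f' g' in simp_all)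
qed

end

lemma full_sub_sel [simp]:
  "Ob (full_sub C S) = Ob C \<inter> S" "Hom (full_sub C S) = Hom C" "cid (full_sub C S) = cid C"
  "ccomp (full_sub C S) = ccomp C" "czero (full_sub C S) = czero C" "cadd (full_sub C S) = cadd C"
  "cneg (full_sub C S) = cneg C" "csum (full_sub C S) = csum C" "cin1 (full_sub C S) = cin1 C"
  "cin2 (full_sub C S) = cin2 C" "cpr1 (full_sub C S) = cpr1 C" "cpr2 (full_sub C S) = cpr2 C"
  by (simp_all add: full_sub_def)

lemma (in additive_cat) full_sub_additive:
  assumes "\<And>X Y. \<lbrakk>X \<in> Ob C; Y \<in> Ob C; X \<in> S; Y \<in> S\<rbrakk> \<Longrightarrow> csum C X Y \<in> S"
  shows "additive_cat (full_sub C S)"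
  by unfold_locales (simp_all add: comp_assoc add_ac comp_add_left comp_add_right
      in_pr assms)

section \<open>Quotients by ideals\<close>

text \<open>The operations of \<open>quot_cat\<close> are unions over representatives. Once
  independence of the representatives is known, such a union collapses to a single class.\<close>

lemma UN_const_on: "\<lbrakk>a \<in> F; \<And>f. f \<in> F \<Longrightarrow> K f = S\<rbrakk> \<Longrightarrow> (\<Union>f\<in>F. K f) = S"
  by blast

lemma UN2_const_on:
  "\<lbrakk>a \<in> F; b \<in> G; \<And>f g. \<lbrakk>f \<in> F; g \<in> G\<rbrakk> \<Longrightarrow> K f g = S\<rbrakk> \<Longrightarrow> (\<Union>f\<in>F. \<Union>g\<in>G. K f g) = S"
  by (rule UN_const_on, assumption, rule UN_const_on)

text \<open>Serves for null-homotopic chain maps, over several coefficient categories, and for chain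
  maps that factor through injectives.\<close>

locale additive_ideal = additive_cat C for C :: "('o, 'm) cat" +
  fixes N :: "'o \<Rightarrow> 'o \<Rightarrow> 'm \<Rightarrow> bool"
  assumes N_zero: "\<lbrakk>X \<in> Ob C; Y \<in> Ob C\<rbrakk> \<Longrightarrow> N X Y (czero C X Y)"
    and N_add: "\<lbrakk>X \<in> Ob C; Y \<in> Ob C; f \<in> Hom C X Y; g \<in> Hom C X Y; N X Y f; N X Y g\<rbrakk>
      \<Longrightarrow> N X Y (cadd C X Y f g)"
    and N_neg: "\<lbrakk>X \<in> Ob C; Y \<in> Ob C; f \<in> Hom C X Y; N X Y f\<rbrakk> \<Longrightarrow> N X Y (cneg C X Y f)"
    and N_comp_left: "\<lbrakk>X \<in> Ob C; Y \<in> Ob C; Z \<in> Ob C; f \<in> Hom C X Y; g \<in> Hom C Y Z; N X Y f\<rbrakk>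
      \<Longrightarrow> N X Z (ccomp C X Y Z g f)"
    and N_comp_right: "\<lbrakk>X \<in> Ob C; Y \<in> Ob C; Z \<in> Ob C; f \<in> Hom C X Y; g \<in> Hom C Y Z; N Y Z g\<rbrakk>
      \<Longrightarrow> N X Z (ccomp C X Y Z g f)"
begin

abbreviation Q where "Q \<equiv> quot_cat C N"
abbreviation cls where "cls \<equiv> cat_cls C N"

lemma quot_Ob [simp]: "Ob Q = Ob C"
  and quot_csum [simp]: "csum Q = csum C"
  by (simp_all add: quot_cat_def)

lemma quot_Hom: "Hom Q X Y = cls X Y ` Hom C X Y"
  by (simp add: quot_cat_def)

lemma N_diff_sym:
  assumes ob: "X \<in> Ob C" "Y \<in> Ob C" and ar: "f \<in> Hom C X Y" "g \<in> Hom C X Y"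
    and N: "N X Y (cadd C X Y f (cneg C X Y g))"
  shows "N X Y (cadd C X Y g (cneg C X Y f))"
proof -
  have "cadd C X Y g (cneg C X Y f) = cneg C X Y (cadd C X Y f (cneg C X Y g))"
    using ob ar by (simp add: add_ac)
  then show ?thesis using N_neg[OF ob _ N] ob ar by simp
qed

lemma N_diff_trans:
  assumes ob: "X \<in> Ob C" "Y \<in> Ob C" and ar: "f \<in> Hom C X Y" "g \<in> Hom C X Y" "h \<in> Hom C X Y"
    and N: "N X Y (cadd C X Y f (cneg C X Y g))" "N X Y (cadd C X Y g (cneg C X Y h))"
  shows "N X Y (cadd C X Y f (cneg C X Y h))"
proof -
  have "cadd C X Y f (cneg C X Y h)
      = cadd C X Y (cadd C X Y f (cneg C X Y g)) (cadd C X Y g (cneg C X Y h))"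
    using ob ar by (simp add: add_assoc)
  then show ?thesis using N_add[OF ob _ _ N] ob ar by simp
qed

lemma in_cls_iff: "g \<in> cls X Y f \<longleftrightarrow> g \<in> Hom C X Y \<and> N X Y (cadd C X Y f (cneg C X Y g))"
  by (simp add: cat_cls_def)

lemma self_in_cls: "\<lbrakk>X \<in> Ob C; Y \<in> Ob C; f \<in> Hom C X Y\<rbrakk> \<Longrightarrow> f \<in> cls X Y f"
  by (simp add: in_cls_iff N_zero)

lemma cls_eq_iff:
  assumes "X \<in> Ob C" "Y \<in> Ob C" "f \<in> Hom C X Y" "g \<in> Hom C X Y"
  shows "cls X Y f = cls X Y g \<longleftrightarrow> N X Y (cadd C X Y f (cneg C X Y g))"
proof
  assume "cls X Y f = cls X Y g"
  then have "g \<in> cls X Y f" using self_in_cls assms by simp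
  then show "N X Y (cadd C X Y f (cneg C X Y g))" by (simp add: in_cls_iff)
next
  assume N: "N X Y (cadd C X Y f (cneg C X Y g))"
  show "cls X Y f = cls X Y g"
    using N_diff_trans[OF assms(1,2) _ _ _ N] N_diff_trans[OF assms(1,2) _ _ _ N_diff_sym[OF assms
        N]]
      assms by (auto simp: in_cls_iff)
qed

lemma in_cls_eq: "\<lbrakk>X \<in> Ob C; Y \<in> Ob C; f \<in> Hom C X Y; g \<in> cls X Y f\<rbrakk> \<Longrightarrow> cls X Y g = cls X Y f"
  using cls_eq_iff[of X Y f g] by (simp add: in_cls_iff)

lemma in_cls_Hom: "g \<in> cls X Y f \<Longrightarrow> g \<in> Hom C X Y"
  by (simp add: in_cls_iff)

lemma quot_HomE:
  assumes "F \<in> Hom Q X Y"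
  obtains f where "f \<in> Hom C X Y" "F = cls X Y f"
  using assms by (auto simp: quot_Hom)

lemma quot_Hom_rep:
  assumes "X \<in> Ob C" "Y \<in> Ob C" "F \<in> Hom Q X Y" "f \<in> F"
  shows "f \<in> Hom C X Y" "F = cls X Y f"
  using assms in_cls_eq in_cls_Hom by (metis quot_HomE)+

lemma cls_in_Hom [simp]: "f \<in> Hom C X Y \<Longrightarrow> cls X Y f \<in> Hom Q X Y"
  by (simp add: quot_Hom)

lemma quot_cid: "cid Q X = cls X X (cid C X)"
  and quot_czero: "czero Q X Y = cls X Y (czero C X Y)"
  and quot_cin1: "cin1 Q X Y = cls X (csum C X Y) (cin1 C X Y)"
  and quot_cin2: "cin2 Q X Y = cls Y (csum C X Y) (cin2 C X Y)"
  and quot_cpr1: "cpr1 Q X Y = cls (csum C X Y) X (cpr1 C X Y)"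
  and quot_cpr2: "cpr2 Q X Y = cls (csum C X Y) Y (cpr2 C X Y)"
  by (simp_all add: quot_cat_def)

text \<open>Independence of representatives rests on gf - g'f' = g(f - f') + (g - g')f', both terms
  of which lie in the ideal.\<close>

lemma quot_ccomp:
  assumes ob: "X \<in> Ob C" "Y \<in> Ob C" "Z \<in> Ob C" and ar: "f \<in> Hom C X Y" "g \<in> Hom C Y Z"
  shows "ccomp Q X Y Z (cls Y Z g) (cls X Y f) = cls X Z (ccomp C X Y Z g f)"
proof -
  have "cls X Z (ccomp C X Y Z g' f') = cls X Z (ccomp C X Y Z g f)"
    if "g' \<in> cls Y Z g" "f' \<in> cls X Y f" for g' f'
  proof -
    have m: "g' \<in> Hom C Y Z" "f' \<in> Hom C X Y"
      and n: "N Y Z (cadd C Y Z g (cneg C Y Z g'))" "N X Y (cadd C X Y f (cneg C X Y f'))"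
      using that by (simp_all add: in_cls_iff)
    have "cadd C X Z (ccomp C X Y Z g f) (cneg C X Z (ccomp C X Y Z g' f'))
        = cadd C X Z (ccomp C X Y Z g (cadd C X Y f (cneg C X Y f')))
            (ccomp C X Y Z (cadd C Y Z g (cneg C Y Z g')) f')"
      using ob ar m by (simp add: comp_add_left comp_add_right add_assoc)
    moreover have "N X Z ..."
      using ob ar m n by (simp add: N_add N_comp_left N_comp_right)
    ultimately show ?thesis using ob ar m by (simp add: cls_eq_iff eq_commute)
  qed
  note eq = this
  have self: "g \<in> cls Y Z g" "f \<in> cls X Y f" using self_in_cls ob ar by auto
  show ?thesis
    unfolding quot_cat_def cat.simps by (rule UN2_const_on[OF self]) (rule eq)
qed

lemma quot_cadd:
  assumes ob: "X \<in> Ob C" "Y \<in> Ob C" and ar: "f \<in> Hom C X Y" "g \<in> Hom C X Y"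
  shows "cadd Q X Y (cls X Y f) (cls X Y g) = cls X Y (cadd C X Y f g)"
proof -
  have "cls X Y (cadd C X Y f' g') = cls X Y (cadd C X Y f g)"
    if "f' \<in> cls X Y f" "g' \<in> cls X Y g" for g' f'
  proof -
    have m: "g' \<in> Hom C X Y" "f' \<in> Hom C X Y"
      and n: "N X Y (cadd C X Y g (cneg C X Y g'))" "N X Y (cadd C X Y f (cneg C X Y f'))"
      using that by (simp_all add: in_cls_iff)
    have "cadd C X Y (cadd C X Y f g) (cneg C X Y (cadd C X Y f' g'))
        = cadd C X Y (cadd C X Y f (cneg C X Y f')) (cadd C X Y g (cneg C X Y g'))"
      using ob ar m by (simp add: add_ac)
    moreover have "N X Y ..."
      using ob ar m n by (simp add: N_add)
    ultimately show ?thesis using ob ar m by (simp add: cls_eq_iff eq_commute)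
  qed
  note eq = this
  have self: "g \<in> cls X Y g" "f \<in> cls X Y f" using self_in_cls ob ar by auto
  show ?thesis
    unfolding quot_cat_def cat.simps by (rule UN2_const_on[OF self(2,1)]) (rule eq)
qed

lemma quot_cneg:
  assumes ob: "X \<in> Ob C" "Y \<in> Ob C" and ar: "f \<in> Hom C X Y"
  shows "cneg Q X Y (cls X Y f) = cls X Y (cneg C X Y f)"
proof -
  have "cls X Y (cneg C X Y f') = cls X Y (cneg C X Y f)" if "f' \<in> cls X Y f" for f'
  proof -
    have m: "f' \<in> Hom C X Y" and n: "N X Y (cadd C X Y f (cneg C X Y f'))"
      using that by (simp_all add: in_cls_iff)
    have "cadd C X Y (cneg C X Y f') (cneg C X Y (cneg C X Y f)) = cadd C X Y f (cneg C X Y f')"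
      using ob ar m by (simp add: add_comm)
    then show ?thesis using ob ar m n by (simp add: cls_eq_iff)
  qed
  note eq = this
  have self: "f \<in> cls X Y f" using self_in_cls ob ar by auto
  show ?thesis
    unfolding quot_cat_def cat.simps by (rule UN_const_on[OF self]) (rule eq)
qed

lemmas quot_ops = quot_cid quot_czero quot_cin1 quot_cin2 quot_cpr1 quot_cpr2
  quot_ccomp quot_cadd quot_cneg

lemma quot_additive: "additive_cat Q"
  by unfold_locales
    ((elim quot_HomE)?, simp add: quot_ops comp_assoc add_assoc comp_add_left comp_add_right in_pr,
      (simp add: add_comm)?)+

lemma quot_cmat:
  assumes "A \<in> Ob C" "B \<in> Ob C" "A' \<in> Ob C" "B' \<in> Ob C"
    "a \<in> Hom C A A'" "b \<in> Hom C B A'" "c \<in> Hom C A B'" "d \<in> Hom C B B'"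
  shows "cmat Q A B A' B' (cls A A' a) (cls B A' b) (cls A B' c) (cls B B' d)
    = cls (csum C A B) (csum C A' B') (cmat C A B A' B' a b c d)"
  using assms by (simp add: cmat_def Let_def quot_ops)

lemma cat_iso_quotI:
  assumes "X \<in> Ob C" "Y \<in> Ob C" "f \<in> Hom C X Y" "g \<in> Hom C Y X"
    "N X X (cadd C X X (ccomp C X Y X g f) (cneg C X X (cid C X)))"
    "N Y Y (cadd C Y Y (ccomp C Y X Y f g) (cneg C Y Y (cid C Y)))"
  shows "cat_iso Q X Y (cls X Y f)"
  unfolding cat_iso_def using assms
  by (intro conjI bexI[where x = "cls Y X g"]) (simp_all add: quot_ops cls_eq_iff)

end

section \<open>Complexes over an additive category\<close>

text \<open>Normal form of indices: numerals stand on the right. Objects at n + 1 and n + 2 then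
  agree syntactically, as the conditional rules about Hom-sets require.\<close>

lemma int_add_commute_numeral [simp]: "1 + n = n + 1" "2 + n = n + 2" "3 + n = n + 3" for n :: int
  by simp_all

lemma Cx_Ob: "X \<in> Ob (Cx C) \<longleftrightarrow> (\<forall>n. trm X n \<in> Ob C \<and> dif X n \<in> Hom C (trm X n) (trm X (n+1)) \<and>
    ccomp C (trm X n) (trm X (n+1)) (trm X (n+2)) (dif X (n+1)) (dif X n)
      = czero C (trm X n) (trm X (n+2)))"
  and Cx_Hom: "f \<in> Hom (Cx C) X Y \<longleftrightarrow> (\<forall>n. f n \<in> Hom C (trm X n) (trm Y n) \<and>
    ccomp C (trm X n) (trm X (n+1)) (trm Y (n+1)) (f (n+1)) (dif X n)
      = ccomp C (trm X n) (trm Y n) (trm Y (n+1)) (dif Y n) (f n))"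
  and Cx_cid: "cid (Cx C) X = (\<lambda>n. cid C (trm X n))"
  and Cx_ccomp: "ccomp (Cx C) X Y Z g f = (\<lambda>n. ccomp C (trm X n) (trm Y n) (trm Z n) (g n) (f n))"
  and Cx_czero: "czero (Cx C) X Y = (\<lambda>n. czero C (trm X n) (trm Y n))"
  and Cx_cadd: "cadd (Cx C) X Y f g = (\<lambda>n. cadd C (trm X n) (trm Y n) (f n) (g n))"
  and Cx_cneg: "cneg (Cx C) X Y f = (\<lambda>n. cneg C (trm X n) (trm Y n) (f n))"
  and Cx_csum: "csum (Cx C) X Y = Cplx (\<lambda>n. csum C (trm X n) (trm Y n))
      (\<lambda>n. cmat C (trm X n) (trm Y n) (trm X (n+1)) (trm Y (n+1))
        (dif X n) (czero C (trm Y n) (trm X (n+1))) (czero C (trm X n) (trm Y (n+1))) (dif Y n))"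
  and Cx_cin1: "cin1 (Cx C) X Y = (\<lambda>n. cin1 C (trm X n) (trm Y n))"
  and Cx_cin2: "cin2 (Cx C) X Y = (\<lambda>n. cin2 C (trm X n) (trm Y n))"
  and Cx_cpr1: "cpr1 (Cx C) X Y = (\<lambda>n. cpr1 C (trm X n) (trm Y n))"
  and Cx_cpr2: "cpr2 (Cx C) X Y = (\<lambda>n. cpr2 C (trm X n) (trm Y n))"
  by (simp_all add: Cx_def)

lemma Cx_HomI:
  "\<lbrakk>\<And>n. f n \<in> Hom C (trm X n) (trm Y n);
    \<And>n. ccomp C (trm X n) (trm X (n+1)) (trm Y (n+1)) (f (n+1)) (dif X n)
      = ccomp C (trm X n) (trm Y n) (trm Y (n+1)) (dif Y n) (f n)\<rbrakk> \<Longrightarrow> f \<in> Hom (Cx C) X Y"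
  by (simp add: Cx_Hom)

lemmas Cx_ops = Cx_cid Cx_ccomp Cx_czero Cx_cadd Cx_cneg Cx_csum Cx_cin1 Cx_cin2 Cx_cpr1 Cx_cpr2

lemma cmat_Cx: "cmat (Cx C) A B A' B' a b c d n
    = cmat C (trm A n) (trm B n) (trm A' n) (trm B' n) (a n) (b n) (c n) (d n)"
  by (simp add: cmat_def Let_def Cx_ops)

text \<open>The formula dh + hd is kept apart from the existential quantifier, so that operations on
  homotopies become identities between boundaries.\<close>

definition boundary ::
  "('o, 'm) cat \<Rightarrow> ('o, 'm) cplx \<Rightarrow> ('o, 'm) cplx \<Rightarrow> (int \<Rightarrow> 'm) \<Rightarrow> int \<Rightarrow> 'm" where
  "boundary C X Y h = (\<lambda>n. cadd C (trm X n) (trm Y n)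
     (ccomp C (trm X n) (trm Y (n-1)) (trm Y n) (dif Y (n-1)) (h n))
     (ccomp C (trm X n) (trm X (n+1)) (trm Y n) (h (n+1)) (dif X n)))"

lemma null_homotopic_iff:
  "null_homotopic C X Y f \<longleftrightarrow>
    (\<exists>h. (\<forall>n. h n \<in> Hom C (trm X n) (trm Y (n-1))) \<and> f = boundary C X Y h)"
  unfolding null_homotopic_def boundary_def fun_eq_iff by blast

lemma null_homotopicI:
  "\<lbrakk>\<And>n. h n \<in> Hom C (trm X n) (trm Y (n-1)); f = boundary C X Y h\<rbrakk> \<Longrightarrow> null_homotopic C X Y f"
  unfolding null_homotopic_iff by blast

lemma null_homotopicE:
  assumes "null_homotopic C X Y f"
  obtains h where "\<And>n. h n \<in> Hom C (trm X n) (trm Y (n-1))" "f = boundary C X Y h"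
  using assms unfolding null_homotopic_iff by blast

context additive_cat
begin

lemma neg_add_eqD:
  assumes "X \<in> Ob C" "Y \<in> Ob C" "f \<in> Hom C X Y" "g \<in> Hom C X Y" "h \<in> Hom C X Y"
    "cadd C X Y (cneg C X Y f) g = h"
  shows "g = cadd C X Y h f"
  using assms by (metis add_comm add_neg_cancel1)

lemma Cx_trm [simp]: "X \<in> Ob (Cx C) \<Longrightarrow> trm X n \<in> Ob C"
  by (simp add: Cx_Ob)

lemma Cx_dif [simp]:
  assumes "X \<in> Ob (Cx C)"
  shows "dif X n \<in> Hom C (trm X n) (trm X (n+1))"
    "dif X (n+1) \<in> Hom C (trm X (n+1)) (trm X (n+2))"
    "dif X (n-1) \<in> Hom C (trm X (n-1)) (trm X n)"
proof -
  have *: "dif X n \<in> Hom C (trm X n) (trm X (n+1))" for n using assms unfolding Cx_Ob by blast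
  show "dif X n \<in> Hom C (trm X n) (trm X (n+1))"
    "dif X (n+1) \<in> Hom C (trm X (n+1)) (trm X (n+2))"
    "dif X (n-1) \<in> Hom C (trm X (n-1)) (trm X n)"
    using *[of n] *[of "n+1"] *[of "n-1"] by simp_all
qed

lemma Cx_dd [simp]:
  assumes "X \<in> Ob (Cx C)"
  shows "ccomp C (trm X n) (trm X (n+1)) (trm X (n+2)) (dif X (n+1)) (dif X n)
      = czero C (trm X n) (trm X (n+2))"
    "ccomp C (trm X (n-1)) (trm X n) (trm X (n+1)) (dif X n) (dif X (n-1))
      = czero C (trm X (n-1)) (trm X (n+1))"
proof -
  have *: "ccomp C (trm X n) (trm X (n+1)) (trm X (n+2)) (dif X (n+1)) (dif X n)
      = czero C (trm X n) (trm X (n+2))" for n using assms unfolding Cx_Ob by blast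
  show "ccomp C (trm X n) (trm X (n+1)) (trm X (n+2)) (dif X (n+1)) (dif X n)
      = czero C (trm X n) (trm X (n+2))" by (rule *)
  show "ccomp C (trm X (n-1)) (trm X n) (trm X (n+1)) (dif X n) (dif X (n-1))
      = czero C (trm X (n-1)) (trm X (n+1))" using *[of "n-1"] by simp
qed

lemma Cx_dd_assoc [simp]:
  assumes X: "X \<in> Ob (Cx C)" and W: "W \<in> Ob C"
  shows "f \<in> Hom C W (trm X n) \<Longrightarrow> ccomp C W (trm X (n+1)) (trm X (n+2)) (dif X (n+1))
        (ccomp C W (trm X n) (trm X (n+1)) (dif X n) f) = czero C W (trm X (n+2))"
    "f \<in> Hom C W (trm X (n-1)) \<Longrightarrow> ccomp C W (trm X n) (trm X (n+1)) (dif X n)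
        (ccomp C W (trm X (n-1)) (trm X n) (dif X (n-1)) f) = czero C W (trm X (n+1))"
proof -
  show "f \<in> Hom C W (trm X n) \<Longrightarrow> ccomp C W (trm X (n+1)) (trm X (n+2)) (dif X (n+1))
        (ccomp C W (trm X n) (trm X (n+1)) (dif X n) f) = czero C W (trm X (n+2))"
    using comp_assoc[of W "trm X n" "trm X (n+1)" "trm X (n+2)" f "dif X n" "dif X (n+1)"] X W
        by simp
  show "f \<in> Hom C W (trm X (n-1)) \<Longrightarrow> ccomp C W (trm X n) (trm X (n+1)) (dif X n)
        (ccomp C W (trm X (n-1)) (trm X n) (dif X (n-1)) f) = czero C W (trm X (n+1))"
    using comp_assoc[of W "trm X (n-1)" "trm X n" "trm X (n+1)" f "dif X (n-1)" "dif X n"] X W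
        by simp
qed

lemma Cx_Hom_in: "f \<in> Hom (Cx C) X Y \<Longrightarrow> f n \<in> Hom C (trm X n) (trm Y n)"
  by (simp add: Cx_Hom)

lemma Cx_commute:
  assumes "f \<in> Hom (Cx C) X Y"
  shows "ccomp C (trm X n) (trm X (n+1)) (trm Y (n+1)) (f (n+1)) (dif X n)
      = ccomp C (trm X n) (trm Y n) (trm Y (n+1)) (dif Y n) (f n)"
    "ccomp C (trm X (n-1)) (trm X n) (trm Y n) (f n) (dif X (n-1))
      = ccomp C (trm X (n-1)) (trm Y (n-1)) (trm Y n) (dif Y (n-1)) (f (n-1))"
proof -
  have *: "ccomp C (trm X n) (trm X (n+1)) (trm Y (n+1)) (f (n+1)) (dif X n)
      = ccomp C (trm X n) (trm Y n) (trm Y (n+1)) (dif Y n) (f n)" for n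
    using assms by (simp add: Cx_Hom)
  show "ccomp C (trm X n) (trm X (n+1)) (trm Y (n+1)) (f (n+1)) (dif X n)
      = ccomp C (trm X n) (trm Y n) (trm Y (n+1)) (dif Y n) (f n)" by (rule *)
  show "ccomp C (trm X (n-1)) (trm X n) (trm Y n) (f n) (dif X (n-1))
      = ccomp C (trm X (n-1)) (trm Y (n-1)) (trm Y n) (dif Y (n-1)) (f (n-1))"
    using *[of "n-1"] by simp
qed

lemma Cx_commute_assoc:
  assumes f: "f \<in> Hom (Cx C) X Y" and X: "X \<in> Ob (Cx C)" "Y \<in> Ob (Cx C)" and W: "W \<in> Ob C"
  shows "g \<in> Hom C W (trm X n) \<Longrightarrow>
      ccomp C W (trm X (n+1)) (trm Y (n+1)) (f (n+1))
          (ccomp C W (trm X n) (trm X (n+1)) (dif X n) g)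
      = ccomp C W (trm Y n) (trm Y (n+1)) (dif Y n) (ccomp C W (trm X n) (trm Y n) (f n) g)"
    "g \<in> Hom C W (trm X (n-1)) \<Longrightarrow>
      ccomp C W (trm X n) (trm Y n) (f n) (ccomp C W (trm X (n-1)) (trm X n) (dif X (n-1)) g)
      = ccomp C W (trm Y (n-1)) (trm Y n) (dif Y (n-1))
          (ccomp C W (trm X (n-1)) (trm Y (n-1)) (f (n-1)) g)"
  using Cx_commute[OF f, of n] X W Cx_Hom_in[OF f]
  by (simp_all flip: comp_assoc)

lemma Cx_additive: "additive_cat (Cx C)"
proof
  fix X Y assume X: "X \<in> Ob (Cx C)" and Y: "Y \<in> Ob (Cx C)"
  then show "csum (Cx C) X Y \<in> Ob (Cx C)"
    by (simp add: Cx_Ob[of "Cplx _ _"] Cx_csum cmat_comp)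
next
  fix X Y f Z g
  assume "X \<in> Ob (Cx C)" "Y \<in> Ob (Cx C)" "Z \<in> Ob (Cx C)"
    and f: "f \<in> Hom (Cx C) X Y" and g: "g \<in> Hom (Cx C) Y Z"
  then show "ccomp (Cx C) X Y Z g f \<in> Hom (Cx C) X Z"
    using Cx_commute[OF f] Cx_commute_assoc[OF g] Cx_Hom_in[OF f] Cx_Hom_in[OF g]
    by (simp add: Cx_Hom[of _ _ X Z] Cx_ops comp_assoc)
next
  fix X Y f g
  assume *: "X \<in> Ob (Cx C)" "Y \<in> Ob (Cx C)" "f \<in> Hom (Cx C) X Y"
  then show "cneg (Cx C) X Y f \<in> Hom (Cx C) X Y"
    unfolding Cx_ops by (intro Cx_HomI) (simp_all add: Cx_Hom_in Cx_commute)
  assume "g \<in> Hom (Cx C) X Y"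
  with * show "cadd (Cx C) X Y f g \<in> Hom (Cx C) X Y"
    unfolding Cx_ops by (intro Cx_HomI) (simp_all add: Cx_Hom_in Cx_commute comp_distrib)
qed (simp_all add: Cx_ops Cx_Hom cmat_in1 cmat_in2 pr1_cmat pr2_cmat comp_assoc add_assoc
    comp_add_left
      comp_add_right in_pr, auto intro!: add_comm)

interpretation Cx: additive_cat "Cx C"
  by (rule Cx_additive)

subsection \<open>Null-homotopic maps\<close>

lemma boundary_in:
  assumes "X \<in> Ob (Cx C)" "Y \<in> Ob (Cx C)" "\<And>n. h n \<in> Hom C (trm X n) (trm Y (n-1))"
  shows "boundary C X Y h \<in> Hom (Cx C) X Y"
proof -
  have "h (n+1) \<in> Hom C (trm X (n+1)) (trm Y n)" "h (n+2) \<in> Hom C (trm X (n+2)) (trm Y (n+1))" for n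
    using assms(3)[of "n+1"] assms(3)[of "n+2"] by simp_all
  then show ?thesis
    using assms by (simp add: Cx_Hom boundary_def comp_distrib)
qed

lemma boundary_add:
  assumes "X \<in> Ob (Cx C)" "Y \<in> Ob (Cx C)" "\<And>n. h n \<in> Hom C (trm X n) (trm Y (n-1))"
    "\<And>n. k n \<in> Hom C (trm X n) (trm Y (n-1))"
  shows "boundary C X Y (\<lambda>n. cadd C (trm X n) (trm Y (n-1)) (h n) (k n))
    = cadd (Cx C) X Y (boundary C X Y h) (boundary C X Y k)"
proof -
  have "h (n+1) \<in> Hom C (trm X (n+1)) (trm Y n)" "k (n+1) \<in> Hom C (trm X (n+1)) (trm Y n)" for n
    using assms(3,4)[of "n+1"] by simp_all
  then show ?thesis
    using assms by (simp add: Cx_ops boundary_def comp_distrib add_ac)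
qed

lemma boundary_neg:
  assumes "X \<in> Ob (Cx C)" "Y \<in> Ob (Cx C)" "\<And>n. h n \<in> Hom C (trm X n) (trm Y (n-1))"
  shows "boundary C X Y (\<lambda>n. cneg C (trm X n) (trm Y (n-1)) (h n))
    = cneg (Cx C) X Y (boundary C X Y h)"
proof -
  have "h (n+1) \<in> Hom C (trm X (n+1)) (trm Y n)" for n
    using assms(3)[of "n+1"] by simp_all
  then show ?thesis
    using assms by (simp add: Cx_ops boundary_def comp_distrib)
qed

lemma boundary_comp_left:
  assumes "X \<in> Ob (Cx C)" "Y \<in> Ob (Cx C)" "Z \<in> Ob (Cx C)" "g \<in> Hom (Cx C) Y Z"
    "\<And>n. h n \<in> Hom C (trm X n) (trm Y (n-1))"
  shows "boundary C X Z (\<lambda>n. ccomp C (trm X n) (trm Y (n-1)) (trm Z (n-1)) (g (n-1)) (h n))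
    = ccomp (Cx C) X Y Z g (boundary C X Y h)"
proof -
  have "h (n+1) \<in> Hom C (trm X (n+1)) (trm Y n)" for n
    using assms(5)[of "n+1"] by simp_all
  then show ?thesis
    using assms Cx_Hom_in[OF assms(4)]
    by (simp add: Cx_ops boundary_def comp_distrib Cx_commute_assoc)
qed

lemma boundary_comp_right:
  assumes "X \<in> Ob (Cx C)" "Y \<in> Ob (Cx C)" "Z \<in> Ob (Cx C)" "f \<in> Hom (Cx C) X Y"
    "\<And>n. h n \<in> Hom C (trm Y n) (trm Z (n-1))"
  shows "boundary C X Z (\<lambda>n. ccomp C (trm X n) (trm Y n) (trm Z (n-1)) (h n) (f n))
    = ccomp (Cx C) X Y Z (boundary C Y Z h) f"
proof -
  have "h (n+1) \<in> Hom C (trm Y (n+1)) (trm Z n)" for n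
    using assms(5)[of "n+1"] by simp_all
  then show ?thesis
    using assms Cx_Hom_in[OF assms(4)]
    by (simp add: Cx_ops boundary_def comp_distrib Cx_commute)
qed

lemma boundary_zero:
  assumes "X \<in> Ob (Cx C)" "Y \<in> Ob (Cx C)"
  shows "boundary C X Y (\<lambda>n. czero C (trm X n) (trm Y (n-1))) = czero (Cx C) X Y"
  using assms by (simp add: Cx_ops boundary_def)

lemma null_homotopic_ideal: "additive_ideal (Cx C) (null_homotopic C)"
proof (intro additive_ideal.intro Cx_additive additive_ideal_axioms.intro)
  fix X Y assume "X \<in> Ob (Cx C)" "Y \<in> Ob (Cx C)"
  then show "null_homotopic C X Y (czero (Cx C) X Y)"
    by (intro null_homotopicI[OF _ boundary_zero [symmetric]]) simp_all
next
  fix X Y f g assume ob: "X \<in> Ob (Cx C)" "Y \<in> Ob (Cx C)"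
    and f: "null_homotopic C X Y f" and g: "null_homotopic C X Y g"
  show "null_homotopic C X Y (cadd (Cx C) X Y f g)"
    using f g by (elim null_homotopicE) (use ob in \<open>auto intro!: null_homotopicI[OF _ boundary_add
        [symmetric]]\<close>)
next
  fix X Y f assume ob: "X \<in> Ob (Cx C)" "Y \<in> Ob (Cx C)" and f: "null_homotopic C X Y f"
  show "null_homotopic C X Y (cneg (Cx C) X Y f)"
    using f by (elim null_homotopicE) (use ob in \<open>auto intro!: null_homotopicI[OF _ boundary_neg
        [symmetric]]\<close>)
next
  fix X Y Z f g assume ob: "X \<in> Ob (Cx C)" "Y \<in> Ob (Cx C)" "Z \<in> Ob (Cx C)"
    and ar: "f \<in> Hom (Cx C) X Y" "g \<in> Hom (Cx C) Y Z"
  show "null_homotopic C X Z (ccomp (Cx C) X Y Z g f)" if "null_homotopic C X Y f"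
    using that by (elim null_homotopicE)
      (use ob ar in \<open>auto simp: Cx_Hom_in intro!: null_homotopicI[OF _ boundary_comp_left
          [symmetric]]\<close>)
  show "null_homotopic C X Z (ccomp (Cx C) X Y Z g f)" if "null_homotopic C Y Z g"
    using that by (elim null_homotopicE)
      (use ob ar in \<open>auto simp: Cx_Hom_in intro!: null_homotopicI[OF _ boundary_comp_right
          [symmetric]]\<close>)
qed

subsection \<open>Shifts and cones\<close>

lemma shift_trm [simp]: "trm (shift C k X) n = trm X (n+k)"
  and shift1_dif [simp]: "dif (shift C 1 X) n = cneg C (trm X (n+1)) (trm X (n+2)) (dif X (n+1))"
  by (simp_all add: shift_def cat_sgn_def)

lemma shift_map_apply [simp]: "shift_map f n = f (n+1)"
  by (simp add: shift_map_def)

lemma shift_Ob [simp]: "X \<in> Ob (Cx C) \<Longrightarrow> shift C 1 X \<in> Ob (Cx C)"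
  using Cx_dd(1)[of X "_ + 1"] Cx_dif(2)[of X "_ + 1"]
  by (simp add: Cx_Ob[of "shift C 1 X"])

text \<open>An equivalence for arbitrary families f: the suspension of a homotopy class is the image
  of a set under \<open>shift_map\<close>, and computing this image requires membership to be
  reflected as well as preserved.\<close>

lemma shift_Hom_iff:
  assumes X: "X \<in> Ob (Cx C)" and Y: "Y \<in> Ob (Cx C)"
  shows "shift_map f \<in> Hom (Cx C) (shift C 1 X) (shift C 1 Y) \<longleftrightarrow> f \<in> Hom (Cx C) X Y"
proof -
  have eq: "cneg C A B x = cneg C A B y \<longleftrightarrow> x = y"
    if "A \<in> Ob C" "B \<in> Ob C" "x \<in> Hom C A B" "y \<in> Hom C A B" for A B x y
    using that by (metis neg_neg)
  have "shift_map f \<in> Hom (Cx C) (shift C 1 X) (shift C 1 Y) \<longleftrightarrow>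
      (\<forall>n. f (n+1) \<in> Hom C (trm X (n+1)) (trm Y (n+1)) \<and>
        f (n+2) \<in> Hom C (trm X (n+2)) (trm Y (n+2)) \<and>
        ccomp C (trm X (n+1)) (trm X (n+2)) (trm Y (n+2)) (f (n+2)) (dif X (n+1))
        = ccomp C (trm X (n+1)) (trm Y (n+1)) (trm Y (n+2)) (dif Y (n+1)) (f (n+1)))"
  proof -
    \<comment> \<open>Cancelling the sign with \<open>eq\<close> needs the memberships at n + 1 and
      at n + 2 together.\<close>
    have s: "(\<forall>n. P (n+1)) \<longleftrightarrow> (\<forall>n. P (n+1) \<and> P (n+2))" for P :: "int \<Rightarrow> bool"
    proof safe
      show "P (n+2)" if "\<forall>n. P (n+1)" for n
        using that[rule_format, of "n+1"] by simp
    qed simp_all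
    show ?thesis unfolding Cx_Hom all_conj_distrib
      using s[of "\<lambda>n. f n \<in> Hom C (trm X n) (trm Y n)"] X Y
      by (auto simp: eq all_conj_distrib)
  qed
  also have "\<dots> \<longleftrightarrow> f \<in> Hom (Cx C) X Y"
  proof -
    have all: "(\<forall>n. P (n+1)) \<longleftrightarrow> (\<forall>n. P n)" for P :: "int \<Rightarrow> bool"
      by (metis diff_add_cancel)
    have "(\<forall>n. f n \<in> Hom C (trm X n) (trm Y n) \<and>
        f (n+1) \<in> Hom C (trm X (n+1)) (trm Y (n+1)) \<and>
        ccomp C (trm X n) (trm X (n+1)) (trm Y (n+1)) (f (n+1)) (dif X n)
        = ccomp C (trm X n) (trm Y n) (trm Y (n+1)) (dif Y n) (f n)) \<longleftrightarrow> f \<in> Hom (Cx C) X Y"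
      by (auto simp: Cx_Hom)
    then show ?thesis
      by (subst (asm) all [symmetric]) simp
  qed
  finally show ?thesis .
qed

text \<open>Both differentials change sign under the shift, so the homotopy has to change sign in
  order to keep dh + hd.\<close>

lemma shift_boundary:
  assumes "X \<in> Ob (Cx C)" "Y \<in> Ob (Cx C)" "\<And>n. h n \<in> Hom C (trm X n) (trm Y (n-1))"
  shows "boundary C (shift C 1 X) (shift C 1 Y) (\<lambda>n. cneg C (trm X (n+1)) (trm Y n) (h (n+1)))
    = shift_map (boundary C X Y h)"
proof -
  have "h (n+1) \<in> Hom C (trm X (n+1)) (trm Y n)" "h (n+2) \<in> Hom C (trm X (n+2)) (trm Y (n+1))"
    "dif Y n \<in> Hom C (trm Y n) (trm Y (n+1))" for n
    using assms(2) assms(3)[of "n+1"] assms(3)[of "n+2"] by simp_all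
  then show ?thesis using assms(1,2)
    by (simp add: boundary_def fun_eq_iff)
qed

lemma null_homotopic_shift_iff:
  assumes X: "X \<in> Ob (Cx C)" and Y: "Y \<in> Ob (Cx C)"
  shows "null_homotopic C (shift C 1 X) (shift C 1 Y) (shift_map f) \<longleftrightarrow> null_homotopic C X Y f"
proof
  assume "null_homotopic C X Y f"
  then obtain h where h: "\<And>n. h n \<in> Hom C (trm X n) (trm Y (n-1))" "f = boundary C X Y h"
    by (elim null_homotopicE) blast
  have "h (n+1) \<in> Hom C (trm X (n+1)) (trm Y n)" for n using h(1)[of "n+1"] by simp
  then show "null_homotopic C (shift C 1 X) (shift C 1 Y) (shift_map f)"
    using X Y by (intro null_homotopicI[OF _ trans[OF _ shift_boundary[OF X Y h(1), symmetric]]])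
      (simp_all add: h(2))
next
  assume "null_homotopic C (shift C 1 X) (shift C 1 Y) (shift_map f)"
  then obtain k where k: "\<And>n. k n \<in> Hom C (trm X (n+1)) (trm Y n)"
    "shift_map f = boundary C (shift C 1 X) (shift C 1 Y) k"
    by (elim null_homotopicE) auto
  define h where "h n = cneg C (trm X n) (trm Y (n-1)) (k (n-1))" for n
  have h: "h n \<in> Hom C (trm X n) (trm Y (n-1))" for n
    using k(1)[of "n-1"] X Y by (simp add: h_def)
  have "shift_map f = shift_map (boundary C X Y h)"
    unfolding k(2) shift_boundary[OF X Y h, symmetric] using X Y k(1) by (simp add: h_def)
  then have "f = boundary C X Y h"
    by (metis diff_add_cancel ext shift_map_apply)
  with h show "null_homotopic C X Y f" by (intro null_homotopicI)
qed

lemma cone_sel [simp]: "trm (cone C X Y f) n = csum C (trm X (n+1)) (trm Y n)"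
  "dif (cone C X Y f) n = cmat C (trm X (n+1)) (trm Y n) (trm X (n+2)) (trm Y (n+1))
        (cneg C (trm X (n+1)) (trm X (n+2)) (dif X (n+1))) (czero C (trm Y n) (trm X (n+2)))
        (f (n+1)) (dif Y n)"
  by (simp_all add: cone_def)

context
  fixes X Y f
  assumes X: "X \<in> Ob (Cx C)" and Y: "Y \<in> Ob (Cx C)" and f: "f \<in> Hom (Cx C) X Y"
begin

private lemma f_in: "f n \<in> Hom C (trm X n) (trm Y n)"
  by (rule Cx_Hom_in[OF f])

private lemma sq: "ccomp C (trm X (n+1)) (trm X (n+2)) (trm Y (n+2)) (f (n+2)) (dif X (n+1))
      = ccomp C (trm X (n+1)) (trm Y (n+1)) (trm Y (n+2)) (dif Y (n+1)) (f (n+1))"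
  using Cx_commute(1)[OF f, of "n+1"] by simp

private lemma difs: "dif X (n+2) \<in> Hom C (trm X (n+2)) (trm X (n+3))"
  "ccomp C (trm X (n+1)) (trm X (n+2)) (trm X (n+3)) (dif X (n+2)) (dif X (n+1))
    = czero C (trm X (n+1)) (trm X (n+3))"
  using Cx_dif(2)[OF X, of "n+1"] Cx_dd(1)[OF X, of "n+1"] by simp_all

lemma cone_Ob [simp]: "cone C X Y f \<in> Ob (Cx C)"
  using X Y f_in difs by (simp add: Cx_Ob[of "cone C X Y f"] cmat_comp sq)

lemma cone_in_Hom [simp]: "cone_in C X Y \<in> Hom (Cx C) Y (cone C X Y f)"
  using X Y f_in by (simp add: Cx_Hom cone_in_def cmat_in2)

lemma cone_pr_Hom [simp]: "cone_pr C X Y \<in> Hom (Cx C) (cone C X Y f) (shift C 1 X)"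
  using X Y f_in by (simp add: Cx_Hom cone_pr_def pr1_cmat)

text \<open>A map out of the cone that restricts to g is a row matrix (h, g). Compatibility with the
  differentials on the first summand reads gf = dh + hd. This equivalence turns null homotopies into
  extension problems, and so links homotopy with injectivity.\<close>

lemma null_homotopic_comp_iff:
  assumes Z: "Z \<in> Ob (Cx C)" and g: "g \<in> Hom (Cx C) Y Z"
  shows "null_homotopic C X Z (ccomp (Cx C) X Y Z g f) \<longleftrightarrow>
    (\<exists>k \<in> Hom (Cx C) (cone C X Y f) Z. ccomp (Cx C) Y (cone C X Y f) Z k (cone_in C X Y) = g)"
proof
  have g_in: "g n \<in> Hom C (trm Y n) (trm Z n)" for n by (rule Cx_Hom_in[OF g])
  {
    assume "null_homotopic C X Z (ccomp (Cx C) X Y Z g f)"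
    then obtain h where h: "\<And>n. h n \<in> Hom C (trm X n) (trm Z (n-1))"
      and b: "ccomp (Cx C) X Y Z g f = boundary C X Z h" by (elim null_homotopicE) blast
    have h': "h (n+1) \<in> Hom C (trm X (n+1)) (trm Z n)" "h (n+2) \<in> Hom C (trm X (n+2)) (trm Z (n+1))"
        for n
      using h[of "n+1"] h[of "n+2"] by simp_all
    have b': "ccomp C (trm X (n+1)) (trm Y (n+1)) (trm Z (n+1)) (g (n+1)) (f (n+1))
      = cadd C (trm X (n+1)) (trm Z (n+1))
         (ccomp C (trm X (n+1)) (trm Z n) (trm Z (n+1)) (dif Z n) (h (n+1)))
         (ccomp C (trm X (n+1)) (trm X (n+2)) (trm Z (n+1)) (h (n+2)) (dif X (n+1)))" for n
      using fun_cong[OF b, of "n+1"] by (simp add: Cx_ops boundary_def)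
    \<comment> \<open>The row matrix with entries h^{n+1} on X^{n+1} and g^n on Y^n.\<close>
    define k where "k n = cadd C (csum C (trm X (n+1)) (trm Y n)) (trm Z n)
      (ccomp C (csum C (trm X (n+1)) (trm Y n)) (trm X (n+1)) (trm Z n) (h (n+1))
          (cpr1 C (trm X (n+1)) (trm Y n)))
      (ccomp C (csum C (trm X (n+1)) (trm Y n)) (trm Y n) (trm Z n) (g n)
          (cpr2 C (trm X (n+1)) (trm Y n)))" for n
    have k1: "ccomp C (trm X (n+1)) (csum C (trm X (n+1)) (trm Y n)) (trm Z n) (k n)
        (cin1 C (trm X (n+1)) (trm Y n)) = h (n+1)"
      and k2: "ccomp C (trm Y n) (csum C (trm X (n+1)) (trm Y n)) (trm Z n) (k n)
          (cin2 C (trm X (n+1)) (trm Y n)) = g n"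
      and k_in: "k n \<in> Hom C (csum C (trm X (n+1)) (trm Y n)) (trm Z n)" for n
      using X Y Z g_in h' by (simp_all add: k_def comp_distrib)
    have k1': "ccomp C (trm X (n+2)) (csum C (trm X (n+2)) (trm Y (n+1))) (trm Z (n+1)) (k (n+1))
        (cin1 C (trm X (n+2)) (trm Y (n+1))) = h (n+2)"
      and k2': "ccomp C (trm Y (n+1)) (csum C (trm X (n+2)) (trm Y (n+1))) (trm Z (n+1)) (k (n+1))
          (cin2 C (trm X (n+2)) (trm Y (n+1))) = g (n+1)"
      and k_in': "k (n+1) \<in> Hom C (csum C (trm X (n+2)) (trm Y (n+1))) (trm Z (n+1))" for n
      using k1[of "n+1"] k2[of "n+1"] k_in[of "n+1"] by simp_all
    have "k \<in> Hom (Cx C) (cone C X Y f) Z"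
      unfolding Cx_Hom
    proof (intro allI conjI)
      fix n
      show "k n \<in> Hom C (trm (cone C X Y f) n) (trm Z n)" using k_in by simp
      show "ccomp C (trm (cone C X Y f) n) (trm (cone C X Y f) (n+1)) (trm Z (n+1)) (k (n+1))
          (dif (cone C X Y f) n)
        = ccomp C (trm (cone C X Y f) n) (trm Z n) (trm Z (n+1)) (dif Z n) (k n)"
      proof -
        have "ccomp C (trm X (n+1)) (csum C (trm X (n+1)) (trm Y n)) (trm Z (n+1))
            (ccomp C (csum C (trm X (n+1)) (trm Y n)) (csum C (trm X (n+2)) (trm Y (n+1)))
                (trm Z (n+1)) (k (n+1))
              (dif (cone C X Y f) n)) (cin1 C (trm X (n+1)) (trm Y n))
          = cadd C (trm X (n+1)) (trm Z (n+1))
              (cneg C (trm X (n+1)) (trm Z (n+1)) (ccomp C (trm X (n+1)) (trm X (n+2)) (trm Z (n+1))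
                  (h (n+2)) (dif X (n+1))))
              (ccomp C (trm X (n+1)) (trm Y (n+1)) (trm Z (n+1)) (g (n+1)) (f (n+1)))"
          using X Y Z f_in g_in k_in'
          by (simp add: comp_assoc cmat_in1 comp_add_right k1' k2' flip: comp_assoc[of _ _ _ _ _ _
              "k _"])
        also have "\<dots> = ccomp C (trm X (n+1)) (trm Z n) (trm Z (n+1)) (dif Z n) (h (n+1))"
          using X Y Z h' by (simp add: b' add_ac)
        finally have 1: "ccomp C (trm X (n+1)) (csum C (trm X (n+1)) (trm Y n)) (trm Z (n+1))
            (ccomp C (csum C (trm X (n+1)) (trm Y n)) (csum C (trm X (n+2)) (trm Y (n+1)))
                (trm Z (n+1)) (k (n+1))
              (dif (cone C X Y f) n)) (cin1 C (trm X (n+1)) (trm Y n))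
          = ccomp C (trm X (n+1)) (trm Z n) (trm Z (n+1)) (dif Z n) (h (n+1))" .
        have "ccomp C (trm Y n) (csum C (trm X (n+1)) (trm Y n)) (trm Z (n+1))
            (ccomp C (csum C (trm X (n+1)) (trm Y n)) (csum C (trm X (n+2)) (trm Y (n+1)))
                (trm Z (n+1)) (k (n+1))
              (dif (cone C X Y f) n)) (cin2 C (trm X (n+1)) (trm Y n))
          = ccomp C (trm Y n) (trm Y (n+1)) (trm Z (n+1)) (g (n+1)) (dif Y n)"
          using X Y Z f_in g_in k_in'
          by (simp add: comp_assoc cmat_in2 comp_add_right k1' k2' flip: comp_assoc[of _ _ _ _ _ _
              "k _"])
        also have "\<dots> = ccomp C (trm Y n) (trm Z n) (trm Z (n+1)) (dif Z n) (g n)"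
          by (rule Cx_commute(1)[OF g])
        finally have 2: "ccomp C (trm Y n) (csum C (trm X (n+1)) (trm Y n)) (trm Z (n+1))
            (ccomp C (csum C (trm X (n+1)) (trm Y n)) (csum C (trm X (n+2)) (trm Y (n+1)))
                (trm Z (n+1)) (k (n+1))
              (dif (cone C X Y f) n)) (cin2 C (trm X (n+1)) (trm Y n))
          = ccomp C (trm Y n) (trm Z n) (trm Z (n+1)) (dif Z n) (g n)" .
        have 3: "dif (cone C X Y f) n
            \<in> Hom C (csum C (trm X (n+1)) (trm Y n)) (csum C (trm X (n+2)) (trm Y (n+1)))"
          using X Y f_in by simp
        have "ccomp C (csum C (trm X (n+1)) (trm Y n)) (csum C (trm X (n+2)) (trm Y (n+1)))
            (trm Z (n+1)) (k (n+1))
              (dif (cone C X Y f) n)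
          = ccomp C (csum C (trm X (n+1)) (trm Y n)) (trm Z n) (trm Z (n+1)) (dif Z n) (k n)"
          by (rule from_sum_eqI[of "trm Z (n+1)" "trm X (n+1)" "trm Y n"])
            (use X Y Z 1 2 3 k_in k_in' k1 k2 in \<open>simp_all del: cone_sel add: comp_assoc\<close>)
        then show ?thesis by simp
      qed
    qed
    moreover have "ccomp (Cx C) Y (cone C X Y f) Z k (cone_in C X Y) = g"
      using k2 by (simp add: Cx_ops cone_in_def)
    ultimately show "\<exists>k \<in> Hom (Cx C) (cone C X Y f) Z. ccomp (Cx C) Y (cone C X Y f) Z k
        (cone_in C X Y) = g"
      by blast
  }
  {
    assume "\<exists>k \<in> Hom (Cx C) (cone C X Y f) Z. ccomp (Cx C) Y (cone C X Y f) Z k (cone_in C X Y) = g"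
    then obtain k where k: "k \<in> Hom (Cx C) (cone C X Y f) Z"
      and kg: "ccomp (Cx C) Y (cone C X Y f) Z k (cone_in C X Y) = g" by blast
    have k_in: "k n \<in> Hom C (csum C (trm X (n+1)) (trm Y n)) (trm Z n)" for n
      using Cx_Hom_in[OF k, of n] by simp
    \<comment> \<open>The restriction of k to the first summand. It starts at X^{n+1}, so the null
      homotopy in degree n is \<open>e (n-1)\<close>.\<close>
    define e where "e n = ccomp C (trm X (n+1)) (csum C (trm X (n+1)) (trm Y n)) (trm Z n) (k n)
        (cin1 C (trm X (n+1)) (trm Y n))" for n
    have e_in: "e n \<in> Hom C (trm X (n+1)) (trm Z n)" for n using X Y Z k_in by (simp add: e_def)
    have k_in': "k (n+1) \<in> Hom C (csum C (trm X (n+2)) (trm Y (n+1))) (trm Z (n+1))" for n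
      using k_in[of "n+1"] by simp_all
    have e': "ccomp C (trm X (n+2)) (csum C (trm X (n+2)) (trm Y (n+1))) (trm Z (n+1)) (k (n+1))
        (cin1 C (trm X (n+2)) (trm Y (n+1))) = e (n+1)" for n
      by (simp add: e_def)
    have kg': "ccomp C (trm Y (n+1)) (csum C (trm X (n+2)) (trm Y (n+1))) (trm Z (n+1)) (k (n+1))
        (cin2 C (trm X (n+2)) (trm Y (n+1))) = g (n+1)" for n
      using fun_cong[OF kg, of "n+1"] by (simp add: Cx_ops cone_in_def)
    have main: "ccomp C (trm X (n+1)) (trm Y (n+1)) (trm Z (n+1)) (g (n+1)) (f (n+1))
      = cadd C (trm X (n+1)) (trm Z (n+1)) (ccomp C (trm X (n+1)) (trm Z n) (trm Z (n+1)) (dif Z n)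
          (e n))
          (ccomp C (trm X (n+1)) (trm X (n+2)) (trm Z (n+1)) (e (n+1)) (dif X (n+1)))" for n
    proof -
      have "cadd C (trm X (n+1)) (trm Z (n+1))
              (cneg C (trm X (n+1)) (trm Z (n+1)) (ccomp C (trm X (n+1)) (trm X (n+2)) (trm Z (n+1))
                  (e (n+1)) (dif X (n+1))))
              (ccomp C (trm X (n+1)) (trm Y (n+1)) (trm Z (n+1)) (g (n+1)) (f (n+1)))
         = ccomp C (trm X (n+1)) (csum C (trm X (n+1)) (trm Y n)) (trm Z (n+1))
            (ccomp C (csum C (trm X (n+1)) (trm Y n)) (csum C (trm X (n+2)) (trm Y (n+1)))
                (trm Z (n+1)) (k (n+1))
              (dif (cone C X Y f) n)) (cin1 C (trm X (n+1)) (trm Y n))"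
        using X Y Z f_in k_in'
        by (simp add: comp_assoc cmat_in1 comp_add_right e' kg' flip: comp_assoc[of _ _ _ _ _ _ "k
            _"])
      also have "\<dots> = ccomp C (trm X (n+1)) (csum C (trm X (n+1)) (trm Y n)) (trm Z (n+1))
          (ccomp C (csum C (trm X (n+1)) (trm Y n)) (trm Z n) (trm Z (n+1)) (dif Z n) (k n))
              (cin1 C (trm X (n+1)) (trm Y n))"
        using Cx_commute(1)[OF k, of n] by simp
      also have "\<dots> = ccomp C (trm X (n+1)) (trm Z n) (trm Z (n+1)) (dif Z n) (e n)"
        using X Y Z k_in by (simp add: comp_assoc e_def)
      finally show ?thesis
        by (rule neg_add_eqD[rotated -1]) (use X Y Z f_in g_in e_in[of n] e_in[of "n+1"]
            in simp_all)
    qed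
    show "null_homotopic C X Z (ccomp (Cx C) X Y Z g f)"
    proof (rule null_homotopicI)
      show "e (n-1) \<in> Hom C (trm X n) (trm Z (n-1))" for n using e_in[of "n-1"] by simp
      show "ccomp (Cx C) X Y Z g f = boundary C X Z (\<lambda>n. e (n-1))"
        using main[of "_ - 1"] by (simp add: fun_eq_iff Cx_ops boundary_def)
    qed
  }
qed

end

end

section \<open>The category of graded objects\<close>

lemma Zplus_Ob: "X \<in> Ob (Zplus C) \<longleftrightarrow> (\<forall>j. X j \<in> Ob C)"
  and Zplus_Hom: "f \<in> Hom (Zplus C) X Y \<longleftrightarrow> (\<forall>n j. f n j \<in> Hom C (X j) (Y (j + int n)))"
  and Zplus_cid: "cid (Zplus C) X = deg0 C X X (\<lambda>j. cid C (X j))"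
  and Zplus_ccomp: "ccomp (Zplus C) X Y Z g f n j = cat_sum_upto C (X j) (Z (j + int n))
      (\<lambda>k. ccomp C (X j) (Y (j + int k)) (Z (j + int n)) (g (n - k) (j + int k)) (f k j)) n"
  and Zplus_czero: "czero (Zplus C) X Y = (\<lambda>n j. czero C (X j) (Y (j + int n)))"
  and Zplus_cadd: "cadd (Zplus C) X Y f g = (\<lambda>n j. cadd C (X j) (Y (j + int n)) (f n j) (g n j))"
  and Zplus_cneg: "cneg (Zplus C) X Y f = (\<lambda>n j. cneg C (X j) (Y (j + int n)) (f n j))"
  and Zplus_csum: "csum (Zplus C) X Y = (\<lambda>j. csum C (X j) (Y j))"
  and Zplus_cin1: "cin1 (Zplus C) X Y = deg0 C X (\<lambda>j. csum C (X j) (Y j)) (\<lambda>j. cin1 C (X j) (Y j))"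
  and Zplus_cin2: "cin2 (Zplus C) X Y = deg0 C Y (\<lambda>j. csum C (X j) (Y j)) (\<lambda>j. cin2 C (X j) (Y j))"
  and Zplus_cpr1: "cpr1 (Zplus C) X Y = deg0 C (\<lambda>j. csum C (X j) (Y j)) X (\<lambda>j. cpr1 C (X j) (Y j))"
  and Zplus_cpr2: "cpr2 (Zplus C) X Y = deg0 C (\<lambda>j. csum C (X j) (Y j)) Y (\<lambda>j. cpr2 C (X j) (Y j))"
  by (simp_all add: Zplus_def)

lemmas Zplus_ops = Zplus_cid Zplus_czero Zplus_cadd Zplus_cneg Zplus_csum
  Zplus_cin1 Zplus_cin2 Zplus_cpr1 Zplus_cpr2

context additive_cat
begin

abbreviation ZC where "ZC \<equiv> Zplus C"
abbreviation CZ where "CZ \<equiv> Cx ZC"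

section \<open>Finite sums in Hom-groups\<close>

lemma sum_in [simp]:
  "\<lbrakk>X \<in> Ob C; Y \<in> Ob C; \<And>k. k \<le> n \<Longrightarrow> f k \<in> Hom C X Y\<rbrakk> \<Longrightarrow> cat_sum_upto C X Y f n \<in> Hom C X Y"
  by (induction n) simp_all

lemma sum_cong:
  "(\<And>k. k \<le> n \<Longrightarrow> f k = g k) \<Longrightarrow> cat_sum_upto C X Y f n = cat_sum_upto C X Y g n"
  by (induction n) simp_all

lemma sum_add:
  "\<lbrakk>X \<in> Ob C; Y \<in> Ob C; \<And>k. k \<le> n \<Longrightarrow> f k \<in> Hom C X Y; \<And>k. k \<le> n \<Longrightarrow> g k \<in> Hom C X Y\<rbrakk>
    \<Longrightarrow> cat_sum_upto C X Y (\<lambda>k. cadd C X Y (f k) (g k)) n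
      = cadd C X Y (cat_sum_upto C X Y f n) (cat_sum_upto C X Y g n)"
  by (induction n) (simp_all add: add_ac)

lemma sum_comp_left:
  "\<lbrakk>X \<in> Ob C; Y \<in> Ob C; Z \<in> Ob C; \<And>k. k \<le> n \<Longrightarrow> f k \<in> Hom C X Y; g \<in> Hom C Y Z\<rbrakk>
    \<Longrightarrow> ccomp C X Y Z g (cat_sum_upto C X Y f n) = cat_sum_upto C X Z (\<lambda>k. ccomp C X Y Z g (f k)) n"
  by (induction n) (simp_all add: comp_add_right)

lemma sum_comp_right:
  "\<lbrakk>X \<in> Ob C; Y \<in> Ob C; Z \<in> Ob C; f \<in> Hom C X Y; \<And>k. k \<le> n \<Longrightarrow> g k \<in> Hom C Y Z\<rbrakk>
    \<Longrightarrow> ccomp C X Y Z (cat_sum_upto C Y Z g n) f = cat_sum_upto C X Z (\<lambda>k. ccomp C X Y Z (g k) f) n"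
  by (induction n) (simp_all add: comp_add_left)

lemma sum_zero:
  "\<lbrakk>X \<in> Ob C; Y \<in> Ob C; \<And>k. k \<le> n \<Longrightarrow> f k = czero C X Y\<rbrakk> \<Longrightarrow> cat_sum_upto C X Y f n = czero C X Y"
  by (induction n) simp_all

lemma sum_single:
  "\<lbrakk>X \<in> Ob C; Y \<in> Ob C; m \<le> n; f m \<in> Hom C X Y; \<And>k. \<lbrakk>k \<le> n; k \<noteq> m\<rbrakk> \<Longrightarrow> f k = czero C X Y\<rbrakk>
    \<Longrightarrow> cat_sum_upto C X Y f n = f m"
proof (induction n)
  case (Suc n)
  show ?case
  proof (cases "m = Suc n")
    case True
    then have "cat_sum_upto C X Y f n = czero C X Y" using Suc.prems by (intro sum_zero) simp_all
    then show ?thesis using Suc.prems True by simp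
  next
    case False
    then show ?thesis using Suc.IH Suc.prems by simp
  qed
qed simp

text \<open>Exchanges the order of summation over the triangle l \<le> k \<le> n by the substitution
  k = l + m. This is the combinatorial content of associativity of the convolution that defines
  composition.\<close>

lemma sum_triangle:
  assumes ob: "X \<in> Ob C" "Y \<in> Ob C" and F: "\<And>k l. \<lbrakk>l \<le> k; k \<le> n\<rbrakk> \<Longrightarrow> F k l \<in> Hom C X Y"
  shows "cat_sum_upto C X Y (\<lambda>k. cat_sum_upto C X Y (F k) k) n
    = cat_sum_upto C X Y (\<lambda>l. cat_sum_upto C X Y (\<lambda>m. F (l + m) l) (n - l)) n"
  using F
proof (induction n)
  case (Suc n)
  have "cat_sum_upto C X Y (\<lambda>l. cat_sum_upto C X Y (\<lambda>m. F (l + m) l) (Suc n - l)) n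
    = cat_sum_upto C X Y (\<lambda>l. cadd C X Y (cat_sum_upto C X Y (\<lambda>m. F (l + m) l) (n - l))
        (F (Suc n) l)) n"
    by (rule sum_cong) (simp add: Suc_diff_le)
  also have "\<dots> = cadd C X Y (cat_sum_upto C X Y (\<lambda>l. cat_sum_upto C X Y (\<lambda>m. F (l + m) l) (n - l))
      n)
      (cat_sum_upto C X Y (F (Suc n)) n)"
    using ob Suc.prems by (intro sum_add) simp_all
  finally show ?case
    using ob Suc by (simp add: add_assoc)
qed simp

section \<open>Composition and biproducts of graded objects\<close>

lemma Zplus_Ob_in [simp]: "X \<in> Ob ZC \<Longrightarrow> X j \<in> Ob C"
  by (simp add: Zplus_Ob)

lemma Zplus_Hom_in: "f \<in> Hom ZC X Y \<Longrightarrow> f n j \<in> Hom C (X j) (Y (j + int n))"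
  by (simp add: Zplus_Hom)

lemma Zplus_Hom_in0: "f \<in> Hom ZC X Y \<Longrightarrow> f 0 j \<in> Hom C (X j) (Y j)"
  using Zplus_Hom_in[of f X Y 0 j] by simp

lemma Zplus_Hom_in_diff:
  "\<lbrakk>f \<in> Hom ZC X Y; k \<le> n\<rbrakk> \<Longrightarrow> f (n - k) (j + int k) \<in> Hom C (X (j + int k)) (Y (j + int n))"
  using Zplus_Hom_in[of f X Y "n - k" "j + int k"] by (simp add: of_nat_diff)

lemma Zplus_summand_in:
  assumes "X \<in> Ob ZC" "Y \<in> Ob ZC" "Z \<in> Ob ZC"
    "f \<in> Hom ZC X Y" "g \<in> Hom ZC Y Z" "k \<le> n"
  shows "ccomp C (X j) (Y (j + int k)) (Z (j + int n)) (g (n - k) (j + int k)) (f k j)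
    \<in> Hom C (X j) (Z (j + int n))"
  using assms Zplus_Hom_in_diff[of g Y Z k n j] Zplus_Hom_in[of f X Y k j] by simp

lemma deg0_apply [simp]: "deg0 C X Y f 0 j = f j"
  "n \<noteq> 0 \<Longrightarrow> deg0 C X Y f n j = czero C (X j) (Y (j + int n))"
  by (simp_all add: deg0_def)

lemma deg0_in:
  assumes "X \<in> Ob ZC" "Y \<in> Ob ZC" "\<And>j. f j \<in> Hom C (X j) (Y j)"
  shows "deg0 C X Y f \<in> Hom ZC X Y"
  using assms by (auto simp: Zplus_Hom deg0_def)

text \<open>Arrows concentrated in degree zero compose componentwise, because one summand of the
  convolution survives. Identities, injections and projections are of this kind.\<close>

lemma Zplus_comp_deg0:
  assumes "X \<in> Ob ZC" "Y \<in> Ob ZC" "Z \<in> Ob ZC"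
    "\<And>j. f j \<in> Hom C (X j) (Y j)" "g \<in> Hom ZC Y Z"
  shows "ccomp ZC X Y Z g (deg0 C X Y f) n j
    = ccomp C (X j) (Y j) (Z (j + int n)) (g n j) (f j)"
  unfolding Zplus_ccomp
  by (rule trans[OF sum_single[where m = 0]])
    (use assms Zplus_Hom_in[OF assms(5)] Zplus_Hom_in_diff[OF assms(5)] in simp_all)

lemma Zplus_deg0_comp:
  assumes "X \<in> Ob ZC" "Y \<in> Ob ZC" "Z \<in> Ob ZC"
    "f \<in> Hom ZC X Y" "\<And>j. g j \<in> Hom C (Y j) (Z j)"
  shows "ccomp ZC X Y Z (deg0 C Y Z g) f n j
    = ccomp C (X j) (Y (j + int n)) (Z (j + int n)) (g (j + int n)) (f n j)"
  unfolding Zplus_ccomp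
  by (rule trans[OF sum_single[where m = n]])
    (use assms Zplus_Hom_in[OF assms(4)] in \<open>simp_all add: of_nat_diff\<close>)

lemma Zplus_deg0_deg0:
  assumes "X \<in> Ob ZC" "Y \<in> Ob ZC" "Z \<in> Ob ZC"
    "\<And>j. f j \<in> Hom C (X j) (Y j)" "\<And>j. g j \<in> Hom C (Y j) (Z j)"
  shows "ccomp ZC X Y Z (deg0 C Y Z g) (deg0 C X Y f)
    = deg0 C X Z (\<lambda>j. ccomp C (X j) (Y j) (Z j) (g j) (f j))"
  using assms
  by (intro ext) (auto simp: Zplus_comp_deg0 deg0_in, auto simp: deg0_def)

lemma deg0_zero: "deg0 C X Y (\<lambda>j. czero C (X j) (Y j)) = (\<lambda>n j. czero C (X j) (Y (j + int n)))"
  by (auto simp: deg0_def fun_eq_iff)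

lemma deg0_add:
  assumes "X \<in> Ob ZC" "Y \<in> Ob ZC"
  shows "(\<lambda>n j. cadd C (X j) (Y (j + int n)) (deg0 C X Y f n j) (deg0 C X Y g n j))
    = deg0 C X Y (\<lambda>j. cadd C (X j) (Y j) (f j) (g j))"
  using assms by (auto simp: deg0_def fun_eq_iff)

lemma Zplus_comp_in:
  assumes "X \<in> Ob ZC" "Y \<in> Ob ZC" "Z \<in> Ob ZC"
    "f \<in> Hom ZC X Y" "g \<in> Hom ZC Y Z"
  shows "ccomp ZC X Y Z g f \<in> Hom ZC X Z"
  using assms by (simp add: Zplus_Hom[of "ccomp _ _ _ _ _ _"] Zplus_ccomp Zplus_summand_in)

text \<open>Both sides are the sum over l \<le> k \<le> n of h_{n-k} g_{k-l} f_l, summed in the two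
  possible orders.\<close>

lemma Zplus_assoc:
  assumes ob: "W \<in> Ob ZC" "X \<in> Ob ZC" "Y \<in> Ob ZC" "Z \<in> Ob ZC"
    and ar: "f \<in> Hom ZC W X" "g \<in> Hom ZC X Y" "h \<in> Hom ZC Y Z"
  shows "ccomp ZC W X Z (ccomp ZC X Y Z h g) f
    = ccomp ZC W Y Z h (ccomp ZC W X Y g f)"
proof (intro ext)
  fix n j
  let ?F = "\<lambda>k l. ccomp C (W j) (Y (j + int k)) (Z (j + int n)) (h (n - k) (j + int k))
     (ccomp C (W j) (X (j + int l)) (Y (j + int k)) (g (k - l) (j + int l)) (f l j))"
  have F: "?F k l \<in> Hom C (W j) (Z (j + int n))" if "l \<le> k" "k \<le> n" for k l
    using that ob Zplus_Hom_in_diff[OF ar(2), of l k j] Zplus_Hom_in_diff[OF ar(3), of k n j]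
      Zplus_Hom_in[OF ar(1), of l j] by simp
  have "ccomp ZC W Y Z h (ccomp ZC W X Y g f) n j
      = cat_sum_upto C (W j) (Z (j + int n)) (\<lambda>k. cat_sum_upto C (W j) (Z (j + int n)) (?F k) k) n"
    unfolding Zplus_ccomp[of C W Y Z]
  proof (rule sum_cong)
    fix k assume k: "k \<le> n"
    show "ccomp C (W j) (Y (j + int k)) (Z (j + int n)) (h (n - k) (j + int k))
         (ccomp ZC W X Y g f k j) = cat_sum_upto C (W j) (Z (j + int n)) (?F k) k"
      unfolding Zplus_ccomp[of C W X Y]
      by (rule sum_comp_left) (use k ob Zplus_summand_in[OF ob(1-3) ar(1,2)]
          Zplus_Hom_in_diff[OF ar(3), of k n j] in simp_all)
  qed
  also have "\<dots> = cat_sum_upto C (W j) (Z (j + int n))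
      (\<lambda>l. cat_sum_upto C (W j) (Z (j + int n)) (\<lambda>m. ?F (l + m) l) (n - l)) n"
    by (rule sum_triangle) (use ob F in simp_all)
  also have "\<dots> = ccomp ZC W X Z (ccomp ZC X Y Z h g) f n j"
    unfolding Zplus_ccomp[of C W X Z]
  proof (rule sum_cong)
    fix l assume l: "l \<le> n"
    have jn: "j + int l + int (n - l) = j + int n" using l by simp
    have *: "ccomp C (X (j + int l)) (Y (j + int l + int k)) (Z (j + int n))
        (h (n - l - k) (j + int l + int k)) (g k (j + int l))
      \<in> Hom C (X (j + int l)) (Z (j + int n))" if "k \<le> n - l" for k
      using Zplus_summand_in[OF ob(2-4) ar(2,3) that, of "j + int l"] jn by simp
    have "ccomp C (W j) (X (j + int l)) (Z (j + int n)) (ccomp ZC X Y Z h g (n - l) (j + int l))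
        (f l j)
        = cat_sum_upto C (W j) (Z (j + int n)) (\<lambda>k. ccomp C (W j) (X (j + int l)) (Z (j + int n))
          (ccomp C (X (j + int l)) (Y (j + int l + int k)) (Z (j + int n))
            (h (n - l - k) (j + int l + int k)) (g k (j + int l))) (f l j)) (n - l)"
      unfolding Zplus_ccomp[of C X Y Z] jn
      by (rule sum_comp_right) (use ob * Zplus_Hom_in[OF ar(1), of l j] in simp_all)
    also have "\<dots> = cat_sum_upto C (W j) (Z (j + int n)) (\<lambda>m. ?F (l + m) l) (n - l)"
    proof (rule sum_cong)
      fix k assume k: "k \<le> n - l"
      have "h (n - l - k) (j + int l + int k) \<in> Hom C (Y (j + int l + int k)) (Z (j + int n))"
        using Zplus_Hom_in_diff[OF ar(3), of k "n - l" "j + int l"] k jn by simp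
      then show "ccomp C (W j) (X (j + int l)) (Z (j + int n))
          (ccomp C (X (j + int l)) (Y (j + int l + int k)) (Z (j + int n))
            (h (n - l - k) (j + int l + int k)) (g k (j + int l))) (f l j) = ?F (l + k) l"
        using ob Zplus_Hom_in[OF ar(1), of l j] Zplus_Hom_in[OF ar(2), of k "j + int l"]
        by (simp add: comp_assoc add.assoc)
    qed
    finally show "cat_sum_upto C (W j) (Z (j + int n)) (\<lambda>m. ?F (l + m) l) (n - l)
        = ccomp C (W j) (X (j + int l)) (Z (j + int n)) (ccomp ZC X Y Z h g (n - l) (j + int l))
            (f l j)"
      by simp
  qed
  finally show "ccomp ZC W X Z (ccomp ZC X Y Z h g) f n j
    = ccomp ZC W Y Z h (ccomp ZC W X Y g f) n j" by simp
qed

lemma Zplus_sum_ob: "\<lbrakk>X \<in> Ob ZC; Y \<in> Ob ZC\<rbrakk> \<Longrightarrow> (\<lambda>j. csum C (X j) (Y j)) \<in> Ob ZC"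
  by (simp add: Zplus_Ob)

lemma Zplus_additive: "additive_cat ZC"
proof
  fix X Y f
  assume ob: "X \<in> Ob ZC" "Y \<in> Ob ZC" and f: "f \<in> Hom ZC X Y"
  show "ccomp ZC X Y Y (cid ZC Y) f = f"
    using ob f Zplus_Hom_in[OF f] by (intro ext) (simp add: Zplus_cid Zplus_deg0_comp)
  show "ccomp ZC X X Y f (cid ZC X) = f"
    using ob f Zplus_Hom_in[OF f] by (intro ext) (simp add: Zplus_cid Zplus_comp_deg0)
next
  fix X Y Z f g h
  assume ob: "X \<in> Ob ZC" "Y \<in> Ob ZC" "Z \<in> Ob ZC"
    and f: "f \<in> Hom ZC X Y" and g: "g \<in> Hom ZC Y Z" and h: "h \<in> Hom ZC Y Z"
  show "ccomp ZC X Y Z (cadd ZC Y Z g h) f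
      = cadd ZC X Z (ccomp ZC X Y Z g f) (ccomp ZC X Y Z h f)"
  proof (intro ext)
    fix n j
    have "ccomp C (X j) (Y (j + int k)) (Z (j + int n))
          (cadd ZC Y Z g h (n - k) (j + int k)) (f k j)
        = cadd C (X j) (Z (j + int n))
            (ccomp C (X j) (Y (j + int k)) (Z (j + int n)) (g (n - k) (j + int k)) (f k j))
            (ccomp C (X j) (Y (j + int k)) (Z (j + int n)) (h (n - k) (j + int k)) (f k j))"
      if "k \<le> n" for k
      using that ob Zplus_Hom_in[OF f, of k j] Zplus_Hom_in_diff[OF g that, of j]
        Zplus_Hom_in_diff[OF h that, of j]
      by (simp add: Zplus_cadd comp_add_left of_nat_diff)
    then show "ccomp ZC X Y Z (cadd ZC Y Z g h) f n j
        = cadd ZC X Z (ccomp ZC X Y Z g f) (ccomp ZC X Y Z h f) n j"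
      using ob f g h
      by (simp add: Zplus_ccomp Zplus_cadd[of C X Z] sum_add Zplus_summand_in cong: sum_cong)
  qed
next
  fix X Y Z f g h
  assume ob: "X \<in> Ob ZC" "Y \<in> Ob ZC" "Z \<in> Ob ZC"
    and f: "f \<in> Hom ZC X Y" and g: "g \<in> Hom ZC X Y" and h: "h \<in> Hom ZC Y Z"
  show "ccomp ZC X Y Z h (cadd ZC X Y f g)
      = cadd ZC X Z (ccomp ZC X Y Z h f) (ccomp ZC X Y Z h g)"
  proof (intro ext)
    fix n j
    have "ccomp C (X j) (Y (j + int k)) (Z (j + int n)) (h (n - k) (j + int k))
          (cadd ZC X Y f g k j)
        = cadd C (X j) (Z (j + int n))
            (ccomp C (X j) (Y (j + int k)) (Z (j + int n)) (h (n - k) (j + int k)) (f k j))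
            (ccomp C (X j) (Y (j + int k)) (Z (j + int n)) (h (n - k) (j + int k)) (g k j))"
      if "k \<le> n" for k
      using that ob Zplus_Hom_in[OF f, of k j] Zplus_Hom_in[OF g, of k j]
        Zplus_Hom_in_diff[OF h that, of j]
      by (simp add: Zplus_cadd comp_add_right)
    then show "ccomp ZC X Y Z h (cadd ZC X Y f g) n j
        = cadd ZC X Z (ccomp ZC X Y Z h f) (ccomp ZC X Y Z h g) n j"
      using ob f g h
      by (simp add: Zplus_ccomp Zplus_cadd[of C X Z] sum_add Zplus_summand_in cong: sum_cong)
  qed
next
  fix X Y
  assume ob: "X \<in> Ob ZC" "Y \<in> Ob ZC"
  note S = Zplus_sum_ob[OF ob]
  show "ccomp ZC X (csum ZC X Y) X (cpr1 ZC X Y) (cin1 ZC X Y) = cid ZC X"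
    "ccomp ZC Y (csum ZC X Y) Y (cpr2 ZC X Y) (cin2 ZC X Y) = cid ZC Y"
    "ccomp ZC Y (csum ZC X Y) X (cpr1 ZC X Y) (cin2 ZC X Y) = czero ZC Y X"
    "ccomp ZC X (csum ZC X Y) Y (cpr2 ZC X Y) (cin1 ZC X Y) = czero ZC X Y"
    "cadd ZC (csum ZC X Y) (csum ZC X Y)
      (ccomp ZC (csum ZC X Y) X (csum ZC X Y) (cin1 ZC X Y) (cpr1 ZC X Y))
      (ccomp ZC (csum ZC X Y) Y (csum ZC X Y) (cin2 ZC X Y) (cpr2 ZC X Y))
     = cid ZC (csum ZC X Y)"
    using ob S
    by (simp_all add: Zplus_ops Zplus_deg0_deg0 deg0_zero deg0_add[OF S S] in_pr)
qed (auto simp: Zplus_assoc Zplus_comp_in Zplus_sum_ob Zplus_ops fun_eq_iff Zplus_Hom_in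
    intro!: deg0_in add_assoc add_comm simp: Zplus_Ob, auto simp: Zplus_Hom)

end

section \<open>The stable category\<close>

text \<open>\<open>gtw\<close>, \<open>gtwm\<close> and \<open>geta\<close> are the automorphism (1)
  and the transformation \<eta> on graded objects. Their termwise extensions to complexes are
  \<open>twist\<close>, \<open>twist_map\<close> and \<open>eta\<close>.\<close>

definition gtw :: "(int \<Rightarrow> 'o) \<Rightarrow> int \<Rightarrow> 'o" where
  "gtw X = (\<lambda>j. X (j+1))"

definition gtwm :: "(nat \<Rightarrow> int \<Rightarrow> 'm) \<Rightarrow> nat \<Rightarrow> int \<Rightarrow> 'm" where
  "gtwm f = (\<lambda>n j. f n (j+1))"

lemma gtw_apply [simp]: "gtw X j = X (j+1)"
  and gtwm_apply [simp]: "gtwm f n j = f n (j+1)"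
  by (simp_all add: gtw_def gtwm_def)

definition geta :: "('o, 'm) cat \<Rightarrow> (int \<Rightarrow> 'o) \<Rightarrow> nat \<Rightarrow> int \<Rightarrow> 'm" where
  "geta C X = (\<lambda>n j. if n = 1 then cid C (X (j+1)) else czero C (X (j+1)) (X (j + int n)))"

lemma twist_trm [simp]: "trm (twist X) i = gtw (trm X i)"
  and twist_dif [simp]: "dif (twist X) i = gtwm (dif X i)"
  and twist_map_apply [simp]: "twist_map f i = gtwm (f i)"
  and eta_apply [simp]: "eta C X i = geta C (trm X i)"
  by (simp_all add: twist_def twist_map_def eta_def geta_def gtw_def gtwm_def)

lemma int_swap [simp]: "j + int n + 1 = j + 1 + int n" "j + (int n + 1) = j + 1 + int n"
  by simp_all

lemma gtwm_eq_iff [simp]: "gtwm f = gtwm g \<longleftrightarrow> f = g"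
proof
  assume "gtwm f = gtwm g"
  then have *: "f n (j+1) = g n (j+1)" for n j by (simp add: fun_eq_iff)
  show "f = g" using *[of _ "_ - 1"] by (simp add: fun_eq_iff)
qed simp

context additive_cat
begin

interpretation B: additive_cat "Zplus C"
  by (rule Zplus_additive)

interpretation BC: additive_cat CZ
  by (rule B.Cx_additive)

section \<open>The automorphism (1) and \<eta> on graded objects\<close>

lemma gtw_Ob [simp]: "X \<in> Ob ZC \<Longrightarrow> gtw X \<in> Ob ZC"
  by (simp add: Zplus_Ob)

lemma gtwm_Hom_iff [simp]: "gtwm f \<in> Hom ZC (gtw X) (gtw Y) \<longleftrightarrow> f \<in> Hom ZC X Y"
proof
  assume "gtwm f \<in> Hom ZC (gtw X) (gtw Y)"
  then have *: "f n (j+1) \<in> Hom C (X (j+1)) (Y (j+1+int n))" for n j by (simp add: Zplus_Hom)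
  show "f \<in> Hom ZC X Y" using *[of _ "_ - 1"] by (simp add: Zplus_Hom)
qed (simp add: Zplus_Hom)

lemma gtwm_comp: "ccomp ZC (gtw X) (gtw Y) (gtw Z) (gtwm g) (gtwm f)
    = gtwm (ccomp ZC X Y Z g f)"
  by (intro ext) (simp add: Zplus_ccomp)

lemma gtwm_zero: "czero ZC (gtw X) (gtw Y) = gtwm (czero ZC X Y)"
  and gtwm_add: "cadd ZC (gtw X) (gtw Y) (gtwm f) (gtwm g) = gtwm (cadd ZC X Y f g)"
  and gtwm_neg: "cneg ZC (gtw X) (gtw Y) (gtwm f) = gtwm (cneg ZC X Y f)"
  by (simp_all add: Zplus_ops fun_eq_iff)

lemma gtw_sum: "csum ZC (gtw X) (gtw Y) = gtw (csum ZC X Y)"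
  and gtwm_in1: "cin1 ZC (gtw X) (gtw Y) = gtwm (cin1 ZC X Y)"
  and gtwm_in2: "cin2 ZC (gtw X) (gtw Y) = gtwm (cin2 ZC X Y)"
  and gtwm_pr1: "cpr1 ZC (gtw X) (gtw Y) = gtwm (cpr1 ZC X Y)"
  and gtwm_pr2: "cpr2 ZC (gtw X) (gtw Y) = gtwm (cpr2 ZC X Y)"
  by (auto simp: Zplus_ops deg0_def fun_eq_iff)

lemma gtwm_cmat: "cmat ZC (gtw U) (gtw V) (gtw U') (gtw V') (gtwm a) (gtwm b) (gtwm c) (gtwm d)
    = gtwm (cmat ZC U V U' V' a b c d)"
  unfolding cmat_def Let_def gtw_sum gtwm_in1 gtwm_in2 gtwm_pr1 gtwm_pr2 gtwm_comp gtwm_add ..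

lemma geta_in [simp]: "X \<in> Ob ZC \<Longrightarrow> geta C X \<in> Hom ZC (gtw X) X"
  by (simp add: geta_def Zplus_Hom)

text \<open>Composing with \<eta> raises the numbering of components by one. For this reason a null
  homotopy of f\<eta> amounts to one of f that starts in degree -1.\<close>

lemma comp_geta:
  assumes ob: "X \<in> Ob ZC" "Y \<in> Ob ZC" and f: "f \<in> Hom ZC X Y"
  shows "ccomp ZC (gtw X) X Y f (geta C X) 0 j = czero C (X (j+1)) (Y j)"
    "ccomp ZC (gtw X) X Y f (geta C X) (Suc n) j = f n (j+1)"
proof -
  show "ccomp ZC (gtw X) X Y f (geta C X) 0 j = czero C (X (j+1)) (Y j)"
    using ob Zplus_Hom_in0[OF f] by (simp add: Zplus_ccomp geta_def)
  have f1: "f n (j+1) \<in> Hom C (X (j+1)) (Y (j+1+int n))" by (rule Zplus_Hom_in[OF f])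
  show "ccomp ZC (gtw X) X Y f (geta C X) (Suc n) j = f n (j+1)"
    unfolding Zplus_ccomp
    by (rule trans[OF sum_single[where m = 1]])
      (use ob f1 Zplus_Hom_in_diff[OF f, of _ "Suc n" j] in \<open>simp_all add: geta_def\<close>)
qed

lemma geta_natural:
  assumes ob: "X \<in> Ob ZC" "Y \<in> Ob ZC" and f: "f \<in> Hom ZC X Y"
  shows "ccomp ZC (gtw X) (gtw Y) Y (geta C Y) (gtwm f)
    = ccomp ZC (gtw X) X Y f (geta C X)"
proof (intro ext)
  fix n j
  show "ccomp ZC (gtw X) (gtw Y) Y (geta C Y) (gtwm f) n j
    = ccomp ZC (gtw X) X Y f (geta C X) n j"
  proof (cases n)
    case 0
    then show ?thesis
      using ob Zplus_Hom_in0[OF f, of "j+1"]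
      by (simp add: comp_geta[OF ob f]) (simp add: Zplus_ccomp geta_def)
  next
    case (Suc m)
    have f1: "f k (j+1) \<in> Hom C (X (j+1)) (Y (j+1+int k))" for k by (rule Zplus_Hom_in[OF f])
    have "ccomp ZC (gtw X) (gtw Y) Y (geta C Y) (gtwm f) (Suc m) j = f m (j+1)"
      unfolding Zplus_ccomp
      by (rule trans[OF sum_single[where m = m]])
        (use ob f1 in \<open>auto simp: geta_def of_nat_diff\<close>)
    then show ?thesis using comp_geta[OF ob f] Suc by simp
  qed
qed

text \<open>Naturality of \<eta> for the two injections, which are fixed by (1) up to reindexing,
  forces \<eta> of a sum to be diagonal.\<close>

lemma geta_sum:
  assumes ob: "U \<in> Ob ZC" "V \<in> Ob ZC"
  shows "geta C (csum ZC U V) = cmat ZC (gtw U) (gtw V) U V (geta C U)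
     (czero ZC (gtw V) U) (czero ZC (gtw U) V) (geta C V)"
proof (rule B.from_sum_eqI[of "csum ZC U V" "gtw U" "gtw V"])
  show "ccomp ZC (gtw U) (csum ZC (gtw U) (gtw V)) (csum ZC U V)
      (geta C (csum ZC U V)) (cin1 ZC (gtw U) (gtw V)) =
    ccomp ZC (gtw U) (csum ZC (gtw U) (gtw V)) (csum ZC U V)
      (cmat ZC (gtw U) (gtw V) U V (geta C U) (czero ZC (gtw V) U) (czero ZC (gtw U) V)
       (geta C V)) (cin1 ZC (gtw U) (gtw V))"
    using ob by (subst B.cmat_in1) (simp_all add: gtw_sum gtwm_in1 geta_natural)
  show "ccomp ZC (gtw V) (csum ZC (gtw U) (gtw V)) (csum ZC U V)
      (geta C (csum ZC U V)) (cin2 ZC (gtw U) (gtw V)) =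
    ccomp ZC (gtw V) (csum ZC (gtw U) (gtw V)) (csum ZC U V)
      (cmat ZC (gtw U) (gtw V) U V (geta C U) (czero ZC (gtw V) U) (czero ZC (gtw U) V)
       (geta C V)) (cin2 ZC (gtw U) (gtw V))"
    using ob by (subst B.cmat_in2) (simp_all add: gtw_sum gtwm_in2 geta_natural)
  show "cmat ZC (gtw U) (gtw V) U V (geta C U) (czero ZC (gtw V) U)
      (czero ZC (gtw U) V) (geta C V)
    \<in> Hom ZC (csum ZC (gtw U) (gtw V)) (csum ZC U V)"
    using ob by (intro B.cmat_in) simp_all
qed (use ob geta_in[OF B.sum_ob[OF ob]] in \<open>simp_all add: gtw_sum\<close>)

section \<open>The automorphism (1) on complexes, injective objects and stably trivial maps\<close>

lemma twist_Ob [simp]: "X \<in> Ob CZ \<Longrightarrow> twist X \<in> Ob CZ"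
  by (simp add: Cx_Ob[of "twist X"] gtwm_comp gtwm_zero)

lemma twist_Hom_iff [simp]: "twist_map f \<in> Hom CZ (twist X) (twist Y)
    \<longleftrightarrow> f \<in> Hom CZ X Y"
  by (simp add: Cx_Hom gtwm_comp)

lemma eta_in [simp]: "X \<in> Ob CZ \<Longrightarrow> eta C X \<in> Hom CZ (twist X) X"
  by (simp add: Cx_Hom geta_natural)

lemma eta_natural:
  assumes "X \<in> Ob CZ" "Y \<in> Ob CZ" "f \<in> Hom CZ X Y"
  shows "ccomp CZ (twist X) (twist Y) Y (eta C Y) (twist_map f)
    = ccomp CZ (twist X) X Y f (eta C X)"
  using assms B.Cx_Hom_in[OF assms(3)] by (simp add: Cx_ops geta_natural)

lemma twist_boundary: "boundary ZC (twist X) (twist Y) (twist_map h)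
    = twist_map (boundary ZC X Y h)"
  by (rule ext) (simp add: boundary_def gtwm_comp gtwm_add)

lemma null_homotopic_twist_iff:
  "null_homotopic ZC (twist X) (twist Y) (twist_map f) \<longleftrightarrow> null_homotopic ZC X Y f"
proof
  assume "null_homotopic ZC X Y f"
  then obtain h where "\<And>n. h n \<in> Hom ZC (trm X n) (trm Y (n-1))" "f = boundary ZC X Y h"
    by (elim null_homotopicE) blast
  then show "null_homotopic ZC (twist X) (twist Y) (twist_map f)"
    by (intro null_homotopicI[of "twist_map h"]) (simp_all add: twist_boundary)
next
  assume "null_homotopic ZC (twist X) (twist Y) (twist_map f)"
  then obtain k where k: "\<And>n. k n \<in> Hom ZC (gtw (trm X n)) (gtw (trm Y (n-1)))"
    "twist_map f = boundary ZC (twist X) (twist Y) k"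
    by (elim null_homotopicE) auto
  define h where "h i n j = k i n (j-1)" for i n j
  have kh: "k = twist_map h" by (simp add: h_def fun_eq_iff)
  have "twist_map f = twist_map (boundary ZC X Y h)"
    using k(2) by (simp add: kh twist_boundary)
  then have "gtwm (f i) = gtwm (boundary ZC X Y h i)" for i
    by (metis twist_map_apply)
  then have "f = boundary ZC X Y h" by (intro ext) (metis gtwm_eq_iff)
  moreover have "h i \<in> Hom ZC (trm X i) (trm Y (i-1))" for i
    using k(1)[of i] by (simp add: kh)
  ultimately show "null_homotopic ZC X Y f" by (intro null_homotopicI)
qed

text \<open>If I is injective, its identity extends along the inflation of I into the cone of
  \<eta>_I, which makes \<eta>_I null-homotopic. Conversely, every conflation is a cone of some
  \<eta>_Y g up to isomorphism; by naturality a map v from Y to I satisfies v \<eta>_Y g = \<eta>_I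
  v(1) g, which is null-homotopic, so v extends over the cone.\<close>

lemma eta_injective_iff:
  "eta_injective C I \<longleftrightarrow> I \<in> Ob CZ \<and> null_homotopic ZC (twist I) I (eta C I)"
proof
  let ?C = CZ
  assume I: "eta_injective C I"
  then have ob: "I \<in> Ob ?C" by (simp add: eta_injective_def Let_def)
  let ?Q = "cone ZC (twist I) I (eta C I)" and ?i = "cone_in ZC (twist I) I"
    and ?p = "cone_pr ZC (twist I) I" and ?S = "shift ZC 1 (twist I)"
  have iso: "cat_iso ?C X X (cid ?C X)" if "X \<in> Ob ?C" for X
    using that by (intro BC.cat_isoI[of _ _ _ "cid ?C X"]) simp_all
  have Q: "?Q \<in> Ob ?C" "?S \<in> Ob ?C" "?i \<in> Hom ?C I ?Q" "?p \<in> Hom ?C ?Q ?S"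
    using ob by simp_all
  have "eta_conflation C I ?Q ?S ?i ?p"
    unfolding eta_conflation_def Let_def
  proof (intro conjI)
    show "\<exists>X\<in>Ob ?C. \<exists>Y\<in>Ob ?C. \<exists>g\<in>Hom ?C X (twist Y). \<exists>f a b c.
        f = ccomp ?C X (twist Y) Y (eta C Y) g \<and> cat_iso ?C I Y a \<and>
        cat_iso ?C ?Q (cone ZC X Y f) b \<and> cat_iso ?C ?S (shift ZC 1 X) c \<and>
        ccomp ?C I ?Q (cone ZC X Y f) b ?i
          = ccomp ?C I Y (cone ZC X Y f) (cone_in ZC X Y) a \<and>
        ccomp ?C ?Q ?S (shift ZC 1 X) c ?p
          = ccomp ?C ?Q (cone ZC X Y f) (shift ZC 1 X) (cone_pr ZC X Y) b"
      \<comment> \<open>The identity of I(1) exhibits \<eta>_I as a map that factors through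
        \<eta>_I; all comparison isomorphisms are identities.\<close>
      by (rule bexI[of _ "twist I"], rule bexI[of _ I], rule bexI[of _ "cid ?C (twist I)"],
          rule exI[of _ "eta C I"], rule exI[of _ "cid ?C I"], rule exI[of _ "cid ?C ?Q"],
          rule exI[of _ "cid ?C ?S"])
        (use ob Q iso in simp_all)
  qed (use ob Q in simp_all)
  then obtain k where k: "k \<in> Hom ?C ?Q I" "ccomp ?C I ?Q I k ?i = cid ?C I"
    using I ob BC.id_in[OF ob] unfolding eta_injective_def Let_def by blast
  then have "null_homotopic ZC (twist I) I (ccomp ?C (twist I) I I (cid ?C I) (eta C I))"
    by (subst B.null_homotopic_comp_iff) (use ob in auto)
  then show "I \<in> Ob ?C \<and> null_homotopic ZC (twist I) I (eta C I)" using ob by simp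
next
  let ?C = CZ
  interpret N: additive_ideal ?C "null_homotopic ZC" by (rule B.null_homotopic_ideal)
  assume "I \<in> Ob ?C \<and> null_homotopic ZC (twist I) I (eta C I)"
  then have I: "I \<in> Ob ?C" and null: "null_homotopic ZC (twist I) I (eta C I)" by simp_all
  show "eta_injective C I"
    unfolding eta_injective_def Let_def
  proof (intro conjI allI impI ballI)
    fix P Q S i p u
    assume cf: "eta_conflation C P Q S i p" and u: "u \<in> Hom ?C P I"
    from cf obtain X Y g f a b c where ob: "P \<in> Ob ?C" "Q \<in> Ob ?C" "X \<in> Ob ?C" "Y \<in> Ob ?C"
      and i: "i \<in> Hom ?C P Q" and g: "g \<in> Hom ?C X (twist Y)"
      and f: "f = ccomp ?C X (twist Y) Y (eta C Y) g"
      and a: "cat_iso ?C P Y a" and b: "cat_iso ?C Q (cone ZC X Y f) b"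
      and sq: "ccomp ?C P Q (cone ZC X Y f) b i
        = ccomp ?C P Y (cone ZC X Y f) (cone_in ZC X Y) a"
      unfolding eta_conflation_def Let_def by blast
    obtain a' where a': "a \<in> Hom ?C P Y" "a' \<in> Hom ?C Y P" "ccomp ?C P Y P a' a = cid ?C P"
      using a by (rule BC.cat_isoE)
    have b': "b \<in> Hom ?C Q (cone ZC X Y f)" using b by (simp add: cat_iso_def)
    have f_in: "f \<in> Hom ?C X Y" using ob g f by simp
    let ?v = "ccomp ?C Y P I u a'"
    have v: "?v \<in> Hom ?C Y I" using ob I a' u by simp
    \<comment> \<open>Naturality moves \<open>?v\<close> past \<eta>, so that the null-homotopic
      \<eta>_I becomes the last factor.\<close>
    have "ccomp ?C X Y I ?v f = ccomp ?C X (twist I) I (eta C I)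
        (ccomp ?C X (twist Y) (twist I) (twist_map ?v) g)"
    proof -
      have "ccomp ?C X Y I ?v f = ccomp ?C X (twist Y) I (ccomp ?C (twist Y) Y I ?v (eta C Y)) g"
        using ob I v g unfolding f by (simp only: BC.comp_assoc twist_Ob eta_in)
      also have "\<dots> = ccomp ?C X (twist Y) I (ccomp ?C (twist Y) (twist I) I (eta C I)
          (twist_map ?v)) g"
        using eta_natural[OF ob(4) I v] by simp
      also have "\<dots> = ccomp ?C X (twist I) I (eta C I)
          (ccomp ?C X (twist Y) (twist I) (twist_map ?v) g)"
        using ob I v g by (simp only: BC.comp_assoc twist_Ob eta_in twist_Hom_iff)
      finally show ?thesis .
    qed
    moreover have "null_homotopic ZC X I
       (ccomp ?C X (twist I) I (eta C I) (ccomp ?C X (twist Y) (twist I) (twist_map ?v) g))"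
      using N.N_comp_right[OF ob(3) twist_Ob[OF I] I _ eta_in[OF I] null] ob I v g by simp
    ultimately have "null_homotopic ZC X I (ccomp ?C X Y I ?v f)" by simp
    then obtain k where k: "k \<in> Hom ?C (cone ZC X Y f) I"
      "ccomp ?C Y (cone ZC X Y f) I k (cone_in ZC X Y) = ?v"
      using B.null_homotopic_comp_iff[OF ob(3,4) f_in I v] by blast
    let ?K = "cone ZC X Y f"
    have K: "?K \<in> Ob ?C" "cone_in ZC X Y \<in> Hom ?C Y ?K" using ob f_in by simp_all
    have "ccomp ?C P Q I (ccomp ?C Q ?K I k b) i = ccomp ?C P ?K I k (ccomp ?C P Q ?K b i)"
      using ob I K k(1) b' i by (simp add: BC.comp_assoc)
    also have "\<dots> = ccomp ?C P Y I (ccomp ?C Y ?K I k (cone_in ZC X Y)) a"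
      using ob I K k(1) a' by (simp add: BC.comp_assoc sq)
    also have "\<dots> = ccomp ?C P P I u (ccomp ?C P Y P a' a)"
      unfolding k(2) using ob I a'(1,2) u by (simp add: BC.comp_assoc)
    also have "\<dots> = u" using a'(3) ob I u by simp
    finally show "\<exists>g\<in>Hom ?C Q I. ccomp ?C P Q I g i = u"
      using ob I K k(1) b' by (intro bexI[where x = "ccomp ?C Q ?K I k b"]) simp_all
  qed (use I in simp)
qed

text \<open>Supplies an injective object into which X maps by an inflation. The null homotopy
  required by \<open>eta_injective_iff\<close> imitates the contraction of the cone of an identity,
  with a twist inserted.\<close>

lemma eta_injective_cone:
  assumes X: "X \<in> Ob CZ"
  shows "eta_injective C (cone ZC (twist X) X (eta C X))"
  unfolding eta_injective_iff
proof
  let ?K = "cone ZC (twist X) X (eta C X)"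
  show "?K \<in> Ob CZ" using X by simp
  \<comment> \<open>The only nonzero entry is the identity of X^n(1), from the second summand of the
    twisted cone to the first summand of the cone. In dh + hd the terms with d cancel, and \<eta>
    remains on the diagonal.\<close>
  define h where "h n = cmat ZC (gtw (gtw (trm X (n+1)))) (gtw (trm X n)) (gtw (trm X n))
      (trm X (n-1))
    (czero ZC (gtw (gtw (trm X (n+1)))) (gtw (trm X n))) (cid ZC (gtw (trm X n)))
    (czero ZC (gtw (gtw (trm X (n+1)))) (trm X (n-1))) (czero ZC (gtw (trm X n)) (trm X (n-1)))"
        for n
  have T: "trm X n \<in> Ob ZC" "gtw (trm X n) \<in> Ob ZC" "gtw (gtw (trm X n)) \<in> Ob ZC" for n
    using B.Cx_trm[OF X, of n] gtw_Ob[OF gtw_Ob] by simp_all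
  have h: "h n \<in> Hom ZC (csum ZC (gtw (gtw (trm X (n+1)))) (gtw (trm X n)))
      (csum ZC (gtw (trm X n)) (trm X (n-1)))" for n
    unfolding h_def using T[of "n+1"] T[of n] T[of "n-1"] by (intro B.cmat_in) simp_all
  have "eta C ?K = boundary ZC (twist ?K) ?K h"
  proof
    fix n
    note T' = T[of "n+2"] T[of "n+1"] T[of n] T[of "n-1"]
    have d: "dif X n \<in> Hom ZC (trm X n) (trm X (n+1))"
      "dif X (n-1) \<in> Hom ZC (trm X (n-1)) (trm X n)"
      "dif X (n+1) \<in> Hom ZC (trm X (n+1)) (trm X (n+2))" using X by simp_all
    have d': "gtwm (dif X n) \<in> Hom ZC (gtw (trm X n)) (gtw (trm X (n+1)))"
      "gtwm (gtwm (dif X (n+1))) \<in> Hom ZC (gtw (gtw (trm X (n+1)))) (gtw (gtw (trm X (n+2))))"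
      using d by simp_all
    have e: "geta C (trm X n) \<in> Hom ZC (gtw (trm X n)) (trm X n)"
      "geta C (gtw (trm X (n+1))) \<in> Hom ZC (gtw (gtw (trm X (n+1)))) (gtw (trm X (n+1)))"
      using geta_in[OF T(1)] geta_in[OF T(2)] by simp_all
    \<comment> \<open>The twisted cone has the twist of \<eta>_X in its differential; this equals
      \<eta> of X(1), because both have an identity as their only nonzero component.\<close>
    have et: "gtwm (geta C (trm X (n+1))) = geta C (gtw (trm X (n+1)))"
      by (auto simp: geta_def fun_eq_iff)
    have "ccomp ZC (trm (twist ?K) n) (trm ?K (n-1)) (trm ?K n) (dif ?K (n-1)) (h n)
      = cmat ZC (gtw (gtw (trm X (n+1)))) (gtw (trm X n)) (gtw (trm X (n+1))) (trm X n)
          (czero ZC (gtw (gtw (trm X (n+1)))) (gtw (trm X (n+1))))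
          (cneg ZC (gtw (trm X n)) (gtw (trm X (n+1))) (gtwm (dif X n)))
          (czero ZC (gtw (gtw (trm X (n+1)))) (trm X n)) (geta C (trm X n))"
      unfolding h_def using T' d d' e
      by (simp add: gtw_sum [symmetric] B.cmat_comp)
    moreover have "ccomp ZC (trm (twist ?K) n) (trm (twist ?K) (n+1)) (trm ?K n) (h (n+1))
        (dif (twist ?K) n)
      = cmat ZC (gtw (gtw (trm X (n+1)))) (gtw (trm X n)) (gtw (trm X (n+1))) (trm X n)
          (geta C (gtw (trm X (n+1)))) (gtwm (dif X n))
          (czero ZC (gtw (gtw (trm X (n+1)))) (trm X n))
          (czero ZC (gtw (trm X n)) (trm X n))"
      unfolding h_def using T' d d' e
      by (simp add: gtw_sum [symmetric] gtwm_cmat [symmetric] gtwm_neg [symmetric] gtwm_zero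
          [symmetric] et B.cmat_comp)
    ultimately show "eta C ?K n = boundary ZC (twist ?K) ?K h n"
      unfolding boundary_def using T' d' e
      by (simp add: gtw_sum [symmetric] B.cmat_add geta_sum)
  qed
  then show "null_homotopic ZC (twist ?K) ?K (eta C ?K)"
    by (intro null_homotopicI[of h]) (use h in \<open>simp_all add: gtw_sum\<close>)
qed

text \<open>A factorization through an injective I lets naturality replace \<eta>_X by \<eta>_I,
  which is null-homotopic. Conversely, a null homotopy of f\<eta>_X extends f over the cone of
  \<eta>_X, and this cone is injective.\<close>

lemma eta_null_iff:
  assumes X: "X \<in> Ob CZ" and Y: "Y \<in> Ob CZ" and f: "f \<in> Hom CZ X Y"
  shows "eta_null C X Y f \<longleftrightarrow>
    null_homotopic ZC (twist X) Y (ccomp CZ (twist X) X Y f (eta C X))"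
proof
  let ?C = CZ
  interpret N: additive_ideal ?C "null_homotopic ZC" by (rule B.null_homotopic_ideal)
  {
    assume "eta_null C X Y f"
    then obtain I a b where I: "eta_injective C I" and a: "a \<in> Hom ?C X I" and b: "b \<in> Hom ?C I Y"
      and fab: "f = ccomp ?C X I Y b a" unfolding eta_null_def Let_def by blast
    from I have I': "I \<in> Ob ?C" and null: "null_homotopic ZC (twist I) I (eta C I)"
      by (simp_all add: eta_injective_iff)
    have "ccomp ?C (twist X) X Y f (eta C X) = ccomp ?C (twist X) I Y b
        (ccomp ?C (twist X) X I a (eta C X))"
      using X Y I' a b by (simp only: fab BC.comp_assoc twist_Ob eta_in)
    also have "\<dots> = ccomp ?C (twist X) I Y b (ccomp ?C (twist X) (twist I) I (eta C I)
        (twist_map a))"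
      using eta_natural[OF X I' a] by simp
    finally have eq: "ccomp ?C (twist X) X Y f (eta C X)
      = ccomp ?C (twist X) I Y b (ccomp ?C (twist X) (twist I) I (eta C I) (twist_map a))" .
    show "null_homotopic ZC (twist X) Y (ccomp ?C (twist X) X Y f (eta C X))"
      unfolding eq using X Y I' a b null
      by (intro N.N_comp_left[of _ I] N.N_comp_right[of _ "twist I"] BC.comp_in[of _ "twist I"])
          simp_all
  }
  {
    assume null: "null_homotopic ZC (twist X) Y (ccomp ?C (twist X) X Y f (eta C X))"
    let ?K = "cone ZC (twist X) X (eta C X)"
    obtain k where k: "k \<in> Hom ?C ?K Y" "ccomp ?C X ?K Y k (cone_in ZC (twist X) X) = f"
      using null B.null_homotopic_comp_iff[OF twist_Ob[OF X] X eta_in[OF X] Y f] by blast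
    moreover have "cone_in ZC (twist X) X \<in> Hom ?C X ?K" using X by simp
    ultimately show "eta_null C X Y f"
      unfolding eta_null_def Let_def using eta_injective_cone[OF X] by blast
  }
qed

text \<open>\<open>eta_null_iff\<close> transfers the laws from null-homotopic maps. Only
  precomposition needs an argument, namely (gf)\<eta>_X = (g\<eta>_Y) f(1).\<close>

lemma eta_null_ideal: "additive_ideal CZ (eta_null C)"
proof (intro additive_ideal.intro B.Cx_additive additive_ideal_axioms.intro)
  let ?C = CZ
  interpret N: additive_ideal ?C "null_homotopic ZC" by (rule B.null_homotopic_ideal)
  {
    fix X Y assume ob: "X \<in> Ob ?C" "Y \<in> Ob ?C"
    then show "eta_null C X Y (czero ?C X Y)" by (simp add: eta_null_iff N.N_zero)
    show "eta_null C X Y (cneg ?C X Y f)" if "f \<in> Hom ?C X Y" "eta_null C X Y f" for f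
    proof -
      have "f \<in> Hom ?C X Y" "eta C X \<in> Hom ?C (twist X) X" "twist X \<in> Ob ?C"
        using that ob by simp_all
      then show ?thesis using that ob
        by (simp only: eta_null_iff BC.neg_in BC.comp_neg_left N.N_neg BC.comp_in)
    qed
    show "eta_null C X Y (cadd ?C X Y f g)"
      if "f \<in> Hom ?C X Y" "g \<in> Hom ?C X Y" "eta_null C X Y f" "eta_null C X Y g" for f g
    proof -
      have "eta C X \<in> Hom ?C (twist X) X" "twist X \<in> Ob ?C" using ob by simp_all
      then show ?thesis using that ob
        by (simp only: eta_null_iff BC.add_in BC.comp_add_left N.N_add BC.comp_in)
    qed
  }
  fix X Y Z f g
  assume ob: "X \<in> Ob ?C" "Y \<in> Ob ?C" "Z \<in> Ob ?C" and f: "f \<in> Hom ?C X Y" and g: "g \<in> Hom ?C Y Z"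
  have e: "eta C X \<in> Hom ?C (twist X) X" "twist X \<in> Ob ?C" "eta C Y \<in> Hom ?C (twist Y) Y" "twist Y \<in>
      Ob ?C"
    "twist_map f \<in> Hom ?C (twist X) (twist Y)" using ob f by simp_all
  have gf: "ccomp ?C X Y Z g f \<in> Hom ?C X Z" using ob f g by simp
  show "eta_null C X Z (ccomp ?C X Y Z g f)" if "eta_null C X Y f"
    using that ob f g e gf
    by (simp only: eta_null_iff BC.comp_assoc N.N_comp_left BC.comp_in)
  have "ccomp ?C (twist X) X Z (ccomp ?C X Y Z g f) (eta C X)
    = ccomp ?C (twist X) (twist Y) Z (ccomp ?C (twist Y) Y Z g (eta C Y)) (twist_map f)"
    using ob f g e eta_natural[OF ob(1,2) f] by (simp only: BC.comp_assoc)
  then show "eta_null C X Z (ccomp ?C X Y Z g f)" if "eta_null C Y Z g"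
    using that ob f g e gf by (simp only: eta_null_iff N.N_comp_right BC.comp_in)
qed

end

section \<open>Obstruction theory\<close>

definition row :: "('o, 'm) zcplx \<Rightarrow> int \<Rightarrow> ('o, 'm) cplx" where
  "row D j = Cplx (\<lambda>i. trm D i j) (\<lambda>i. dif D i 0 j)"

definition rowm :: "'m zmap \<Rightarrow> int \<Rightarrow> int \<Rightarrow> 'm" where
  "rowm f j = (\<lambda>i. f i 0 j)"

lemma row_sel [simp]: "trm (row D j) i = trm D i j" "dif (row D j) i = dif D i 0 j"
  and rowm_apply [simp]: "rowm f j i = f i 0 j"
  by (simp_all add: row_def rowm_def)

context additive_cat
begin

interpretation B: additive_cat "Zplus C"
  by (rule Zplus_additive)

interpretation BC: additive_cat CZ
  by (rule B.Cx_additive)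

section \<open>Rows and leading components\<close>

lemma add_diff_cancel [simp]:
  assumes "X \<in> Ob C" "Y \<in> Ob C" "f \<in> Hom C X Y" "g \<in> Hom C X Y"
  shows "cadd C X Y f (cadd C X Y g (cneg C X Y f)) = g"
  using assms by (simp add: add_left_comm[of X Y f g])

lemma row_Ob [simp]:
  assumes D: "D \<in> Ob CZ"
  shows "row D j \<in> Ob (Cx C)"
proof -
  have "ccomp C (trm D i j) (trm D (i+1) j) (trm D (i+2) j) (dif D (i+1) 0 j) (dif D i 0 j)
      = czero C (trm D i j) (trm D (i+2) j)" for i
    using fun_cong[OF fun_cong[OF B.Cx_dd(1)[OF D, of i], of 0], of j]
    by (simp add: Zplus_ccomp Zplus_czero)
  then show ?thesis
    using B.Cx_trm[OF D] Zplus_Hom_in0[OF B.Cx_dif(1)[OF D]] by (simp add: Cx_Ob[of "row D j"])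
qed

lemma Zplus_comp0: "ccomp ZC X Y Z g f 0 j = ccomp C (X j) (Y j) (Z j) (g 0 j) (f 0 j)"
  by (simp add: Zplus_ccomp)

lemma Zplus_comp1: "ccomp ZC X Y Z g f (Suc 0) j = cadd C (X j) (Z (j+1))
    (ccomp C (X j) (Y j) (Z (j+1)) (g (Suc 0) j) (f 0 j))
    (ccomp C (X j) (Y (j+1)) (Z (j+1)) (g 0 (j+1)) (f (Suc 0) j))"
  by (simp add: Zplus_ccomp)

lemma rowm_in:
  assumes f: "f \<in> Hom CZ D E"
  shows "rowm f j \<in> Hom (Cx C) (row D j) (row E j)"
proof (rule Cx_HomI)
  fix i
  show "rowm f j i \<in> Hom C (trm (row D j) i) (trm (row E j) i)"
    using Zplus_Hom_in0[OF B.Cx_Hom_in[OF f]] by simp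
  show "ccomp C (trm (row D j) i) (trm (row D j) (i+1)) (trm (row E j) (i+1)) (rowm f j (i+1))
      (dif (row D j) i)
    = ccomp C (trm (row D j) i) (trm (row E j) i) (trm (row E j) (i+1)) (dif (row E j) i)
        (rowm f j i)"
    using fun_cong[OF fun_cong[OF B.Cx_commute(1)[OF f, of i], of 0], of j]
    by (simp add: Zplus_comp0)
qed

lemma rowm_comp: "rowm (ccomp CZ X Y Z g f) j
    = ccomp (Cx C) (row X j) (row Y j) (row Z j) (rowm g j) (rowm f j)"
  and rowm_add: "rowm (cadd CZ X Y f f') j = cadd (Cx C) (row X j) (row Y j) (rowm f j) (rowm f' j)"
  and rowm_neg: "rowm (cneg CZ X Y f) j = cneg (Cx C) (row X j) (row Y j) (rowm f j)"
  and rowm_id: "rowm (cid CZ X) j = cid (Cx C) (row X j)"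
  and rowm_zero: "rowm (czero CZ X Y) j = czero (Cx C) (row X j) (row Y j)"
  by (simp_all add: Cx_ops Zplus_comp0 Zplus_ops fun_eq_iff)

text \<open>Leading-term calculus: when f vanishes below degree n, the convolution in degree n
  reduces to g_0 f_n. Together with its mirror image it makes the lowest component of a chain map a
  chain map between rows.\<close>

lemma Zplus_comp_lead_right:
  assumes ob: "X \<in> Ob ZC" "Y \<in> Ob ZC" "Z \<in> Ob ZC"
    and f: "f \<in> Hom ZC X Y" and g: "g \<in> Hom ZC Y Z"
    and f0: "\<And>k j. k < n \<Longrightarrow> f k j = czero C (X j) (Y (j + int k))"
  shows "k < n \<Longrightarrow> ccomp ZC X Y Z g f k j = czero C (X j) (Z (j + int k))"
    "ccomp ZC X Y Z g f n j
      = ccomp C (X j) (Y (j + int n)) (Z (j + int n)) (g 0 (j + int n)) (f n j)"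
proof -
  show "ccomp ZC X Y Z g f k j = czero C (X j) (Z (j + int k))" if "k < n"
    unfolding Zplus_ccomp
    by (rule sum_zero) (use that ob f0 Zplus_Hom_in_diff[OF g] in simp_all)
  show "ccomp ZC X Y Z g f n j
      = ccomp C (X j) (Y (j + int n)) (Z (j + int n)) (g 0 (j + int n)) (f n j)"
    unfolding Zplus_ccomp
    by (rule trans[OF sum_single[where m = n]])
      (use ob f0 Zplus_Hom_in[OF f] Zplus_Hom_in0[OF g] Zplus_Hom_in_diff[OF g] in simp_all)
qed

lemma Zplus_comp_lead_left:
  assumes ob: "X \<in> Ob ZC" "Y \<in> Ob ZC" "Z \<in> Ob ZC"
    and f: "f \<in> Hom ZC X Y" and g: "g \<in> Hom ZC Y Z"
    and g0: "\<And>k j. k < n \<Longrightarrow> g k j = czero C (Y j) (Z (j + int k))"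
  shows "k < n \<Longrightarrow> ccomp ZC X Y Z g f k j = czero C (X j) (Z (j + int k))"
    "ccomp ZC X Y Z g f n j = ccomp C (X j) (Y j) (Z (j + int n)) (g n j) (f 0 j)"
proof -
  show "ccomp ZC X Y Z g f k j = czero C (X j) (Z (j + int k))" if "k < n"
    unfolding Zplus_ccomp
    by (rule sum_zero) (use that ob g0 Zplus_Hom_in[OF f] in \<open>simp_all add: of_nat_diff\<close>)
  show "ccomp ZC X Y Z g f n j = ccomp C (X j) (Y j) (Z (j + int n)) (g n j) (f 0 j)"
    unfolding Zplus_ccomp
    by (rule trans[OF sum_single[where m = 0]])
      (use ob g0 Zplus_Hom_in[OF f] Zplus_Hom_in0[OF f] Zplus_Hom_in[OF g] in \<open>simp_all
          add: of_nat_diff\<close>)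
qed

text \<open>Composition is triangular: degree n involves only components of degree at most n. A
  homotopy may therefore be built degree by degree and verified at the limit.\<close>

lemma Zplus_comp_cong:
  assumes "\<And>k j. k \<le> n \<Longrightarrow> f k j = f' k j" "\<And>k j. k \<le> n \<Longrightarrow> g k j = g' k j"
  shows "ccomp ZC X Y Z g f n j = ccomp ZC X Y Z g' f' n j"
  unfolding Zplus_ccomp by (rule sum_cong) (simp add: assms)

lemma Zplus_boundary_cong:
  assumes "\<And>i k j. k \<le> n \<Longrightarrow> h i k j = h' i k j"
  shows "boundary ZC D E h i n j = boundary ZC D E h' i n j"
  unfolding boundary_def Zplus_cadd
  by (intro arg_cong2[where f = "cadd C _ _"] Zplus_comp_cong) (simp_all add: assms)

text \<open>The residue \<open>u - dh - hd\<close> of a partial homotopy is a chain map, so its lowest component is a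
  chain map between rows; a null homotopy of that component improves \<open>h\<close> by one degree.\<close>

lemma obstruction_step:
  assumes D: "D \<in> Ob CZ" and E: "E \<in> Ob CZ"
    and u: "u \<in> Hom CZ D E"
    and h: "\<And>i. h i \<in> Hom ZC (trm D i) (trm E (i-1))"
    and eq: "\<And>i k j. k < N \<Longrightarrow> u i k j = boundary ZC D E h i k j"
    and van: "\<And>j f. f \<in> Hom (Cx C) (row D j) (row E (j + int N))
      \<Longrightarrow> null_homotopic C (row D j) (row E (j + int N)) f"
  obtains h' where "\<And>i. h' i \<in> Hom ZC (trm D i) (trm E (i-1))"
    "\<And>i k j. k \<le> N \<Longrightarrow> u i k j = boundary ZC D E h' i k j"
    "\<And>i k j. k < N \<Longrightarrow> h' i k j = h i k j"
proof -
  let ?C = CZ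
  define b where "b = boundary ZC D E h"
  define r where "r = cadd ?C D E u (cneg ?C D E b)"
  have b_in: "b \<in> Hom ?C D E" unfolding b_def using D E h by (rule B.boundary_in)
  have r_in: "r \<in> Hom ?C D E" unfolding r_def using D E u b_in by simp
  have T: "trm D i \<in> Ob ZC" "trm E i \<in> Ob ZC" for i using D E by simp_all
  have Tj: "trm D i j \<in> Ob C" "trm E i j \<in> Ob C" for i j using T by simp_all
  have u_mem: "u i k j \<in> Hom C (trm D i j) (trm E i (j + int k))"
    and b_mem: "b i k j \<in> Hom C (trm D i j) (trm E i (j + int k))"
    and r_mem: "r i k j \<in> Hom C (trm D i j) (trm E i (j + int k))"
    and h_mem: "h i k j \<in> Hom C (trm D i j) (trm E (i-1) (j + int k))" for i k j
    using Zplus_Hom_in[OF B.Cx_Hom_in[OF u]] Zplus_Hom_in[OF B.Cx_Hom_in[OF b_in]]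
      Zplus_Hom_in[OF B.Cx_Hom_in[OF r_in]] Zplus_Hom_in[OF h] by simp_all
  have r_apply: "r i k j = cadd C (trm D i j) (trm E i (j + int k)) (u i k j)
      (cneg C (trm D i j) (trm E i (j + int k)) (b i k j))" for i k j
    by (simp add: r_def Cx_ops Zplus_ops)
  have r0: "r i k j = czero C (trm D i j) (trm E i (j + int k))" if "k < N" for i k j
    using eq[OF that] u_mem[of i k j] Tj by (simp add: r_apply b_def)
  have "(\<lambda>i. r i N j) \<in> Hom (Cx C) (row D j) (row E (j + int N))" for j
  proof (rule Cx_HomI)
    fix i
    show "r i N j \<in> Hom C (trm (row D j) i) (trm (row E (j + int N)) i)" using r_mem by simp
    show "ccomp C (trm (row D j) i) (trm (row D j) (i+1)) (trm (row E (j + int N)) (i+1))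
        (r (i+1) N j) (dif (row D j) i)
      = ccomp C (trm (row D j) i) (trm (row E (j + int N)) i) (trm (row E (j + int N)) (i+1))
         (dif (row E (j + int N)) i) (r i N j)"
      using Zplus_comp_lead_right(2)[OF T(1) T(2) T(2) B.Cx_Hom_in[OF r_in] B.Cx_dif(1)[OF E, of i]
          r0, of N j]
        Zplus_comp_lead_left(2)[OF T(1) T(1) T(2) B.Cx_dif(1)[OF D, of i] B.Cx_Hom_in[OF r_in] r0,
            of N j]
        fun_cong[OF fun_cong[OF B.Cx_commute(1)[OF r_in, of i], of N], of j]
      by simp
  qed
  then have "\<exists>t. (\<forall>i. t i \<in> Hom C (trm D i j) (trm E (i-1) (j + int N))) \<and>
      (\<lambda>i. r i N j) = boundary C (row D j) (row E (j + int N)) t" for j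
    using van[of "\<lambda>i. r i N j" j] unfolding null_homotopic_iff by simp
  then obtain t where t: "\<And>j i. t j i \<in> Hom C (trm D i j) (trm E (i-1) (j + int N))"
    and rt: "\<And>j. (\<lambda>i. r i N j) = boundary C (row D j) (row E (j + int N)) (t j)" by metis
  \<comment> \<open>Concentrated in degree N. Its boundary vanishes below N and equals the residue
    in degree N, so adding it repairs degree N without disturbing the lower ones.\<close>
  define t' where "t' i k j = (if k = N then t j i else czero C (trm D i j)
      (trm E (i-1) (j + int k)))" for i k j
  have t'_in: "t' i \<in> Hom ZC (trm D i) (trm E (i-1))" for i
    using t Tj by (simp add: Zplus_Hom t'_def)
  have t'_in': "t' (i+1) \<in> Hom ZC (trm D (i+1)) (trm E i)" for i
    using t'_in[of "i+1"] by simp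
  have t'0: "t' i k j = czero C (trm D i j) (trm E (i-1) (j + int k))" if "k < N" for i k j
    using that by (simp add: t'_def)
  have t'0': "t' (i+1) k j = czero C (trm D (i+1) j) (trm E i (j + int k))" if "k < N" for i k j
    using t'0[OF that, of "i+1"] by simp
  note lead = Zplus_comp_lead_right[OF T(1) T(2) T(2) t'_in B.Cx_dif(3)[OF E] t'0]
    Zplus_comp_lead_left[OF T(1) T(1) T(2) B.Cx_dif(1)[OF D] t'_in' t'0']
  have bt0: "boundary ZC D E t' i k j = czero C (trm D i j) (trm E i (j + int k))" if "k < N"
      for i k j
    using that Tj by (simp add: boundary_def Zplus_cadd lead)
  have btN: "boundary ZC D E t' i N j = r i N j" for i j
    using fun_cong[OF rt[of j], of i] by (simp add: boundary_def Zplus_cadd lead) (simp add: t'_def)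
  define h' where "h' i = cadd ZC (trm D i) (trm E (i-1)) (h i) (t' i)" for i
  have bh': "boundary ZC D E h' = cadd ?C D E b (boundary ZC D E t')"
    unfolding b_def h'_def using D E h t'_in by (rule B.boundary_add)
  show ?thesis
  proof (rule that)
    show "h' i \<in> Hom ZC (trm D i) (trm E (i-1))" for i
      unfolding h'_def using T h t'_in by simp
    show "h' i k j = h i k j" if "k < N" for i k j
      using that t'0 h_mem Tj by (simp add: h'_def Zplus_cadd)
    show "u i k j = boundary ZC D E h' i k j" if "k \<le> N" for i k j
    proof -
      have "boundary ZC D E t' i k j = r i k j"
        using that bt0 btN r0 by (cases "k = N") simp_all
      then show ?thesis
        unfolding bh' using u_mem[of i k j] b_mem[of i k j] Tj
        by (simp add: Cx_ops Zplus_cadd r_apply)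
    qed
  qed
qed

text \<open>Iterating \<open>obstruction_step\<close> changes ever higher components, so the
  homotopies stabilise in each degree and have a limit. The components below N remain zero, which is
  what keeps prescribed components of a chain map unchanged in
  \<open>extend_chain_map\<close>.\<close>

lemma obstruction:
  assumes D: "D \<in> Ob CZ" and E: "E \<in> Ob CZ"
    and u: "u \<in> Hom CZ D E"
    and u0: "\<And>i k j. k < N \<Longrightarrow> u i k j = czero C (trm D i j) (trm E i (j + int k))"
    and van: "\<And>n j f. \<lbrakk>N \<le> n; f \<in> Hom (Cx C) (row D j) (row E (j + int n))\<rbrakk>
      \<Longrightarrow> null_homotopic C (row D j) (row E (j + int n)) f"
  obtains s where "\<And>i. s i \<in> Hom ZC (trm D i) (trm E (i-1))"
    "u = boundary ZC D E s"
    "\<And>i k j. k < N \<Longrightarrow> s i k j = czero C (trm D i j) (trm E (i-1) (j + int k))"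
proof -
  let ?z = "\<lambda>i. czero ZC (trm D i) (trm E (i-1))"
  define P where "P n h \<longleftrightarrow> (\<forall>i. h i \<in> Hom ZC (trm D i) (trm E (i-1))) \<and>
    (\<forall>i k j. k < N \<longrightarrow> h i k j = ?z i k j) \<and>
    (\<forall>i k j. k < N + n \<longrightarrow> u i k j = boundary ZC D E h i k j)" for n and h :: "'m zmap"
  have T: "trm D i \<in> Ob ZC" "trm E i \<in> Ob ZC" for i using D E by simp_all
  have P0: "P 0 ?z"
    using T u0 B.zero_in[OF T] unfolding P_def B.boundary_zero[OF D E]
        by (simp add: Cx_ops Zplus_czero)
  have PS: "\<exists>h'. P (Suc n) h' \<and> (\<forall>i k j. k < N + n \<longrightarrow> h' i k j = h i k j)" if "P n h" for n h
  proof -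
    have h: "\<And>i. h i \<in> Hom ZC (trm D i) (trm E (i-1))"
      "\<And>i k j. k < N + n \<Longrightarrow> u i k j = boundary ZC D E h i k j"
      "\<And>i k j. k < N \<Longrightarrow> h i k j = ?z i k j"
      using that by (simp_all add: P_def)
    obtain h' where "\<And>i. h' i \<in> Hom ZC (trm D i) (trm E (i-1))"
      "\<And>i k j. k \<le> N + n \<Longrightarrow> u i k j = boundary ZC D E h' i k j"
      "\<And>i k j. k < N + n \<Longrightarrow> h' i k j = h i k j"
      using obstruction_step[OF D E u h(1,2) van] by (metis le_add1)
    then have "P (Suc n) h' \<and> (\<forall>i k j. k < N + n \<longrightarrow> h' i k j = h i k j)"
      using h(3) by (simp add: P_def less_Suc_eq_le)
    then show ?thesis by blast
  qed
  have "\<exists>H. \<forall>n. P n (H n) \<and> (\<forall>i k j. k < N + n \<longrightarrow> H (Suc n) i k j = H n i k j)"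
    by (rule dependent_nat_choice) (use P0 PS in blast)+
  then obtain H where "\<forall>n. P n (H n) \<and> (\<forall>i k j. k < N + n \<longrightarrow> H (Suc n) i k j = H n i k j)" ..
  then have H: "P n (H n)" and HH: "k < N + n \<Longrightarrow> H (Suc n) i k j = H n i k j" for n i k j
    by blast+
  \<comment> \<open>The limit: component k is already correct at stage k + 1 and is not changed
    afterwards.\<close>
  define s where "s i k j = H (Suc k) i k j" for i k j
  have Hs: "H m i k j = s i k j" if "Suc k \<le> m" for m i k j
    using that
  proof (induction m rule: dec_induct)
    case (step m)
    then show ?case using HH[of k m i j] by simp
  qed (simp add: s_def)
  show ?thesis
  proof (rule that)
    show "s i \<in> Hom ZC (trm D i) (trm E (i-1))" for i
      using H unfolding Zplus_Hom s_def P_def by blast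
    show "u = boundary ZC D E s"
    proof (intro ext)
      fix i k j
      have "u i k j = boundary ZC D E (H (Suc k)) i k j"
        using H[of "Suc k"] by (simp add: P_def)
      also have "\<dots> = boundary ZC D E s i k j"
        by (rule Zplus_boundary_cong) (simp add: Hs)
      finally show "u i k j = boundary ZC D E s i k j" .
    qed
    show "s i k j = czero C (trm D i j) (trm E (i-1) (j + int k))" if "k < N" for i k j
      using H[of "Suc k"] that by (simp add: P_def s_def Zplus_czero)
  qed
qed

lemma row_shift: "row (shift ZC 1 E) j = shift C 1 (row E j)"
  by (simp add: row_def shift_def cat_sgn_def Zplus_cneg)

lemma row_twist: "row (twist E) j = row E (j+1)"
  by (simp add: row_def)

text \<open>The defect \<open>df - fd\<close> of a family that commutes with the differentials up to its first two
  components is a chain map \<open>D \<rightarrow> E[1]\<close> to which obstruction theory applies.\<close>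

lemma extend_chain_map:
  assumes D: "D \<in> Ob CZ" and E: "E \<in> Ob CZ"
    and f0: "\<And>j. f0 j \<in> Hom (Cx C) (row D j) (row E j)"
    and f1: "\<And>i j. f1 j i \<in> Hom C (trm D i j) (trm E i (j+1))"
    and eq: "\<And>i j. cadd C (trm D i j) (trm E (i+1) (j+1))
        (ccomp C (trm D i j) (trm E i j) (trm E (i+1) (j+1)) (dif E i 1 j) (f0 j i))
        (ccomp C (trm D i j) (trm E i (j+1)) (trm E (i+1) (j+1)) (dif E i 0 (j+1)) (f1 j i))
      = cadd C (trm D i j) (trm E (i+1) (j+1))
        (ccomp C (trm D i j) (trm D (i+1) (j+1)) (trm E (i+1) (j+1)) (f0 (j+1) (i+1)) (dif D i 1 j))
        (ccomp C (trm D i j) (trm D (i+1) j) (trm E (i+1) (j+1)) (f1 j (i+1)) (dif D i 0 j))"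
    and van: "\<And>n j f. \<lbrakk>2 \<le> n; f \<in> Hom (Cx C) (row D j) (shift C 1 (row E (j + int n)))\<rbrakk>
      \<Longrightarrow> null_homotopic C (row D j) (shift C 1 (row E (j + int n))) f"
  obtains f where "f \<in> Hom CZ D E" "\<And>j. rowm f j = f0 j"
proof -
  let ?S = "shift ZC 1 E"
  \<comment> \<open>The prescribed components, extended by zero; the defect of this family is what
    obstruction theory has to remove.\<close>
  define g where "g i k j = (if k = 0 then f0 j i else if k = 1 then f1 j i
    else czero C (trm D i j) (trm E i (j + int k)))" for i and k :: nat and j
  have T: "trm D i \<in> Ob ZC" "trm E i \<in> Ob ZC" for i using D E by simp_all
  have Tj: "trm D i j \<in> Ob C" "trm E i j \<in> Ob C" for i j using T by simp_all
  have g_in: "g i \<in> Hom ZC (trm D i) (trm E i)" for i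
    using Tj f1 Cx_Hom_in[OF f0] by (simp add: Zplus_Hom g_def)
  have d: "dif D i \<in> Hom ZC (trm D i) (trm D (i+1))" "dif E i \<in> Hom ZC (trm E i) (trm E (i+1))"
      for i
    using D E by simp_all
  have d': "dif D (i+1) \<in> Hom ZC (trm D (i+1)) (trm D (i+2))"
    "dif E (i+1) \<in> Hom ZC (trm E (i+1)) (trm E (i+2))"
    "g (i+2) \<in> Hom ZC (trm D (i+2)) (trm E (i+2))" for i
    using D E g_in by simp_all
  define u where "u i = cadd ZC (trm D i) (trm E (i+1))
      (ccomp ZC (trm D i) (trm E i) (trm E (i+1)) (dif E i) (g i))
      (cneg ZC (trm D i) (trm E (i+1))
        (ccomp ZC (trm D i) (trm D (i+1)) (trm E (i+1)) (g (i+1)) (dif D i)))" for i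
  have u_in: "u \<in> Hom CZ D ?S"
    by (rule Cx_HomI) (use D E T g_in d d' in \<open>simp_all add: u_def B.comp_distrib\<close>)
  have dmem: "dif D i 0 j \<in> Hom C (trm D i j) (trm D (i+1) j)" "dif E i 0 j \<in> Hom C (trm E i j)
      (trm E (i+1) j)"
    "dif D i (Suc 0) j \<in> Hom C (trm D i j) (trm D (i+1) (j+1))"
    "dif E i (Suc 0) j \<in> Hom C (trm E i j) (trm E (i+1) (j+1))" for i j
    using Zplus_Hom_in[OF d(1), of i 0 j] Zplus_Hom_in[OF d(2), of i 0 j]
      Zplus_Hom_in[OF d(1), of i "Suc 0" j] Zplus_Hom_in[OF d(2), of i "Suc 0" j] by simp_all
  \<comment> \<open>Degree zero vanishes because each \<open>f0 j\<close> is a chain map between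
    rows, degree one by \<open>eq\<close>. From degree two on, \<open>van\<close> takes
    over.\<close>
  have u0: "u i k j = czero C (trm D i j) (trm ?S i (j + int k))" if "k < 2" for i k j
  proof (cases "k = 0")
    case True
    have "ccomp C (trm D i j) (trm D (i+1) j) (trm E (i+1) j) (f0 j (i+1)) (dif D i 0 j)
      = ccomp C (trm D i j) (trm E i j) (trm E (i+1) j) (dif E i 0 j) (f0 j i)"
      using Cx_commute(1)[OF f0[of j], of i] by simp
    then show ?thesis
      using True Tj dmem Cx_Hom_in[OF f0[of j]]
          by (simp add: u_def Zplus_cadd Zplus_cneg Zplus_comp0 g_def)
  next
    case False
    with that have k: "k = Suc 0" by simp
    have "f0 j i \<in> Hom C (trm D i j) (trm E i j)" "f0 (j+1) (i+1) \<in> Hom C (trm D (i+1) (j+1))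
        (trm E (i+1) (j+1))"
      using Cx_Hom_in[OF f0[of j], of i] Cx_Hom_in[OF f0[of "j+1"], of "i+1"] by simp_all
    moreover have "ccomp ZC (trm D i) (trm D (i+1)) (trm E (i+1)) (g (i+1)) (dif D i) (Suc 0) j
      = ccomp ZC (trm D i) (trm E i) (trm E (i+1)) (dif E i) (g i) (Suc 0) j"
      using eq[where i = i and j = j] Tj calculation f1[of j i] f1[of j "i+1"] dmem
      by (simp add: Zplus_comp1 g_def add_comm)
    moreover have "ccomp ZC (trm D i) (trm E i) (trm E (i+1)) (dif E i) (g i) (Suc 0) j
        \<in> Hom C (trm D i j) (trm E (i+1) (j+1))"
      using Zplus_Hom_in[OF B.comp_in[OF T(1) T(2) T(2) g_in[of i] d(2)[of i]], of "Suc 0" j]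
          by simp
    ultimately show ?thesis
      using Tj k by (simp add: u_def Zplus_cadd Zplus_cneg)
  qed
  have S: "?S \<in> Ob CZ" using E by simp
  obtain s where s: "\<And>i. s i \<in> Hom ZC (trm D i) (trm ?S (i-1))"
    and us: "u = boundary ZC D ?S s"
    and s0: "\<And>i k j. k < 2 \<Longrightarrow> s i k j = czero C (trm D i j) (trm ?S (i-1) (j + int k))"
    by (rule obstruction[OF D S u_in u0]) (use van in \<open>auto simp: row_shift\<close>)
  have s': "s i \<in> Hom ZC (trm D i) (trm E i)" for i using s by simp
  \<comment> \<open>Since E[1] carries the differential -d, the equation for u reads dg - gd = -ds +
    sd, so g + s commutes with the differentials. As s vanishes below degree two, \<open>f0\<close>
    survives.\<close>
  define f where "f i = cadd ZC (trm D i) (trm E i) (g i) (s i)" for i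
  have us': "cadd ZC (trm D i) (trm E (i+1))
      (ccomp ZC (trm D i) (trm E i) (trm E (i+1)) (dif E i) (g i))
      (cneg ZC (trm D i) (trm E (i+1))
        (ccomp ZC (trm D i) (trm D (i+1)) (trm E (i+1)) (g (i+1)) (dif D i)))
    = cadd ZC (trm D i) (trm E (i+1))
      (cneg ZC (trm D i) (trm E (i+1)) (ccomp ZC (trm D i) (trm E i) (trm E (i+1)) (dif E i) (s i)))
      (ccomp ZC (trm D i) (trm D (i+1)) (trm E (i+1)) (s (i+1)) (dif D i))" for i
    using fun_cong[OF us, of i] T d s' by (simp add: u_def boundary_def)
  have "f \<in> Hom CZ D E"
  proof (rule Cx_HomI)
    fix i
    show "f i \<in> Hom ZC (trm D i) (trm E i)" using T g_in s' by (simp add: f_def)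
    let ?A = "ccomp ZC (trm D i) (trm E i) (trm E (i+1)) (dif E i) (g i)"
    let ?B = "ccomp ZC (trm D i) (trm D (i+1)) (trm E (i+1)) (g (i+1)) (dif D i)"
    let ?A' = "ccomp ZC (trm D i) (trm E i) (trm E (i+1)) (dif E i) (s i)"
    let ?B' = "ccomp ZC (trm D i) (trm D (i+1)) (trm E (i+1)) (s (i+1)) (dif D i)"
    let ?p = "cadd ZC (trm D i) (trm E (i+1))" and ?n = "cneg ZC (trm D i) (trm E (i+1))"
    have m: "?A \<in> Hom ZC (trm D i) (trm E (i+1))" "?B \<in> Hom ZC (trm D i) (trm E (i+1))"
      "?A' \<in> Hom ZC (trm D i) (trm E (i+1))" "?B' \<in> Hom ZC (trm D i) (trm E (i+1))"
      using T d g_in s' by simp_all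
    have "?p ?B ?B' = ?p ?B (?p ?A' (?p (?n ?A') ?B'))" using T m by simp
    also have "\<dots> = ?p ?B (?p ?A' (?p ?A (?n ?B)))" by (simp only: us')
    also have "\<dots> = ?p ?A ?A'" using T m by (simp add: B.add_ac)
    finally show "ccomp ZC (trm D i) (trm D (i+1)) (trm E (i+1)) (f (i+1)) (dif D i)
      = ccomp ZC (trm D i) (trm E i) (trm E (i+1)) (dif E i) (f i)"
      using T d g_in s' by (simp add: f_def B.comp_add_left B.comp_add_right)
  qed
  moreover have "rowm f j = f0 j" for j
    using s0[of 0 _ j] Tj Cx_Hom_in[OF f0[of j]] by (simp add: fun_eq_iff f_def Zplus_cadd g_def)
  ultimately show ?thesis by (rule that)
qed

text \<open>The family \<open>p\<close> is the component of degree \<open>-1\<close> of a null homotopy of \<open>g \<circ> \<eta>\<close>. Its degree-zero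
  component comes from the null homotopies in the hypothesis \<open>pg\<close>.\<close>

lemma eta_null_criterion:
  assumes D: "D \<in> Ob CZ" and E: "E \<in> Ob CZ"
    and g: "g \<in> Hom CZ D E"
    and p: "\<And>i j. p i j \<in> Hom C (trm D i (j+1)) (trm E (i-1) j)"
    and p0: "\<And>i j. cadd C (trm D i (j+1)) (trm E i j)
        (ccomp C (trm D i (j+1)) (trm E (i-1) j) (trm E i j) (dif E (i-1) 0 j) (p i j))
        (ccomp C (trm D i (j+1)) (trm D (i+1) (j+1)) (trm E i j) (p (i+1) j) (dif D i 0 (j+1)))
      = czero C (trm D i (j+1)) (trm E i j)"
    and pg: "\<And>j. null_homotopic C (row D (j+1)) (row E (j+1))
        (\<lambda>i. cadd C (trm D i (j+1)) (trm E i (j+1)) (g i 0 (j+1))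
            (cneg C (trm D i (j+1)) (trm E i (j+1))
          (cadd C (trm D i (j+1)) (trm E i (j+1))
            (ccomp C (trm D i (j+1)) (trm E (i-1) j) (trm E i (j+1)) (dif E (i-1) 1 j) (p i j))
            (ccomp C (trm D i (j+1)) (trm D (i+1) (j+2)) (trm E i (j+1)) (p (i+1) (j+1))
                (dif D i 1 (j+1))))))"
    and van: "\<And>n j f. \<lbrakk>2 \<le> n; f \<in> Hom (Cx C) (row D (j+1)) (row E (j + int n))\<rbrakk>
      \<Longrightarrow> null_homotopic C (row D (j+1)) (row E (j + int n)) f"
  shows "eta_null C D E g"
proof -
  let ?C = CZ
  let ?T = "twist D"
  have T: "trm D i \<in> Ob ZC" "trm E i \<in> Ob ZC" "gtw (trm D i) \<in> Ob ZC" for i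
    using D E by simp_all
  have Tj: "trm D i j \<in> Ob C" "trm E i j \<in> Ob C" for i j using T by simp_all
  define r where "r j = (\<lambda>i. cadd C (trm D i (j+1)) (trm E i (j+1)) (g i 0 (j+1))
      (cneg C (trm D i (j+1)) (trm E i (j+1))
          (cadd C (trm D i (j+1)) (trm E i (j+1))
            (ccomp C (trm D i (j+1)) (trm E (i-1) j) (trm E i (j+1)) (dif E (i-1) 1 j) (p i j))
            (ccomp C (trm D i (j+1)) (trm D (i+1) (j+2)) (trm E i (j+1)) (p (i+1) (j+1))
                (dif D i 1 (j+1))))))" for j
  have "\<exists>q. (\<forall>i. q i \<in> Hom C (trm D i (j+1)) (trm E (i-1) (j+1))) \<and>
     r j = boundary C (row D (j+1)) (row E (j+1)) q" for j
    using pg[of j] unfolding null_homotopic_iff by (simp add: r_def)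
  then obtain q where q: "\<And>j i. q j i \<in> Hom C (trm D i (j+1)) (trm E (i-1) (j+1))"
    and qg: "\<And>j. r j = boundary C (row D (j+1)) (row E (j+1)) (q j)" by metis
  \<comment> \<open>h starts at D(1), so its component k has degree k - 1 as seen from D:
    \<open>p\<close> becomes component 0, and the row homotopies \<open>q\<close> become component
    1.\<close>
  define h where "h i k j = (if k = 0 then p i j else if k = 1 then q j i
    else czero C (trm D i (j+1)) (trm E (i-1) (j + int k)))" for i and k :: nat and j
  have h_in: "h i \<in> Hom ZC (trm ?T i) (trm E (i-1))" for i
    using Tj p q by (simp add: Zplus_Hom h_def)
  define b where "b = boundary ZC ?T E h"
  have b_in: "b \<in> Hom ?C ?T E" unfolding b_def using D E h_in by (intro B.boundary_in) simp_all
  have ge_in: "ccomp ?C ?T D E g (eta C D) \<in> Hom ?C ?T E" using D E g by simp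
  define u where "u = cadd ?C ?T E (ccomp ?C ?T D E g (eta C D)) (cneg ?C ?T E b)"
  have u_in: "u \<in> Hom ?C ?T E" unfolding u_def using D E b_in ge_in by simp
  have g_in: "g i \<in> Hom ZC (trm D i) (trm E i)" for i by (rule B.Cx_Hom_in[OF g])
  have ge: "ccomp ?C ?T D E g (eta C D) i 0 j = czero C (trm D i (j+1)) (trm E i j)"
    "ccomp ?C ?T D E g (eta C D) i (Suc k) j = g i k (j+1)" for i j k
    using comp_geta[OF T(1,2) g_in] by (simp_all add: Cx_ccomp)
  have d: "dif D i \<in> Hom ZC (trm D i) (trm D (i+1))" "dif E i \<in> Hom ZC (trm E i) (trm E (i+1))"
    "dif E (i-1) \<in> Hom ZC (trm E (i-1)) (trm E i)" for i
    using D E by simp_all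
  have dmem: "dif D i 0 j \<in> Hom C (trm D i j) (trm D (i+1) j)" "dif E (i-1) 0 j \<in> Hom C
      (trm E (i-1) j) (trm E i j)"
    "dif D i (Suc 0) j \<in> Hom C (trm D i j) (trm D (i+1) (j+1))"
    "dif D i (Suc 0) (j+1) \<in> Hom C (trm D i (j+1)) (trm D (i+1) (j+2))"
    "dif E (i-1) (Suc 0) j \<in> Hom C (trm E (i-1) j) (trm E i (j+1))"
    "p (i+1) j \<in> Hom C (trm D (i+1) (j+1)) (trm E i j)"
    "p (i+1) (j+1) \<in> Hom C (trm D (i+1) (j+2)) (trm E i (j+1))"
    "q j (i+1) \<in> Hom C (trm D (i+1) (j+1)) (trm E i (j+1))"
    "g i 0 j \<in> Hom C (trm D i j) (trm E i j)" for i j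
    using Zplus_Hom_in[OF d(1), of i 0 j] Zplus_Hom_in[OF d(3), of i 0 j]
      Zplus_Hom_in[OF d(1), of i "Suc 0" j] Zplus_Hom_in[OF d(1), of i "Suc 0" "j+1"]
          Zplus_Hom_in[OF d(3), of i "Suc 0" j]
      p[of "i+1" j] p[of "i+1" "j+1"] q[of j "i+1"] Zplus_Hom_in0[OF g_in] by simp_all
  have u0: "u i k j = czero C (trm ?T i j) (trm E i (j + int k))" if "k < 2" for i k j
  proof (cases "k = 0")
    case True
    have "b i 0 j = czero C (trm D i (j+1)) (trm E i j)"
      using p0[of i j] by (simp add: b_def boundary_def Zplus_cadd Zplus_comp0 h_def)
    then show ?thesis using True Tj by (simp add: u_def Cx_cadd Cx_cneg Zplus_cadd Zplus_cneg ge)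
  next
    case False
    with that have k: "k = Suc 0" by simp
    let ?p = "cadd C (trm D i (j+1)) (trm E i (j+1))" and ?n = "cneg C (trm D i (j+1))
        (trm E i (j+1))"
    let ?x1 = "ccomp C (trm D i (j+1)) (trm E (i-1) j) (trm E i (j+1)) (dif E (i-1) (Suc 0) j)
        (p i j)"
    let ?x2 = "ccomp C (trm D i (j+1)) (trm D (i+1) (j+2)) (trm E i (j+1)) (p (i+1) (j+1))
        (dif D i (Suc 0) (j+1))"
    let ?y1 = "ccomp C (trm D i (j+1)) (trm E (i-1) (j+1)) (trm E i (j+1)) (dif E (i-1) 0 (j+1))
        (q j i)"
    let ?y2 = "ccomp C (trm D i (j+1)) (trm D (i+1) (j+1)) (trm E i (j+1)) (q j (i+1))
        (dif D i 0 (j+1))"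
    have m: "?x1 \<in> Hom C (trm D i (j+1)) (trm E i (j+1))" "?x2 \<in> Hom C (trm D i (j+1))
        (trm E i (j+1))"
      "?y1 \<in> Hom C (trm D i (j+1)) (trm E i (j+1))" "?y2 \<in> Hom C (trm D i (j+1)) (trm E i (j+1))"
      "g i 0 (j+1) \<in> Hom C (trm D i (j+1)) (trm E i (j+1))"
      using Tj dmem p q by simp_all
    have "b i (Suc 0) j = ?p (?p ?x1 ?y1) (?p ?y2 ?x2)"
      by (simp add: b_def boundary_def Zplus_cadd Zplus_comp1 h_def)
    also have "\<dots> = ?p (?p ?x1 ?x2) (?p ?y1 ?y2)" using Tj m by (simp add: add_ac)
    also have "?p ?y1 ?y2 = ?p (g i 0 (j+1)) (?n (?p ?x1 ?x2))"
      using fun_cong[OF qg[of j], of i] by (simp add: boundary_def r_def)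
    also have "?p (?p ?x1 ?x2) \<dots> = g i 0 (j+1)" using Tj m by (simp add: add_ac)
    finally show ?thesis using k Tj m(5) by (simp add: u_def Cx_cadd Cx_cneg Zplus_cadd Zplus_cneg
        ge)
  qed
  obtain s where s: "\<And>i. s i \<in> Hom ZC (trm ?T i) (trm E (i-1))"
    and us: "u = boundary ZC ?T E s"
    by (rule obstruction[OF twist_Ob[OF D] E u_in u0]) (use van in \<open>auto simp: row_twist\<close>)
  have "ccomp ?C ?T D E g (eta C D) = cadd ?C ?T E b u"
    unfolding u_def using twist_Ob[OF D] E b_in ge_in by (simp add: BC.add_ac)
  also have "\<dots> = boundary ZC ?T E (\<lambda>i. cadd ZC (trm ?T i) (trm E (i-1)) (h i) (s i))"
    unfolding us b_def using B.boundary_add[OF twist_Ob[OF D] E h_in s] by simp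
  finally have "null_homotopic ZC ?T E (ccomp ?C ?T D E g (eta C D))"
    by (rule null_homotopicI[rotated]) (use T h_in s in simp_all)
  then show ?thesis using D E g by (simp add: eta_null_iff)
qed

text \<open>The special case in which the component of degree -1 is zero: the correction by d_1
  disappears, and only the rows of g_0 have to be null-homotopic.\<close>

lemma eta_null_rows:
  assumes D: "D \<in> Ob CZ" and E: "E \<in> Ob CZ"
    and g: "g \<in> Hom CZ D E"
    and rows: "\<And>j. null_homotopic C (row D j) (row E j) (rowm g j)"
    and van: "\<And>n j f. \<lbrakk>2 \<le> n; f \<in> Hom (Cx C) (row D (j+1)) (row E (j + int n))\<rbrakk>
      \<Longrightarrow> null_homotopic C (row D (j+1)) (row E (j + int n)) f"
  shows "eta_null C D E g"
proof (rule eta_null_criterion[OF D E g _ _ _ van])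
  let ?z = "\<lambda>i j. czero C (trm D i (j+1)) (trm E (i-1) j)"
  have T: "trm D i \<in> Ob ZC" "trm E i \<in> Ob ZC" for i using D E by simp_all
  have Tj: "trm D i j \<in> Ob C" "trm E i j \<in> Ob C" for i j using T by simp_all
  have d: "dif D i \<in> Hom ZC (trm D i) (trm D (i+1))"
    "dif E (i-1) \<in> Hom ZC (trm E (i-1)) (trm E i)" for i
    using D E by simp_all
  have dmem: "dif D i 0 j \<in> Hom C (trm D i j) (trm D (i+1) j)" "dif E (i-1) 0 j \<in> Hom C
      (trm E (i-1) j) (trm E i j)"
    "dif D i (Suc 0) (j+1) \<in> Hom C (trm D i (j+1)) (trm D (i+1) (j+2))"
    "dif E (i-1) (Suc 0) j \<in> Hom C (trm E (i-1) j) (trm E i (j+1))"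
    "g i 0 j \<in> Hom C (trm D i j) (trm E i j)" for i j
    using Zplus_Hom_in[OF d(1), of i 0 j] Zplus_Hom_in[OF d(2), of i 0 j]
      Zplus_Hom_in[OF d(1), of i "Suc 0" "j+1"] Zplus_Hom_in[OF d(2), of i "Suc 0" j]
      Zplus_Hom_in0[OF B.Cx_Hom_in[OF g]] by simp_all
  show "?z i j \<in> Hom C (trm D i (j+1)) (trm E (i-1) j)" for i j using Tj by simp
  show "cadd C (trm D i (j+1)) (trm E i j)
        (ccomp C (trm D i (j+1)) (trm E (i-1) j) (trm E i j) (dif E (i-1) 0 j) (?z i j))
        (ccomp C (trm D i (j+1)) (trm D (i+1) (j+1)) (trm E i j) (?z (i+1) j) (dif D i 0 (j+1)))
      = czero C (trm D i (j+1)) (trm E i j)" for i j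
    using Tj dmem by simp
  show "null_homotopic C (row D (j+1)) (row E (j+1))
        (\<lambda>i. cadd C (trm D i (j+1)) (trm E i (j+1)) (g i 0 (j+1))
            (cneg C (trm D i (j+1)) (trm E i (j+1))
          (cadd C (trm D i (j+1)) (trm E i (j+1))
            (ccomp C (trm D i (j+1)) (trm E (i-1) j) (trm E i (j+1)) (dif E (i-1) 1 j) (?z i j))
            (ccomp C (trm D i (j+1)) (trm D (i+1) (j+2)) (trm E i (j+1)) (?z (i+1) (j+1))
                (dif D i 1 (j+1))))))" for j
    using rows[of "j+1"] Tj dmem by (simp add: rowm_def)
qed

text \<open>The injections and projections of graded objects sit in degree zero, so they pick out
  the components of the entries one degree at a time.\<close>

lemma cmat_Zplus:
  assumes "X \<in> Ob ZC" "Y \<in> Ob ZC" "X' \<in> Ob ZC" "Y' \<in> Ob ZC"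
    "a \<in> Hom ZC X X'" "b \<in> Hom ZC Y X'" "c \<in> Hom ZC X Y'" "d \<in> Hom ZC Y Y'"
  shows "cmat ZC X Y X' Y' a b c d n j
    = cmat C (X j) (Y j) (X' (j + int n)) (Y' (j + int n)) (a n j) (b n j) (c n j) (d n j)"
proof -
  have S: "(\<lambda>j. csum C (X j) (Y j)) \<in> Ob ZC" "(\<lambda>j. csum C (X' j) (Y' j)) \<in> Ob ZC"
    using assms by (simp_all add: Zplus_sum_ob)
  have i: "ccomp ZC X X' (\<lambda>j. csum C (X' j) (Y' j)) (cin1 ZC X' Y') a \<in> Hom ZC X
      (\<lambda>j. csum C (X' j) (Y' j))"
    "ccomp ZC Y X' (\<lambda>j. csum C (X' j) (Y' j)) (cin1 ZC X' Y') b \<in> Hom ZC Y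
        (\<lambda>j. csum C (X' j) (Y' j))"
    "ccomp ZC X Y' (\<lambda>j. csum C (X' j) (Y' j)) (cin2 ZC X' Y') c \<in> Hom ZC X
        (\<lambda>j. csum C (X' j) (Y' j))"
    "ccomp ZC Y Y' (\<lambda>j. csum C (X' j) (Y' j)) (cin2 ZC X' Y') d \<in> Hom ZC Y
        (\<lambda>j. csum C (X' j) (Y' j))"
    using assms B.in1_in[OF assms(3,4)] B.in2_in[OF assms(3,4)] S
    by (simp_all add: Zplus_csum)
  show ?thesis
    using assms S i
    by (simp add: cmat_def Let_def Zplus_csum Zplus_cadd Zplus_cpr1 Zplus_cpr2 Zplus_comp_deg0
        Zplus_cin1 Zplus_cin2 Zplus_deg0_comp)
qed

end

section \<open>Modules\<close>

lemma right_module_group: "right_module R M \<Longrightarrow> abelian_group M"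
  by (simp add: right_module_def)

context
  fixes R :: "'a ring" and M :: "('a, 'm) module"
  assumes M: "right_module R M"
begin

interpretation M: abelian_group M
  by (rule right_module_group[OF M])

lemma rm_zero [simp]: "\<zero>\<^bsub>M\<^esub> \<in> carrier M"
  and rm_add [simp]: "\<lbrakk>x \<in> carrier M; y \<in> carrier M\<rbrakk> \<Longrightarrow> x \<oplus>\<^bsub>M\<^esub> y \<in> carrier M"
  and rm_neg [simp]: "x \<in> carrier M \<Longrightarrow> \<ominus>\<^bsub>M\<^esub> x \<in> carrier M"
  and rm_zero_left [simp]: "x \<in> carrier M \<Longrightarrow> \<zero>\<^bsub>M\<^esub> \<oplus>\<^bsub>M\<^esub> x = x"
  and rm_zero_right [simp]: "x \<in> carrier M \<Longrightarrow> x \<oplus>\<^bsub>M\<^esub> \<zero>\<^bsub>M\<^esub> = x"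
  and rm_neg_left [simp]: "x \<in> carrier M \<Longrightarrow> \<ominus>\<^bsub>M\<^esub> x \<oplus>\<^bsub>M\<^esub> x = \<zero>\<^bsub>M\<^esub>"
  and rm_neg_add: "\<lbrakk>x \<in> carrier M; y \<in> carrier M\<rbrakk> \<Longrightarrow> \<ominus>\<^bsub>M\<^esub> (x \<oplus>\<^bsub>M\<^esub> y) = \<ominus>\<^bsub>M\<^esub> x \<oplus>\<^bsub>M\<^esub> \<ominus>\<^bsub>M\<^esub> y"
  and rm_assoc: "\<lbrakk>x \<in> carrier M; y \<in> carrier M; z \<in> carrier M\<rbrakk>
    \<Longrightarrow> (x \<oplus>\<^bsub>M\<^esub> y) \<oplus>\<^bsub>M\<^esub> z = x \<oplus>\<^bsub>M\<^esub> (y \<oplus>\<^bsub>M\<^esub> z)"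
  and rm_comm: "\<lbrakk>x \<in> carrier M; y \<in> carrier M\<rbrakk> \<Longrightarrow> x \<oplus>\<^bsub>M\<^esub> y = y \<oplus>\<^bsub>M\<^esub> x"
  and rm_left_comm: "\<lbrakk>x \<in> carrier M; y \<in> carrier M; z \<in> carrier M\<rbrakk>
    \<Longrightarrow> x \<oplus>\<^bsub>M\<^esub> (y \<oplus>\<^bsub>M\<^esub> z) = y \<oplus>\<^bsub>M\<^esub> (x \<oplus>\<^bsub>M\<^esub> z)"
  by (simp_all add: M.l_neg M.r_neg M.minus_add M.a_ac)

lemma rm_smult [simp]: "\<lbrakk>a \<in> carrier R; x \<in> carrier M\<rbrakk> \<Longrightarrow> a \<odot>\<^bsub>M\<^esub> x \<in> carrier M"
  and rm_smult_add: "\<lbrakk>a \<in> carrier R; x \<in> carrier M; y \<in> carrier M\<rbrakk>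
    \<Longrightarrow> a \<odot>\<^bsub>M\<^esub> (x \<oplus>\<^bsub>M\<^esub> y) = a \<odot>\<^bsub>M\<^esub> x \<oplus>\<^bsub>M\<^esub> a \<odot>\<^bsub>M\<^esub> y"
  using M by (simp_all add: right_module_def)

lemma rm_double: "\<lbrakk>x \<in> carrier M; x \<oplus>\<^bsub>M\<^esub> x = x\<rbrakk> \<Longrightarrow> x = \<zero>\<^bsub>M\<^esub>"
  by (metis M.add.l_cancel_one)

lemma rm_neg_unique: "\<lbrakk>x \<in> carrier M; y \<in> carrier M; x \<oplus>\<^bsub>M\<^esub> y = \<zero>\<^bsub>M\<^esub>\<rbrakk> \<Longrightarrow> y = \<ominus>\<^bsub>M\<^esub> x"
  by (metis M.a_comm M.minus_equality M.minus_minus)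

lemma rm_smult_zero [simp]: "a \<in> carrier R \<Longrightarrow> a \<odot>\<^bsub>M\<^esub> \<zero>\<^bsub>M\<^esub> = \<zero>\<^bsub>M\<^esub>"
  using rm_double[of "a \<odot>\<^bsub>M\<^esub> \<zero>\<^bsub>M\<^esub>"] rm_smult_add[of a "\<zero>\<^bsub>M\<^esub>" "\<zero>\<^bsub>M\<^esub>"] by simp

lemma rm_smult_neg: "\<lbrakk>a \<in> carrier R; x \<in> carrier M\<rbrakk> \<Longrightarrow> a \<odot>\<^bsub>M\<^esub> (\<ominus>\<^bsub>M\<^esub> x) = \<ominus>\<^bsub>M\<^esub> (a \<odot>\<^bsub>M\<^esub> x)"
  using rm_smult_add[of a x "\<ominus>\<^bsub>M\<^esub> x"] by (intro rm_neg_unique) (simp_all add: M.r_neg)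

end

lemma mod_homD:
  assumes "f \<in> mod_hom R M N"
  shows "f \<in> carrier M \<rightarrow>\<^sub>E carrier N" "x \<in> carrier M \<Longrightarrow> f x \<in> carrier N"
    "\<lbrakk>x \<in> carrier M; y \<in> carrier M\<rbrakk> \<Longrightarrow> f (x \<oplus>\<^bsub>M\<^esub> y) = f x \<oplus>\<^bsub>N\<^esub> f y"
    "\<lbrakk>a \<in> carrier R; x \<in> carrier M\<rbrakk> \<Longrightarrow> f (a \<odot>\<^bsub>M\<^esub> x) = a \<odot>\<^bsub>N\<^esub> f x"
  using assms by (auto simp: mod_hom_def)

lemma mod_hom_eqI:
  assumes "f \<in> mod_hom R M N" "g \<in> mod_hom R M N" "\<And>x. x \<in> carrier M \<Longrightarrow> f x = g x"
  shows "f = g"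
  using PiE_ext[OF mod_homD(1)[OF assms(1)] mod_homD(1)[OF assms(2)]] assms(3) by blast

lemma mod_homI:
  assumes "\<And>x. x \<in> carrier M \<Longrightarrow> f x \<in> carrier N"
    "\<And>x y. \<lbrakk>x \<in> carrier M; y \<in> carrier M\<rbrakk> \<Longrightarrow> f (x \<oplus>\<^bsub>M\<^esub> y) = f x \<oplus>\<^bsub>N\<^esub> f y"
    "\<And>a x. \<lbrakk>a \<in> carrier R; x \<in> carrier M\<rbrakk> \<Longrightarrow> f (a \<odot>\<^bsub>M\<^esub> x) = a \<odot>\<^bsub>N\<^esub> f x"
    "right_module R M"
  shows "restrict f (carrier M) \<in> mod_hom R M N"
  using assms by (auto simp: mod_hom_def)

lemma mod_hom_zero_apply:
  assumes M: "right_module R M" and N: "right_module R N" and f: "f \<in> mod_hom R M N"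
  shows "f \<zero>\<^bsub>M\<^esub> = \<zero>\<^bsub>N\<^esub>"
  using M N mod_homD(2,3)[OF f, of "\<zero>\<^bsub>M\<^esub>"] rm_double[OF N, of "f \<zero>\<^bsub>M\<^esub>"] by simp

lemma mod_hom_compose:
  assumes L: "right_module R L" and f: "f \<in> mod_hom R L M" and g: "g \<in> mod_hom R M N"
  shows "compose (carrier L) g f \<in> mod_hom R L N"
  unfolding compose_def using L by (intro mod_homI) (simp_all add: mod_homD[OF f] mod_homD[OF g])

lemma mod_sum_carrier: "carrier (mod_sum M N) = case_prod Pair ` (carrier M \<times> carrier N)"
  and mod_sum_zero [simp]: "\<zero>\<^bsub>mod_sum M N\<^esub> = Pair \<zero>\<^bsub>M\<^esub> \<zero>\<^bsub>N\<^esub>"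
  and mod_sum_add [simp]: "x \<oplus>\<^bsub>mod_sum M N\<^esub> y = Pair (pfst x \<oplus>\<^bsub>M\<^esub> pfst y) (psnd x \<oplus>\<^bsub>N\<^esub> psnd y)"
  and mod_sum_smult [simp]: "a \<odot>\<^bsub>mod_sum M N\<^esub> x = Pair (a \<odot>\<^bsub>M\<^esub> pfst x) (a \<odot>\<^bsub>N\<^esub> psnd x)"
  by (simp_all add: mod_sum_def)

lemma mod_sum_carrierE:
  assumes "z \<in> carrier (mod_sum M N)"
  obtains x y where "z = Pair x y" "x \<in> carrier M" "y \<in> carrier N"
  using assms by (auto simp: mod_sum_carrier)

lemma Pair_in_mod_sum [simp]: "Pair x y \<in> carrier (mod_sum M N) \<longleftrightarrow> x \<in> carrier M \<and> y \<in> carrier N"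
  by (auto simp: mod_sum_carrier)

lemma mod_sum_module:
  assumes M: "right_module R M" and N: "right_module R N"
  shows "right_module R (mod_sum M N)"
proof -
  have "abelian_group (mod_sum M N)"
  proof (rule abelian_groupI)
    fix x assume "x \<in> carrier (mod_sum M N)"
    then obtain a b where x: "x = Pair a b" "a \<in> carrier M" "b \<in> carrier N"
      by (rule mod_sum_carrierE)
    show "\<exists>y\<in>carrier (mod_sum M N). y \<oplus>\<^bsub>mod_sum M N\<^esub> x = \<zero>\<^bsub>mod_sum M N\<^esub>"
      by (rule bexI[where x = "Pair (\<ominus>\<^bsub>M\<^esub> a) (\<ominus>\<^bsub>N\<^esub> b)"]) (use M N x in simp_all)
  qed (use M N in \<open>auto elim!: mod_sum_carrierE simp: rm_assoc[OF M] rm_assoc[OF N]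
        intro: rm_comm[OF M] rm_comm[OF N]\<close>)
  then show ?thesis
    using M N by (auto simp: right_module_def elim!: mod_sum_carrierE)
qed

lemma Mod_sel [simp]:
  "Ob (Mod R) = {M. right_module R M}" "Hom (Mod R) = mod_hom R"
  "cid (Mod R) M = (\<lambda>x\<in>carrier M. x)" "ccomp (Mod R) L M N g f = compose (carrier L) g f"
  "czero (Mod R) M N = (\<lambda>x\<in>carrier M. \<zero>\<^bsub>N\<^esub>)"
  "cadd (Mod R) M N f g = (\<lambda>x\<in>carrier M. f x \<oplus>\<^bsub>N\<^esub> g x)"
  "cneg (Mod R) M N f = (\<lambda>x\<in>carrier M. \<ominus>\<^bsub>N\<^esub> f x)"
  "csum (Mod R) = mod_sum"
  "cin1 (Mod R) M N = (\<lambda>x\<in>carrier M. Pair x \<zero>\<^bsub>N\<^esub>)"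
  "cin2 (Mod R) M N = (\<lambda>y\<in>carrier N. Pair \<zero>\<^bsub>M\<^esub> y)"
  "cpr1 (Mod R) M N = (\<lambda>z\<in>carrier (mod_sum M N). pfst z)"
  "cpr2 (Mod R) M N = (\<lambda>z\<in>carrier (mod_sum M N). psnd z)"
  by (simp_all add: Mod_def)

lemma mod_hom_id: "right_module R M \<Longrightarrow> (\<lambda>x\<in>carrier M. x) \<in> mod_hom R M M"
  by (intro mod_homI) simp_all

lemma mod_hom_zero:
  "\<lbrakk>right_module R M; right_module R N\<rbrakk> \<Longrightarrow> (\<lambda>x\<in>carrier M. \<zero>\<^bsub>N\<^esub>) \<in> mod_hom R M N"
  by (intro mod_homI) simp_all

lemma mod_hom_add:
  assumes M: "right_module R M" and N: "right_module R N"
    and f: "f \<in> mod_hom R M N" and g: "g \<in> mod_hom R M N"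
  shows "(\<lambda>x\<in>carrier M. f x \<oplus>\<^bsub>N\<^esub> g x) \<in> mod_hom R M N"
  using M N by (intro mod_homI)
    (simp_all add: mod_homD[OF f] mod_homD[OF g] rm_smult_add rm_assoc[OF N] rm_left_comm[OF N])

lemma mod_hom_neg:
  assumes M: "right_module R M" and N: "right_module R N" and f: "f \<in> mod_hom R M N"
  shows "(\<lambda>x\<in>carrier M. \<ominus>\<^bsub>N\<^esub> f x) \<in> mod_hom R M N"
  using M N by (intro mod_homI) (simp_all add: mod_homD[OF f] rm_neg_add rm_smult_neg)

lemma mod_hom_injections:
  assumes M: "right_module R M" and N: "right_module R N"
  shows "(\<lambda>x\<in>carrier M. Pair x \<zero>\<^bsub>N\<^esub>) \<in> mod_hom R M (mod_sum M N)"
    "(\<lambda>y\<in>carrier N. Pair \<zero>\<^bsub>M\<^esub> y) \<in> mod_hom R N (mod_sum M N)"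
    "(\<lambda>z\<in>carrier (mod_sum M N). pfst z) \<in> mod_hom R (mod_sum M N) M"
    "(\<lambda>z\<in>carrier (mod_sum M N). psnd z) \<in> mod_hom R (mod_sum M N) N"
  using M N mod_sum_module[OF M N] by (auto intro!: mod_homI elim!: mod_sum_carrierE)

lemma Mod_additive: "additive_cat (Mod R)"
proof (unfold_locales, goal_cases)
  case (5 W X Y Z f g h)
  then show ?case
    by (intro mod_hom_eqI[of _ R W Z]) (auto intro!: mod_hom_compose simp: compose_eq mod_homD)
next
  case (3 X Y f)
  then show ?case
    by (intro mod_hom_eqI[of _ R X Y]) (auto intro!: mod_hom_compose mod_hom_id simp: compose_eq
        mod_homD)
next
  case (4 X Y f)
  then show ?case
    by (intro mod_hom_eqI[of _ R X Y]) (auto intro!: mod_hom_compose mod_hom_id simp: compose_eq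
        mod_homD)
next
  case (9 X Y f g h)
  then show ?case by (auto simp: restrict_def fun_eq_iff mod_homD rm_assoc)
next
  case (10 X Y f g)
  then show ?case by (auto simp: restrict_def fun_eq_iff mod_homD intro: rm_comm)
next
  case (11 X Y f)
  then show ?case
    by (auto simp: restrict_def fun_eq_iff mod_homD dest: PiE_arb[OF mod_homD(1)])
next
  case (12 X Y f)
  then show ?case by (auto simp: restrict_def fun_eq_iff mod_homD)
next
  case (13 X Y Z f g h)
  then show ?case by (auto simp: compose_def restrict_def fun_eq_iff mod_homD)
next
  case (14 X Y Z f g h)
  then show ?case by (auto simp: compose_def restrict_def fun_eq_iff mod_homD)
qed (auto simp: compose_def restrict_def fun_eq_iff mod_sum_module elim!: mod_sum_carrierE
    intro: mod_hom_id[unfolded restrict_def] mod_hom_compose[unfolded compose_def restrict_def]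
      mod_hom_zero[unfolded restrict_def] mod_hom_add[unfolded restrict_def]
      mod_hom_neg[unfolded restrict_def] mod_hom_injections[unfolded restrict_def])

section \<open>Projective modules\<close>

lemma projective_lift:
  fixes P M N :: "('a, 'b) mdl"
  assumes "projective_module R P" "right_module R M" "right_module R N" "g \<in> mod_hom R M N"
    "g ` carrier M = carrier N" "f \<in> mod_hom R P N"
  obtains h where "h \<in> mod_hom R P M" "compose (carrier P) g h = f"
  using assms unfolding projective_module_def by meson

text \<open>A map out of the sum is lifted on each summand separately; the two lifts, composed with
  the projections, are added.\<close>

lemma projective_sum:
  assumes P: "projective_module R P" and Q: "projective_module R Q"
  shows "projective_module R (mod_sum P Q)"
  unfolding projective_module_def
proof (intro conjI allI impI)
  have PM: "right_module R P" and QM: "right_module R Q"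
    using P Q by (simp_all add: projective_module_def)
  show S: "right_module R (mod_sum P Q)" using PM QM by (rule mod_sum_module)
  interpret A: additive_cat "Mod R :: (('a, 'b) mdl, ('a, 'b) mmap) cat" by (rule Mod_additive)
  let ?C = "Mod R :: (('a, 'b) mdl, ('a, 'b) mmap) cat"
  fix M N :: "('a, 'b) mdl" and g f
  assume "right_module R M \<and> right_module R N \<and> g \<in> mod_hom R M N \<and> g ` carrier M = carrier N \<and>
    f \<in> mod_hom R (mod_sum P Q) N"
  then have M: "right_module R M" and N: "right_module R N" and g: "g \<in> mod_hom R M N"
    and gs: "g ` carrier M = carrier N" and f: "f \<in> mod_hom R (mod_sum P Q) N" by simp_all
  note inj = mod_hom_injections[OF PM QM]
  obtain h1 where h1: "h1 \<in> mod_hom R P M" "compose (carrier P) g h1 = compose (carrier P) f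
      (cin1 ?C P Q)"
    by (rule projective_lift[OF P M N g gs, of "compose (carrier P) f (cin1 ?C P Q)"])
      (use mod_hom_compose[OF PM inj(1) f] in simp_all)
  obtain h2 where h2: "h2 \<in> mod_hom R Q M" "compose (carrier Q) g h2 = compose (carrier Q) f
      (cin2 ?C P Q)"
    by (rule projective_lift[OF Q M N g gs, of "compose (carrier Q) f (cin2 ?C P Q)"])
      (use mod_hom_compose[OF QM inj(2) f] in simp_all)
  let ?h = "cadd ?C (mod_sum P Q) M (ccomp ?C (mod_sum P Q) P M h1 (cpr1 ?C P Q))
      (ccomp ?C (mod_sum P Q) Q M h2 (cpr2 ?C P Q))"
  have h: "?h \<in> mod_hom R (mod_sum P Q) M"
    using mod_hom_add[OF S M mod_hom_compose[OF S inj(3) h1(1)] mod_hom_compose[OF S inj(4) h2(1)]]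
        by simp
  have "compose (carrier (mod_sum P Q)) g ?h = f"
  proof (rule A.from_sum_eqI[of N P Q, simplified])
    have ob: "P \<in> Ob ?C" "Q \<in> Ob ?C" "M \<in> Ob ?C" "N \<in> Ob ?C" using PM QM M N by simp_all
    have hm: "h1 \<in> Hom ?C P M" "h2 \<in> Hom ?C Q M" "g \<in> Hom ?C M N" using h1(1) h2(1) g by simp_all
    have "ccomp ?C P (csum ?C P Q) N (ccomp ?C (csum ?C P Q) M N g
       (cadd ?C (csum ?C P Q) M (ccomp ?C (csum ?C P Q) P M h1 (cpr1 ?C P Q))
      (ccomp ?C (csum ?C P Q) Q M h2 (cpr2 ?C P Q)))) (cin1 ?C P Q) = ccomp ?C P M N g h1"
      using ob hm by (simp add: A.comp_distrib del: Mod_sel)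
    then show "compose (carrier P) (compose (carrier (mod_sum P Q)) g ?h)
        (\<lambda>x\<in>carrier P. Pair x \<zero>\<^bsub>Q\<^esub>) =
        compose (carrier P) f (\<lambda>x\<in>carrier P. Pair x \<zero>\<^bsub>Q\<^esub>)"
      using h1(2) by simp
    have "ccomp ?C Q (csum ?C P Q) N (ccomp ?C (csum ?C P Q) M N g
       (cadd ?C (csum ?C P Q) M (ccomp ?C (csum ?C P Q) P M h1 (cpr1 ?C P Q))
      (ccomp ?C (csum ?C P Q) Q M h2 (cpr2 ?C P Q)))) (cin2 ?C P Q) = ccomp ?C Q M N g h2"
      using ob hm by (simp add: A.comp_distrib del: Mod_sel)
    then show "compose (carrier Q) (compose (carrier (mod_sum P Q)) g ?h)
        (\<lambda>y\<in>carrier Q. Pair \<zero>\<^bsub>P\<^esub> y) =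
        compose (carrier Q) f (\<lambda>y\<in>carrier Q. Pair \<zero>\<^bsub>P\<^esub> y)"
      using h2(2) by simp
  qed (use PM QM N f mod_hom_compose[OF S h g] in simp_all)
  with h show "\<exists>h\<in>mod_hom R (mod_sum P Q) M. compose (carrier (mod_sum P Q)) g h = f" by blast
qed

lemma Proj_additive: "additive_cat (Proj R)"
proof -
  interpret A: additive_cat "Mod R :: (('a, 'b) mdl, ('a, 'b) mmap) cat" by (rule Mod_additive)
  show "additive_cat (Proj R :: (('a, 'b) mdl, ('a, 'b) mmap) cat)"
    unfolding Proj_def by (rule A.full_sub_additive) (simp add: projective_sum)
qed

section \<open>Direct sums of copies of a module\<close>

text \<open>Stated for additive functions instead of module homomorphisms, because it is also
  applied to multiplication by a fixed scalar.\<close>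

lemma additive_finsum:
  assumes M: "right_module R M" and N: "right_module R N" and F: "finite F"
    and h: "h \<in> carrier M \<rightarrow> carrier N"
    and add: "\<And>x y. \<lbrakk>x \<in> carrier M; y \<in> carrier M\<rbrakk> \<Longrightarrow> h (x \<oplus>\<^bsub>M\<^esub> y) = h x \<oplus>\<^bsub>N\<^esub> h y"
    and g: "g \<in> F \<rightarrow> carrier M"
  shows "h (finsum M g F) = finsum N (\<lambda>i. h (g i)) F"
proof -
  interpret M: abelian_group M by (rule right_module_group[OF M])
  interpret N: abelian_group N by (rule right_module_group[OF N])
  have h0: "h \<zero>\<^bsub>M\<^esub> = \<zero>\<^bsub>N\<^esub>"
    using add[of "\<zero>\<^bsub>M\<^esub>" "\<zero>\<^bsub>M\<^esub>"] h rm_double[OF N, of "h \<zero>\<^bsub>M\<^esub>"] by (simp add: Pi_iff)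
  show ?thesis
    using F g h by (induction F) (auto simp: h0 add Pi_iff)
qed

text \<open>Direct sums in coordinates. Finite support and joint separation by the projections take
  the place of unique finite expansions; \<open>is_mod_direct_sum\<close> and
  \<open>is_mod_direct_sum_projections\<close> pass between the two descriptions.\<close>

locale module_direct_sum =
  fixes R :: "'a ring" and N :: "('a, 'm) module" and I :: "'i set"
    and \<iota> :: "'i \<Rightarrow> 'm \<Rightarrow> 'm" and \<pi> :: "'i \<Rightarrow> 'm \<Rightarrow> 'm" and M :: "('a, 'm) module"
  assumes N: "right_module R N" and M: "right_module R M"
    and iota: "i \<in> I \<Longrightarrow> \<iota> i \<in> mod_hom R N M"
    and pi: "i \<in> I \<Longrightarrow> \<pi> i \<in> mod_hom R M N"
    and pi_iota: "\<lbrakk>i \<in> I; k \<in> I; y \<in> carrier N\<rbrakk> \<Longrightarrow> \<pi> k (\<iota> i y) = (if k = i then y else \<zero>\<^bsub>N\<^esub>)"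
    and supp_finite: "x \<in> carrier M \<Longrightarrow> finite {i \<in> I. \<pi> i x \<noteq> \<zero>\<^bsub>N\<^esub>}"
    and separating: "\<lbrakk>x \<in> carrier M; \<And>i. i \<in> I \<Longrightarrow> \<pi> i x = \<zero>\<^bsub>N\<^esub>\<rbrakk> \<Longrightarrow> x = \<zero>\<^bsub>M\<^esub>"
begin

sublocale M: abelian_group M by (rule right_module_group[OF M])
sublocale N: abelian_group N by (rule right_module_group[OF N])

lemma pi_sum:
  assumes F: "finite F" "F \<subseteq> I" and t: "\<And>i. i \<in> F \<Longrightarrow> t i \<in> carrier N" and k: "k \<in> I"
  shows "\<pi> k (\<Oplus>\<^bsub>M\<^esub>i\<in>F. \<iota> i (t i)) = (if k \<in> F then t k else \<zero>\<^bsub>N\<^esub>)"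
proof -
  have "\<pi> k (\<Oplus>\<^bsub>M\<^esub>i\<in>F. \<iota> i (t i)) = (\<Oplus>\<^bsub>N\<^esub>i\<in>F. \<pi> k (\<iota> i (t i)))"
    by (rule additive_finsum[OF M N F(1)])
      (use k F t mod_homD(2,3)[OF pi[OF k]] mod_homD(2)[OF iota] in auto)
  also have "\<dots> = (\<Oplus>\<^bsub>N\<^esub>i\<in>F. if k = i then t i else \<zero>\<^bsub>N\<^esub>)"
    by (rule N.finsum_cong') (use k F t in \<open>auto simp: pi_iota\<close>)
  also have "\<dots> = (if k \<in> F then t k else \<zero>\<^bsub>N\<^esub>)"
  proof (cases "k \<in> F")
    case True
    then show ?thesis using N.finsum_singleton[of k F t] F t by simp
  next
    case False
    then have "(\<Oplus>\<^bsub>N\<^esub>i\<in>F. if k = i then t i else \<zero>\<^bsub>N\<^esub>) = (\<Oplus>\<^bsub>N\<^esub>i\<in>F. \<zero>\<^bsub>N\<^esub>)"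
      by (intro N.finsum_cong') auto
    then show ?thesis using False by simp
  qed
  finally show ?thesis .
qed

text \<open>The difference between x and the finite sum has all coordinates zero, so
  \<open>separating\<close> applies. F may be larger than the support.\<close>

lemma expansion:
  assumes x: "x \<in> carrier M" and F: "finite F" "F \<subseteq> I" and s: "\<And>i. i \<in> I - F \<Longrightarrow> \<pi> i x = \<zero>\<^bsub>N\<^esub>"
  shows "x = (\<Oplus>\<^bsub>M\<^esub>i\<in>F. \<iota> i (\<pi> i x))"
proof -
  let ?y = "\<Oplus>\<^bsub>M\<^esub>i\<in>F. \<iota> i (\<pi> i x)"
  have y: "?y \<in> carrier M"
    using F by (intro M.finsum_closed) (auto intro: mod_homD(2)[OF iota] mod_homD(2)[OF pi] x)
  have "\<pi> k (x \<oplus>\<^bsub>M\<^esub> \<ominus>\<^bsub>M\<^esub> ?y) = \<zero>\<^bsub>N\<^esub>" if k: "k \<in> I" for k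
  proof -
    have px: "\<pi> k x \<in> carrier N" by (rule mod_homD(2)[OF pi[OF k] x])
    have py: "\<pi> k ?y = \<pi> k x"
      by (subst pi_sum[OF F _ k]) (use F x s k mod_homD(2)[OF pi x] in auto)
    have "\<pi> k (\<ominus>\<^bsub>M\<^esub> ?y) = \<ominus>\<^bsub>N\<^esub> \<pi> k ?y"
    proof (rule rm_neg_unique[OF N])
      show "\<pi> k ?y \<oplus>\<^bsub>N\<^esub> \<pi> k (\<ominus>\<^bsub>M\<^esub> ?y) = \<zero>\<^bsub>N\<^esub>"
        using mod_homD(3)[OF pi[OF k] y, of "\<ominus>\<^bsub>M\<^esub> ?y"] y mod_hom_zero_apply[OF M N pi[OF k]]
        by (simp add: M.r_neg)
    qed (use y mod_homD(2)[OF pi[OF k]] in simp_all)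
    then show ?thesis using mod_homD(3)[OF pi[OF k] x, of "\<ominus>\<^bsub>M\<^esub> ?y"] y py px by (simp add: N.r_neg)
  qed
  then have "x \<oplus>\<^bsub>M\<^esub> \<ominus>\<^bsub>M\<^esub> ?y = \<zero>\<^bsub>M\<^esub>" using x y by (intro separating) simp_all
  then show ?thesis
    using x y rm_neg_unique[OF M, of "\<ominus>\<^bsub>M\<^esub> ?y" x] by (simp add: M.a_comm)
qed

lemma is_mod_direct_sum: "is_mod_direct_sum R N I \<iota> M"
  unfolding is_mod_direct_sum_def
proof (intro conjI ballI)
  fix x assume x: "x \<in> carrier M"
  let ?t = "\<lambda>i\<in>I. \<pi> i x"
  have eq: "{i \<in> I. ?t i \<noteq> \<zero>\<^bsub>N\<^esub>} = {i \<in> I. \<pi> i x \<noteq> \<zero>\<^bsub>N\<^esub>}" by auto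
  show "\<exists>!t. t \<in> I \<rightarrow>\<^sub>E carrier N \<and> finite {i \<in> I. t i \<noteq> \<zero>\<^bsub>N\<^esub>} \<and>
      x = (\<Oplus>\<^bsub>M\<^esub>i\<in>{i \<in> I. t i \<noteq> \<zero>\<^bsub>N\<^esub>}. \<iota> i (t i))"
  proof (rule ex1I[of _ ?t], intro conjI)
    show "?t \<in> I \<rightarrow>\<^sub>E carrier N" using mod_homD(2)[OF pi x] by auto
    show "finite {i \<in> I. ?t i \<noteq> \<zero>\<^bsub>N\<^esub>}" using supp_finite[OF x] eq by simp
    have "x = (\<Oplus>\<^bsub>M\<^esub>i\<in>{i \<in> I. \<pi> i x \<noteq> \<zero>\<^bsub>N\<^esub>}. \<iota> i (\<pi> i x))"
      by (rule expansion[OF x supp_finite[OF x]]) auto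
    also have "\<dots> = (\<Oplus>\<^bsub>M\<^esub>i\<in>{i \<in> I. ?t i \<noteq> \<zero>\<^bsub>N\<^esub>}. \<iota> i (?t i))"
      by (rule M.finsum_cong') (use eq mod_homD(2)[OF iota] mod_homD(2)[OF pi x] in auto)
    finally show "x = (\<Oplus>\<^bsub>M\<^esub>i\<in>{i \<in> I. ?t i \<noteq> \<zero>\<^bsub>N\<^esub>}. \<iota> i (?t i))" .
  next
    fix t assume t: "t \<in> I \<rightarrow>\<^sub>E carrier N \<and> finite {i \<in> I. t i \<noteq> \<zero>\<^bsub>N\<^esub>} \<and>
      x = (\<Oplus>\<^bsub>M\<^esub>i\<in>{i \<in> I. t i \<noteq> \<zero>\<^bsub>N\<^esub>}. \<iota> i (t i))"
    note t1 = conjunct1[OF t] and t2 = conjunct1[OF conjunct2[OF t]]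
      and t3 = conjunct2[OF conjunct2[OF t]]
    have "\<pi> k x = t k" if k: "k \<in> I" for k
      by (subst t3, subst pi_sum) (use t1 t2 k in auto)
    then show "t = ?t"
      by (intro ext) (simp add: PiE_arb[OF t1])
  qed
qed (rule iota)

lemma hom_ext:
  assumes L: "right_module R L" and f: "f \<in> mod_hom R M L" and g: "g \<in> mod_hom R M L"
    and eq: "\<And>i y. \<lbrakk>i \<in> I; y \<in> carrier N\<rbrakk> \<Longrightarrow> f (\<iota> i y) = g (\<iota> i y)"
  shows "f = g"
proof (rule mod_hom_eqI[OF f g])
  fix x assume x: "x \<in> carrier M"
  let ?F = "{i \<in> I. \<pi> i x \<noteq> \<zero>\<^bsub>N\<^esub>}"
  interpret L: abelian_group L by (rule right_module_group[OF L])
  have x': "x = (\<Oplus>\<^bsub>M\<^esub>i\<in>?F. \<iota> i (\<pi> i x))" by (rule expansion[OF x supp_finite[OF x]]) auto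
  have m: "(\<lambda>i. \<iota> i (\<pi> i x)) \<in> ?F \<rightarrow> carrier M"
    using mod_homD(2)[OF iota] mod_homD(2)[OF pi x] by auto
  have *: "h x = (\<Oplus>\<^bsub>L\<^esub>i\<in>?F. h (\<iota> i (\<pi> i x)))" if h: "h \<in> mod_hom R M L" for h
    by (subst x', rule additive_finsum[OF M L supp_finite[OF x]]) (use m mod_homD[OF h] in auto)
  show "f x = g x"
    unfolding *[OF f] *[OF g]
    by (rule L.finsum_cong') (use eq m mod_homD(2)[OF pi x] mod_homD(2)[OF g mod_homD(2)[OF iota]]
        in auto)
qed

text \<open>The universal property: the images \<phi> i (\<pi> i x) are added up over the finite
  support of x.\<close>

lemma hom_exists:
  assumes L: "right_module R L" and phi: "\<And>i. i \<in> I \<Longrightarrow> \<phi> i \<in> mod_hom R N L"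
  obtains h where "h \<in> mod_hom R M L" "\<And>i y. \<lbrakk>i \<in> I; y \<in> carrier N\<rbrakk> \<Longrightarrow> h (\<iota> i y) = \<phi> i y"
proof -
  interpret L: abelian_group L by (rule right_module_group[OF L])
  define S where "S x = {i \<in> I. \<pi> i x \<noteq> \<zero>\<^bsub>N\<^esub>}" for x
  define h where "h x = (\<Oplus>\<^bsub>L\<^esub>i\<in>S x. \<phi> i (\<pi> i x))" for x
  have S: "finite (S x)" "S x \<subseteq> I" if "x \<in> carrier M" for x
    using supp_finite[OF that] by (auto simp: S_def)
  have mem: "\<phi> i (\<pi> i x) \<in> carrier L" if "i \<in> I" "x \<in> carrier M" for i x
    using that mod_homD(2)[OF phi] mod_homD(2)[OF pi] by blast
  \<comment> \<open>The sum may run over any finite set containing the support, so that x, y and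
    their sum can be compared over a common index set.\<close>
  have sup: "h x = (\<Oplus>\<^bsub>L\<^esub>i\<in>F. \<phi> i (\<pi> i x))" if x: "x \<in> carrier M" and F: "finite F" "F \<subseteq> I" "S x \<subseteq> F"
      for x F
    unfolding h_def
    by (rule L.add.finprod_mono_neutral_cong_left)
      (use x F mem mod_hom_zero_apply[OF N L phi] in \<open>auto simp: S_def\<close>)
  have "restrict h (carrier M) \<in> mod_hom R M L"
  proof (rule mod_homI[OF _ _ _ M])
    show "h x \<in> carrier L" if "x \<in> carrier M" for x
      unfolding h_def using mem[OF _ that] S[OF that] by (intro L.finsum_closed) auto
    show "h (x \<oplus>\<^bsub>M\<^esub> y) = h x \<oplus>\<^bsub>L\<^esub> h y" if x: "x \<in> carrier M" and y: "y \<in> carrier M" for x y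
    proof -
      have sub: "S (x \<oplus>\<^bsub>M\<^esub> y) \<subseteq> S x \<union> S y"
        using mod_homD(3)[OF pi x y] by (auto simp: S_def)
      have "h (x \<oplus>\<^bsub>M\<^esub> y) = (\<Oplus>\<^bsub>L\<^esub>i\<in>S x \<union> S y. \<phi> i (\<pi> i (x \<oplus>\<^bsub>M\<^esub> y)))"
        by (rule sup) (use x y S sub in auto)
      also have "\<dots> = (\<Oplus>\<^bsub>L\<^esub>i\<in>S x \<union> S y. \<phi> i (\<pi> i x) \<oplus>\<^bsub>L\<^esub> \<phi> i (\<pi> i y))"
        by (rule L.finsum_cong')
          (use x y S mem mod_homD(3)[OF pi] mod_homD(2)[OF pi] mod_homD(3)[OF phi] in \<open>auto
              simp: subset_iff\<close>)
      also have "\<dots> = h x \<oplus>\<^bsub>L\<^esub> h y"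
        unfolding sup[OF x, of "S x \<union> S y"] using x y S mem
        by (subst L.finsum_addf) (auto intro!: arg_cong2[where f = "add L"] sup[symmetric]
            simp: subset_iff)
      finally show ?thesis .
    qed
    show "h (a \<odot>\<^bsub>M\<^esub> x) = a \<odot>\<^bsub>L\<^esub> h x" if a: "a \<in> carrier R" and x: "x \<in> carrier M" for a x
    proof -
      have sub: "S (a \<odot>\<^bsub>M\<^esub> x) \<subseteq> S x"
        using a x mod_homD(4)[OF pi a x] N by (auto simp: S_def)
      have "h (a \<odot>\<^bsub>M\<^esub> x) = (\<Oplus>\<^bsub>L\<^esub>i\<in>S x. \<phi> i (\<pi> i (a \<odot>\<^bsub>M\<^esub> x)))"
        by (rule sup) (use a x S sub M in auto)
      also have "\<dots> = (\<Oplus>\<^bsub>L\<^esub>i\<in>S x. a \<odot>\<^bsub>L\<^esub> \<phi> i (\<pi> i x))"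
        by (rule L.finsum_cong')
          (use a x S mem L mod_homD(4)[OF pi a x] mod_homD(2)[OF pi x] mod_homD(4)[OF phi a]
              in \<open>auto simp: subset_iff\<close>)
      also have "\<dots> = a \<odot>\<^bsub>L\<^esub> h x"
        unfolding h_def
        by (rule additive_finsum[OF L L, symmetric])
          (use a x S mem L in \<open>auto simp: rm_smult_add[OF L] subset_iff\<close>)
      finally show ?thesis .
    qed
  qed
  moreover have "restrict h (carrier M) (\<iota> i y) = \<phi> i y" if i: "i \<in> I" and y: "y \<in> carrier N"
      for i y
  proof -
    have iy: "\<iota> i y \<in> carrier M" by (rule mod_homD(2)[OF iota[OF i] y])
    have "h (\<iota> i y) = (\<Oplus>\<^bsub>L\<^esub>k\<in>{i}. \<phi> k (\<pi> k (\<iota> i y)))"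
      by (rule sup) (use i y iy in \<open>auto simp: S_def pi_iota split: if_splits\<close>)
    also have "\<dots> = \<phi> i y" using i y mem[OF i iy] mod_homD(2)[OF phi] by (simp add: pi_iota)
    finally show ?thesis using iy by simp
  qed
  ultimately show ?thesis by (rule that)
qed

text \<open>Smallness of finitely generated modules: the images of finitely many generators have
  only finitely many nonzero coordinates between them, and all other coordinates vanish on the whole
  image.\<close>

lemma finite_support:
  assumes P: "right_module R P" and f: "f \<in> mod_hom R P M"
    and B: "finite B" "B \<subseteq> carrier P"
    and gen: "\<And>x. x \<in> carrier P \<Longrightarrow> \<exists>c \<in> B \<rightarrow> carrier R. x = (\<Oplus>\<^bsub>P\<^esub>b\<in>B. c b \<odot>\<^bsub>P\<^esub> b)"
  obtains F where "finite F" "F \<subseteq> I" "\<And>x i. \<lbrakk>x \<in> carrier P; i \<in> I - F\<rbrakk> \<Longrightarrow> \<pi> i (f x) = \<zero>\<^bsub>N\<^esub>"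
proof -
  define F where "F = (\<Union>b\<in>B. {i \<in> I. \<pi> i (f b) \<noteq> \<zero>\<^bsub>N\<^esub>})"
  have "\<pi> i (f x) = \<zero>\<^bsub>N\<^esub>" if x: "x \<in> carrier P" and i: "i \<in> I - F" for x i
  proof -
    obtain c where c: "c \<in> B \<rightarrow> carrier R" and xc: "x = (\<Oplus>\<^bsub>P\<^esub>b\<in>B. c b \<odot>\<^bsub>P\<^esub> b)" using gen[OF x]
        by blast
    have z: "\<pi> i (f b) = \<zero>\<^bsub>N\<^esub>" if "b \<in> B" for b using that i by (auto simp: F_def)
    have i': "i \<in> I" using i by simp
    have "\<pi> i (f x) = (\<Oplus>\<^bsub>N\<^esub>b\<in>B. \<pi> i (f (c b \<odot>\<^bsub>P\<^esub> b)))"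
      unfolding xc
      by (rule additive_finsum[OF P N B(1), of "\<lambda>x. \<pi> i (f x)"])
        (use P B c mod_homD[OF f] mod_homD[OF pi[OF i']] in \<open>auto simp: Pi_iff subset_iff\<close>)
    also have "\<dots> = (\<Oplus>\<^bsub>N\<^esub>b\<in>B. \<zero>\<^bsub>N\<^esub>)"
    proof (rule N.finsum_cong')
      fix b assume b: "b \<in> B"
      then have m: "c b \<in> carrier R" "b \<in> carrier P" "f b \<in> carrier M"
        using c B mod_homD(2)[OF f] by auto
      show "\<pi> i (f (c b \<odot>\<^bsub>P\<^esub> b)) = \<zero>\<^bsub>N\<^esub>"
        using z[OF b] m mod_homD(4)[OF f, of "c b" b] mod_homD(4)[OF pi[OF i'], of "c b" "f b"] N
            by simp
    qed auto
    finally show ?thesis by simp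
  qed
  moreover have "finite F" "F \<subseteq> I"
    using B supp_finite[OF mod_homD(2)[OF f]] by (auto simp: F_def)
  ultimately show ?thesis by (intro that) auto
qed

end

text \<open>The coordinates of x are the coefficients of its unique expansion. Sums and scalar
  multiples of expansions are expansions again, so uniqueness makes the coordinates linear.\<close>

lemma is_mod_direct_sum_projections:
  assumes N: "right_module R N" and M: "right_module R M" and ds: "is_mod_direct_sum R N I \<iota> M"
  obtains \<pi> where "module_direct_sum R N I \<iota> \<pi> M"
proof -
  interpret M: abelian_group M by (rule right_module_group[OF M])
  interpret N: abelian_group N by (rule right_module_group[OF N])
  have iota: "\<iota> i \<in> mod_hom R N M" if "i \<in> I" for i using ds that
      by (simp add: is_mod_direct_sum_def)
  have iota_in: "\<iota> i y \<in> carrier M" if "i \<in> I" "y \<in> carrier N" for i y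
    using mod_homD(2)[OF iota[OF that(1)] that(2)] .
  define Q where "Q x t \<longleftrightarrow> t \<in> I \<rightarrow>\<^sub>E carrier N \<and> finite {i \<in> I. t i \<noteq> \<zero>\<^bsub>N\<^esub>} \<and>
      x = (\<Oplus>\<^bsub>M\<^esub>i\<in>{i \<in> I. t i \<noteq> \<zero>\<^bsub>N\<^esub>}. \<iota> i (t i))" for x t
  have ex1: "\<exists>!t. Q x t" if "x \<in> carrier M" for x
    using ds that by (simp add: is_mod_direct_sum_def Q_def)
  define c where "c x = (THE t. Q x t)" for x
  have Q: "Q x (c x)" if "x \<in> carrier M" for x unfolding c_def by (rule theI'[OF ex1[OF that]])
  have c_in: "c x i \<in> carrier N" if "x \<in> carrier M" "i \<in> I" for x i
    using Q[OF that(1)] that(2) by (auto simp: Q_def)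
  define S where "S x = {i \<in> I. c x i \<noteq> \<zero>\<^bsub>N\<^esub>}" for x
  have S: "finite (S x)" "S x \<subseteq> I" if "x \<in> carrier M" for x using Q[OF that]
      by (auto simp: Q_def S_def)
  have sup: "(\<Oplus>\<^bsub>M\<^esub>i\<in>{i \<in> I. t i \<noteq> \<zero>\<^bsub>N\<^esub>}. \<iota> i (t i)) = (\<Oplus>\<^bsub>M\<^esub>i\<in>F. \<iota> i (t i))"
    if "finite F" "F \<subseteq> I" "\<And>i. i \<in> I \<Longrightarrow> t i \<in> carrier N" "\<And>i. i \<in> I - F \<Longrightarrow> t i = \<zero>\<^bsub>N\<^esub>" for t F
    by (rule M.add.finprod_mono_neutral_cong_left)
      (use that iota_in mod_hom_zero_apply[OF N M iota] in auto)
  have exp: "x = (\<Oplus>\<^bsub>M\<^esub>i\<in>F. \<iota> i (c x i))" if x: "x \<in> carrier M" and F: "finite F" "F \<subseteq> I" "S x \<subseteq> F"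
      for x F
  proof -
    have "x = (\<Oplus>\<^bsub>M\<^esub>i\<in>{i \<in> I. c x i \<noteq> \<zero>\<^bsub>N\<^esub>}. \<iota> i (c x i))" using Q[OF x] by (simp add: Q_def)
    also have "\<dots> = (\<Oplus>\<^bsub>M\<^esub>i\<in>F. \<iota> i (c x i))"
      by (rule sup) (use F c_in[OF x] in \<open>auto simp: S_def\<close>)
    finally show ?thesis .
  qed
  \<comment> \<open>Uniqueness for expansions over any finite F, with zero coefficients allowed; the
    definition speaks only of sums over the exact support.\<close>
  have uniq: "c x k = t k" if x: "x \<in> carrier M" and F: "finite F" "F \<subseteq> I"
    and t: "\<And>i. i \<in> I \<Longrightarrow> t i \<in> carrier N" "\<And>i. i \<in> I - F \<Longrightarrow> t i = \<zero>\<^bsub>N\<^esub>"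
    and xt: "x = (\<Oplus>\<^bsub>M\<^esub>i\<in>F. \<iota> i (t i))" and k: "k \<in> I" for x t F k
  proof -
    have "{i \<in> I. t i \<noteq> \<zero>\<^bsub>N\<^esub>} \<subseteq> F" using t(2) by auto
    then have fin: "finite {i \<in> I. t i \<noteq> \<zero>\<^bsub>N\<^esub>}" using F finite_subset by blast
    have eq: "{i \<in> I. restrict t I i \<noteq> \<zero>\<^bsub>N\<^esub>} = {i \<in> I. t i \<noteq> \<zero>\<^bsub>N\<^esub>}" by auto
    have "x = (\<Oplus>\<^bsub>M\<^esub>i\<in>{i \<in> I. t i \<noteq> \<zero>\<^bsub>N\<^esub>}. \<iota> i (t i))" using sup[OF F t] xt by simp
    also have "\<dots> = (\<Oplus>\<^bsub>M\<^esub>i\<in>{i \<in> I. t i \<noteq> \<zero>\<^bsub>N\<^esub>}. \<iota> i (restrict t I i))"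
      by (rule M.finsum_cong') (use t(1) iota_in in auto)
    finally have "Q x (restrict t I)" unfolding Q_def eq using fin t(1) by auto
    then have "c x = restrict t I" using ex1[OF x] Q[OF x] by blast
    then show ?thesis using k by simp
  qed
  define \<pi> where "\<pi> i = (\<lambda>x\<in>carrier M. c x i)" for i
  have "module_direct_sum R N I \<iota> \<pi> M"
  proof
    show "right_module R N" "right_module R M" by (fact N M)+
    show "\<iota> i \<in> mod_hom R N M" if "i \<in> I" for i using that by (rule iota)
    show "\<pi> i \<in> mod_hom R M N" if i: "i \<in> I" for i
      unfolding \<pi>_def
    proof (rule mod_homI[OF _ _ _ M])
      show "c x i \<in> carrier N" if "x \<in> carrier M" for x using that i by (rule c_in)
      show "c (x \<oplus>\<^bsub>M\<^esub> y) i = c x i \<oplus>\<^bsub>N\<^esub> c y i" if x: "x \<in> carrier M" and y: "y \<in> carrier M" for x y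
      proof (rule uniq[OF _ _ _ _ _ _ i, where F = "S x \<union> S y"])
        have "x \<oplus>\<^bsub>M\<^esub> y = (\<Oplus>\<^bsub>M\<^esub>i\<in>S x \<union> S y. \<iota> i (c x i)) \<oplus>\<^bsub>M\<^esub> (\<Oplus>\<^bsub>M\<^esub>i\<in>S x \<union> S y. \<iota> i (c y i))"
          using exp[OF x, of "S x \<union> S y"] exp[OF y, of "S x \<union> S y"] S[OF x] S[OF y] by auto
        also have "\<dots> = (\<Oplus>\<^bsub>M\<^esub>i\<in>S x \<union> S y. \<iota> i (c x i) \<oplus>\<^bsub>M\<^esub> \<iota> i (c y i))"
          by (rule M.finsum_addf[symmetric]) (use S[OF x] S[OF y] iota_in c_in x y in auto)
        also have "\<dots> = (\<Oplus>\<^bsub>M\<^esub>i\<in>S x \<union> S y. \<iota> i (c x i \<oplus>\<^bsub>N\<^esub> c y i))"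
          by (rule M.finsum_cong') (use S[OF x] S[OF y] iota_in c_in x y mod_homD(3)[OF iota]
              in \<open>auto simp: subset_iff\<close>)
        finally show "x \<oplus>\<^bsub>M\<^esub> y = (\<Oplus>\<^bsub>M\<^esub>i\<in>S x \<union> S y. \<iota> i (c x i \<oplus>\<^bsub>N\<^esub> c y i))" .
      qed (use x y S[OF x] S[OF y] c_in in \<open>auto simp: S_def\<close>)
      show "c (a \<odot>\<^bsub>M\<^esub> x) i = a \<odot>\<^bsub>N\<^esub> c x i" if a: "a \<in> carrier R" and x: "x \<in> carrier M" for a x
      proof (rule uniq[OF _ _ _ _ _ _ i, where F = "S x"])
        have "a \<odot>\<^bsub>M\<^esub> x = a \<odot>\<^bsub>M\<^esub> (\<Oplus>\<^bsub>M\<^esub>i\<in>S x. \<iota> i (c x i))"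
          using exp[OF x, of "S x"] S[OF x] by simp
        also have "\<dots> = (\<Oplus>\<^bsub>M\<^esub>i\<in>S x. a \<odot>\<^bsub>M\<^esub> \<iota> i (c x i))"
          by (rule additive_finsum[OF M M])
            (use a S[OF x] iota_in c_in x M in \<open>auto simp: rm_smult_add[OF M]\<close>)
        also have "\<dots> = (\<Oplus>\<^bsub>M\<^esub>i\<in>S x. \<iota> i (a \<odot>\<^bsub>N\<^esub> c x i))"
          by (rule M.finsum_cong') (use a N M S[OF x] iota_in c_in x mod_homD(4)[OF iota] in \<open>auto
              simp: subset_iff\<close>)
        finally show "a \<odot>\<^bsub>M\<^esub> x = (\<Oplus>\<^bsub>M\<^esub>i\<in>S x. \<iota> i (a \<odot>\<^bsub>N\<^esub> c x i))" .
      qed (use a x M N S[OF x] c_in in \<open>auto simp: S_def\<close>)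
    qed
    show "\<pi> k (\<iota> i y) = (if k = i then y else \<zero>\<^bsub>N\<^esub>)"
        if i: "i \<in> I" and k: "k \<in> I" and y: "y \<in> carrier N" for i k y
    proof -
      have "c (\<iota> i y) k = (if k = i then y else \<zero>\<^bsub>N\<^esub>)"
        by (rule uniq[where F = "{i}"]) (use i k y iota_in N in auto)
      then show ?thesis using iota_in[OF i y] by (simp add: \<pi>_def)
    qed
    show "finite {i \<in> I. \<pi> i x \<noteq> \<zero>\<^bsub>N\<^esub>}" if "x \<in> carrier M" for x
      using S[OF that] that by (simp add: \<pi>_def S_def)
    show "x = \<zero>\<^bsub>M\<^esub>" if x: "x \<in> carrier M" and z: "\<And>i. i \<in> I \<Longrightarrow> \<pi> i x = \<zero>\<^bsub>N\<^esub>" for x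
      using exp[OF x, of "{}"] x z by (auto simp: \<pi>_def S_def)
  qed
  then show ?thesis by (rule that)
qed

section \<open>Orthogonality in the homotopy category\<close>

text \<open>Shifts without a sign on the differential compose strictly. The maps \<open>(-1)\<^sup>i\<close>
  identify them with the usual shifts.\<close>

definition ushift :: "int \<Rightarrow> ('o, 'm) cplx \<Rightarrow> ('o, 'm) cplx" where
  "ushift m X = Cplx (\<lambda>i. trm X (i+m)) (\<lambda>i. dif X (i+m))"

definition negc :: "('o, 'm) cat \<Rightarrow> ('o, 'm) cplx \<Rightarrow> ('o, 'm) cplx" where
  "negc C X = Cplx (trm X) (\<lambda>i. cneg C (trm X i) (trm X (i+1)) (dif X i))"

definition sgn_id :: "('o, 'm) cat \<Rightarrow> ('o, 'm) cplx \<Rightarrow> int \<Rightarrow> 'm" where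
  "sgn_id C X = (\<lambda>i. cat_sgn C (trm X i) (trm X i) i (cid C (trm X i)))"

definition K_orth :: "('o, 'm) cat \<Rightarrow> ('o, 'm) cplx \<Rightarrow> ('o, 'm) cplx \<Rightarrow> bool" where
  "K_orth C P Q \<longleftrightarrow> (\<forall>f \<in> Hom (Cx C) P Q. null_homotopic C P Q f)"

lemma ushift_sel [simp]: "trm (ushift m X) i = trm X (i+m)" "dif (ushift m X) i = dif X (i+m)"
  by (simp_all add: ushift_def)

lemma negc_sel [simp]: "trm (negc C X) i = trm X i"
  "dif (negc C X) i = cneg C (trm X i) (trm X (i+1)) (dif X i)"
  by (simp_all add: negc_def)

lemma ushift_ushift [simp]: "ushift m (ushift n X) = ushift (m+n) X"
  by (simp add: ushift_def add.assoc)

lemma ushift_0 [simp]: "ushift 0 X = X"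
  by (simp add: ushift_def)

text \<open>Moves a shift next to the index variable, giving i + m + 1. The uses instantiate m so
  that the rewriting stays directed.\<close>

lemma int_shift1: "i + 1 + m = i + m + (1::int)" "i + 2 + m = i + m + (2::int)"
  "i - 1 + m = i + m - (1::int)"
  by simp_all

lemma shift1_negc: "shift C 1 X = negc C (ushift 1 X)"
  by (simp add: shift_def negc_def cat_sgn_def ushift_def)

lemma shift_cases: "shift C k X = (if even k then ushift k X else negc C (ushift k X))"
  by (auto simp: shift_def negc_def cat_sgn_def ushift_def int_shift1[of _ k])

context additive_cat
begin

interpretation Cx: additive_cat "Cx C"
  by (rule Cx_additive)

interpretation K: additive_ideal "Cx C" "null_homotopic C"
  by (rule null_homotopic_ideal)

section \<open>Isomorphisms, unsigned shifts and orthogonality\<close>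

lemma isomorphic_trans:
  assumes "X \<in> Ob C" "Y \<in> Ob C" "Z \<in> Ob C" "isomorphic C X Y" "isomorphic C Y Z"
  shows "isomorphic C X Z"
  using assms cat_iso_comp unfolding isomorphic_def by blast

lemma isomorphic_sym: "isomorphic C X Y \<Longrightarrow> isomorphic C Y X"
  unfolding isomorphic_def cat_iso_def by blast

lemma isomorphic_refl: "X \<in> Ob C \<Longrightarrow> isomorphic C X X"
  unfolding isomorphic_def by (intro exI[of _ "cid C X"] cat_isoI[of _ _ _ "cid C X"]) simp_all

lemma isomorphic_csum:
  assumes ob: "X \<in> Ob C" "Y \<in> Ob C" "X' \<in> Ob C" "Y' \<in> Ob C"
    and iso: "isomorphic C X X'" "isomorphic C Y Y'"
  shows "isomorphic C (csum C X Y) (csum C X' Y')"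
proof -
  obtain f f' where f: "f \<in> Hom C X X'" "f' \<in> Hom C X' X" "ccomp C X X' X f' f = cid C X"
    "ccomp C X' X X' f f' = cid C X'" using iso(1) unfolding isomorphic_def cat_iso_def by blast
  obtain g g' where g: "g \<in> Hom C Y Y'" "g' \<in> Hom C Y' Y" "ccomp C Y Y' Y g' g = cid C Y"
    "ccomp C Y' Y Y' g g' = cid C Y'" using iso(2) unfolding isomorphic_def cat_iso_def by blast
  have "cat_iso C (csum C X Y) (csum C X' Y') (cmat C X Y X' Y' f (czero C Y X') (czero C X Y') g)"
    by (rule cat_isoI[of _ _ _ "cmat C X' Y' X Y f' (czero C Y' X) (czero C X' Y) g'"])
      (use ob f g in \<open>simp_all add: cmat_comp\<close>)
  then show ?thesis unfolding isomorphic_def by blast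
qed

lemma ushift_Ob [simp]:
  assumes X: "X \<in> Ob (Cx C)"
  shows "ushift m X \<in> Ob (Cx C)"
  using X by (simp add: Cx_Ob[of "ushift m X"] int_shift1[of _ m])

lemma ushift_Hom: "f \<in> Hom (Cx C) X Y \<Longrightarrow> (\<lambda>i. f (i+m)) \<in> Hom (Cx C) (ushift m X) (ushift m Y)"
  by (simp add: Cx_Hom int_shift1[of _ m])

lemma ushift_boundary: "boundary C (ushift m X) (ushift m Y) (\<lambda>i. h (i+m))
    = (\<lambda>i. boundary C X Y h (i+m))"
  by (simp add: boundary_def int_shift1[of _ m])

lemma null_homotopic_ushift:
  "null_homotopic C X Y f \<Longrightarrow> null_homotopic C (ushift m X) (ushift m Y) (\<lambda>i. f (i+m))"
  by (elim null_homotopicE)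
    (auto simp: int_shift1[of _ m] intro!: null_homotopicI[OF _ ushift_boundary[symmetric]])

lemma K_orth_ushift:
  assumes o: "K_orth C X Y"
  shows "K_orth C (ushift m X) (ushift m Y)"
  unfolding K_orth_def
proof
  fix f assume "f \<in> Hom (Cx C) (ushift m X) (ushift m Y)"
  from ushift_Hom[OF this, of "-m"] have "null_homotopic C X Y (\<lambda>i. f (i + -m))"
    using o by (simp add: K_orth_def)
  from null_homotopic_ushift[OF this, of m] show "null_homotopic C (ushift m X) (ushift m Y) f"
    by simp
qed

lemma isomorphic_K_E:
  assumes ob: "X \<in> Ob (Cx C)" "Y \<in> Ob (Cx C)" and iso: "isomorphic (K_cat C) X Y"
  obtains a b where "a \<in> Hom (Cx C) X Y" "b \<in> Hom (Cx C) Y X"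
    "null_homotopic C X X (cadd (Cx C) X X (ccomp (Cx C) X Y X b a)
        (cneg (Cx C) X X (cid (Cx C) X)))"
    "null_homotopic C Y Y (cadd (Cx C) Y Y (ccomp (Cx C) Y X Y a b)
        (cneg (Cx C) Y Y (cid (Cx C) Y)))"
proof -
  obtain F G where F: "F \<in> Hom K.Q X Y" and G: "G \<in> Hom K.Q Y X"
    and e: "ccomp K.Q X Y X G F = cid K.Q X" "ccomp K.Q Y X Y F G = cid K.Q Y"
    using iso unfolding isomorphic_def cat_iso_def K_cat_def by blast
  obtain a where a: "a \<in> Hom (Cx C) X Y" "F = K.cls X Y a" using F by (rule K.quot_HomE)
  obtain b where b: "b \<in> Hom (Cx C) Y X" "G = K.cls Y X b" using G by (rule K.quot_HomE)
  show ?thesis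
    by (rule that[OF a(1) b(1)])
      (use e ob a b in \<open>simp_all add: K.quot_ccomp K.quot_cid K.cls_eq_iff\<close>)
qed

lemma isomorphic_K_I:
  assumes "X \<in> Ob (Cx C)" "Y \<in> Ob (Cx C)" "f \<in> Hom (Cx C) X Y" "g \<in> Hom (Cx C) Y X"
    "null_homotopic C X X (cadd (Cx C) X X (ccomp (Cx C) X Y X g f)
        (cneg (Cx C) X X (cid (Cx C) X)))"
    "null_homotopic C Y Y (cadd (Cx C) Y Y (ccomp (Cx C) Y X Y f g)
        (cneg (Cx C) Y Y (cid (Cx C) Y)))"
  shows "isomorphic (K_cat C) X Y"
  unfolding K_cat_def isomorphic_def using K.cat_iso_quotI[OF assms] by blast

text \<open>Up to homotopy f equals b'(b f a')a, and the middle factor is a map between the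
  orthogonal objects X' and Y'.\<close>

lemma K_orth_iso:
  assumes ob: "X \<in> Ob (Cx C)" "Y \<in> Ob (Cx C)" "X' \<in> Ob (Cx C)" "Y' \<in> Ob (Cx C)"
    and iso: "isomorphic (K_cat C) X X'" "isomorphic (K_cat C) Y Y'" and o: "K_orth C X' Y'"
  shows "K_orth C X Y"
  unfolding K_orth_def
proof
  fix f assume f: "f \<in> Hom (Cx C) X Y"
  obtain a a' where a: "a \<in> Hom (Cx C) X X'" "a' \<in> Hom (Cx C) X' X"
    "null_homotopic C X X (cadd (Cx C) X X (ccomp (Cx C) X X' X a' a)
        (cneg (Cx C) X X (cid (Cx C) X)))"
    using isomorphic_K_E[OF ob(1,3) iso(1)] by metis
  obtain b b' where b: "b \<in> Hom (Cx C) Y Y'" "b' \<in> Hom (Cx C) Y' Y"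
    "null_homotopic C Y Y (cadd (Cx C) Y Y (ccomp (Cx C) Y Y' Y b' b)
        (cneg (Cx C) Y Y (cid (Cx C) Y)))"
    using isomorphic_K_E[OF ob(2,4) iso(2)] by metis
  have ea: "K.cls X X (ccomp (Cx C) X X' X a' a) = K.cls X X (cid (Cx C) X)"
    using a ob by (simp add: K.cls_eq_iff)
  have eb: "K.cls Y Y (ccomp (Cx C) Y Y' Y b' b) = K.cls Y Y (cid (Cx C) Y)"
    using b ob by (simp add: K.cls_eq_iff)
  let ?g = "ccomp (Cx C) X' Y Y' b (ccomp (Cx C) X' X Y f a')"
  have g: "?g \<in> Hom (Cx C) X' Y'" using ob f a b by simp
  then have "null_homotopic C X' Y' ?g" using o by (simp add: K_orth_def)
  then have "null_homotopic C X Y (ccomp (Cx C) X Y' Y b' (ccomp (Cx C) X X' Y' ?g a))"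
    using ob a(1) b(2) g by (intro K.N_comp_left[of X Y'] K.N_comp_right[of X X']) simp_all
  then have "K.cls X Y (ccomp (Cx C) X Y' Y b' (ccomp (Cx C) X X' Y' ?g a)) = K.cls X Y
      (czero (Cx C) X Y)"
    using ob a(1) b(2) g by (simp add: K.cls_eq_iff)
  moreover have "ccomp (Cx C) X Y' Y b' (ccomp (Cx C) X X' Y' ?g a)
    = ccomp (Cx C) X Y Y (ccomp (Cx C) Y Y' Y b' b)
        (ccomp (Cx C) X X Y f (ccomp (Cx C) X X' X a' a))"
    using ob f a(1,2) b(1,2) by (simp add: Cx.comp_assoc)
  moreover have "K.cls X Y \<dots> = K.cls X Y f"
  proof -
    have "K.cls X Y (ccomp (Cx C) X Y Y (ccomp (Cx C) Y Y' Y b' b)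
        (ccomp (Cx C) X X Y f (ccomp (Cx C) X X' X a' a)))
      = ccomp K.Q X Y Y (K.cls Y Y (ccomp (Cx C) Y Y' Y b' b))
          (ccomp K.Q X X Y (K.cls X Y f) (K.cls X X (ccomp (Cx C) X X' X a' a)))"
      using ob f a(1,2) b(1,2) by (simp add: K.quot_ccomp)
    then show ?thesis unfolding ea eb using ob f by (simp add: K.quot_ccomp)
  qed
  ultimately have "K.cls X Y f = K.cls X Y (czero (Cx C) X Y)" by simp
  then show "null_homotopic C X Y f" using ob f by (simp add: K.cls_eq_iff)
qed

lemma negc_Ob [simp]: "X \<in> Ob (Cx C) \<Longrightarrow> negc C X \<in> Ob (Cx C)"
  by (simp add: Cx_Ob[of "negc C X"])

lemma sgn_id_in: "X \<in> Ob (Cx C) \<Longrightarrow> sgn_id C X \<in> Hom (Cx C) X (negc C X)"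
  "X \<in> Ob (Cx C) \<Longrightarrow> sgn_id C X \<in> Hom (Cx C) (negc C X) X"
  by (simp_all add: Cx_Hom sgn_id_def)

text \<open>The sign maps are inverse to each other already as chain maps, so the homotopies
  required in the homotopy category are zero.\<close>

lemma isomorphic_negc:
  assumes X: "X \<in> Ob (Cx C)"
  shows "isomorphic (K_cat C) (negc C X) X"
proof (rule isomorphic_K_I[OF negc_Ob[OF X] X sgn_id_in(2)[OF X] sgn_id_in(1)[OF X]])
  have "ccomp (Cx C) (negc C X) X (negc C X) (sgn_id C X) (sgn_id C X) = cid (Cx C) (negc C X)"
    "ccomp (Cx C) X (negc C X) X (sgn_id C X) (sgn_id C X) = cid (Cx C) X"
    using X by (simp_all add: Cx_ops sgn_id_def)
  then show "null_homotopic C (negc C X) (negc C X) (cadd (Cx C) (negc C X) (negc C X)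
      (ccomp (Cx C) (negc C X) X (negc C X) (sgn_id C X) (sgn_id C X))
          (cneg (Cx C) (negc C X) (negc C X) (cid (Cx C) (negc C X))))"
    "null_homotopic C X X (cadd (Cx C) X X (ccomp (Cx C) X (negc C X) X (sgn_id C X) (sgn_id C X))
        (cneg (Cx C) X X (cid (Cx C) X)))"
    using X by (simp_all add: K.N_zero)
qed

lemma isomorphic_ushift:
  assumes ob: "X \<in> Ob (Cx C)" "Y \<in> Ob (Cx C)" and iso: "isomorphic (K_cat C) X Y"
  shows "isomorphic (K_cat C) (ushift m X) (ushift m Y)"
proof -
  obtain a b where a: "a \<in> Hom (Cx C) X Y" and b: "b \<in> Hom (Cx C) Y X"
    and n: "null_homotopic C X X (cadd (Cx C) X X (ccomp (Cx C) X Y X b a)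
        (cneg (Cx C) X X (cid (Cx C) X)))"
    "null_homotopic C Y Y (cadd (Cx C) Y Y (ccomp (Cx C) Y X Y a b)
        (cneg (Cx C) Y Y (cid (Cx C) Y)))"
    using isomorphic_K_E[OF ob iso] by metis
  show ?thesis
    by (rule isomorphic_K_I[OF _ _ ushift_Hom[OF a] ushift_Hom[OF b]])
      (use ob null_homotopic_ushift[OF n(1), of m] null_homotopic_ushift[OF n(2), of m] in \<open>simp_all
          add: Cx_ops\<close>)
qed

end

section \<open>Sums of copies of a tilting complex\<close>

text \<open>A full subcategory restricts the admissible terms only; chain maps, homotopies and
  shifts are given by the same formulas. Hence a Hom-set in the homotopy category of finitely
  generated projectives may be computed among all projectives.\<close>

lemma Cx_full_sub [simp]:
  fixes A :: "('o, 'm) cat"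
  shows "Hom (Cx (full_sub A S)) = Hom (Cx A)" "cadd (Cx (full_sub A S)) = cadd (Cx A)"
    "cneg (Cx (full_sub A S)) = cneg (Cx A)" "czero (Cx (full_sub A S)) = czero (Cx A)"
    "null_homotopic (full_sub A S) = null_homotopic A" "shift (full_sub A S) = shift A"
  by (simp_all add: Cx_def null_homotopic_def fun_eq_iff shift_def cat_sgn_def)

lemma mk_tricat_sel [simp]:
  "Ob (mk_tricat C S s St) = Ob C" "Hom (mk_tricat C S s St) = Hom C" "cid (mk_tricat C S s St)
      = cid C"
  "ccomp (mk_tricat C S s St) = ccomp C" "czero (mk_tricat C S s St) = czero C"
  "cadd (mk_tricat C S s St) = cadd C" "cneg (mk_tricat C S s St) = cneg C"
  "csum (mk_tricat C S s St) = csum C"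
  "Sus (mk_tricat C S s St) = S" "SusM (mk_tricat C S s St) = s"
  by (simp_all add: mk_tricat_def cat.extend_def)

locale tilting =
  fixes R :: "'a ring" and T :: "('a, 'b) mcplx"
  assumes tilting: "tilting_complex R T"
begin

abbreviation A :: "(('a, 'b) mdl, ('a, 'b) mmap) cat" where "A \<equiv> Proj R"

sublocale A: additive_cat A by (rule Proj_additive)

lemma A_Ob: "X \<in> Ob A \<longleftrightarrow> projective_module R X"
  by (auto simp: Proj_def projective_module_def)

lemma A_sel: "Hom A = mod_hom R" "ccomp A L M N g f = compose (carrier L) g f"
  "cadd A M N f g = (\<lambda>x\<in>carrier M. f x \<oplus>\<^bsub>N\<^esub> g x)" "cneg A M N f = (\<lambda>x\<in>carrier M. \<ominus>\<^bsub>N\<^esub> f x)"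
  "csum A = mod_sum" "cid A M = (\<lambda>x\<in>carrier M. x)" "czero A M N = (\<lambda>x\<in>carrier M. \<zero>\<^bsub>N\<^esub>)"
  "cin1 A M N = (\<lambda>x\<in>carrier M. Pair x \<zero>\<^bsub>N\<^esub>)" "cin2 A M N = (\<lambda>y\<in>carrier N. Pair \<zero>\<^bsub>M\<^esub> y)"
  "cpr1 A M N = (\<lambda>z\<in>carrier (mod_sum M N). pfst z)" "cpr2 A M N
      = (\<lambda>z\<in>carrier (mod_sum M N). psnd z)"
  by (simp_all add: Proj_def)

lemma A_module: "X \<in> Ob (Cx A) \<Longrightarrow> right_module R (trm X n)"
  using A.Cx_trm[of X n] by (simp add: A_Ob projective_module_def)

text \<open>Extracts the source of compactness: T has finitely generated terms, and they are zero
  outside a bounded range. In a zero object the identity equals the zero map, so its carrier is a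
  single point.\<close>

lemma T_Ob: "T \<in> Ob (Cx A)" and T_fg: "fg_module R (trm T n)"
  and T_bounded: "\<exists>N. \<forall>n. \<bar>n\<bar> > N \<longrightarrow> carrier (trm T n) = {\<zero>\<^bsub>trm T n\<^esub>}"
proof -
  have T: "T \<in> Ob (Cx (proj_fg R))" "bounded_cplx (proj_fg R) T"
    using tilting by (simp_all add: tilting_complex_def Kb_proj_def K_tri_def K_cat_def
        quot_cat_def)
  show T': "T \<in> Ob (Cx A)" using T(1) unfolding Cx_Ob by (auto simp: proj_fg_def)
  show "fg_module R (trm T n)" using T(1) unfolding Cx_Ob by (auto simp: proj_fg_def)
  have "carrier (trm T n) = {\<zero>\<^bsub>trm T n\<^esub>}" if z: "zero_object (proj_fg R) (trm T n)" for n
  proof -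
    have eq: "restrict (\<lambda>x. x) (carrier (trm T n)) = (\<lambda>x\<in>carrier (trm T n). \<zero>\<^bsub>trm T n\<^esub>)"
      using z by (simp add: zero_object_def proj_fg_def A_sel)
    have "x = \<zero>\<^bsub>trm T n\<^esub>" if "x \<in> carrier (trm T n)" for x
      using fun_cong[OF eq, of x] that by simp
    then show ?thesis using rm_zero[OF A_module[OF T', of n]] by blast
  qed
  then show "\<exists>N. \<forall>n. \<bar>n\<bar> > N \<longrightarrow> carrier (trm T n) = {\<zero>\<^bsub>trm T n\<^esub>}"
    using T(2) unfolding bounded_cplx_def by blast
qed

interpretation CxA: additive_cat "Cx A" by (rule A.Cx_additive)
interpretation K: additive_ideal "Cx A" "null_homotopic A" by (rule A.null_homotopic_ideal)
interpretation KA: additive_cat "K_cat A" unfolding K_cat_def by (rule K.quot_additive)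

lemma K_cat_Ob [simp]: "Ob (K_cat A) = Ob (Cx A)"
  by (simp add: K_cat_def)

text \<open>The tilting condition (i), transported to complexes over all projectives and freed of
  the sign of the shift.\<close>

lemma T_orth:
  assumes k: "k \<noteq> 0"
  shows "K_orth A T (ushift k T)"
proof -
  have U: "ushift k T \<in> Ob (Cx A)" using T_Ob by simp
  have S: "shift A k T \<in> Ob (Cx A)" using T_Ob U by (simp add: shift_cases)
  have "K_orth A T (shift A k T)"
    unfolding K_orth_def
  proof
    fix f assume f: "f \<in> Hom (Cx A) T (shift A k T)"
    have "Hom (Kb_proj R) T (shift (proj_fg R) k T) = {czero (Kb_proj R) T (shift (proj_fg R) k T)}"
      using tilting k by (simp add: tilting_complex_def)
    then have "K.cls T (shift A k T) ` Hom (Cx A) T (shift A k T) = {K.cls T (shift A k T)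
        (czero (Cx A) T (shift A k T))}"
      by (simp add: Kb_proj_def K_tri_def K_cat_def quot_cat_def proj_fg_def cat_cls_def)
    then have "K.cls T (shift A k T) f = K.cls T (shift A k T) (czero (Cx A) T (shift A k T))"
      using f by blast
    then show "null_homotopic A T (shift A k T) f"
      using f T_Ob S by (simp add: K.cls_eq_iff)
  qed
  moreover have "isomorphic (K_cat A) (ushift k T) (shift A k T)"
    using A.isomorphic_negc[OF U] KA.isomorphic_refl[of "ushift k T"] U
    by (auto simp: shift_cases intro: KA.isomorphic_sym)
  ultimately show ?thesis
    using A.K_orth_iso[OF T_Ob U T_Ob S] KA.isomorphic_refl[of T] T_Ob by simp
qed

text \<open>The projections are chosen independently in each degree; their compatibility with the
  differentials is a consequence, \<open>copies_pi_chain\<close>.\<close>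

definition copies_of :: "('a, 'b) mcplx \<Rightarrow> 'i set \<Rightarrow> ('i \<Rightarrow> ('a, 'b) mcmap) \<Rightarrow>
    (int \<Rightarrow> 'i \<Rightarrow> ('a, 'b) mmap) \<Rightarrow> bool" where
  "copies_of X I \<iota> \<pi> \<longleftrightarrow> X \<in> Ob (Cx A) \<and> (\<forall>i \<in> I. \<iota> i \<in> Hom (Cx A) T X) \<and>
    (\<forall>n. module_direct_sum R (trm T n) I (\<lambda>i. \<iota> i n) (\<pi> n) (trm X n))"

lemma copies_ofE:
  fixes X :: "('a, 'b) mcplx"
  assumes X: "X \<in> Ob (Cx A)" "is_direct_sum_of_copies R T X"
  obtains I :: "('a, 'b) elem set" and \<iota> \<pi> where "copies_of X I \<iota> \<pi>"
proof -
  obtain I :: "('a, 'b) elem set" and \<iota> where i: "\<forall>i \<in> I. \<iota> i \<in> Hom (Cx A) T X"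
    and ds: "\<forall>n. is_mod_direct_sum R (trm T n) I (\<lambda>i. \<iota> i n) (trm X n)"
    using X unfolding is_direct_sum_of_copies_def by blast
  have "\<exists>\<pi>. module_direct_sum R (trm T n) I (\<lambda>i. \<iota> i n) \<pi> (trm X n)" for n
    using is_mod_direct_sum_projections[OF A_module[OF T_Ob] A_module[OF X(1)] ds[rule_format]]
        by blast
  then obtain \<pi> where "\<And>n. module_direct_sum R (trm T n) I (\<lambda>i. \<iota> i n) (\<pi> n) (trm X n)" by metis
  then show ?thesis using i X by (intro that[of I \<iota> \<pi>]) (simp add: copies_of_def)
qed

section \<open>Orthogonality of T and its sums of copies\<close>

lemma chain_apply:
  assumes f: "f \<in> Hom (Cx A) X Y" and x: "x \<in> carrier (trm X n)"
  shows "f (n+1) (dif X n x) = dif Y n (f n x)"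
  using fun_cong[OF A.Cx_commute(1)[OF f, of n], of x] x by (simp add: A_sel compose_eq)

context
  fixes X :: "('a, 'b) mcplx" and I :: "'i set" and \<iota> \<pi>
  assumes cp: "copies_of X I \<iota> \<pi>"
begin

private lemma X: "X \<in> Ob (Cx A)" and iota_chain: "i \<in> I \<Longrightarrow> \<iota> i \<in> Hom (Cx A) T X"
  and ds: "module_direct_sum R (trm T n) I (\<lambda>i. \<iota> i n) (\<pi> n) (trm X n)"
  using cp by (simp_all add: copies_of_def)

text \<open>By \<open>hom_ext\<close> it suffices to compare on the copies: both sides are the
  differential of T on copy j and zero on the others.\<close>

lemma copies_pi_chain:
  assumes j: "j \<in> I"
  shows "(\<lambda>n. \<pi> n j) \<in> Hom (Cx A) X T"
proof (rule Cx_HomI)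
  fix n
  interpret D: module_direct_sum R "trm T n" I "\<lambda>i. \<iota> i n" "\<pi> n" "trm X n" by (rule ds)
  interpret D': module_direct_sum R "trm T (n+1)" I "\<lambda>i. \<iota> i (n+1)" "\<pi> (n+1)" "trm X (n+1)"
      by (rule ds)
  show "\<pi> n j \<in> Hom A (trm X n) (trm T n)" using D.pi[OF j] by (simp add: A_sel)
  have d: "dif X n \<in> mod_hom R (trm X n) (trm X (n+1))" "dif T n \<in> mod_hom R (trm T n)
      (trm T (n+1))"
    using A.Cx_dif(1)[OF X, of n] A.Cx_dif(1)[OF T_Ob, of n] by (simp_all add: A_sel)
  have "compose (carrier (trm X n)) (\<pi> (n+1) j) (dif X n) = compose (carrier (trm X n)) (dif T n)
      (\<pi> n j)"
  proof (rule D.hom_ext[of "trm T (n+1)"])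
    fix i y assume i: "i \<in> I" and y: "y \<in> carrier (trm T n)"
    have iy: "\<iota> i n y \<in> carrier (trm X n)" by (rule mod_homD(2)[OF D.iota[OF i] y])
    have dy: "dif T n y \<in> carrier (trm T (n+1))" by (rule mod_homD(2)[OF d(2) y])
    have "dif X n (\<iota> i n y) = \<iota> i (n+1) (dif T n y)"
      using chain_apply[OF iota_chain[OF i] y] by simp
    then show "compose (carrier (trm X n)) (\<pi> (n+1) j) (dif X n) (\<iota> i n y)
        = compose (carrier (trm X n)) (dif T n) (\<pi> n j) (\<iota> i n y)"
      using iy D.pi_iota[OF i j y] D'.pi_iota[OF i j dy] mod_hom_zero_apply[OF D.N D'.N d(2)]
      by (simp add: compose_eq)
  qed (use D.M D'.N d D.pi[OF j] D'.pi[OF j] mod_hom_compose in blast)+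
  then show "ccomp A (trm X n) (trm X (n+1)) (trm T (n+1)) (\<pi> (n+1) j) (dif X n)
      = ccomp A (trm X n) (trm T n) (trm T (n+1)) (dif T n) (\<pi> n j)"
    by (simp add: A_sel)
qed

text \<open>Compactness of T: finitely many nonzero terms, each finitely generated, allow a chain
  map out of T to meet only finitely many copies. It is then a finite sum of its coordinates, each
  null-homotopic by \<open>T_orth\<close>.\<close>

lemma T_orth_copies:
  assumes m: "m \<noteq> 0"
  shows "K_orth A T (ushift m X)"
proof -
  let ?Y = "ushift m X"
  have Y: "?Y \<in> Ob (Cx A)" and U: "ushift m T \<in> Ob (Cx A)" using X T_Ob by simp_all
  \<comment> \<open>Induction on a finite set F of copies outside of which all coordinates of f
    vanish.\<close>
  have fin: "null_homotopic A T ?Y f"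
    if "finite F" "F \<subseteq> I" "f \<in> Hom (Cx A) T ?Y"
      "\<And>n x j. \<lbrakk>x \<in> carrier (trm T n); j \<in> I - F\<rbrakk> \<Longrightarrow> \<pi> (n+m) j (f n x) = \<zero>\<^bsub>trm T (n+m)\<^esub>" for F f
    using that
  proof (induction F arbitrary: f)
    case empty
    have "f n x = \<zero>\<^bsub>trm X (n+m)\<^esub>" if x: "x \<in> carrier (trm T n)" for n x
    proof -
      interpret D: module_direct_sum R "trm T (n+m)" I "\<lambda>i. \<iota> i (n+m)" "\<pi> (n+m)" "trm X (n+m)"
          by (rule ds)
      have "f n x \<in> carrier (trm X (n+m))"
        using A.Cx_Hom_in[OF empty(2), of n] mod_homD(2)[OF _ x] by (simp add: A_sel)
      then show ?thesis using empty(3)[OF x] by (intro D.separating) auto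
    qed
    moreover have "f n \<in> extensional (carrier (trm T n))" for n
      using A.Cx_Hom_in[OF empty(2), of n] by (auto simp: A_sel mod_hom_def PiE_def)
    ultimately have "f = czero (Cx A) T ?Y"
      by (auto simp: Cx_ops A_sel fun_eq_iff extensional_def)
    then show ?case using K.N_zero[OF T_Ob Y] by simp
  next
    case (insert j F)
    have j: "j \<in> I" and F: "F \<subseteq> I" using insert.prems(1) by auto
    note f = insert.prems(2)
    let ?p = "\<lambda>n. \<pi> (n+m) j" and ?i = "\<lambda>n. \<iota> j (n+m)"
    have p: "?p \<in> Hom (Cx A) ?Y (ushift m T)"
      using A.ushift_Hom[OF copies_pi_chain[OF j], of m] by simp
    have i: "?i \<in> Hom (Cx A) (ushift m T) ?Y" by (rule A.ushift_Hom[OF iota_chain[OF j]])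
    let ?g = "ccomp (Cx A) T ?Y (ushift m T) ?p f"
    let ?e = "ccomp (Cx A) T (ushift m T) ?Y ?i ?g"
    have g: "?g \<in> Hom (Cx A) T (ushift m T)" using T_Ob Y U f p by simp
    then have "null_homotopic A T (ushift m T) ?g" using T_orth[OF m] by (simp add: K_orth_def)
    then have ne: "null_homotopic A T ?Y ?e" using T_Ob Y U i g
        by (intro K.N_comp_left[of T "ushift m T"]) simp_all
    have e: "?e \<in> Hom (Cx A) T ?Y" using T_Ob Y U i g by simp
    \<comment> \<open>Subtracting the composite of f with projection and injection of copy j removes
      coordinate j and leaves the others unchanged, so the induction hypothesis for F
      applies.\<close>
    let ?d = "cadd (Cx A) T ?Y f (cneg (Cx A) T ?Y ?e)"
    have d: "?d \<in> Hom (Cx A) T ?Y" using T_Ob Y f e by simp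
    have "\<pi> (n+m) k (?d n x) = \<zero>\<^bsub>trm T (n+m)\<^esub>" if x: "x \<in> carrier (trm T n)" and k: "k \<in> I - F"
        for n x k
    proof -
      interpret D: module_direct_sum R "trm T (n+m)" I "\<lambda>i. \<iota> i (n+m)" "\<pi> (n+m)" "trm X (n+m)"
          by (rule ds)
      have k': "k \<in> I" using k by simp
      have fx: "f n x \<in> carrier (trm X (n+m))"
        using A.Cx_Hom_in[OF f, of n] mod_homD(2)[OF _ x] by (simp add: A_sel)
      let ?y = "\<pi> (n+m) j (f n x)"
      have y: "?y \<in> carrier (trm T (n+m))" by (rule mod_homD(2)[OF D.pi[OF j] fx])
      let ?z = "\<iota> j (n+m) ?y"
      have z: "?z \<in> carrier (trm X (n+m))" by (rule mod_homD(2)[OF D.iota[OF j] y])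
      have pf: "\<pi> (n+m) k (f n x) \<in> carrier (trm T (n+m))" by (rule mod_homD(2)[OF D.pi[OF k'] fx])
      have pz: "\<pi> (n+m) k ?z = (if k = j then ?y else \<zero>\<^bsub>trm T (n+m)\<^esub>)"
          by (rule D.pi_iota[OF j k' y])
      have eq: "\<pi> (n+m) k (f n x) = \<pi> (n+m) k ?z"
        using pz insert.prems(3)[OF x, of k] k by auto
      have dx: "?d n x = f n x \<oplus>\<^bsub>trm X (n+m)\<^esub> \<ominus>\<^bsub>trm X (n+m)\<^esub> ?z"
        using x by (simp add: Cx_ops A_sel compose_eq)
      have "\<pi> (n+m) k (\<ominus>\<^bsub>trm X (n+m)\<^esub> ?z) \<oplus>\<^bsub>trm T (n+m)\<^esub> \<pi> (n+m) k ?z = \<zero>\<^bsub>trm T (n+m)\<^esub>"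
        using mod_homD(3)[OF D.pi[OF k'], of "\<ominus>\<^bsub>trm X (n+m)\<^esub> ?z" ?z] z mod_hom_zero_apply[OF D.M D.N
            D.pi[OF k']]
          rm_neg[OF D.M z] rm_neg_left[OF D.M z] by simp
      moreover have "\<pi> (n+m) k (\<ominus>\<^bsub>trm X (n+m)\<^esub> ?z) \<in> carrier (trm T (n+m))"
        by (rule mod_homD(2)[OF D.pi[OF k'] rm_neg[OF D.M z]])
      ultimately show ?thesis
        unfolding dx mod_homD(3)[OF D.pi[OF k'] fx rm_neg[OF D.M z]] eq
        using pf eq rm_comm[OF D.N, of "\<pi> (n+m) k ?z" "\<pi> (n+m) k (\<ominus>\<^bsub>trm X (n+m)\<^esub> ?z)"] by simp
    qed
    then have nd: "null_homotopic A T ?Y ?d" using insert.IH[OF F d] by blast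
    have "f = cadd (Cx A) T ?Y ?e ?d" using T_Ob Y f e by simp
    then show ?case using K.N_add[OF T_Ob Y e d ne nd] by simp
  qed
  show ?thesis
    unfolding K_orth_def
  proof
    fix f assume f: "f \<in> Hom (Cx A) T ?Y"
    have fn: "f n \<in> mod_hom R (trm T n) (trm X (n+m))" for n
      using A.Cx_Hom_in[OF f, of n] by (simp add: A_sel)
    have "\<exists>F. finite F \<and> F \<subseteq> I \<and> (\<forall>x \<in> carrier (trm T n). \<forall>j \<in> I - F. \<pi> (n+m) j (f n x) = \<zero>\<^bsub>trm T
        (n+m)\<^esub>)" for n
    proof -
      interpret D: module_direct_sum R "trm T (n+m)" I "\<lambda>i. \<iota> i (n+m)" "\<pi> (n+m)" "trm X (n+m)"
          by (rule ds)
      obtain B where B: "finite B" "B \<subseteq> carrier (trm T n)" "\<And>x. x \<in> carrier (trm T n) \<Longrightarrow>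
          \<exists>c \<in> B \<rightarrow> carrier R. x = (\<Oplus>\<^bsub>trm T n\<^esub>b\<in>B. c b \<odot>\<^bsub>trm T n\<^esub> b)"
        using T_fg[of n] unfolding fg_module_def by blast
      show ?thesis
      proof (rule D.finite_support[OF A_module[OF T_Ob] fn B])
        fix F assume "finite F" "F \<subseteq> I"
          "\<And>x i. \<lbrakk>x \<in> carrier (trm T n); i \<in> I - F\<rbrakk> \<Longrightarrow> \<pi> (n+m) i (f n x) = \<zero>\<^bsub>trm T (n+m)\<^esub>"
        then show ?thesis by (intro exI[of _ F]) simp
      qed
    qed
    then obtain F where F: "\<And>n. finite (F n)" "\<And>n. F n \<subseteq> I"
      "\<And>n x j. \<lbrakk>x \<in> carrier (trm T n); j \<in> I - F n\<rbrakk> \<Longrightarrow> \<pi> (n+m) j (f n x) = \<zero>\<^bsub>trm T (n+m)\<^esub>"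
      by metis
    obtain N where N: "\<And>n. \<bar>n\<bar> > N \<Longrightarrow> carrier (trm T n) = {\<zero>\<^bsub>trm T n\<^esub>}" using T_bounded by blast
    \<comment> \<open>Outside [-N, N] the terms of T are zero; a finite union of finite sets
      therefore serves all degrees at once.\<close>
    let ?F = "\<Union>n\<in>{-N..N}. F n"
    show "null_homotopic A T ?Y f"
    proof (rule fin[of ?F])
      show "\<pi> (n+m) j (f n x) = \<zero>\<^bsub>trm T (n+m)\<^esub>" if x: "x \<in> carrier (trm T n)" and j: "j \<in> I - ?F"
          for n x j
      proof (cases "\<bar>n\<bar> > N")
        case True
        interpret D: module_direct_sum R "trm T (n+m)" I "\<lambda>i. \<iota> i (n+m)" "\<pi> (n+m)" "trm X (n+m)"
            by (rule ds)
        have "x = \<zero>\<^bsub>trm T n\<^esub>" using x N[OF True] by simp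
        then show ?thesis
          using mod_hom_zero_apply[OF A_module[OF T_Ob] D.M fn] mod_hom_zero_apply[OF D.M D.N D.pi]
              j by simp
      next
        case False
        then have "n \<in> {-N..N}" by auto
        then show ?thesis using F(3)[OF x, of j] j by blast
      qed
    qed (use F f in auto)
  qed
qed

text \<open>Null homotopies of the restrictions to the copies are glued degreewise by the universal
  property. The boundary of the glued family agrees with f on every copy, hence everywhere.\<close>

lemma copies_orth:
  assumes Y: "Y \<in> Ob (Cx A)" and o: "K_orth A T Y"
  shows "K_orth A X Y"
  unfolding K_orth_def
proof
  fix f assume f: "f \<in> Hom (Cx A) X Y"
  have "\<exists>h. (\<forall>n. h n \<in> Hom A (trm T n) (trm Y (n-1))) \<and> ccomp (Cx A) T X Y f (\<iota> i) = boundary A T Y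
      h"
    if i: "i \<in> I" for i
    using o CxA.comp_in[OF T_Ob X Y iota_chain[OF i] f] by (simp add: K_orth_def null_homotopic_iff)
  then obtain h where h: "\<And>i n. i \<in> I \<Longrightarrow> h i n \<in> Hom A (trm T n) (trm Y (n-1))"
    and fh: "\<And>i. i \<in> I \<Longrightarrow> ccomp (Cx A) T X Y f (\<iota> i) = boundary A T Y (h i)" by metis
  have "\<exists>H. H \<in> mod_hom R (trm X n) (trm Y (n-1)) \<and>
      (\<forall>i \<in> I. \<forall>y \<in> carrier (trm T n). H (\<iota> i n y) = h i n y)" for n
  proof -
    interpret D: module_direct_sum R "trm T n" I "\<lambda>i. \<iota> i n" "\<pi> n" "trm X n" by (rule ds)
    have "h i n \<in> mod_hom R (trm T n) (trm Y (n-1))" if "i \<in> I" for i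
      using h[OF that, of n] by (simp add: A_sel)
    then show ?thesis using D.hom_exists[OF A_module[OF Y], of "\<lambda>i. h i n" "n-1"] by metis
  qed
  then obtain H where H: "\<And>n. H n \<in> mod_hom R (trm X n) (trm Y (n-1))"
    and Hi: "\<And>n i y. \<lbrakk>i \<in> I; y \<in> carrier (trm T n)\<rbrakk> \<Longrightarrow> H n (\<iota> i n y) = h i n y" by metis
  have "f = boundary A X Y H"
  proof
    fix n
    interpret D: module_direct_sum R "trm T n" I "\<lambda>i. \<iota> i n" "\<pi> n" "trm X n" by (rule ds)
    have b: "boundary A X Y H \<in> Hom (Cx A) X Y" using X Y H
        by (intro A.boundary_in) (simp_all add: A_sel)
    show "f n = boundary A X Y H n"
    proof (rule D.hom_ext[OF A_module[OF Y, of n]])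
      fix i y assume i: "i \<in> I" and y: "y \<in> carrier (trm T n)"
      have iy: "\<iota> i n y \<in> carrier (trm X n)" by (rule mod_homD(2)[OF D.iota[OF i] y])
      have dT: "dif T n \<in> mod_hom R (trm T n) (trm T (n+1))" using A.Cx_dif(1)[OF T_Ob, of n]
          by (simp add: A_sel)
      have dy: "dif T n y \<in> carrier (trm T (n+1))" by (rule mod_homD(2)[OF dT y])
      have dX: "dif X n (\<iota> i n y) = \<iota> i (n+1) (dif T n y)"
        using chain_apply[OF iota_chain[OF i] y] by simp
      have "f n (\<iota> i n y) = boundary A T Y (h i) n y"
        using fun_cong[OF fun_cong[OF fh[OF i], of n], of y] y
            by (simp add: Cx_ops A_sel compose_eq)
      also have "\<dots> = boundary A X Y H n (\<iota> i n y)"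
        using y iy dy Hi[OF i y] Hi[OF i dy] dX by (simp add: boundary_def A_sel compose_eq)
      finally show "f n (\<iota> i n y) = boundary A X Y H n (\<iota> i n y)" .
    qed (use A.Cx_Hom_in[OF f, of n] A.Cx_Hom_in[OF b, of n] in \<open>simp_all add: A_sel\<close>)
  qed
  then show "null_homotopic A X Y f" using H by (intro null_homotopicI[of H]) (simp_all add: A_sel)
qed

end

abbreviation ST where "ST \<equiv> SumT R T"
abbreviation CS where "CS \<equiv> Cx ST"

section \<open>The additive category Sum-T\<close>

lemma SumT_Ob: "X \<in> Ob ST \<longleftrightarrow> X \<in> Ob (Cx A) \<and>
    (\<exists>X' \<in> Ob (Cx A). is_direct_sum_of_copies R T X' \<and> isomorphic (K_cat A) X X')"
  unfolding SumT_def by (simp add: K_cat_def)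

lemma SumT_Ob_Cx: "X \<in> Ob ST \<Longrightarrow> X \<in> Ob (Cx A)"
  by (simp add: SumT_Ob)

lemma SumT_iso:
  assumes X: "X \<in> Ob ST" and Y: "Y \<in> Ob (Cx A)" and iso: "isomorphic (K_cat A) Y X"
  shows "Y \<in> Ob ST"
  using X Y iso KA.isomorphic_trans unfolding SumT_Ob K_cat_Ob by blast

lemma SumT_negc: "X \<in> Ob ST \<Longrightarrow> negc A X \<in> Ob ST"
  by (rule SumT_iso[OF _ A.negc_Ob[OF SumT_Ob_Cx] A.isomorphic_negc[OF SumT_Ob_Cx]])

text \<open>After replacing both objects by actual sums of copies, the target is handled by
  compactness of T and the source by gluing homotopies.\<close>

lemma SumT_orth:
  assumes X: "X \<in> Ob ST" and Y: "Y \<in> Ob ST" and m: "m \<noteq> 0"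
  shows "K_orth A X (ushift m Y)"
proof -
  obtain X' where X': "X' \<in> Ob (Cx A)" "is_direct_sum_of_copies R T X'" "isomorphic (K_cat A) X X'"
    using X by (auto simp: SumT_Ob)
  obtain Y' where Y': "Y' \<in> Ob (Cx A)" "is_direct_sum_of_copies R T Y'" "isomorphic (K_cat A) Y Y'"
    using Y by (auto simp: SumT_Ob)
  have ob: "X \<in> Ob (Cx A)" "Y \<in> Ob (Cx A)" using X Y by (simp_all add: SumT_Ob)
  obtain I :: "('a, 'b) elem set" and \<iota> \<pi> where cX: "copies_of X' I \<iota> \<pi>"
      by (rule copies_ofE[OF X'(1,2)])
  obtain I' :: "('a, 'b) elem set" and \<iota>' \<pi>' where cY: "copies_of Y' I' \<iota>' \<pi>'"
      by (rule copies_ofE[OF Y'(1,2)])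
  have "K_orth A X' (ushift m Y')"
    by (rule copies_orth[OF cX _ T_orth_copies[OF cY m]]) (use Y' in simp)
  then show ?thesis
    by (rule A.K_orth_iso[rotated -1]) (use ob X' Y' A.isomorphic_ushift[OF ob(2) Y'(1,3)]
        in simp_all)
qed

text \<open>A finite tree is never its own left subtree. This provides two distinct tags, u and
  \<open>Pair u u\<close>, in every instance of the universe.\<close>

lemma Pair_neq: "Pair x y \<noteq> (x :: ('a, 'b) elem)"
  by (induction x arbitrary: y) auto

text \<open>Index sets must lie in the universe \<open>elem\<close>, so the disjoint union of I and
  J is realised there by tagging: u marks the copies in X, v those in Y.\<close>

lemma copies_csum:
  assumes X: "X \<in> Ob (Cx A)" "is_direct_sum_of_copies R T X" and Y: "Y \<in> Ob (Cx A)"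
      "is_direct_sum_of_copies R T Y"
  shows "is_direct_sum_of_copies R T (csum (Cx A) X Y)"
proof -
  obtain I :: "('a, 'b) elem set" and \<iota> \<pi> where cX: "copies_of X I \<iota> \<pi>" by (rule copies_ofE[OF X])
  obtain J :: "('a, 'b) elem set" and \<kappa> \<rho> where cY: "copies_of Y J \<kappa> \<rho>" by (rule copies_ofE[OF Y])
  let ?S = "csum (Cx A) X Y"
  define u :: "('a, 'b) elem" where "u = undefined"
  define v where "v = Pair u u"
  have uv: "u \<noteq> v" "v \<noteq> u" using Pair_neq[of u u] by (auto simp: v_def)
  define L where "L = Pair u ` I \<union> Pair v ` J"
  define l where "l k = (if pfst k = u then ccomp (Cx A) T X ?S (cin1 (Cx A) X Y) (\<iota> (psnd k))
      else ccomp (Cx A) T Y ?S (cin2 (Cx A) X Y) (\<kappa> (psnd k)))" for k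
  define r where "r n k = (if pfst k = u then compose (carrier (trm ?S n)) (\<pi> n (psnd k))
      (cpr1 A (trm X n) (trm Y n))
      else compose (carrier (trm ?S n)) (\<rho> n (psnd k)) (cpr2 A (trm X n) (trm Y n)))" for n k
  have i: "\<iota> i \<in> Hom (Cx A) T X" if "i \<in> I" for i using cX that by (simp add: copies_of_def)
  have k: "\<kappa> j \<in> Hom (Cx A) T Y" if "j \<in> J" for j using cY that by (simp add: copies_of_def)
  have l: "l a \<in> Hom (Cx A) T ?S" if "a \<in> L" for a
    using that X(1) Y(1) T_Ob i k uv by (auto simp: L_def l_def)
  have "is_mod_direct_sum R (trm T n) L (\<lambda>a. l a n) (trm ?S n)" for n
  proof -
    interpret DX: module_direct_sum R "trm T n" I "\<lambda>i. \<iota> i n" "\<pi> n" "trm X n"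
      using cX by (simp add: copies_of_def)
    interpret DY: module_direct_sum R "trm T n" J "\<lambda>i. \<kappa> i n" "\<rho> n" "trm Y n"
      using cY by (simp add: copies_of_def)
    have S: "trm ?S n = mod_sum (trm X n) (trm Y n)" by (simp add: Cx_csum A_sel)
    note mS = mod_sum_module[OF DX.M DY.M] and inj = mod_hom_injections[OF DX.M DY.M]
    have rx: "r n (Pair u i) (Pair x y) = \<pi> n i x" and ry: "r n (Pair v j) (Pair x y) = \<rho> n j y"
      if "x \<in> carrier (trm X n)" "y \<in> carrier (trm Y n)" for i j x y
      using that uv by (simp_all add: r_def S A_sel compose_eq)
    have lx: "l (Pair u i) n y = Pair (\<iota> i n y) \<zero>\<^bsub>trm Y n\<^esub>" if "i \<in> I" "y \<in> carrier (trm T n)"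
        for i y
      using that mod_homD(2)[OF DX.iota] by (simp add: l_def Cx_ops A_sel compose_eq)
    have ly: "l (Pair v j) n y = Pair \<zero>\<^bsub>trm X n\<^esub> (\<kappa> j n y)" if "j \<in> J" "y \<in> carrier (trm T n)"
        for j y
      using that uv mod_homD(2)[OF DY.iota] by (simp add: l_def Cx_ops A_sel compose_eq)
    have "module_direct_sum R (trm T n) L (\<lambda>a. l a n) (r n) (trm ?S n)"
    proof
      show "right_module R (trm T n)" "right_module R (trm ?S n)" using DX.N mS S by simp_all
      show "l a n \<in> mod_hom R (trm T n) (trm ?S n)" if "a \<in> L" for a
        using A.Cx_Hom_in[OF l[OF that], of n] by (simp add: A_sel)
      show "r n a \<in> mod_hom R (trm ?S n) (trm T n)" if "a \<in> L" for a
        using that mod_hom_compose[OF mS inj(3) DX.pi] mod_hom_compose[OF mS inj(4) DY.pi] uv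
        by (auto simp: L_def r_def S A_sel)
      show "r n b (l a n y) = (if b = a then y else \<zero>\<^bsub>trm T n\<^esub>)"
        if "a \<in> L" "b \<in> L" "y \<in> carrier (trm T n)" for a b y
        using that uv DX.pi_iota DY.pi_iota mod_homD(2)[OF DX.iota] mod_homD(2)[OF DY.iota]
          rm_zero[OF DX.M] rm_zero[OF DY.M] mod_hom_zero_apply[OF DX.M DX.N DX.pi]
              mod_hom_zero_apply[OF DY.M DY.N DY.pi]
        by (auto simp: L_def lx ly rx ry split: if_splits)
      show "finite {a \<in> L. r n a z \<noteq> \<zero>\<^bsub>trm T n\<^esub>}" if zS: "z \<in> carrier (trm ?S n)" for z
      proof -
        obtain x y where z: "z = Pair x y" "x \<in> carrier (trm X n)" "y \<in> carrier (trm Y n)"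
          using zS unfolding S by (rule mod_sum_carrierE)
        have "{a \<in> L. r n a z \<noteq> \<zero>\<^bsub>trm T n\<^esub>} \<subseteq> Pair u ` {i \<in> I. \<pi> n i x \<noteq> \<zero>\<^bsub>trm T n\<^esub>} \<union> Pair v ` {j \<in>
            J. \<rho> n j y \<noteq> \<zero>\<^bsub>trm T n\<^esub>}"
          using z by (auto simp: L_def rx ry)
        then show ?thesis
          by (rule finite_subset) (simp add: DX.supp_finite[OF z(2)] DY.supp_finite[OF z(3)])
      qed
      show "z = \<zero>\<^bsub>trm ?S n\<^esub>" if zS: "z \<in> carrier (trm ?S n)" and 0: "\<And>a. a \<in> L \<Longrightarrow> r n a z = \<zero>\<^bsub>trm T
          n\<^esub>" for z
      proof -
        obtain x y where z: "z = Pair x y" "x \<in> carrier (trm X n)" "y \<in> carrier (trm Y n)"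
          using zS unfolding S by (rule mod_sum_carrierE)
        have "\<pi> n i x = \<zero>\<^bsub>trm T n\<^esub>" if "i \<in> I" for i using 0[of "Pair u i"] that z
            by (simp add: L_def rx)
        then have "x = \<zero>\<^bsub>trm X n\<^esub>" using z by (intro DX.separating)
        moreover have "\<rho> n j y = \<zero>\<^bsub>trm T n\<^esub>" if "j \<in> J" for j using 0[of "Pair v j"] that z
            by (simp add: L_def ry)
        then have "y = \<zero>\<^bsub>trm Y n\<^esub>" using z by (intro DY.separating)
        ultimately show ?thesis using z S by simp
      qed
    qed
    then show ?thesis by (rule module_direct_sum.is_mod_direct_sum)
  qed
  then show ?thesis unfolding is_direct_sum_of_copies_def using l by blast
qed

lemma SumT_csum:
  assumes X: "X \<in> Ob ST" and Y: "Y \<in> Ob ST"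
  shows "csum (Cx A) X Y \<in> Ob ST"
proof -
  obtain X' where X': "X' \<in> Ob (Cx A)" "is_direct_sum_of_copies R T X'" "isomorphic (K_cat A) X X'"
    using X by (auto simp: SumT_Ob)
  obtain Y' where Y': "Y' \<in> Ob (Cx A)" "is_direct_sum_of_copies R T Y'" "isomorphic (K_cat A) Y Y'"
    using Y by (auto simp: SumT_Ob)
  have ob: "X \<in> Ob (Cx A)" "Y \<in> Ob (Cx A)" using X Y by (simp_all add: SumT_Ob)
  have "csum (K_cat A) = csum (Cx A)" by (simp add: K_cat_def)
  then have "isomorphic (K_cat A) (csum (Cx A) X Y) (csum (Cx A) X' Y')"
    using KA.isomorphic_csum[of X Y X' Y'] ob X' Y' by simp
  then show ?thesis
    unfolding SumT_Ob using ob X' Y' copies_csum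
        by (intro conjI bexI[of _ "csum (Cx A) X' Y'"]) simp_all
qed

lemma SumT_additive: "additive_cat ST"
proof -
  have "csum (K_cat A) X Y \<in> {X. \<exists>X' \<in> Ob (K_cat A). is_direct_sum_of_copies R T X' \<and> isomorphic
      (K_cat A) X X'}"
    if "X \<in> Ob (K_cat A)" "Y \<in> Ob (K_cat A)"
      "X \<in> {X. \<exists>X' \<in> Ob (K_cat A). is_direct_sum_of_copies R T X' \<and> isomorphic (K_cat A) X X'}"
      "Y \<in> {X. \<exists>X' \<in> Ob (K_cat A). is_direct_sum_of_copies R T X' \<and> isomorphic (K_cat A) X X'}"
          for X Y
  proof -
    have "csum (K_cat A) X Y = csum (Cx A) X Y" by (simp add: K_cat_def)
    then show ?thesis using SumT_csum[of X Y] that unfolding SumT_Ob by simp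
  qed
  then show ?thesis unfolding SumT_def by (rule KA.full_sub_additive)
qed

end

section \<open>Suspensions of homotopy classes\<close>

text \<open>Suspending a class means taking the image of a set. The image is the whole target class
  because the suspension is surjective on families and reflects membership.\<close>

lemma surj_image_eq:
  assumes "surj \<phi>" "\<And>g. \<phi> g \<in> U \<longleftrightarrow> g \<in> S"
  shows "\<phi> ` S = U"
proof
  show "U \<subseteq> \<phi> ` S"
  proof
    fix u assume "u \<in> U"
    moreover obtain g where "u = \<phi> g" using assms(1) by (rule surjE)
    ultimately show "u \<in> \<phi> ` S" using assms(2) by simp
  qed
qed (use assms(2) in auto)

lemma surj_shift_map: "surj shift_map"
  by (rule surjI[of _ "\<lambda>g i. g (i-1)"]) (simp add: fun_eq_iff shift_map_def)

lemma surj_twist_map: "surj twist_map"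
  by (rule surjI[of _ "\<lambda>g i n j. g i n (j-1)"]) (simp add: fun_eq_iff twist_map_def)

context additive_cat
begin

interpretation B: additive_cat "Zplus C"
  by (rule Zplus_additive)

interpretation Cx: additive_cat "Cx C"
  by (rule Cx_additive)

interpretation BC: additive_cat CZ
  by (rule B.Cx_additive)

interpretation K: additive_ideal "Cx C" "null_homotopic C"
  by (rule null_homotopic_ideal)

interpretation E: additive_ideal CZ "eta_null C"
  by (rule eta_null_ideal)

lemma shift_map_cls:
  assumes X: "X \<in> Ob (Cx C)" and Y: "Y \<in> Ob (Cx C)" and f: "f \<in> Hom (Cx C) X Y"
  shows "shift_map ` htp_cls C X Y f = htp_cls C (shift C 1 X) (shift C 1 Y) (shift_map f)"
proof -
  have diff: "cadd (Cx C) (shift C 1 X) (shift C 1 Y) (shift_map f)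
      (cneg (Cx C) (shift C 1 X) (shift C 1 Y) (shift_map g))
    = shift_map (cadd (Cx C) X Y f (cneg (Cx C) X Y g))" for g
    by (simp add: Cx_ops fun_eq_iff)
  have mem: "shift_map g \<in> htp_cls C (shift C 1 X) (shift C 1 Y) (shift_map f) \<longleftrightarrow> g \<in> htp_cls C X Y
      f" for g
    unfolding htp_cls_def K.in_cls_iff diff using X Y
        by (simp add: shift_Hom_iff null_homotopic_shift_iff)
  show ?thesis by (rule surj_image_eq[OF surj_shift_map mem])
qed

lemma twist_shift: "twist (shift ZC 1 X) = shift ZC 1 (twist X)"
  by (simp add: twist_def shift_def cat_sgn_def Zplus_cneg twist_map_def fun_eq_iff)

lemma eta_twist: "eta C (twist X) = twist_map (eta C X)"
  by (auto simp: eta_def twist_def twist_map_def fun_eq_iff)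

lemma eta_shift: "eta C (shift ZC 1 X) = shift_map (eta C X)"
  by (simp add: eta_def shift_def fun_eq_iff)

abbreviation sus :: "('o, 'm) zcplx \<Rightarrow> ('o, 'm) zcplx" where
  "sus X \<equiv> shift ZC 1 (twist X)"

lemma sus_Hom_iff:
  assumes "X \<in> Ob CZ" "Y \<in> Ob CZ"
  shows "shift_map (twist_map f) \<in> Hom CZ (sus X) (sus Y) \<longleftrightarrow> f \<in> Hom CZ X Y"
  using assms B.shift_Hom_iff[of "twist X" "twist Y" "twist_map f"] by simp

lemma sus_comp: "ccomp CZ (sus X) (sus Y) (sus Z) (shift_map (twist_map g))
    (shift_map (twist_map f))
    = shift_map (twist_map (ccomp CZ X Y Z g f))"
  by (simp add: Cx_ops fun_eq_iff Zplus_ccomp)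

text \<open>By \<open>eta_null_iff\<close> both sides say that a composite with \<eta> is
  null-homotopic. Since \<eta> commutes with the twist and with the shift, the two composites
  correspond, and both operations preserve and reflect null homotopies.\<close>

lemma sus_null_iff:
  assumes X: "X \<in> Ob CZ" and Y: "Y \<in> Ob CZ" and f: "f \<in> Hom CZ X Y"
  shows "eta_null C (sus X) (sus Y) (shift_map (twist_map f)) \<longleftrightarrow> eta_null C X Y f"
proof -
  have ob: "sus X \<in> Ob CZ" "sus Y \<in> Ob CZ" using X Y by simp_all
  have eq: "ccomp CZ (twist (sus X)) (sus X) (sus Y) (shift_map (twist_map f)) (eta C (sus X))
    = shift_map (twist_map (ccomp CZ (twist X) X Y f (eta C X)))"
    unfolding eta_shift eta_twist twist_shift by (rule sus_comp)
  have "eta_null C (sus X) (sus Y) (shift_map (twist_map f)) \<longleftrightarrow>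
    null_homotopic ZC (shift ZC 1 (twist (twist X))) (shift ZC 1 (twist Y))
      (shift_map (twist_map (ccomp CZ (twist X) X Y f (eta C X))))"
    unfolding eta_null_iff[OF ob iffD2[OF sus_Hom_iff[OF X Y] f]] eq unfolding twist_shift ..
  also have "\<dots> \<longleftrightarrow> null_homotopic ZC (twist X) Y (ccomp CZ (twist X) X Y f (eta C X))"
    using X Y by (simp add: B.null_homotopic_shift_iff null_homotopic_twist_iff)
  also have "\<dots> \<longleftrightarrow> eta_null C X Y f" using X Y f by (simp add: eta_null_iff)
  finally show ?thesis .
qed

lemma sus_cls:
  assumes X: "X \<in> Ob CZ" and Y: "Y \<in> Ob CZ" and f: "f \<in> Hom CZ X Y"
  shows "(shift_map \<circ> twist_map) ` eta_cls C X Y f = eta_cls C (sus X) (sus Y)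
      (shift_map (twist_map f))"
proof -
  have diff: "cadd CZ (sus X) (sus Y) (shift_map (twist_map f))
      (cneg CZ (sus X) (sus Y) (shift_map (twist_map g)))
    = shift_map (twist_map (cadd CZ X Y f (cneg CZ X Y g)))" for g
    by (simp add: Cx_ops fun_eq_iff Zplus_ops)
  have mem: "shift_map (twist_map g) \<in> eta_cls C (sus X) (sus Y) (shift_map (twist_map f)) \<longleftrightarrow> g \<in>
      eta_cls C X Y f" for g
  proof (cases "g \<in> Hom CZ X Y")
    case True
    then have "cadd CZ X Y f (cneg CZ X Y g) \<in> Hom CZ X Y"
      using X Y f by simp
    then show ?thesis
      unfolding eta_cls_def E.in_cls_iff diff using X Y by (simp add: sus_Hom_iff sus_null_iff)
  next
    case False
    then show ?thesis unfolding eta_cls_def E.in_cls_iff using X Y by (simp add: sus_Hom_iff)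
  qed
  show ?thesis
    by (rule surj_image_eq[OF comp_surj[OF surj_twist_map surj_shift_map]]) (simp add: mem)
qed

section \<open>Isomorphisms detected on rows\<close>

text \<open>The row isomorphism and its inverse are extended separately, which is why vanishing is
  assumed in both directions. The extensions need be inverse to each other only on rows; that
  suffices for an isomorphism in the stable category.\<close>

lemma extend_row_iso:
  assumes D: "D \<in> Ob CZ" and E: "E \<in> Ob CZ"
    and f0: "\<And>j. f0 j \<in> Hom (Cx C) (row D j) (row E j)"
    and g0: "\<And>j. g0 j \<in> Hom (Cx C) (row E j) (row D j)"
    and gf: "\<And>j. ccomp (Cx C) (row D j) (row E j) (row D j) (g0 j) (f0 j) = cid (Cx C) (row D j)"
    and fg: "\<And>j. ccomp (Cx C) (row E j) (row D j) (row E j) (f0 j) (g0 j) = cid (Cx C) (row E j)"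
    and f1: "\<And>i j. f1 j i \<in> Hom C (trm D i j) (trm E i (j+1))"
    and eq: "\<And>i j. cadd C (trm D i j) (trm E (i+1) (j+1))
        (ccomp C (trm D i j) (trm E i j) (trm E (i+1) (j+1)) (dif E i 1 j) (f0 j i))
        (ccomp C (trm D i j) (trm E i (j+1)) (trm E (i+1) (j+1)) (dif E i 0 (j+1)) (f1 j i))
      = cadd C (trm D i j) (trm E (i+1) (j+1))
        (ccomp C (trm D i j) (trm D (i+1) (j+1)) (trm E (i+1) (j+1)) (f0 (j+1) (i+1)) (dif D i 1 j))
        (ccomp C (trm D i j) (trm D (i+1) j) (trm E (i+1) (j+1)) (f1 j (i+1)) (dif D i 0 j))"
    and vanDE: "\<And>n j. 2 \<le> n \<Longrightarrow> K_orth C (row D j) (shift C 1 (row E (j + int n)))"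
    and vanED: "\<And>n j. 2 \<le> n \<Longrightarrow> K_orth C (row E j) (shift C 1 (row D (j + int n)))"
  obtains f g where "f \<in> Hom CZ D E" "\<And>j. rowm f j = f0 j"
    "g \<in> Hom CZ E D" "\<And>j. rowm g j = g0 j"
proof -
  obtain f where f: "f \<in> Hom CZ D E" "\<And>j. rowm f j = f0 j"
    by (rule extend_chain_map[OF D E f0 f1 eq]) (use vanDE in \<open>auto simp: K_orth_def\<close>)
  have T: "trm D i \<in> Ob ZC" "trm E i \<in> Ob ZC" for i using D E by simp_all
  have Tj: "trm D i j \<in> Ob C" "trm E i j \<in> Ob C" for i j using T by simp_all
  have d: "dif D i \<in> Hom ZC (trm D i) (trm D (i+1))" "dif E i \<in> Hom ZC (trm E i) (trm E (i+1))"
      for i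
    using D E by simp_all
  have dmem: "dif D i 0 j \<in> Hom C (trm D i j) (trm D (i+1) j)" "dif E i 0 j \<in> Hom C (trm E i j)
      (trm E (i+1) j)"
    "dif D i (Suc 0) j \<in> Hom C (trm D i j) (trm D (i+1) (j+1))"
    "dif E i (Suc 0) j \<in> Hom C (trm E i j) (trm E (i+1) (j+1))" for i j
    using Zplus_Hom_in[OF d(1), of i 0 j] Zplus_Hom_in[OF d(2), of i 0 j]
      Zplus_Hom_in[OF d(1), of i "Suc 0" j] Zplus_Hom_in[OF d(2), of i "Suc 0" j] by simp_all
  have m0: "f0 j i \<in> Hom C (trm D i j) (trm E i j)" "g0 j i \<in> Hom C (trm E i j) (trm D i j)" for i j
    using Cx_Hom_in[OF f0[of j], of i] Cx_Hom_in[OF g0[of j], of i] by simp_all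
  have inv: "ccomp C (trm D i j) (trm E i j) (trm D i j) (g0 j i) (f0 j i) = cid C (trm D i j)"
    "ccomp C (trm E i j) (trm D i j) (trm E i j) (f0 j i) (g0 j i) = cid C (trm E i j)" for i j
    using fun_cong[OF gf[of j], of i] fun_cong[OF fg[of j], of i] by (simp_all add: Cx_ops)
  have inv': "ccomp C W (trm E i j) (trm D i j) (g0 j i)
      (ccomp C W (trm D i j) (trm E i j) (f0 j i) x) = x"
    if "W \<in> Ob C" "x \<in> Hom C W (trm D i j)" for W x i j
    using that Tj m0 inv by (simp flip: comp_assoc)
  have g_chain: "ccomp C W (trm E (i+1) j) (trm D (i+1) j) (g0 j (i+1))
      (ccomp C W (trm E i j) (trm E (i+1) j) (dif E i 0 j) x)
    = ccomp C W (trm D i j) (trm D (i+1) j) (dif D i 0 j)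
        (ccomp C W (trm E i j) (trm D i j) (g0 j i) x)"
    if "W \<in> Ob C" "x \<in> Hom C W (trm E i j)" for W x i j
    using Cx_commute_assoc(1)[OF g0 row_Ob[OF E] row_Ob[OF D], of W x j i] that by simp
  have g_chain0: "ccomp C (trm E i j) (trm E (i+1) j) (trm D (i+1) j) (g0 j (i+1)) (dif E i 0 j)
    = ccomp C (trm E i j) (trm D i j) (trm D (i+1) j) (dif D i 0 j) (g0 j i)" for i j
    using Cx_commute(1)[OF g0[of j], of i] by simp
  \<comment> \<open>Inverting f_0 + f_1 + ... formally gives -g_0 f_1 g_0 in degree one; k is this
    term without the sign.\<close>
  define k where "k j i = ccomp C (trm E i j) (trm E i (j+1)) (trm D i (j+1)) (g0 (j+1) i)
      (ccomp C (trm E i j) (trm D i j) (trm E i (j+1)) (f1 j i) (g0 j i))" for i j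
  have k: "k j i \<in> Hom C (trm E i j) (trm D i (j+1))" for i j
    unfolding k_def using Tj m0 f1 by simp
  define g1 where "g1 j i = cneg C (trm E i j) (trm D i (j+1)) (k j i)" for i j
  have g1: "g1 j i \<in> Hom C (trm E i j) (trm D i (j+1))" for i j
    unfolding g1_def using Tj k by simp
  have geq: "cadd C (trm E i j) (trm D (i+1) (j+1))
        (ccomp C (trm E i j) (trm D i j) (trm D (i+1) (j+1)) (dif D i 1 j) (g0 j i))
        (ccomp C (trm E i j) (trm D i (j+1)) (trm D (i+1) (j+1)) (dif D i 0 (j+1)) (g1 j i))
      = cadd C (trm E i j) (trm D (i+1) (j+1))
        (ccomp C (trm E i j) (trm E (i+1) (j+1)) (trm D (i+1) (j+1)) (g0 (j+1) (i+1)) (dif E i 1 j))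
        (ccomp C (trm E i j) (trm E (i+1) j) (trm D (i+1) (j+1)) (g1 j (i+1)) (dif E i 0 j))"
            for i j
  proof -
    let ?p = "cadd C (trm E i j) (trm D (i+1) (j+1))" and ?n = "cneg C (trm E i j)
        (trm D (i+1) (j+1))"
    let ?a = "ccomp C (trm E i j) (trm D i j) (trm D (i+1) (j+1)) (dif D i (Suc 0) j) (g0 j i)"
    let ?b = "ccomp C (trm E i j) (trm D i (j+1)) (trm D (i+1) (j+1)) (dif D i 0 (j+1)) (k j i)"
    let ?c = "ccomp C (trm E i j) (trm E (i+1) (j+1)) (trm D (i+1) (j+1)) (g0 (j+1) (i+1))
        (dif E i (Suc 0) j)"
    let ?e = "ccomp C (trm E i j) (trm E (i+1) j) (trm D (i+1) (j+1)) (k j (i+1)) (dif E i 0 j)"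
    let ?conj = "\<lambda>x. ccomp C (trm E i j) (trm E (i+1) (j+1)) (trm D (i+1) (j+1)) (g0 (j+1) (i+1))
      (ccomp C (trm E i j) (trm D i j) (trm E (i+1) (j+1)) x (g0 j i))"
    have m: "?a \<in> Hom C (trm E i j) (trm D (i+1) (j+1))" "?b \<in> Hom C (trm E i j)
        (trm D (i+1) (j+1))"
      "?c \<in> Hom C (trm E i j) (trm D (i+1) (j+1))" "?e \<in> Hom C (trm E i j) (trm D (i+1) (j+1))"
      using Tj m0 dmem k by simp_all
    \<comment> \<open>Composing \<open>eq\<close> with g_0 on both sides turns the degree-one
      equation for (f_0, f_1) into the one for (g_0, g_1).\<close>
    have "?conj (cadd C (trm D i j) (trm E (i+1) (j+1))
        (ccomp C (trm D i j) (trm E i j) (trm E (i+1) (j+1)) (dif E i (Suc 0) j) (f0 j i))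
        (ccomp C (trm D i j) (trm E i (j+1)) (trm E (i+1) (j+1)) (dif E i 0 (j+1)) (f1 j i))) = ?p
            ?c ?b"
      unfolding k_def using Tj m0 dmem f1 inv by (simp add: comp_distrib g_chain)
    moreover have "?conj (cadd C (trm D i j) (trm E (i+1) (j+1))
        (ccomp C (trm D i j) (trm D (i+1) (j+1)) (trm E (i+1) (j+1)) (f0 (j+1) (i+1))
            (dif D i (Suc 0) j))
        (ccomp C (trm D i j) (trm D (i+1) j) (trm E (i+1) (j+1)) (f1 j (i+1)) (dif D i 0 j))) = ?p
            ?a ?e"
      unfolding k_def using Tj m0 dmem f1[of j i] f1[of j "i+1"] inv'
          by (simp add: comp_distrib g_chain0)
    ultimately have cb: "?p ?c ?b = ?p ?a ?e" using eq[of i j] by simp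
    have "?p ?a (?n ?b) = ?p (?p ?a ?e) (?p (?n ?b) (?n ?e))" using Tj m by (simp add: add_ac)
    also have "\<dots> = ?p ?c (?n ?e)" unfolding cb[symmetric] using Tj m by (simp add: add_assoc)
    finally show ?thesis unfolding g1_def using Tj dmem k by simp
  qed
  obtain g where g: "g \<in> Hom CZ E D" "\<And>j. rowm g j = g0 j"
    by (rule extend_chain_map[OF E D g0 g1 geq]) (use vanED in \<open>auto simp: K_orth_def\<close>)
  show ?thesis by (rule that[OF f g])
qed

text \<open>The row differential of a cone involves g only through g_0. When g_0 vanishes, as it
  does for composites with \<eta>, the row splits as a direct sum of complexes.\<close>

lemma row_cone:
  assumes X: "X \<in> Ob CZ" and Y: "Y \<in> Ob CZ" and g: "g \<in> Hom CZ X Y"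
    and g0: "\<And>i. g i 0 j = czero C (trm X i j) (trm Y i j)"
  shows "row (cone ZC X Y g) j = csum (Cx C) (shift C 1 (row X j)) (row Y j)"
proof -
  have T: "trm X i \<in> Ob ZC" "trm Y i \<in> Ob ZC" for i using X Y by simp_all
  have d: "dif X (i+1) \<in> Hom ZC (trm X (i+1)) (trm X (i+2))" "dif Y i \<in> Hom ZC (trm Y i)
      (trm Y (i+1))"
    "g (i+1) \<in> Hom ZC (trm X (i+1)) (trm Y (i+1))" for i
    using X Y B.Cx_Hom_in[OF g] by simp_all
  have "dif (row (cone ZC X Y g) j) i = dif (csum (Cx C) (shift C 1 (row X j)) (row Y j)) i" for i
    using T d by (simp add: cmat_Zplus Cx_csum g0) (simp add: Zplus_cneg Zplus_czero)
  moreover have "trm (row (cone ZC X Y g) j) i = trm (csum (Cx C) (shift C 1 (row X j)) (row Y j))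
      i" for i
    by (simp add: Cx_csum Zplus_csum)
  ultimately show ?thesis by (intro cplx.expand) (simp add: fun_eq_iff)
qed

end

section \<open>Complexes of graded objects whose rows are shifted objects of Sum-T\<close>

lemma ushift_negc: "ushift m (negc C X) = negc C (ushift m X)"
  by (simp add: ushift_def negc_def int_shift1[of _ m])

lemma ushift_csum: "ushift m (csum (Cx C) X Y) = csum (Cx C) (ushift m X) (ushift m Y)"
  by (simp add: ushift_def Cx_csum int_shift1[of _ m])

context tilting
begin

interpretation B: additive_cat A.ZC by (rule A.Zplus_additive)
interpretation CA: additive_cat "Cx A" by (rule A.Cx_additive)
interpretation BC: additive_cat A.CZ by (rule B.Cx_additive)
interpretation K: additive_ideal "Cx A" "null_homotopic A" by (rule A.null_homotopic_ideal)
interpretation E: additive_ideal A.CZ "eta_null A" by (rule A.eta_null_ideal)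
interpretation S: additive_cat ST by (rule SumT_additive)
interpretation SC: additive_cat CS by (rule S.Cx_additive)
interpretation SK: additive_ideal CS "null_homotopic ST" by (rule S.null_homotopic_ideal)

text \<open>Unshifting by k turns a map from P to Q into a map from an object of Sum-T to an object
  of Sum-T shifted by k - l, which is nonzero.\<close>

lemma graded_orth:
  assumes P: "ushift k P \<in> Ob ST" and Q: "ushift l Q \<in> Ob ST" and kl: "k \<noteq> l"
  shows "K_orth A P Q"
proof -
  have "K_orth A (ushift k P) (ushift (k-l) (ushift l Q))" using SumT_orth[OF P Q, of "k-l"] kl
      by simp
  from A.K_orth_ushift[OF this, of "-k"] show ?thesis by simp
qed

text \<open>The domain of the obstruction arguments. It has to contain not only the \<Theta>(X) but
  also the other ends of the comparison isomorphisms, \<Theta>(X)(1)[1] and the cones of composites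
  with \<eta>; hence the closure properties below.\<close>

definition rows_SumT :: "(('a, 'b) mdl, ('a, 'b) mmap) zcplx \<Rightarrow> bool" where
  "rows_SumT D \<longleftrightarrow> D \<in> Ob A.CZ \<and> (\<forall>j. ushift j (row D j) \<in> Ob ST)"

lemma rows_SumT_Ob: "rows_SumT D \<Longrightarrow> D \<in> Ob A.CZ"
  by (simp add: rows_SumT_def)

lemma rows_SumT_sus:
  assumes D: "rows_SumT D"
  shows "rows_SumT (shift A.ZC 1 (twist D))"
proof -
  have "ushift j (row (shift A.ZC 1 (twist D)) j) = negc A (ushift (j+1) (row D (j+1)))" for j
    by (simp add: A.row_shift A.row_twist) (simp add: shift1_negc ushift_negc)
  then show ?thesis using D SumT_negc by (simp add: rows_SumT_def)
qed

lemma comp_eta_row: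
  assumes D: "D \<in> Ob A.CZ" and E: "E \<in> Ob A.CZ" and f: "f \<in> Hom A.CZ D E"
  shows "ccomp A.CZ (twist D) D E f (eta A D) i 0 j = czero A (trm (twist D) i j) (trm E i j)"
    "ccomp A.CZ (twist D) D E f (eta A D) i (Suc 0) j = f i 0 (j+1)"
  using A.comp_geta[OF B.Cx_trm[OF D] B.Cx_trm[OF E] B.Cx_Hom_in[OF f]] by (simp_all add: Cx_ccomp)

lemma row_cone_eta:
  assumes D: "D \<in> Ob A.CZ" and E: "E \<in> Ob A.CZ" and f: "f \<in> Hom A.CZ D E"
  shows "row (cone A.ZC (twist D) E (ccomp A.CZ (twist D) D E f (eta A D))) j
    = csum (Cx A) (shift A 1 (row D (j+1))) (row E j)"
  using D E f comp_eta_row[OF D E f] by (subst A.row_cone) (simp_all add: A.row_twist)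

lemma rows_SumT_cone:
  assumes D: "rows_SumT D" and E: "rows_SumT E" and f: "f \<in> Hom A.CZ D E"
  shows "rows_SumT (cone A.ZC (twist D) E (ccomp A.CZ (twist D) D E f (eta A D)))"
proof -
  note ob = D[THEN rows_SumT_Ob] E[THEN rows_SumT_Ob]
  have "ushift j (csum (Cx A) (shift A 1 (row D (j+1))) (row E j))
    = csum (Cx A) (negc A (ushift (j+1) (row D (j+1)))) (ushift j (row E j))" for j
    by (simp add: ushift_csum shift1_negc ushift_negc)
  then show ?thesis
    using D E ob f SumT_negc SumT_csum by (simp add: rows_SumT_def row_cone_eta)
qed

lemma rows_SumT_row_null:
  assumes D: "rows_SumT D" and E: "rows_SumT E" and g: "g \<in> Hom A.CZ D E"
    and rows: "\<And>j. null_homotopic A (row D j) (row E j) (rowm g j)"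
  shows "eta_null A D E g"
proof (rule A.eta_null_rows[OF rows_SumT_Ob[OF D] rows_SumT_Ob[OF E] g rows])
  fix n j f
  assume n: "2 \<le> (n::nat)" and f: "f \<in> Hom (Cx A) (row D (j+1)) (row E (j + int n))"
  have "K_orth A (row D (j+1)) (row E (j + int n))"
    by (rule graded_orth[of "j+1" _ "j + int n"]) (use D E n in \<open>auto simp: rows_SumT_def\<close>)
  then show "null_homotopic A (row D (j+1)) (row E (j + int n)) f" using f by (simp add: K_orth_def)
qed

text \<open>The tool for naturality and for the squares of the standard triangles: the class of a
  map in the stable category is determined by the homotopy classes of its rows, where strict
  formulas are available.\<close>

lemma row_cls_eqI:
  assumes D: "rows_SumT D" and E: "rows_SumT E" and f: "f \<in> Hom A.CZ D E" and g: "g \<in> Hom A.CZ D E"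
    and rows: "\<And>j. K.cls (row D j) (row E j) (rowm f j) = K.cls (row D j) (row E j) (rowm g j)"
  shows "E.cls D E f = E.cls D E g"
proof -
  note ob = D[THEN rows_SumT_Ob] E[THEN rows_SumT_Ob]
  have "null_homotopic A (row D j) (row E j) (rowm (cadd A.CZ D E f (cneg A.CZ D E g)) j)" for j
    using rows[of j] ob A.rowm_in[OF f] A.rowm_in[OF g]
    by (simp add: K.cls_eq_iff A.rowm_add A.rowm_neg)
  then have "eta_null A D E (cadd A.CZ D E f (cneg A.CZ D E g))"
    using ob f g by (intro rows_SumT_row_null[OF D E]) simp_all
  then show ?thesis using ob f g by (simp add: E.cls_eq_iff)
qed

lemma SumT_ops: "Hom ST = Hom K.Q" "cid ST = cid K.Q" "ccomp ST = ccomp K.Q"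
  "czero ST = czero K.Q" "cadd ST = cadd K.Q" "cneg ST = cneg K.Q"
  "csum ST = csum (Cx A)" "cin1 ST = cin1 K.Q" "cin2 ST = cin2 K.Q"
  "cpr1 ST = cpr1 K.Q" "cpr2 ST = cpr2 K.Q"
  by (simp_all add: SumT_def K_cat_def)

lemma scx_trm: "X \<in> Ob CS \<Longrightarrow> trm X j \<in> Ob ST"
  "X \<in> Ob CS \<Longrightarrow> trm X j \<in> Ob (Cx A)"
  by (simp_all add: SumT_Ob_Cx)

lemma SumT_rep:
  assumes ob: "X \<in> Ob (Cx A)" "Y \<in> Ob (Cx A)" and F: "F \<in> Hom ST X Y" and f: "f \<in> F"
  shows "f \<in> Hom (Cx A) X Y" "F = K.cls X Y f"
  using K.quot_Hom_rep[OF ob _ f] F by (simp_all add: SumT_ops)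

lemma Theta_objectE:
  assumes X: "X \<in> Ob CS" and D: "is_Theta_object R X D"
  obtains \<delta> where "rows_SumT D" "\<And>j. row D j = ushift (-j) (trm X j)"
    "\<And>i j. trm D i j = trm (trm X j) (i-j)" "\<And>i j. dif D i 0 j = dif (trm X j) (i-j)"
    "\<And>j. \<delta> j \<in> dif X j" "\<And>j. \<delta> j \<in> Hom (Cx A) (trm X j) (trm X (j+1))"
    "\<And>j. dif X j = K.cls (trm X j) (trm X (j+1)) (\<delta> j)"
    "\<And>i j. dif D i (Suc 0) j = cat_sgn A (trm (trm X j) (i-j)) (trm (trm X (j+1)) (i-j)) i
        (\<delta> j (i-j))"
proof -
  obtain \<delta> where d: "D \<in> Ob A.CZ" "\<And>i j. trm D i j = trm (trm X j) (i-j)"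
    "\<And>i j. dif D i 0 j = dif (trm X j) (i-j)" "\<And>j. \<delta> j \<in> dif X j"
    "\<And>i j. dif D i (Suc 0) j = cat_sgn A (trm (trm X j) (i-j)) (trm (trm X (j+1)) (i-j)) i
        (\<delta> j (i-j))"
    using D unfolding is_Theta_object_def by auto
  have row: "row D j = ushift (-j) (trm X j)" for j by (simp add: row_def ushift_def d)
  have "rows_SumT D" using d(1) X by (simp add: rows_SumT_def row scx_trm)
  moreover have "\<delta> j \<in> Hom (Cx A) (trm X j) (trm X (j+1))" "dif X j = K.cls (trm X j) (trm X (j+1))
      (\<delta> j)" for j
    using SumT_rep[OF scx_trm(2)[OF X] scx_trm(2)[OF X] S.Cx_dif(1)[OF X] d(4)] by simp_all
  ultimately show ?thesis using that[of \<delta>] row d by simp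
qed

lemma Theta_mapE:
  assumes X: "X \<in> Ob CS" and Y: "Y \<in> Ob CS"
    and al: "\<alpha> \<in> Hom CS X Y" and f: "is_Theta_map R D E \<alpha> f"
  obtains a where "f \<in> Hom A.CZ D E" "\<And>j. a j \<in> Hom (Cx A) (trm X j) (trm Y j)"
    "\<And>j. \<alpha> j = K.cls (trm X j) (trm Y j) (a j)" "\<And>j. a j \<in> \<alpha> j" "\<And>j. rowm f j
        = (\<lambda>i. a j (i + (-j)))"
    "\<And>i j. f i 0 j = a j (i-j)"
proof -
  obtain a where a: "f \<in> Hom A.CZ D E" "\<And>j. a j \<in> \<alpha> j" "\<And>i j. f i 0 j = a j (i-j)"
    using f unfolding is_Theta_map_def by auto
  have "a j \<in> Hom (Cx A) (trm X j) (trm Y j)" "\<alpha> j = K.cls (trm X j) (trm Y j) (a j)" for j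
    using SumT_rep[OF scx_trm(2)[OF X] scx_trm(2)[OF Y] S.Cx_Hom_in[OF al] a(2)] by simp_all
  moreover have "rowm f j = (\<lambda>i. a j (i + (-j)))" for j by (simp add: fun_eq_iff a)
  ultimately show ?thesis using that[of a] a by simp
qed

lemma ushift_cls:
  assumes ob: "X \<in> Ob (Cx A)" "Y \<in> Ob (Cx A)" and ar: "f \<in> Hom (Cx A) X Y" "g \<in> Hom (Cx A) X Y"
    and eq: "K.cls X Y f = K.cls X Y g"
  shows "K.cls (ushift m X) (ushift m Y) (\<lambda>i. f (i+m)) = K.cls (ushift m X) (ushift m Y)
      (\<lambda>i. g (i+m))"
proof -
  have "null_homotopic A X Y (cadd (Cx A) X Y f (cneg (Cx A) X Y g))"
    using eq ob ar by (simp add: K.cls_eq_iff)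
  from A.null_homotopic_ushift[OF this, of m]
  have "null_homotopic A (ushift m X) (ushift m Y)
      (cadd (Cx A) (ushift m X) (ushift m Y) (\<lambda>i. f (i+m))
      (cneg (Cx A) (ushift m X) (ushift m Y) (\<lambda>i. g (i+m))))"
    by (simp add: Cx_ops)
  then show ?thesis using ob A.ushift_Hom[OF ar(1)] A.ushift_Hom[OF ar(2)]
      by (simp add: K.cls_eq_iff)
qed

section \<open>The triangle functor\<close>

text \<open>The components \<open>s\<^sub>-\<^sub>1\<close> of a null homotopy of \<open>\<Theta>(\<alpha>)\<close> represent, up to sign, a null homotopy
  of \<open>\<alpha>\<close>; the remaining components come from the vanishing of negative self-extensions.\<close>

lemma Theta_map_cls_eq:
  assumes X: "X \<in> Ob CS" and Y: "Y \<in> Ob CS"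
    and D: "is_Theta_object R X D" and E: "is_Theta_object R Y E"
    and al: "\<alpha> \<in> Hom CS X Y" and be: "\<beta> \<in> Hom CS X Y"
    and eq: "SK.cls X Y \<alpha> = SK.cls X Y \<beta>"
    and f: "is_Theta_map R D E \<alpha> f" and g: "is_Theta_map R D E \<beta> g"
  shows "E.cls D E f = E.cls D E g"
proof -
  obtain \<delta> where tD: "rows_SumT D" and rD: "\<And>j. row D j = ushift (-j) (trm X j)"
    and D0: "\<And>i j. trm D i j = trm (trm X j) (i-j)" "\<And>i j. dif D i 0 j = dif (trm X j) (i-j)"
    and dX: "\<And>j. \<delta> j \<in> Hom (Cx A) (trm X j) (trm X (j+1))" "\<And>j. dif X j = K.cls (trm X j)
        (trm X (j+1)) (\<delta> j)"
    and D1: "\<And>i j. dif D i (Suc 0) j = cat_sgn A (trm (trm X j) (i-j)) (trm (trm X (j+1)) (i-j)) i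
        (\<delta> j (i-j))"
    by (rule Theta_objectE[OF X D]) blast
  obtain \<epsilon> where tE: "rows_SumT E" and rE: "\<And>j. row E j = ushift (-j) (trm Y j)"
    and E0: "\<And>i j. trm E i j = trm (trm Y j) (i-j)" "\<And>i j. dif E i 0 j = dif (trm Y j) (i-j)"
    and dY: "\<And>j. \<epsilon> j \<in> Hom (Cx A) (trm Y j) (trm Y (j+1))" "\<And>j. dif Y j = K.cls (trm Y j)
        (trm Y (j+1)) (\<epsilon> j)"
    and E1: "\<And>i j. dif E i (Suc 0) j = cat_sgn A (trm (trm Y j) (i-j)) (trm (trm Y (j+1)) (i-j)) i
        (\<epsilon> j (i-j))"
    by (rule Theta_objectE[OF Y E]) blast
  obtain a where f_in: "f \<in> Hom A.CZ D E" and a: "\<And>j. a j \<in> Hom (Cx A) (trm X j) (trm Y j)"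
    "\<And>j. \<alpha> j = K.cls (trm X j) (trm Y j) (a j)" and fa: "\<And>i j. f i 0 j = a j (i-j)"
    by (rule Theta_mapE[OF X Y al f]) blast
  obtain b where g_in: "g \<in> Hom A.CZ D E" and b: "\<And>j. b j \<in> Hom (Cx A) (trm X j) (trm Y j)"
    "\<And>j. \<beta> j = K.cls (trm X j) (trm Y j) (b j)" and gb: "\<And>i j. g i 0 j = b j (i-j)"
    by (rule Theta_mapE[OF X Y be g]) blast
  note obj = rows_SumT_Ob[OF tD] rows_SumT_Ob[OF tE]
  note trms = scx_trm(2)[OF X] scx_trm(2)[OF Y]
  have "null_homotopic ST X Y (cadd CS X Y \<alpha> (cneg CS X Y \<beta>))"
    using eq X Y al be by (simp add: SK.cls_eq_iff)
  \<comment> \<open>Over Sum-T a null homotopy consists of homotopy classes. After choosing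
    representatives s, its equation holds only up to homotopy, and \<open>\<Phi>\<close> is the
    discrepancy.\<close>
  then obtain \<sigma> where sg: "\<And>j. \<sigma> j \<in> Hom ST (trm X j) (trm Y (j-1))"
    and sge: "cadd CS X Y \<alpha> (cneg CS X Y \<beta>) = boundary ST X Y \<sigma>"
    by (elim null_homotopicE) blast
  have "\<exists>s. s \<in> Hom (Cx A) (trm X j) (trm Y (j-1)) \<and> \<sigma> j = K.cls (trm X j) (trm Y (j-1)) s" for j
    using sg[of j] by (auto simp: SumT_ops elim!: K.quot_HomE)
  then obtain s where s: "\<And>j. s j \<in> Hom (Cx A) (trm X j) (trm Y (j-1))"
    and ss: "\<And>j. \<sigma> j = K.cls (trm X j) (trm Y (j-1)) (s j)" by metis
  have s': "s (j+1) \<in> Hom (Cx A) (trm X (j+1)) (trm Y j)" "s (j+2) \<in> Hom (Cx A) (trm X (j+2))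
      (trm Y (j+1))" for j
    using s[of "j+1"] s[of "j+2"] by simp_all
  have dX': "\<delta> (j+1) \<in> Hom (Cx A) (trm X (j+1)) (trm X (j+2))" for j using dX(1)[of "j+1"] by simp
  define \<Phi> where "\<Phi> j = cadd (Cx A) (trm X (j+1)) (trm Y (j+1))
      (cadd (Cx A) (trm X (j+1)) (trm Y (j+1)) (a (j+1))
          (cneg (Cx A) (trm X (j+1)) (trm Y (j+1)) (b (j+1))))
      (cneg (Cx A) (trm X (j+1)) (trm Y (j+1)) (cadd (Cx A) (trm X (j+1)) (trm Y (j+1))
        (ccomp (Cx A) (trm X (j+1)) (trm Y j) (trm Y (j+1)) (\<epsilon> j) (s (j+1)))
        (ccomp (Cx A) (trm X (j+1)) (trm X (j+2)) (trm Y (j+1)) (s (j+2)) (\<delta> (j+1)))))" for j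
  have Phi: "null_homotopic A (trm X (j+1)) (trm Y (j+1)) (\<Phi> j)" for j
  proof -
    have sY: "dif Y j = K.cls (trm Y j) (trm Y (j+1)) (\<epsilon> j)" "\<sigma> (j+1) = K.cls (trm X (j+1))
        (trm Y j) (s (j+1))"
      "\<sigma> (j+2) = K.cls (trm X (j+2)) (trm Y (j+1)) (s (j+2))"
      "dif X (j+1) = K.cls (trm X (j+1)) (trm X (j+2)) (\<delta> (j+1))"
      using dY(2)[of j] ss[of "j+1"] ss[of "j+2"] dX(2)[of "j+1"] by simp_all
    have "K.cls (trm X (j+1)) (trm Y (j+1)) (cadd (Cx A) (trm X (j+1)) (trm Y (j+1)) (a (j+1))
        (cneg (Cx A) (trm X (j+1)) (trm Y (j+1)) (b (j+1))))
      = K.cls (trm X (j+1)) (trm Y (j+1)) (cadd (Cx A) (trm X (j+1)) (trm Y (j+1))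
        (ccomp (Cx A) (trm X (j+1)) (trm Y j) (trm Y (j+1)) (\<epsilon> j) (s (j+1)))
        (ccomp (Cx A) (trm X (j+1)) (trm X (j+2)) (trm Y (j+1)) (s (j+2)) (\<delta> (j+1))))"
      using fun_cong[OF sge, of "j+1"] trms a[of "j+1"] b[of "j+1"] s' dX' dY(1)[of j]
      by (simp add: Cx_cadd[of ST] Cx_cneg[of ST] boundary_def SumT_ops sY
          K.quot_ccomp K.quot_cadd K.quot_cneg)
    then show ?thesis
      unfolding \<Phi>_def using trms a(1)[of "j+1"] b(1)[of "j+1"] s' dX' dY(1)[of j]
          by (simp add: K.cls_eq_iff)
  qed
  \<comment> \<open>The sign (-1)^{i+1} does two things: it makes p anticommute with d_0, and it
    cancels the signs of d_1 in both products, since (-1)^{i-1}(-1)^{i+1} = 1 and (-1)^{i+2}(-1)^i =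
    1.\<close>
  define p where "p i j = cat_sgn A (trm (trm X (j+1)) (i-j-1)) (trm (trm Y j) (i-j-1)) (i+1)
      (s (j+1) (i-j-1))" for i j
  have idx: "i - (j+1) = i - j - 1" "i - 1 - j = i - j - 1" "i + 1 - (j + 1) = i - j" "i + 1 - j = i
      - j + 1"
    "i + 1 - (j+2) = i - j - 1" for i j :: int
    by simp_all
  have tr: "trm (trm X j) n \<in> Ob A" "trm (trm Y j) n \<in> Ob A" for j n using trms by simp_all
  have sm: "s (j+1) n \<in> Hom A (trm (trm X (j+1)) n) (trm (trm Y j) n)"
    "s (j+2) n \<in> Hom A (trm (trm X (j+2)) n) (trm (trm Y (j+1)) n)"
    "\<delta> (j+1) n \<in> Hom A (trm (trm X (j+1)) n) (trm (trm X (j+2)) n)"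
    "\<epsilon> j n \<in> Hom A (trm (trm Y j) n) (trm (trm Y (j+1)) n)" for j n
    using A.Cx_Hom_in[OF s'(1)] A.Cx_Hom_in[OF s'(2)] A.Cx_Hom_in[OF dX'] A.Cx_Hom_in[OF dY(1)]
        by simp_all
  have dm: "dif (trm Y j) (n-1) \<in> Hom A (trm (trm Y j) (n-1)) (trm (trm Y j) n)"
    "dif (trm X j) (n-1) \<in> Hom A (trm (trm X j) (n-1)) (trm (trm X j) n)" for j n
    using trms by simp_all
  let ?h = "cadd A.CZ D E f (cneg A.CZ D E g)"
  have "eta_null A D E ?h"
  \<comment> \<open>The rows of f - g need not be null-homotopic, since \<alpha> and \<beta> are
    merely homotopic over Sum-T; so a nonzero component of degree -1 is needed here.\<close>
  proof (rule A.eta_null_criterion[OF obj, where p = p])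
    show "?h \<in> Hom A.CZ D E" using obj f_in g_in by simp
    show "p i j \<in> Hom A (trm D i (j+1)) (trm E (i-1) j)" for i j
      unfolding p_def D0 E0 idx using tr sm by simp
    show "cadd A (trm D i (j+1)) (trm E i j)
        (ccomp A (trm D i (j+1)) (trm E (i-1) j) (trm E i j) (dif E (i-1) 0 j) (p i j))
        (ccomp A (trm D i (j+1)) (trm D (i+1) (j+1)) (trm E i j) (p (i+1) j) (dif D i 0 (j+1)))
      = czero A (trm D i (j+1)) (trm E i j)" for i j
    proof -
      have p1: "p (i+1) j = cat_sgn A (trm (trm X (j+1)) (i-j)) (trm (trm Y j) (i-j)) i
          (s (j+1) (i-j))"
        unfolding p_def by (simp add: cat_sgn_def)
      show ?thesis
        unfolding p1 unfolding p_def D0 E0 idx using tr sm dm[of j "i-j"] dm[of "j+1" "i-j"]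
          A.Cx_commute(2)[OF s'(1)[of j], of "i-j"] by simp
    qed
    show "null_homotopic A (row D (j+1)) (row E (j+1))
        (\<lambda>i. cadd A (trm D i (j+1)) (trm E i (j+1)) (?h i 0 (j+1))
            (cneg A (trm D i (j+1)) (trm E i (j+1))
          (cadd A (trm D i (j+1)) (trm E i (j+1))
            (ccomp A (trm D i (j+1)) (trm E (i-1) j) (trm E i (j+1)) (dif E (i-1) 1 j) (p i j))
            (ccomp A (trm D i (j+1)) (trm D (i+1) (j+2)) (trm E i (j+1)) (p (i+1) (j+1))
                (dif D i 1 (j+1))))))" for j
    proof -
      have h0: "?h i 0 (j+1) = cadd A (trm D i (j+1)) (trm E i (j+1)) (a (j+1) (i-j-1))
          (cneg A (trm D i (j+1)) (trm E i (j+1)) (b (j+1) (i-j-1)))" for i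
        by (simp add: Cx_ops Zplus_ops fa gb idx)
      have c1: "ccomp A (trm D i (j+1)) (trm E (i-1) j) (trm E i (j+1)) (dif E (i-1) 1 j) (p i j)
          = ccomp A (trm (trm X (j+1)) (i-j-1)) (trm (trm Y j) (i-j-1)) (trm (trm Y (j+1)) (i-j-1))
              (\<epsilon> j (i-j-1)) (s (j+1) (i-j-1))" for i
        unfolding p_def One_nat_def E1 D0 E0 idx using tr sm by simp
      have p2: "p (i+1) (j+1) = cat_sgn A (trm (trm X (j+2)) (i-j-1)) (trm (trm Y (j+1)) (i-j-1)) i
          (s (j+2) (i-j-1))" for i
        unfolding p_def by (simp add: cat_sgn_def idx)
      have dD1: "dif D i (Suc 0) (j+1) = cat_sgn A (trm (trm X (j+1)) (i-j-1))
          (trm (trm X (j+2)) (i-j-1)) i (\<delta> (j+1) (i-j-1))" for i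
        using D1[of i "j+1"] by (simp add: idx)
      have c2: "ccomp A (trm D i (j+1)) (trm D (i+1) (j+2)) (trm E i (j+1)) (p (i+1) (j+1))
          (dif D i 1 (j+1))
          = ccomp A (trm (trm X (j+1)) (i-j-1)) (trm (trm X (j+2)) (i-j-1))
              (trm (trm Y (j+1)) (i-j-1)) (s (j+2) (i-j-1)) (\<delta> (j+1) (i-j-1))" for i
        unfolding p2 One_nat_def dD1 D0 E0 idx using tr sm by simp
      have e: "i + (-(j+1)) = i - j - 1" for i by simp
      have "null_homotopic A (row D (j+1)) (row E (j+1)) (\<lambda>i. \<Phi> j (i + (-(j+1))))"
        unfolding rD rE by (rule A.null_homotopic_ushift[OF Phi])
      then show ?thesis
        unfolding e h0 c1 c2 by (simp add: \<Phi>_def Cx_ops D0 E0 idx)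
    qed
    show "null_homotopic A (row D (j+1)) (row E (j + int n)) u"
      if "2 \<le> n" "u \<in> Hom (Cx A) (row D (j+1)) (row E (j + int n))" for n j u
      using graded_orth[of "j+1" "row D (j+1)" "j + int n" "row E (j + int n)"] that tD tE
      by (auto simp: rows_SumT_def K_orth_def)
  qed
  then show ?thesis using obj f_in g_in by (simp add: E.cls_eq_iff)
qed

text \<open>The square \<open>sq\<close> may be checked with any representative M of the
  differential of X, in place of the one chosen by \<Theta>. The two differ by a null homotopy,
  which becomes the degree-one component needed to extend the isomorphism of rows.\<close>

lemma Theta_row_iso:
  assumes X: "X \<in> Ob CS" and D: "is_Theta_object R X D" and E: "rows_SumT E"
    and th: "\<And>j. \<theta> j \<in> Hom (Cx A) (row D j) (row E j)" and th': "\<And>j. \<theta>' j \<in> Hom (Cx A) (row E j)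
        (row D j)"
    and inv: "\<And>j. ccomp (Cx A) (row D j) (row E j) (row D j) (\<theta>' j) (\<theta> j) = cid (Cx A) (row D j)"
      "\<And>j. ccomp (Cx A) (row E j) (row D j) (row E j) (\<theta> j) (\<theta>' j) = cid (Cx A) (row E j)"
    and M: "\<And>j. M j \<in> dif X j"
    and sq: "\<And>i j. ccomp A (trm D i j) (trm E i j) (trm E (i+1) (j+1)) (dif E i 1 j) (\<theta> j i)
      = ccomp A (trm D i j) (trm D (i+1) (j+1)) (trm E (i+1) (j+1)) (\<theta> (j+1) (i+1))
          (cat_sgn A (trm D i j) (trm D (i+1) (j+1)) i (M j (i-j)))"
  obtains F where "F \<in> Hom A.CZ D E" "\<And>j. rowm F j = \<theta> j" "cat_iso E.Q D E (E.cls D E F)"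
proof -
  obtain \<delta> where tD: "rows_SumT D" and rD: "\<And>j. row D j = ushift (-j) (trm X j)"
    and D0: "\<And>i j. trm D i j = trm (trm X j) (i-j)" "\<And>i j. dif D i 0 j = dif (trm X j) (i-j)"
    and dX: "\<And>j. \<delta> j \<in> Hom (Cx A) (trm X j) (trm X (j+1))" "\<And>j. dif X j = K.cls (trm X j)
        (trm X (j+1)) (\<delta> j)"
    and D1: "\<And>i j. dif D i (Suc 0) j = cat_sgn A (trm (trm X j) (i-j)) (trm (trm X (j+1)) (i-j)) i
        (\<delta> j (i-j))"
    by (rule Theta_objectE[OF X D]) blast
  note obj = rows_SumT_Ob[OF tD] rows_SumT_Ob[OF E]
  note trms = scx_trm(2)[OF X]
  have Mh: "M j \<in> Hom (Cx A) (trm X j) (trm X (j+1))" "dif X j = K.cls (trm X j) (trm X (j+1))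
      (M j)" for j
    using SumT_rep[OF trms trms S.Cx_dif(1)[OF X] M] by simp_all
  have "null_homotopic A (trm X j) (trm X (j+1))
      (cadd (Cx A) (trm X j) (trm X (j+1)) (\<delta> j) (cneg (Cx A) (trm X j) (trm X (j+1)) (M j)))" for j
    using dX[of j] Mh[of j] trms by (simp add: K.cls_eq_iff[symmetric])
  then have "\<exists>h. (\<forall>n. h n \<in> Hom A (trm (trm X j) n) (trm (trm X (j+1)) (n-1))) \<and>
      cadd (Cx A) (trm X j) (trm X (j+1)) (\<delta> j) (cneg (Cx A) (trm X j) (trm X (j+1)) (M j))
          = boundary A (trm X j) (trm X (j+1)) h" for j
    unfolding null_homotopic_iff by blast
  then obtain h where h: "\<And>j n. h j n \<in> Hom A (trm (trm X j) n) (trm (trm X (j+1)) (n-1))"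
    and hb: "\<And>j. cadd (Cx A) (trm X j) (trm X (j+1)) (\<delta> j)
        (cneg (Cx A) (trm X j) (trm X (j+1)) (M j)) = boundary A (trm X j) (trm X (j+1)) (h j)"
    by metis
  have tr: "trm (trm X j) n \<in> Ob A" for j n using trms by simp
  have trE: "trm E i j \<in> Ob A" for i j using B.Cx_trm[OF obj(2)] by simp
  have idx: "i - (j+1) = i - j - 1" "i + 1 - (j + 1) = i - j" "i + 1 - j = i - j + 1" for i j :: int
    by simp_all
  have tm: "\<theta> j i \<in> Hom A (trm (trm X j) (i-j)) (trm E i j)"
    "\<theta> (j+1) (i+1) \<in> Hom A (trm (trm X (j+1)) (i-j)) (trm E (i+1) (j+1))"
    "\<theta> (j+1) i \<in> Hom A (trm (trm X (j+1)) (i-j-1)) (trm E i (j+1))" for i j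
    using A.Cx_Hom_in[OF th[of j], of i] A.Cx_Hom_in[OF th[of "j+1"], of "i+1"]
        A.Cx_Hom_in[OF th[of "j+1"], of i]
    by (simp_all add: D0 idx)
  have hm: "h j (n+1) \<in> Hom A (trm (trm X j) (n+1)) (trm (trm X (j+1)) n)"
    and Mm: "M j n \<in> Hom A (trm (trm X j) n) (trm (trm X (j+1)) n)"
    and dm: "\<delta> j n \<in> Hom A (trm (trm X j) n) (trm (trm X (j+1)) n)" for j n
    using h[of j "n+1"] A.Cx_Hom_in[OF Mh(1)] A.Cx_Hom_in[OF dX(1)] by simp_all
  have dd: "dif (trm X j) n \<in> Hom A (trm (trm X j) n) (trm (trm X j) (n+1))"
    "dif (trm X j) (n-1) \<in> Hom A (trm (trm X j) (n-1)) (trm (trm X j) n)" for j n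
    using trms by simp_all
  have dE: "dif E i 0 j \<in> Hom A (trm E i j) (trm E (i+1) j)" for i j
    using A.Cx_dif(1)[OF A.row_Ob[OF obj(2)], of j i] by simp
  have dec: "\<delta> j n = cadd A (trm (trm X j) n) (trm (trm X (j+1)) n) (M j n)
     (cadd A (trm (trm X j) n) (trm (trm X (j+1)) n)
       (ccomp A (trm (trm X j) n) (trm (trm X (j+1)) (n-1)) (trm (trm X (j+1)) n)
           (dif (trm X (j+1)) (n-1)) (h j n))
       (ccomp A (trm (trm X j) n) (trm (trm X j) (n+1)) (trm (trm X (j+1)) n) (h j (n+1))
           (dif (trm X j) n)))" for j n
  proof -
    have "cadd A (trm (trm X j) n) (trm (trm X (j+1)) n) (\<delta> j n)
        (cneg A (trm (trm X j) n) (trm (trm X (j+1)) n) (M j n))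
      = cadd A (trm (trm X j) n) (trm (trm X (j+1)) n)
       (ccomp A (trm (trm X j) n) (trm (trm X (j+1)) (n-1)) (trm (trm X (j+1)) n)
           (dif (trm X (j+1)) (n-1)) (h j n))
       (ccomp A (trm (trm X j) n) (trm (trm X j) (n+1)) (trm (trm X (j+1)) n) (h j (n+1))
           (dif (trm X j) n))"
      using fun_cong[OF hb[of j], of n] by (simp add: Cx_ops boundary_def)
    then show ?thesis using A.add_diff_cancel[OF tr tr Mm dm, of j n] by simp
  qed
  \<comment> \<open>The null homotopy h of \<delta> - M, carried over by \<theta>. With the sign
    (-1)^i, which changes from i to i + 1, the terms dh and hd of the difference are absorbed on the
    two sides of \<open>eq\<close>.\<close>
  define f1 where "f1 j i = cat_sgn A (trm D i j) (trm E i (j+1)) i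
     (ccomp A (trm D i j) (trm D i (j+1)) (trm E i (j+1)) (\<theta> (j+1) i) (h j (i-j)))" for i j
  have f1: "f1 j i \<in> Hom A (trm D i j) (trm E i (j+1))" for i j
    unfolding f1_def D0 idx using tr trE tm h by simp
  have eq: "cadd A (trm D i j) (trm E (i+1) (j+1))
        (ccomp A (trm D i j) (trm E i j) (trm E (i+1) (j+1)) (dif E i 1 j) (\<theta> j i))
        (ccomp A (trm D i j) (trm E i (j+1)) (trm E (i+1) (j+1)) (dif E i 0 (j+1)) (f1 j i))
      = cadd A (trm D i j) (trm E (i+1) (j+1))
        (ccomp A (trm D i j) (trm D (i+1) (j+1)) (trm E (i+1) (j+1)) (\<theta> (j+1) (i+1)) (dif D i 1 j))
        (ccomp A (trm D i j) (trm D (i+1) j) (trm E (i+1) (j+1)) (f1 j (i+1)) (dif D i 0 j))"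
            for i j
  proof -
    let ?n = "i - j"
    have chain: "ccomp A (trm (trm X j) ?n) (trm E i (j+1)) (trm E (i+1) (j+1)) (dif E i 0 (j+1))
        (ccomp A (trm (trm X j) ?n) (trm (trm X (j+1)) (?n-1)) (trm E i (j+1)) (\<theta> (j+1) i) (h j ?n))
      = ccomp A (trm (trm X j) ?n) (trm (trm X (j+1)) ?n) (trm E (i+1) (j+1)) (\<theta> (j+1) (i+1))
         (ccomp A (trm (trm X j) ?n) (trm (trm X (j+1)) (?n-1)) (trm (trm X (j+1)) ?n)
             (dif (trm X (j+1)) (?n-1)) (h j ?n))"
      using A.Cx_commute_assoc(1)[OF th[of "j+1"] A.row_Ob[OF obj(1)] A.row_Ob[OF obj(2)] tr, of "h
          j ?n" j ?n i] h[of j ?n]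
      by (simp add: D0 idx)
    have f1': "f1 j (i+1) = cneg A (trm (trm X j) (?n+1)) (trm E (i+1) (j+1))
        (cat_sgn A (trm (trm X j) (?n+1)) (trm E (i+1) (j+1)) i
       (ccomp A (trm (trm X j) (?n+1)) (trm (trm X (j+1)) ?n) (trm E (i+1) (j+1)) (\<theta> (j+1) (i+1))
           (h j (?n+1))))"
      unfolding f1_def D0 idx using tr trE tm hm by simp
    show ?thesis
      unfolding sq f1' unfolding f1_def One_nat_def D1 dec[of j ?n] unfolding D0 idx
      using tr trE tm hm h[of j ?n] Mm dd dE chain by (simp add: A.comp_distrib A.add_ac)
  qed
  have orth: "K_orth A (row D j) (shift A 1 (row E (j + int n)))" "K_orth A (row E j)
      (shift A 1 (row D (j + int n)))"
    if "2 \<le> n" for n j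
  proof -
    \<comment> \<open>The extra shift lowers the offset of row j + n to j + n - 1, which differs
      from j for n \<ge> 2.\<close>
    have "ushift (j + int n - 1) (shift A 1 (row Z (j + int n))) \<in> Ob ST" if "rows_SumT Z" for Z
      using that SumT_negc by (simp add: shift1_negc ushift_negc rows_SumT_def)
    then show "K_orth A (row D j) (shift A 1 (row E (j + int n)))" "K_orth A (row E j)
        (shift A 1 (row D (j + int n)))"
      using tD E that by (auto simp: rows_SumT_def intro!: graded_orth[of j _ "j + int n - 1"])
  qed
  obtain F G where F: "F \<in> Hom A.CZ D E" "\<And>j. rowm F j = \<theta> j"
    and G: "G \<in> Hom A.CZ E D" "\<And>j. rowm G j = \<theta>' j"
    by (rule A.extend_row_iso[OF obj th th' inv f1 eq orth]) auto
  have "cat_iso E.Q D E (E.cls D E F)"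
  proof (rule E.cat_iso_quotI[OF obj F(1) G(1)])
    \<comment> \<open>G and F are strictly inverse on rows, and rows decide equality in the stable
      category.\<close>
    have "E.cls D D (ccomp A.CZ D E D G F) = E.cls D D (cid A.CZ D)"
      by (rule row_cls_eqI[OF tD tD]) (use obj F G inv in \<open>simp_all add: A.rowm_comp A.rowm_id\<close>)
    then show "eta_null A D D (cadd A.CZ D D (ccomp A.CZ D E D G F) (cneg A.CZ D D (cid A.CZ D)))"
      using obj F(1) G(1) by (simp add: E.cls_eq_iff)
    have "E.cls E E (ccomp A.CZ E D E F G) = E.cls E E (cid A.CZ E)"
      by (rule row_cls_eqI[OF E E]) (use obj F G inv in \<open>simp_all add: A.rowm_comp A.rowm_id\<close>)
    then show "eta_null A E E (cadd A.CZ E E (ccomp A.CZ E D E F G) (cneg A.CZ E E (cid A.CZ E)))"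
      using obj F(1) G(1) by (simp add: E.cls_eq_iff)
  qed
  with F show ?thesis by (rule that)
qed

end

lemma cmat_full_sub:
  fixes C :: "('o, 'm) cat"
  shows "cmat (full_sub C S) = cmat C"
  by (simp add: fun_eq_iff cmat_def)

lemma (in additive_cat) cmat_sgn:
  assumes "X \<in> Ob C" "Y \<in> Ob C" "X' \<in> Ob C" "Y' \<in> Ob C"
    "a \<in> Hom C X X'" "b \<in> Hom C Y X'" "c \<in> Hom C X Y'" "d \<in> Hom C Y Y'"
  shows "cat_sgn C (csum C X Y) (csum C X' Y') i (cmat C X Y X' Y' a b c d)
    = cmat C X Y X' Y' (cat_sgn C X X' i a) (cat_sgn C Y X' i b) (cat_sgn C X Y' i c)
        (cat_sgn C Y Y' i d)"
  using assms by (simp add: cat_sgn_def cmat_neg)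

lemma (in additive_cat) sgn_id_inverse:
  assumes "X \<in> Ob (Cx C)"
  shows "ccomp (Cx C) X (negc C X) X (sgn_id C X) (sgn_id C X) = cid (Cx C) X"
    "ccomp (Cx C) (negc C X) X (negc C X) (sgn_id C X) (sgn_id C X) = cid (Cx C) (negc C X)"
  using assms by (simp_all add: Cx_ops sgn_id_def)

lemma (in additive_cat) sgn_id_natural:
  assumes "X \<in> Ob (Cx C)" "Y \<in> Ob (Cx C)" "f \<in> Hom (Cx C) X Y"
  shows "ccomp (Cx C) X Y (negc C Y) (sgn_id C Y) f = ccomp (Cx C) X (negc C X) (negc C Y) f
      (sgn_id C X)"
  using assms Cx_Hom_in[OF assms(3)] by (simp add: Cx_ops sgn_id_def)

locale Theta = tilting R T for R :: "'a ring" and T :: "('a, 'b) mcplx" +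
  fixes Th :: "('a, 'b) scplx \<Rightarrow> (('a, 'b) mdl, ('a, 'b) mmap) zcplx"
    and Thm :: "('a, 'b) scplx \<Rightarrow> ('a, 'b) scplx \<Rightarrow> ('a, 'b) smap \<Rightarrow> ('a, 'b) mmap zmap"
  assumes Theta: "is_Theta R T Th Thm"
begin

interpretation B: additive_cat A.ZC by (rule A.Zplus_additive)
interpretation CA: additive_cat "Cx A" by (rule A.Cx_additive)
interpretation BC: additive_cat A.CZ by (rule B.Cx_additive)
interpretation K: additive_ideal "Cx A" "null_homotopic A" by (rule A.null_homotopic_ideal)
interpretation E: additive_ideal A.CZ "eta_null A" by (rule A.eta_null_ideal)
interpretation S: additive_cat ST by (rule SumT_additive)
interpretation SC: additive_cat CS by (rule S.Cx_additive)
interpretation SK: additive_ideal CS "null_homotopic ST" by (rule S.null_homotopic_ideal)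
interpretation QE: additive_cat E.Q by (rule E.quot_additive)
interpretation QS: additive_cat SK.Q by (rule SK.quot_additive)

abbreviation SX where "SX \<equiv> Ob CS"
abbreviation sus where "sus D \<equiv> shift A.ZC 1 (twist D)"
abbreviation sh where "sh \<equiv> shift ST 1"

section \<open>The induced functor on stable classes\<close>

lemma Th_object: "X \<in> SX \<Longrightarrow> is_Theta_object R X (Th X)"
  and Thm_map: "\<lbrakk>X \<in> SX; Y \<in> SX; \<alpha> \<in> Hom CS X Y\<rbrakk>
    \<Longrightarrow> is_Theta_map R (Th X) (Th Y) \<alpha> (Thm X Y \<alpha>)"
  using Theta by (simp_all add: is_Theta_def)

lemma Th_rows_SumT: "X \<in> SX \<Longrightarrow> rows_SumT (Th X)"
  by (rule Theta_objectE[OF _ Th_object])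

lemma Th_Ob [simp]: "X \<in> SX \<Longrightarrow> Th X \<in> Ob A.CZ"
  by (rule rows_SumT_Ob[OF Th_rows_SumT])

lemma Th_row: "X \<in> SX \<Longrightarrow> row (Th X) j = ushift (-j) (trm X j)"
  by (rule Theta_objectE[OF _ Th_object]) auto

lemma Th_trm: "X \<in> SX \<Longrightarrow> trm (Th X) i j = trm (trm X j) (i-j)"
  by (rule Theta_objectE[OF _ Th_object]) auto

lemma Thm_in [simp]: "\<lbrakk>X \<in> SX; Y \<in> SX; \<alpha> \<in> Hom CS X Y\<rbrakk>
    \<Longrightarrow> Thm X Y \<alpha> \<in> Hom A.CZ (Th X) (Th Y)"
  using Thm_map unfolding is_Theta_map_def by blast

text \<open>A representative of the class is chosen before \<Theta> is applied; \<open>Fm_eq\<close>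
  shows that the choice does not matter.\<close>

definition Fm where
  "Fm X Y F = E.cls (Th X) (Th Y) (Thm X Y (SOME \<alpha>. \<alpha> \<in> F))"

text \<open>Every g that is admissible as a value of \<Theta> on \<alpha> computes the functor, not
  just the value actually chosen. Functoriality and additivity then follow as soon as identities,
  composites and sums of admissible maps are admissible.\<close>

lemma Fm_eq:
  assumes X: "X \<in> SX" and Y: "Y \<in> SX" and al: "\<alpha> \<in> Hom CS X Y"
    and g: "is_Theta_map R (Th X) (Th Y) \<alpha> g"
  shows "Fm X Y (SK.cls X Y \<alpha>) = E.cls (Th X) (Th Y) g"
proof -
  let ?b = "SOME \<beta>. \<beta> \<in> SK.cls X Y \<alpha>"
  have "?b \<in> SK.cls X Y \<alpha>" using SK.self_in_cls[OF X Y al]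
      by (rule someI[of "\<lambda>\<beta>. \<beta> \<in> SK.cls X Y \<alpha>"])
  then have b: "?b \<in> Hom CS X Y" "SK.cls X Y ?b = SK.cls X Y \<alpha>"
    using SK.in_cls_Hom SK.in_cls_eq[OF X Y al] by blast+
  show ?thesis
    unfolding Fm_def
    by (rule Theta_map_cls_eq[OF X Y Th_object[OF X] Th_object[OF Y] b(1) al b(2) Thm_map[OF X Y
        b(1)] g])
qed

lemma Fm_cls: "\<lbrakk>X \<in> SX; Y \<in> SX; \<alpha> \<in> Hom CS X Y\<rbrakk>
    \<Longrightarrow> Fm X Y (SK.cls X Y \<alpha>) = E.cls (Th X) (Th Y) (Thm X Y \<alpha>)"
  by (rule Fm_eq) (simp_all add: Thm_map)

lemma Theta_map_id:
  assumes X: "X \<in> SX"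
  shows "is_Theta_map R (Th X) (Th X) (cid CS X) (cid A.CZ (Th X))"
  unfolding is_Theta_map_def
proof (intro conjI exI allI)
  show "cid A.CZ (Th X) \<in> Hom A.CZ (Th X) (Th X)" using X by simp
  show "cid (Cx A) (trm X j) \<in> cid CS X j" for j
    using scx_trm(2)[OF X] by (simp add: Cx_cid[of ST] SumT_ops K.quot_cid K.self_in_cls)
  show "cid A.CZ (Th X) i 0 j = cid (Cx A) (trm X j) (i-j)" for i j
    by (simp add: Cx_cid Zplus_cid Th_trm[OF X])
qed

lemma Theta_map_comp:
  assumes X: "X \<in> SX" and Y: "Y \<in> SX" and Z: "Z \<in> SX"
    and al: "\<alpha> \<in> Hom CS X Y" and be: "\<beta> \<in> Hom CS Y Z"
    and f: "is_Theta_map R (Th X) (Th Y) \<alpha> f" and g: "is_Theta_map R (Th Y) (Th Z) \<beta> g"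
  shows "is_Theta_map R (Th X) (Th Z) (ccomp CS X Y Z \<beta> \<alpha>) (ccomp A.CZ (Th X) (Th Y) (Th Z) g f)"
proof -
  obtain a where a: "f \<in> Hom A.CZ (Th X) (Th Y)" "\<And>j. a j \<in> Hom (Cx A) (trm X j) (trm Y j)"
    "\<And>j. \<alpha> j = K.cls (trm X j) (trm Y j) (a j)" "\<And>i j. f i 0 j = a j (i-j)"
    by (rule Theta_mapE[OF X Y al f]) blast
  obtain b where b: "g \<in> Hom A.CZ (Th Y) (Th Z)" "\<And>j. b j \<in> Hom (Cx A) (trm Y j) (trm Z j)"
    "\<And>j. \<beta> j = K.cls (trm Y j) (trm Z j) (b j)" "\<And>i j. g i 0 j = b j (i-j)"
    by (rule Theta_mapE[OF Y Z be g]) blast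
  note t = scx_trm(2)[OF X] scx_trm(2)[OF Y] scx_trm(2)[OF Z]
  show ?thesis
    unfolding is_Theta_map_def
  proof (intro conjI exI allI)
    show "ccomp A.CZ (Th X) (Th Y) (Th Z) g f \<in> Hom A.CZ (Th X) (Th Z)"
      using X Y Z a(1) b(1) by simp
    show "ccomp (Cx A) (trm X j) (trm Y j) (trm Z j) (b j) (a j) \<in> ccomp CS X Y Z \<beta> \<alpha> j" for j
      using t a(2)[of j] b(2)[of j]
      by (simp add: Cx_ccomp[of ST] SumT_ops a(3) b(3) K.quot_ccomp K.self_in_cls)
    show "ccomp A.CZ (Th X) (Th Y) (Th Z) g f i 0 j
        = ccomp (Cx A) (trm X j) (trm Y j) (trm Z j) (b j) (a j) (i-j)" for i j
      by (simp add: Cx_ccomp A.Zplus_comp0 Th_trm X Y Z a(4) b(4))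
  qed
qed

lemma Theta_map_add:
  assumes X: "X \<in> SX" and Y: "Y \<in> SX"
    and al: "\<alpha> \<in> Hom CS X Y" and be: "\<beta> \<in> Hom CS X Y"
    and f: "is_Theta_map R (Th X) (Th Y) \<alpha> f" and g: "is_Theta_map R (Th X) (Th Y) \<beta> g"
  shows "is_Theta_map R (Th X) (Th Y) (cadd CS X Y \<alpha> \<beta>) (cadd A.CZ (Th X) (Th Y) f g)"
proof -
  obtain a where a: "f \<in> Hom A.CZ (Th X) (Th Y)" "\<And>j. a j \<in> Hom (Cx A) (trm X j) (trm Y j)"
    "\<And>j. \<alpha> j = K.cls (trm X j) (trm Y j) (a j)" "\<And>i j. f i 0 j = a j (i-j)"
    by (rule Theta_mapE[OF X Y al f]) blast
  obtain b where b: "g \<in> Hom A.CZ (Th X) (Th Y)" "\<And>j. b j \<in> Hom (Cx A) (trm X j) (trm Y j)"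
    "\<And>j. \<beta> j = K.cls (trm X j) (trm Y j) (b j)" "\<And>i j. g i 0 j = b j (i-j)"
    by (rule Theta_mapE[OF X Y be g]) blast
  note t = scx_trm(2)[OF X] scx_trm(2)[OF Y]
  show ?thesis
    unfolding is_Theta_map_def
  proof (intro conjI exI allI)
    show "cadd A.CZ (Th X) (Th Y) f g \<in> Hom A.CZ (Th X) (Th Y)"
      using X Y a(1) b(1) by simp
    show "cadd (Cx A) (trm X j) (trm Y j) (a j) (b j) \<in> cadd CS X Y \<alpha> \<beta> j" for j
      using t a(2)[of j] b(2)[of j]
      by (simp add: Cx_cadd[of ST] SumT_ops a(3) b(3) K.quot_cadd K.self_in_cls)
    show "cadd A.CZ (Th X) (Th Y) f g i 0 j = cadd (Cx A) (trm X j) (trm Y j) (a j) (b j) (i-j)"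
        for i j
      by (simp add: Cx_cadd Zplus_cadd Th_trm X Y a(4) b(4))
  qed
qed

lemma Fm_in: "\<lbrakk>X \<in> SX; Y \<in> SX; F \<in> Hom SK.Q X Y\<rbrakk> \<Longrightarrow> Fm X Y F \<in> Hom E.Q (Th X) (Th Y)"
  by (elim SK.quot_HomE) (simp add: Fm_cls)

lemma Fm_id: "X \<in> SX \<Longrightarrow> Fm X X (cid SK.Q X) = cid E.Q (Th X)"
  using Fm_eq[OF _ _ _ Theta_map_id] by (simp add: SK.quot_cid E.quot_cid)

lemma Fm_comp:
  assumes X: "X \<in> SX" and Y: "Y \<in> SX" and Z: "Z \<in> SX" and F: "F \<in> Hom SK.Q X Y" and G: "G \<in> Hom SK.Q
      Y Z"
  shows "Fm X Z (ccomp SK.Q X Y Z G F) = ccomp E.Q (Th X) (Th Y) (Th Z) (Fm Y Z G) (Fm X Y F)"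
proof -
  obtain \<alpha> where al: "\<alpha> \<in> Hom CS X Y" "F = SK.cls X Y \<alpha>" using F by (rule SK.quot_HomE)
  obtain \<beta> where be: "\<beta> \<in> Hom CS Y Z" "G = SK.cls Y Z \<beta>" using G by (rule SK.quot_HomE)
  show ?thesis
    using Fm_eq[OF X Z _ Theta_map_comp[OF X Y Z al(1) be(1) Thm_map[OF X Y al(1)] Thm_map[OF Y Z
        be(1)]]]
      X Y Z al be by (simp add: SK.quot_ccomp Fm_cls E.quot_ccomp)
qed

lemma Fm_add:
  assumes X: "X \<in> SX" and Y: "Y \<in> SX" and F: "F \<in> Hom SK.Q X Y" and G: "G \<in> Hom SK.Q X Y"
  shows "Fm X Y (cadd SK.Q X Y F G) = cadd E.Q (Th X) (Th Y) (Fm X Y F) (Fm X Y G)"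
proof -
  obtain \<alpha> where al: "\<alpha> \<in> Hom CS X Y" "F = SK.cls X Y \<alpha>" using F by (rule SK.quot_HomE)
  obtain \<beta> where be: "\<beta> \<in> Hom CS X Y" "G = SK.cls X Y \<beta>" using G by (rule SK.quot_HomE)
  show ?thesis
    using Fm_eq[OF X Y _ Theta_map_add[OF X Y al(1) be(1) Thm_map[OF X Y al(1)] Thm_map[OF X Y
        be(1)]]]
      X Y al be by (simp add: SK.quot_cadd Fm_cls E.quot_cadd)
qed

lemma Fm_iso:
  assumes X: "X \<in> SX" and Y: "Y \<in> SX" and F: "cat_iso SK.Q X Y F"
  shows "cat_iso E.Q (Th X) (Th Y) (Fm X Y F)"
proof -
  obtain G where G: "F \<in> Hom SK.Q X Y" "G \<in> Hom SK.Q Y X" "ccomp SK.Q X Y X G F = cid SK.Q X"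
    "ccomp SK.Q Y X Y F G = cid SK.Q Y" using F by (rule QS.cat_isoE)
  show ?thesis
    by (rule QE.cat_isoI[of _ _ _ "Fm Y X G"])
      (use X Y G Fm_in Fm_comp[OF X Y X G(1,2)] Fm_comp[OF Y X Y G(2,1)] in \<open>simp_all add: Fm_id\<close>)
qed

text \<open>\<open>\<Theta>(X[1])\<close> and \<open>\<Theta>(X)(1)[1]\<close> have the same terms; their rows differ by the sign of the
  differential, so \<open>(-1)\<^sup>i\<close> is an isomorphism of rows.\<close>

lemma row_sus:
  assumes X: "X \<in> SX"
  shows "row (sus (Th X)) j = negc A (row (Th (sh X)) j)"
proof -
  have "sh X \<in> SX" using X by simp
  then show ?thesis using X by (simp add: A.row_shift A.row_twist Th_row) (simp add: shift1_negc)
qed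

section \<open>Compatibility with the translation functors\<close>

lemma phi_exists:
  assumes X: "X \<in> SX"
  obtains \<phi> where "\<phi> \<in> Hom A.CZ (Th (sh X)) (sus (Th X))"
    "\<And>j. rowm \<phi> j = sgn_id A (row (Th (sh X)) j)"
    "cat_iso E.Q (Th (sh X)) (sus (Th X)) (E.cls (Th (sh X)) (sus (Th X)) \<phi>)"
proof -
  have sX: "sh X \<in> SX" using X by simp
  obtain \<delta> where dX: "\<And>j. \<delta> j \<in> Hom (Cx A) (trm X j) (trm X (j+1))" "\<And>j. dif X j = K.cls (trm X j)
      (trm X (j+1)) (\<delta> j)"
    and D1: "\<And>i j. dif (Th X) i (Suc 0) j = cat_sgn A (trm (trm X j) (i-j))
        (trm (trm X (j+1)) (i-j)) i (\<delta> j (i-j))"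
    by (rule Theta_objectE[OF X Th_object[OF X]]) blast
  have t: "trm X j \<in> Ob (Cx A)" for j by (rule scx_trm(2)[OF X])
  have tr: "trm (trm X j) n \<in> Ob A" for j n using t by simp
  have d1: "\<delta> (j+1) \<in> Hom (Cx A) (trm X (j+1)) (trm X (j+2))"
    "dif X (j+1) = K.cls (trm X (j+1)) (trm X (j+2)) (\<delta> (j+1))" for j
    using dX[of "j+1"] by simp_all
  have dm: "\<delta> (j+1) n \<in> Hom A (trm (trm X (j+1)) n) (trm (trm X (j+2)) n)" for j n
    using A.Cx_Hom_in[OF d1(1)] .
  \<comment> \<open>X[1] has the differential -d over Sum-T, so the negative of \<delta> represents
    it. In the square both paths reduce to \<delta> without sign.\<close>
  define M where "M j = cneg (Cx A) (trm X (j+1)) (trm X (j+2)) (\<delta> (j+1))" for j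
  let ?D = "Th (sh X)" and ?E = "sus (Th X)"
  have rows: "row ?E j = negc A (row ?D j)" for j by (rule row_sus[OF X])
  have rob: "row ?D j \<in> Ob (Cx A)" for j using sX by simp
  obtain F where "F \<in> Hom A.CZ ?D ?E" "\<And>j. rowm F j = sgn_id A (row ?D j)"
    "cat_iso E.Q ?D ?E (E.cls ?D ?E F)"
  proof (rule Theta_row_iso[OF sX Th_object[OF sX] rows_SumT_sus[OF Th_rows_SumT[OF X]],
        of "\<lambda>j. sgn_id A (row ?D j)" "\<lambda>j. sgn_id A (row ?D j)" M])
    show "M j \<in> dif (sh X) j" for j
      unfolding M_def using t d1[of j] by (simp add: SumT_ops K.quot_cneg K.self_in_cls)
    show "ccomp A (trm ?D i j) (trm ?E i j) (trm ?E (i+1) (j+1)) (dif ?E i 1 j)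
        (sgn_id A (row ?D j) i)
      = ccomp A (trm ?D i j) (trm ?D (i+1) (j+1)) (trm ?E (i+1) (j+1))
          (sgn_id A (row ?D (j+1)) (i+1))
          (cat_sgn A (trm ?D i j) (trm ?D (i+1) (j+1)) i (M j (i-j)))" for i j
    proof -
      have "dif ?E i 1 j = cneg A (trm (trm X (j+1)) (i-j)) (trm (trm X (j+2)) (i-j))
          (cat_sgn A (trm (trm X (j+1)) (i-j)) (trm (trm X (j+2)) (i-j)) (i+1) (\<delta> (j+1) (i-j)))"
        using D1[of "i+1" "j+1"] by (simp add: Zplus_cneg Th_trm X)
      moreover have "trm ?D i j = trm (trm X (j+1)) (i-j)" "trm ?E i j = trm (trm X (j+1)) (i-j)"
        "trm ?E (i+1) (j+1) = trm (trm X (j+2)) (i-j)" "trm ?D (i+1) (j+1) = trm (trm X (j+2))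
            (i-j)"
        using X sX by (simp_all add: Th_trm)
      ultimately show ?thesis
        using tr dm by (simp add: sgn_id_def M_def Cx_cneg)
    qed
  qed (use rob A.sgn_id_in[OF rob] A.sgn_id_inverse[OF rob] in \<open>simp_all add: rows\<close>)
  then show ?thesis by (rule that)
qed

definition phi where
  "phi X = (SOME \<phi>. \<phi> \<in> Hom A.CZ (Th (sh X)) (sus (Th X)) \<and>
    (\<forall>j. rowm \<phi> j = sgn_id A (row (Th (sh X)) j)) \<and>
    cat_iso E.Q (Th (sh X)) (sus (Th X)) (E.cls (Th (sh X)) (sus (Th X)) \<phi>))"

lemma phi:
  assumes X: "X \<in> SX"
  shows "phi X \<in> Hom A.CZ (Th (sh X)) (sus (Th X))"
    "rowm (phi X) j = sgn_id A (row (Th (sh X)) j)"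
    "cat_iso E.Q (Th (sh X)) (sus (Th X)) (E.cls (Th (sh X)) (sus (Th X)) (phi X))"
proof -
  have "\<exists>\<phi>. \<phi> \<in> Hom A.CZ (Th (sh X)) (sus (Th X)) \<and>
    (\<forall>j. rowm \<phi> j = sgn_id A (row (Th (sh X)) j)) \<and>
    cat_iso E.Q (Th (sh X)) (sus (Th X)) (E.cls (Th (sh X)) (sus (Th X)) \<phi>)"
    by (rule phi_exists[OF X]) blast
  from someI_ex[OF this] show "phi X \<in> Hom A.CZ (Th (sh X)) (sus (Th X))"
    "rowm (phi X) j = sgn_id A (row (Th (sh X)) j)"
    "cat_iso E.Q (Th (sh X)) (sus (Th X)) (E.cls (Th (sh X)) (sus (Th X)) (phi X))"
    unfolding phi_def by blast+
qed

definition Phi where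
  "Phi X = E.cls (Th (sh X)) (sus (Th X)) (phi X)"

lemma SusM_cls: "\<lbrakk>X \<in> SX; Y \<in> SX; \<alpha> \<in> Hom CS X Y\<rbrakk>
    \<Longrightarrow> shift_map ` SK.cls X Y \<alpha> = SK.cls (sh X) (sh Y) (shift_map \<alpha>)"
  using S.shift_map_cls by (simp add: htp_cls_def)

lemma sus_E_cls: "\<lbrakk>D \<in> Ob A.CZ; E \<in> Ob A.CZ; f \<in> Hom A.CZ D E\<rbrakk>
    \<Longrightarrow> (shift_map \<circ> twist_map) ` E.cls D E f = E.cls (sus D) (sus E) (shift_map (twist_map f))"
  using A.sus_cls by (simp add: eta_cls_def)

text \<open>On row j both sides are the sign map composed with a representative of \<alpha>^{j+1},
  and sign maps commute with degree-preserving chain maps.\<close>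

lemma Phi_natural:
  assumes X: "X \<in> SX" and Y: "Y \<in> SX" and F: "F \<in> Hom SK.Q X Y"
  shows "ccomp E.Q (Th (sh X)) (Th (sh Y)) (sus (Th Y)) (Phi Y) (Fm (sh X) (sh Y) (shift_map ` F))
    = ccomp E.Q (Th (sh X)) (sus (Th X)) (sus (Th Y)) ((shift_map \<circ> twist_map) ` Fm X Y F) (Phi X)"
proof -
  obtain \<alpha> where al: "\<alpha> \<in> Hom CS X Y" "F = SK.cls X Y \<alpha>" using F by (rule SK.quot_HomE)
  have s: "sh X \<in> SX" "sh Y \<in> SX" using X Y by simp_all
  have sal: "shift_map \<alpha> \<in> Hom CS (sh X) (sh Y)" using X Y al by (simp add: S.shift_Hom_iff)
  let ?f = "Thm X Y \<alpha>" and ?g = "Thm (sh X) (sh Y) (shift_map \<alpha>)"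
  have fin: "?f \<in> Hom A.CZ (Th X) (Th Y)" "?g \<in> Hom A.CZ (Th (sh X)) (Th (sh Y))"
    using X Y s al sal by simp_all
  have sob: "sus (Th X) \<in> Ob A.CZ" "sus (Th Y) \<in> Ob A.CZ" using X Y by simp_all
  have sf: "shift_map (twist_map ?f) \<in> Hom A.CZ (sus (Th X)) (sus (Th Y))"
    using A.sus_Hom_iff[OF Th_Ob[OF X] Th_Ob[OF Y]] fin by simp
  obtain a where a: "\<And>j. a j \<in> Hom (Cx A) (trm X j) (trm Y j)" "\<And>j. \<alpha> j = K.cls (trm X j) (trm Y j)
      (a j)"
    "\<And>i j. ?f i 0 j = a j (i-j)"
    by (rule Theta_mapE[OF X Y al(1) Thm_map[OF X Y al(1)]]) blast
  obtain b where b: "\<And>j. b j \<in> Hom (Cx A) (trm X (j+1)) (trm Y (j+1))"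
    "\<And>j. \<alpha> (j+1) = K.cls (trm X (j+1)) (trm Y (j+1)) (b j)" "\<And>j. rowm ?g j = (\<lambda>i. b j (i + (-j)))"
    by (rule Theta_mapE[OF s sal Thm_map[OF s sal]]) auto
  have "E.cls (Th (sh X)) (sus (Th Y)) (ccomp A.CZ (Th (sh X)) (Th (sh Y)) (sus (Th Y)) (phi Y) ?g)
    = E.cls (Th (sh X)) (sus (Th Y)) (ccomp A.CZ (Th (sh X)) (sus (Th X)) (sus (Th Y))
        (shift_map (twist_map ?f)) (phi X))"
  proof (rule row_cls_eqI[OF Th_rows_SumT[OF s(1)] rows_SumT_sus[OF Th_rows_SumT[OF Y]]])
    show "ccomp A.CZ (Th (sh X)) (Th (sh Y)) (sus (Th Y)) (phi Y) ?g \<in> Hom A.CZ (Th (sh X))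
        (sus (Th Y))"
      "ccomp A.CZ (Th (sh X)) (sus (Th X)) (sus (Th Y)) (shift_map (twist_map ?f)) (phi X)
        \<in> Hom A.CZ (Th (sh X)) (sus (Th Y))"
      using s sob fin sf phi(1)[OF X] phi(1)[OF Y] by simp_all
    fix j
    let ?P = "row (Th (sh X)) j" and ?Q = "row (Th (sh Y)) j"
    have rob: "?P \<in> Ob (Cx A)" "?Q \<in> Ob (Cx A)" using s by simp_all
    have P: "?P = ushift (-j) (trm X (j+1))" "?Q = ushift (-j) (trm Y (j+1))" using s
        by (simp_all add: Th_row)
    \<comment> \<open>\<Theta> may represent \<alpha>^{j+1} by different chain maps in its values on
      \<alpha> and on the shift of \<alpha>; only their homotopy classes agree.\<close>
    have a1: "K.cls (trm X (j+1)) (trm Y (j+1)) (b j) = K.cls (trm X (j+1)) (trm Y (j+1)) (a (j+1))"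
      using a(2)[of "j+1"] b(2)[of j] by simp
    have ra: "rowm (shift_map (twist_map ?f)) j = (\<lambda>i. a (j+1) (i + (-j)))"
      by (simp add: fun_eq_iff a(3))
    have Pa: "(\<lambda>i. a (j+1) (i + (-j))) \<in> Hom (Cx A) ?P ?Q" "(\<lambda>i. b j (i + (-j))) \<in> Hom (Cx A) ?P ?Q"
      unfolding P by (rule A.ushift_Hom[OF a(1)], rule A.ushift_Hom[OF b(1)])
    have eq: "K.cls ?P ?Q (\<lambda>i. b j (i + (-j))) = K.cls ?P ?Q (\<lambda>i. a (j+1) (i + (-j)))"
      unfolding P by (rule ushift_cls[OF scx_trm(2)[OF X] scx_trm(2)[OF Y] b(1) a(1) a1])
    have N: "negc A ?P \<in> Ob (Cx A)" "negc A ?Q \<in> Ob (Cx A)" using rob by simp_all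
    have "K.cls ?P (negc A ?Q) (ccomp (Cx A) ?P ?Q (negc A ?Q) (sgn_id A ?Q) (\<lambda>i. b j (i + (-j))))
      = ccomp K.Q ?P ?Q (negc A ?Q) (K.cls ?Q (negc A ?Q) (sgn_id A ?Q))
          (K.cls ?P ?Q (\<lambda>i. a (j+1) (i + (-j))))"
      unfolding eq[symmetric] using rob N Pa A.sgn_id_in[OF rob(2)] by (simp add: K.quot_ccomp)
    also have "\<dots> = K.cls ?P (negc A ?Q) (ccomp (Cx A) ?P (negc A ?P) (negc A ?Q)
        (\<lambda>i. a (j+1) (i + (-j))) (sgn_id A ?P))"
      using rob N Pa A.sgn_id_in[OF rob(2)] A.sgn_id_natural[OF rob Pa(1)]
          by (simp add: K.quot_ccomp)
    finally show "K.cls ?P (row (sus (Th Y)) j)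
        (rowm (ccomp A.CZ (Th (sh X)) (Th (sh Y)) (sus (Th Y)) (phi Y) ?g) j)
      = K.cls ?P (row (sus (Th Y)) j) (rowm (ccomp A.CZ (Th (sh X)) (sus (Th X)) (sus (Th Y))
          (shift_map (twist_map ?f)) (phi X)) j)"
      unfolding A.rowm_comp phi(2)[OF X] phi(2)[OF Y] b(3) ra row_sus[OF X] row_sus[OF Y] .
  qed
  then show ?thesis
    unfolding al(2) SusM_cls[OF X Y al(1)] Fm_cls[OF X Y al(1)] Fm_cls[OF s sal]
      sus_E_cls[OF Th_Ob[OF X] Th_Ob[OF Y] fin(1)] Phi_def
    using s sob fin sf phi(1)[OF X] phi(1)[OF Y] by (simp add: E.quot_ccomp)
qed

section \<open>Standard triangles\<close>

abbreviation scone where "scone X Y \<alpha> \<equiv> cone ST X Y \<alpha>"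

abbreviation econe where
  "econe D E f \<equiv> cone A.ZC (twist D) E (ccomp A.CZ (twist D) D E f (eta A D))"

definition cone_theta where
  "cone_theta X Y j = cmat (Cx A) (row (Th (sh X)) j) (row (Th Y) j) (negc A (row (Th (sh X)) j))
      (row (Th Y) j)
     (sgn_id A (row (Th (sh X)) j)) (czero (Cx A) (row (Th Y) j) (negc A (row (Th (sh X)) j)))
     (czero (Cx A) (row (Th (sh X)) j) (row (Th Y) j)) (cid (Cx A) (row (Th Y) j))"

text \<open>The inverse of \<open>cone_theta\<close>: the entries are the same, since the sign map
  is its own inverse, but source and target are exchanged.\<close>

definition cone_theta' where
  "cone_theta' X Y j = cmat (Cx A) (negc A (row (Th (sh X)) j)) (row (Th Y) j) (row (Th (sh X)) j)
      (row (Th Y) j)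
     (sgn_id A (row (Th (sh X)) j)) (czero (Cx A) (row (Th Y) j) (row (Th (sh X)) j))
     (czero (Cx A) (negc A (row (Th (sh X)) j)) (row (Th Y) j)) (cid (Cx A) (row (Th Y) j))"

lemma cmat_SumT: "cmat ST = cmat K.Q"
  by (simp add: SumT_def K_cat_def cmat_full_sub)

context
  fixes X Y \<alpha>
  assumes X: "X \<in> SX" and Y: "Y \<in> SX" and al: "\<alpha> \<in> Hom CS X Y"
begin

private lemma sX: "sh X \<in> SX" and Z: "scone X Y \<alpha> \<in> SX"
  using X Y al by simp_all

private lemma f: "Thm X Y \<alpha> \<in> Hom A.CZ (Th X) (Th Y)"
  using X Y al by simp

private lemma rob: "row (Th (sh X)) j \<in> Ob (Cx A)" "row (Th Y) j \<in> Ob (Cx A)"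
    "negc A (row (Th (sh X)) j) \<in> Ob (Cx A)"
  using sX Y by simp_all

private lemma row_Z: "row (Th (scone X Y \<alpha>)) j = csum (Cx A) (row (Th (sh X)) j) (row (Th Y) j)"
  using Z sX Y by (simp add: Th_row SumT_ops ushift_csum)

private lemma row_C: "row (econe (Th X) (Th Y) (Thm X Y \<alpha>)) j
    = csum (Cx A) (negc A (row (Th (sh X)) j)) (row (Th Y) j)"
  using row_cone_eta[OF Th_Ob[OF X] Th_Ob[OF Y] f, of j] row_sus[OF X, of j]
  by (simp add: A.row_shift A.row_twist)

private lemma C: "rows_SumT (econe (Th X) (Th Y) (Thm X Y \<alpha>))"
  by (rule rows_SumT_cone[OF Th_rows_SumT[OF X] Th_rows_SumT[OF Y] f])

private lemma theta_in:
  "cone_theta X Y j \<in> Hom (Cx A) (row (Th (scone X Y \<alpha>)) j)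
      (row (econe (Th X) (Th Y) (Thm X Y \<alpha>)) j)"
  "cone_theta' X Y j \<in> Hom (Cx A) (row (econe (Th X) (Th Y) (Thm X Y \<alpha>)) j)
      (row (Th (scone X Y \<alpha>)) j)"
  unfolding row_Z row_C cone_theta_def cone_theta'_def
  by (rule CA.cmat_in; use rob A.sgn_id_in[OF rob(1)] in simp)+

text \<open>The degree-one differentials match by the following computation. On the side of the
  graded cone it has entries (-1)^i \<delta>, \<alpha> and (-1)^i \<epsilon>; on the side of
  \<Theta> of the cone it is (-1)^i times the matrix with entries -\<delta>, \<alpha> and
  \<epsilon>. Conjugation by diag((-1)^i, 1), whose sign changes with i, identifies the two.\<close>

lemma cone_iso_exists:
  obtains c where "c \<in> Hom A.CZ (Th (scone X Y \<alpha>)) (econe (Th X) (Th Y) (Thm X Y \<alpha>))"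
    "\<And>j. rowm c j = cone_theta X Y j"
    "cat_iso E.Q (Th (scone X Y \<alpha>)) (econe (Th X) (Th Y) (Thm X Y \<alpha>))
      (E.cls (Th (scone X Y \<alpha>)) (econe (Th X) (Th Y) (Thm X Y \<alpha>)) c)"
proof -
  let ?D = "Th (scone X Y \<alpha>)" and ?E = "econe (Th X) (Th Y) (Thm X Y \<alpha>)"
  obtain \<delta> where dX: "\<And>j. \<delta> j \<in> Hom (Cx A) (trm X j) (trm X (j+1))" "\<And>j. dif X j = K.cls (trm X j)
      (trm X (j+1)) (\<delta> j)"
    and D1: "\<And>i j. dif (Th X) i (Suc 0) j = cat_sgn A (trm (trm X j) (i-j))
        (trm (trm X (j+1)) (i-j)) i (\<delta> j (i-j))"
    by (rule Theta_objectE[OF X Th_object[OF X]]) blast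
  obtain \<epsilon> where dY: "\<And>j. \<epsilon> j \<in> Hom (Cx A) (trm Y j) (trm Y (j+1))" "\<And>j. dif Y j = K.cls (trm Y j)
      (trm Y (j+1)) (\<epsilon> j)"
    and E1: "\<And>i j. dif (Th Y) i (Suc 0) j = cat_sgn A (trm (trm Y j) (i-j))
        (trm (trm Y (j+1)) (i-j)) i (\<epsilon> j (i-j))"
    by (rule Theta_objectE[OF Y Th_object[OF Y]]) blast
  obtain a where a: "\<And>j. a j \<in> Hom (Cx A) (trm X j) (trm Y j)" "\<And>j. \<alpha> j = K.cls (trm X j) (trm Y j)
      (a j)"
    "\<And>i j. Thm X Y \<alpha> i 0 j = a j (i-j)"
    by (rule Theta_mapE[OF X Y al Thm_map[OF X Y al]]) blast
  have t: "trm X j \<in> Ob (Cx A)" "trm Y j \<in> Ob (Cx A)" for j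
    by (rule scx_trm(2)[OF X], rule scx_trm(2)[OF Y])
  have tr: "trm (trm X j) n \<in> Ob A" "trm (trm Y j) n \<in> Ob A" for j n using t by simp_all
  have d1: "\<delta> (j+1) \<in> Hom (Cx A) (trm X (j+1)) (trm X (j+2))"
    "dif X (j+1) = K.cls (trm X (j+1)) (trm X (j+2)) (\<delta> (j+1))" for j
    using dX[of "j+1"] by simp_all
  have m: "\<delta> (j+1) n \<in> Hom A (trm (trm X (j+1)) n) (trm (trm X (j+2)) n)"
    "\<epsilon> j n \<in> Hom A (trm (trm Y j) n) (trm (trm Y (j+1)) n)"
    "a (j+1) n \<in> Hom A (trm (trm X (j+1)) n) (trm (trm Y (j+1)) n)" for j n
    using A.Cx_Hom_in[OF d1(1)] A.Cx_Hom_in[OF dY(1)] A.Cx_Hom_in[OF a(1)] by simp_all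
  \<comment> \<open>The differential of the cone over Sum-T, written with the representatives that
    \<Theta> chose for X, Y and \<alpha>; the one chosen for the cone itself may differ from it by a
    homotopy.\<close>
  define M where "M j = cmat (Cx A) (trm X (j+1)) (trm Y j) (trm X (j+2)) (trm Y (j+1))
      (cneg (Cx A) (trm X (j+1)) (trm X (j+2)) (\<delta> (j+1))) (czero (Cx A) (trm Y j) (trm X (j+2)))
      (a (j+1)) (\<epsilon> j)" for j
  obtain c where "c \<in> Hom A.CZ ?D ?E" "\<And>j. rowm c j = cone_theta X Y j"
    "cat_iso E.Q ?D ?E (E.cls ?D ?E c)"
  proof (rule Theta_row_iso[OF Z Th_object[OF Z] C theta_in, of M])
    show "ccomp (Cx A) (row ?D j) (row ?E j) (row ?D j) (cone_theta' X Y j) (cone_theta X Y j) = cid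
        (Cx A) (row ?D j)"
      "ccomp (Cx A) (row ?E j) (row ?D j) (row ?E j) (cone_theta X Y j) (cone_theta' X Y j) = cid
          (Cx A) (row ?E j)" for j
      unfolding row_Z row_C cone_theta_def cone_theta'_def
      using rob A.sgn_id_in[OF rob(1)] by (simp_all add: CA.cmat_comp A.sgn_id_inverse)
    show "M j \<in> dif (scone X Y \<alpha>) j" for j
    proof -
      have "dif (scone X Y \<alpha>) j = K.cls (csum (Cx A) (trm X (j+1)) (trm Y j))
          (csum (Cx A) (trm X (j+2)) (trm Y (j+1))) (M j)"
        unfolding M_def using t d1[of j] dY(1)[of j] a(1)[of "j+1"]
        by (simp add: cmat_SumT SumT_ops a(2) dY(2) K.quot_cneg K.quot_czero K.quot_cmat)
      moreover have "M j \<in> Hom (Cx A) (csum (Cx A) (trm X (j+1)) (trm Y j))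
          (csum (Cx A) (trm X (j+2)) (trm Y (j+1)))"
        unfolding M_def using t d1[of j] dY(1)[of j] a(1)[of "j+1"] by (intro CA.cmat_in) simp_all
      ultimately show ?thesis using t K.self_in_cls by simp
    qed
    show "ccomp A (trm ?D i j) (trm ?E i j) (trm ?E (i+1) (j+1)) (dif ?E i 1 j) (cone_theta X Y j i)
      = ccomp A (trm ?D i j) (trm ?D (i+1) (j+1)) (trm ?E (i+1) (j+1)) (cone_theta X Y (j+1) (i+1))
          (cat_sgn A (trm ?D i j) (trm ?D (i+1) (j+1)) i (M j (i-j)))" for i j
    proof -
      let ?n = "i - j"
      let ?x1 = "trm (trm X (j+1)) ?n" and ?x2 = "trm (trm X (j+2)) ?n"
        and ?y0 = "trm (trm Y j) ?n" and ?y1 = "trm (trm Y (j+1)) ?n"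
      have tD: "trm ?D i j = csum A ?x1 ?y0" "trm ?D (i+1) (j+1) = csum A ?x2 ?y1"
        using Z by (simp_all add: Th_trm SumT_ops Cx_csum)
      have tE: "trm ?E i j = csum A ?x1 ?y0" "trm ?E (i+1) (j+1) = csum A ?x2 ?y1"
        by (simp_all add: Th_trm X Y Zplus_csum)
      have th: "cone_theta X Y j i = cmat A ?x1 ?y0 ?x1 ?y0 (cat_sgn A ?x1 ?x1 i (cid A ?x1))
          (czero A ?y0 ?x1) (czero A ?x1 ?y0) (cid A ?y0)"
        "cone_theta X Y (j+1) (i+1) = cmat A ?x2 ?y1 ?x2 ?y1 (cat_sgn A ?x2 ?x2 (i+1) (cid A ?x2))
          (czero A ?y1 ?x2) (czero A ?x2 ?y1) (cid A ?y1)"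
        by (simp_all only: cone_theta_def cmat_Cx Cx_ops sgn_id_def negc_sel row_sel)
          (simp_all add: Th_trm sX Y)
      have Mn: "M j ?n = cmat A ?x1 ?y0 ?x2 ?y1 (cneg A ?x1 ?x2 (\<delta> (j+1) ?n)) (czero A ?y0 ?x2)
          (a (j+1) ?n) (\<epsilon> j ?n)"
        by (simp add: M_def cmat_Cx Cx_ops)
      have dE: "dif ?E i 1 j = cmat A ?x1 ?y0 ?x2 ?y1
          (cneg A ?x1 ?x2 (cat_sgn A ?x1 ?x2 (i+1) (\<delta> (j+1) ?n))) (czero A ?y0 ?x2) (a (j+1) ?n)
          (cat_sgn A ?y0 ?y1 i (\<epsilon> j ?n))"
      proof -
        have T: "trm (Th X) i \<in> Ob A.ZC" "trm (Th Y) i \<in> Ob A.ZC" for i using X Y by simp_all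
        have g: "ccomp A.CZ (twist (Th X)) (Th X) (Th Y) (Thm X Y \<alpha>) (eta A (Th X)) \<in> Hom A.CZ
            (twist (Th X)) (Th Y)"
          using X Y f by simp
        have d: "gtwm (dif (Th X) (i+1)) \<in> Hom A.ZC (gtw (trm (Th X) (i+1)))
            (gtw (trm (Th X) (i+2)))"
          "dif (Th Y) i \<in> Hom A.ZC (trm (Th Y) i) (trm (Th Y) (i+1))"
          using B.Cx_dif(2)[OF Th_Ob[OF X]] B.Cx_dif(1)[OF Th_Ob[OF Y]] by simp_all
        have g1: "ccomp A.CZ (twist (Th X)) (Th X) (Th Y) (Thm X Y \<alpha>) (eta A (Th X)) (i+1)
            \<in> Hom A.ZC (gtw (trm (Th X) (i+1))) (trm (Th Y) (i+1))"
          using B.Cx_Hom_in[OF g, of "i+1"] by simp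
        \<comment> \<open>The entry \<alpha> appears in degree one because \<eta> raises f_0 to
          component one; this is what makes the cone of f\<eta>, and not of f, the right
          target.\<close>
        have g2: "ccomp A.CZ (twist (Th X)) (Th X) (Th Y) (Thm X Y \<alpha>) (eta A (Th X)) (i+1) (Suc 0) j
            = a (j+1) ?n"
          using comp_eta_row(2)[OF Th_Ob[OF X] Th_Ob[OF Y] f, of "i+1" j] by (simp add: a(3))
        have "dif ?E i 1 j = cmat A (trm (Th X) (i+1) (j+1)) (trm (Th Y) i j)
            (trm (Th X) (i+2) (j+2)) (trm (Th Y) (i+1) (j+1))
          (cneg A.ZC (gtw (trm (Th X) (i+1))) (gtw (trm (Th X) (i+2))) (gtwm (dif (Th X) (i+1))) 1
              j)
          (czero A.ZC (trm (Th Y) i) (gtw (trm (Th X) (i+2))) 1 j)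
          (ccomp A.CZ (twist (Th X)) (Th X) (Th Y) (Thm X Y \<alpha>) (eta A (Th X)) (i+1) 1 j)
          (dif (Th Y) i 1 j)"
          using T d g1 by (simp add: A.cmat_Zplus)
        then show ?thesis
          unfolding One_nat_def g2 E1 by (simp add: Zplus_cneg Zplus_czero D1 Th_trm X Y)
      qed
      show ?thesis
        unfolding tD tE th Mn dE using tr m by (simp add: A.cmat_sgn A.cmat_comp)
    qed
  qed blast
  then show ?thesis by (rule that)
qed

text \<open>On rows the diagonal isomorphism restricts to the identity on the second summand and to
  the sign map on the first. The former gives the square with the inclusions; the latter gives the
  square with the projections, because \<phi> is the same sign map.\<close>

lemma cone_triangle:
  obtains c where "cat_iso E.Q (Th (scone X Y \<alpha>)) (econe (Th X) (Th Y) (Thm X Y \<alpha>)) c"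
    "ccomp E.Q (Th Y) (Th (scone X Y \<alpha>)) (econe (Th X) (Th Y) (Thm X Y \<alpha>)) c
        (Fm Y (scone X Y \<alpha>) (SK.cls Y (scone X Y \<alpha>) (cone_in ST X Y)))
      = E.cls (Th Y) (econe (Th X) (Th Y) (Thm X Y \<alpha>)) (cone_in A.ZC (twist (Th X)) (Th Y))"
    "ccomp E.Q (Th (scone X Y \<alpha>)) (econe (Th X) (Th Y) (Thm X Y \<alpha>)) (sus (Th X))
        (E.cls (econe (Th X) (Th Y) (Thm X Y \<alpha>)) (sus (Th X)) (cone_pr A.ZC (twist (Th X)) (Th Y)))
            c
      = ccomp E.Q (Th (scone X Y \<alpha>)) (Th (sh X)) (sus (Th X)) (Phi X)
          (Fm (scone X Y \<alpha>) (sh X) (SK.cls (scone X Y \<alpha>) (sh X) (cone_pr ST X Y)))"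
proof -
  let ?Z = "scone X Y \<alpha>" and ?C = "econe (Th X) (Th Y) (Thm X Y \<alpha>)"
  let ?P = "\<lambda>j. row (Th (sh X)) j" and ?Q = "\<lambda>j. row (Th Y) j"
  obtain c where c: "c \<in> Hom A.CZ (Th ?Z) ?C" "\<And>j. rowm c j = cone_theta X Y j"
    "cat_iso E.Q (Th ?Z) ?C (E.cls (Th ?Z) ?C c)"
    by (rule cone_iso_exists) blast
  note Cob = rows_SumT_Ob[OF C]
  have t: "trm X j \<in> Ob (Cx A)" "trm Y j \<in> Ob (Cx A)" for j
    by (rule scx_trm(2)[OF X], rule scx_trm(2)[OF Y])
  have susob: "sus (Th X) \<in> Ob A.CZ" using X by simp
  have g: "ccomp A.CZ (twist (Th X)) (Th X) (Th Y) (Thm X Y \<alpha>) (eta A (Th X)) \<in> Hom A.CZ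
      (twist (Th X)) (Th Y)"
    using X Y f by simp
  have v: "cone_in ST X Y \<in> Hom CS Y ?Z" and w: "cone_pr ST X Y \<in> Hom CS ?Z (sh X)"
    using X Y al by simp_all
  have V: "cone_in A.ZC (twist (Th X)) (Th Y) \<in> Hom A.CZ (Th Y) ?C"
    and W: "cone_pr A.ZC (twist (Th X)) (Th Y) \<in> Hom A.CZ ?C (sus (Th X))"
    using X Y g by simp_all
  let ?v = "Thm Y ?Z (cone_in ST X Y)" and ?w = "Thm ?Z (sh X) (cone_pr ST X Y)"
  have vin: "?v \<in> Hom A.CZ (Th Y) (Th ?Z)" and win: "?w \<in> Hom A.CZ (Th ?Z) (Th (sh X))"
    using Y Z sX v w by simp_all
  have P: "?P j = ushift (-j) (trm X (j+1))" "?Q j = ushift (-j) (trm Y j)" for j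
    using sX Y by (simp_all add: Th_row)
  have Ztrm: "trm ?Z j = csum (Cx A) (trm X (j+1)) (trm Y j)" for j by (simp add: SumT_ops)
  obtain p where p: "\<And>j. p j \<in> Hom (Cx A) (trm Y j) (trm ?Z j)" "\<And>j. cone_in ST X Y j = K.cls
      (trm Y j) (trm ?Z j) (p j)"
    "\<And>j. rowm ?v j = (\<lambda>i. p j (i + (-j)))"
    by (rule Theta_mapE[OF Y Z v Thm_map[OF Y Z v]]) blast
  obtain q where q: "\<And>j. q j \<in> Hom (Cx A) (trm ?Z j) (trm X (j+1))" "\<And>j. cone_pr ST X Y j = K.cls
      (trm ?Z j) (trm X (j+1)) (q j)"
    "\<And>j. rowm ?w j = (\<lambda>i. q j (i + (-j)))"
    by (rule Theta_mapE[OF Z sX w Thm_map[OF Z sX w]]) auto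
  \<comment> \<open>The representatives that \<Theta> uses for the inclusion and the projection of
    the cone are only homotopic to the biproduct maps, so the squares are compared between classes
    of rows.\<close>
  have ps: "K.cls (trm Y j) (trm ?Z j) (p j) = K.cls (trm Y j) (trm ?Z j)
      (cin2 (Cx A) (trm X (j+1)) (trm Y j))" for j
    using p(2)[of j] by (simp add: cone_in_def SumT_ops K.quot_cin2)
  have qs: "K.cls (trm ?Z j) (trm X (j+1)) (q j) = K.cls (trm ?Z j) (trm X (j+1))
      (cpr1 (Cx A) (trm X (j+1)) (trm Y j))" for j
    using q(2)[of j] by (simp add: cone_pr_def SumT_ops K.quot_cpr1)
  have vrow: "K.cls (?Q j) (csum (Cx A) (?P j) (?Q j)) (rowm ?v j) = K.cls (?Q j)
      (csum (Cx A) (?P j) (?Q j)) (cin2 (Cx A) (?P j) (?Q j))" for j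
  proof -
    have "(\<lambda>i. cin2 (Cx A) (trm X (j+1)) (trm Y j) (i + (-j))) = cin2 (Cx A) (?P j) (?Q j)"
      by (simp add: P Cx_cin2)
    then show ?thesis
      using ushift_cls[OF t(2) _ p(1) _ ps, of j "-j"] t CA.in2_in[OF t(1)[of "j+1"] t(2)[of j]]
      by (simp only: p(3) P ushift_csum[symmetric] Ztrm CA.sum_ob)
  qed
  have wrow: "K.cls (csum (Cx A) (?P j) (?Q j)) (?P j) (rowm ?w j) = K.cls
      (csum (Cx A) (?P j) (?Q j)) (?P j) (cpr1 (Cx A) (?P j) (?Q j))" for j
  proof -
    have "(\<lambda>i. cpr1 (Cx A) (trm X (j+1)) (trm Y j) (i + (-j))) = cpr1 (Cx A) (?P j) (?Q j)"
      by (simp add: P Cx_cpr1)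
    then show ?thesis
      using ushift_cls[OF _ t(1) q(1) _ qs, of j "-j"] t CA.pr1_in[OF t(1)[of "j+1"] t(2)[of j]]
      by (simp only: q(3) P ushift_csum[symmetric] Ztrm CA.sum_ob)
  qed
  have pin: "rowm ?v j \<in> Hom (Cx A) (?Q j) (csum (Cx A) (?P j) (?Q j))"
    "rowm ?w j \<in> Hom (Cx A) (csum (Cx A) (?P j) (?Q j)) (?P j)" for j
    using A.rowm_in[OF vin] A.rowm_in[OF win] by (simp_all add: row_Z)
  have Vrow: "rowm (cone_in A.ZC (twist (Th X)) (Th Y)) j = cin2 (Cx A) (negc A (?P j)) (?Q j)"
      for j
    by (simp add: fun_eq_iff cone_in_def Zplus_cin2 Cx_cin2 Th_trm X sX)
  have Wrow: "rowm (cone_pr A.ZC (twist (Th X)) (Th Y)) j = cpr1 (Cx A) (negc A (?P j)) (?Q j)"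
      for j
    by (simp add: fun_eq_iff cone_pr_def Zplus_cpr1 Cx_cpr1 Th_trm X sX)
  have th: "cone_theta X Y j \<in> Hom (Cx A) (csum (Cx A) (?P j) (?Q j))
      (csum (Cx A) (negc A (?P j)) (?Q j))" for j
    using theta_in(1)[of j] by (simp add: row_Z row_C)
  have ob2: "csum (Cx A) (?P j) (?Q j) \<in> Ob (Cx A)" "csum (Cx A) (negc A (?P j)) (?Q j) \<in> Ob (Cx A)"
      for j
    using rob by simp_all
  have 1: "E.cls (Th Y) ?C (ccomp A.CZ (Th Y) (Th ?Z) ?C c ?v) = E.cls (Th Y) ?C
      (cone_in A.ZC (twist (Th X)) (Th Y))"
  proof (rule row_cls_eqI[OF Th_rows_SumT[OF Y] C _ V])
    show "ccomp A.CZ (Th Y) (Th ?Z) ?C c ?v \<in> Hom A.CZ (Th Y) ?C"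
      using Y Z Cob c(1) vin by simp
    fix j
    have "K.cls (?Q j) (csum (Cx A) (negc A (?P j)) (?Q j))
        (ccomp (Cx A) (?Q j) (csum (Cx A) (?P j) (?Q j)) (csum (Cx A) (negc A (?P j)) (?Q j))
        (cone_theta X Y j) (rowm ?v j))
      = ccomp K.Q (?Q j) (csum (Cx A) (?P j) (?Q j)) (csum (Cx A) (negc A (?P j)) (?Q j))
          (K.cls (csum (Cx A) (?P j) (?Q j)) (csum (Cx A) (negc A (?P j)) (?Q j))
              (cone_theta X Y j))
          (K.cls (?Q j) (csum (Cx A) (?P j) (?Q j)) (cin2 (Cx A) (?P j) (?Q j)))"
      unfolding vrow[symmetric] using rob ob2 th pin by (simp add: K.quot_ccomp)
    also have "\<dots> = K.cls (?Q j) (csum (Cx A) (negc A (?P j)) (?Q j))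
        (cin2 (Cx A) (negc A (?P j)) (?Q j))"
    proof -
      have "ccomp (Cx A) (?Q j) (csum (Cx A) (?P j) (?Q j)) (csum (Cx A) (negc A (?P j)) (?Q j))
          (cone_theta X Y j) (cin2 (Cx A) (?P j) (?Q j))
        = cin2 (Cx A) (negc A (?P j)) (?Q j)"
        unfolding cone_theta_def using rob A.sgn_id_in[OF rob(1)] by (simp add: CA.cmat_in2)
      then show ?thesis using rob ob2 th by (simp add: K.quot_ccomp)
    qed
    finally show "K.cls (?Q j) (row ?C j) (rowm (ccomp A.CZ (Th Y) (Th ?Z) ?C c ?v) j)
      = K.cls (?Q j) (row ?C j) (rowm (cone_in A.ZC (twist (Th X)) (Th Y)) j)"
      unfolding A.rowm_comp row_Z row_C c(2) Vrow .
  qed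
  have 2: "E.cls (Th ?Z) (sus (Th X)) (ccomp A.CZ (Th ?Z) ?C (sus (Th X))
      (cone_pr A.ZC (twist (Th X)) (Th Y)) c)
    = E.cls (Th ?Z) (sus (Th X)) (ccomp A.CZ (Th ?Z) (Th (sh X)) (sus (Th X)) (phi X) ?w)"
  proof (rule row_cls_eqI[OF Th_rows_SumT[OF Z] rows_SumT_sus[OF Th_rows_SumT[OF X]]])
    show "ccomp A.CZ (Th ?Z) ?C (sus (Th X)) (cone_pr A.ZC (twist (Th X)) (Th Y)) c \<in> Hom A.CZ
        (Th ?Z) (sus (Th X))"
      "ccomp A.CZ (Th ?Z) (Th (sh X)) (sus (Th X)) (phi X) ?w \<in> Hom A.CZ (Th ?Z) (sus (Th X))"
      using Z sX susob Cob c(1) W win phi(1)[OF X] by simp_all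
    fix j
    note sg = A.sgn_id_in(1)[OF rob(1)]
    have "K.cls (csum (Cx A) (?P j) (?Q j)) (negc A (?P j))
        (ccomp (Cx A) (csum (Cx A) (?P j) (?Q j)) (?P j) (negc A (?P j)) (sgn_id A (?P j))
        (rowm ?w j))
      = ccomp K.Q (csum (Cx A) (?P j) (?Q j)) (?P j) (negc A (?P j))
          (K.cls (?P j) (negc A (?P j)) (sgn_id A (?P j)))
          (K.cls (csum (Cx A) (?P j) (?Q j)) (?P j) (cpr1 (Cx A) (?P j) (?Q j)))"
      unfolding wrow[symmetric] using rob ob2 sg pin by (simp add: K.quot_ccomp)
    also have "\<dots> = K.cls (csum (Cx A) (?P j) (?Q j)) (negc A (?P j))
        (ccomp (Cx A) (csum (Cx A) (?P j) (?Q j))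
        (csum (Cx A) (negc A (?P j)) (?Q j)) (negc A (?P j)) (cpr1 (Cx A) (negc A (?P j)) (?Q j))
            (cone_theta X Y j))"
      unfolding cone_theta_def using rob ob2 sg by (simp add: K.quot_ccomp CA.pr1_cmat)
    finally show "K.cls (row (Th ?Z) j) (row (sus (Th X)) j)
        (rowm (ccomp A.CZ (Th ?Z) ?C (sus (Th X)) (cone_pr A.ZC (twist (Th X)) (Th Y)) c) j)
      = K.cls (row (Th ?Z) j) (row (sus (Th X)) j)
          (rowm (ccomp A.CZ (Th ?Z) (Th (sh X)) (sus (Th X)) (phi X) ?w) j)"
      unfolding A.rowm_comp row_Z row_C row_sus[OF X] c(2) Wrow phi(2)[OF X] by (rule sym)
  qed
  show ?thesis
  proof (rule that[OF c(3)])
    show "ccomp E.Q (Th Y) (Th ?Z) ?C (E.cls (Th ?Z) ?C c) (Fm Y ?Z (SK.cls Y ?Z (cone_in ST X Y)))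
      = E.cls (Th Y) ?C (cone_in A.ZC (twist (Th X)) (Th Y))"
      using Y Z Cob v vin c(1) 1 by (simp add: Fm_cls E.quot_ccomp)
    show "ccomp E.Q (Th ?Z) ?C (sus (Th X)) (E.cls ?C (sus (Th X))
        (cone_pr A.ZC (twist (Th X)) (Th Y))) (E.cls (Th ?Z) ?C c)
      = ccomp E.Q (Th ?Z) (Th (sh X)) (sus (Th X)) (Phi X)
          (Fm ?Z (sh X) (SK.cls ?Z (sh X) (cone_pr ST X Y)))"
      unfolding Fm_cls[OF Z sX w] Phi_def using Z sX susob Cob c(1) W win phi(1)[OF X] 2
          by (simp add: E.quot_ccomp)
  qed
qed

end

section \<open>Distinguished triangles\<close>

lemma K_tri_sel: "Ob (K_tri ST) = SX" "Hom (K_tri ST) = Hom SK.Q"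
  "cid (K_tri ST) = cid SK.Q" "ccomp (K_tri ST) = ccomp SK.Q"
  "cadd (K_tri ST) = cadd SK.Q" "Sus (K_tri ST) = sh"
  "SusM (K_tri ST) = (\<lambda>X Y F. shift_map ` F)"
  by (simp_all add: K_tri_def K_cat_def)

lemma K_eta_sel: "Ob (K_eta A) = Ob A.CZ" "Hom (K_eta A) = Hom E.Q"
  "cid (K_eta A) = cid E.Q" "ccomp (K_eta A) = ccomp E.Q"
  "cadd (K_eta A) = cadd E.Q" "Sus (K_eta A) = sus"
  "SusM (K_eta A) = (\<lambda>X Y F. (shift_map \<circ> twist_map) ` F)"
  by (simp_all add: K_eta_def)

lemma cat_iso_tri: "cat_iso (K_eta A) = cat_iso E.Q"
  by (simp add: fun_eq_iff cat_iso_def K_eta_sel)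

lemma Fm_additive: "additive_functor (K_tri ST) (K_eta A) Th Fm"
  unfolding additive_functor_def K_tri_sel K_eta_sel
  by (simp add: Fm_id Fm_in Fm_comp Fm_add)

lemma Tri_K_triE:
  assumes "(X, Y, Z, u, v, w) \<in> Tri (K_tri ST)"
  obtains X' Y' \<alpha> a b c where "X \<in> SX" "Y \<in> SX" "Z \<in> SX" "u \<in> Hom SK.Q X Y" "v \<in> Hom SK.Q Y Z"
    "w \<in> Hom SK.Q Z (sh X)" "X' \<in> SX" "Y' \<in> SX" "\<alpha> \<in> Hom CS X' Y'"
    "cat_iso SK.Q X X' a" "cat_iso SK.Q Y Y' b" "cat_iso SK.Q Z (scone X' Y' \<alpha>) c"
    "ccomp SK.Q X Y Y' b u = ccomp SK.Q X X' Y' (SK.cls X' Y' \<alpha>) a"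
    "ccomp SK.Q Y Z (scone X' Y' \<alpha>) c v
      = ccomp SK.Q Y Y' (scone X' Y' \<alpha>) (SK.cls Y' (scone X' Y' \<alpha>) (cone_in ST X' Y')) b"
    "ccomp SK.Q Z (sh X) (sh X') (shift_map ` a) w
      = ccomp SK.Q Z (scone X' Y' \<alpha>) (sh X') (SK.cls (scone X' Y' \<alpha>) (sh X') (cone_pr ST X' Y')) c"
proof -
  show ?thesis
    using assms unfolding K_tri_def mk_tricat_def K_cat_def htp_cls_def
    by (auto simp: cat.extend_def intro: that)
qed

lemma Tri_K_etaI:
  assumes "X \<in> Ob A.CZ" "Y \<in> Ob A.CZ" "Z \<in> Ob A.CZ"
    "u \<in> Hom E.Q X Y" "v \<in> Hom E.Q Y Z" "w \<in> Hom E.Q Z (sus X)"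
    "X' \<in> Ob A.CZ" "Y' \<in> Ob A.CZ" "f \<in> Hom A.CZ X' Y'"
    "cat_iso E.Q X X' a" "cat_iso E.Q Y Y' b" "cat_iso E.Q Z (econe X' Y' f) c"
    "ccomp E.Q X Y Y' b u = ccomp E.Q X X' Y' (E.cls X' Y' f) a"
    "ccomp E.Q Y Z (econe X' Y' f) c v
      = ccomp E.Q Y Y' (econe X' Y' f) (E.cls Y' (econe X' Y' f) (cone_in A.ZC (twist X') Y')) b"
    "ccomp E.Q Z (sus X) (sus X') ((shift_map \<circ> twist_map) ` a) w
      = ccomp E.Q Z (econe X' Y' f) (sus X') (E.cls (econe X' Y' f) (sus X')
          (cone_pr A.ZC (twist X') Y')) c"
  shows "(X, Y, Z, u, v, w) \<in> Tri (K_eta A)"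
proof -
  let ?St = "{(X, Y, Z, u, v, w). X \<in> Ob A.CZ \<and> Y \<in> Ob A.CZ \<and>
        (\<exists>f \<in> Hom A.CZ X Y.
          Z = econe X Y f \<and> u = eta_cls A X Y f \<and>
          v = eta_cls A Y Z (cone_in A.ZC (twist X) Y) \<and>
          w = eta_cls A Z (sus X) (cone_pr A.ZC (twist X) Y))}"
  have "(X', Y', econe X' Y' f, E.cls X' Y' f, E.cls Y' (econe X' Y' f)
      (cone_in A.ZC (twist X') Y'),
      E.cls (econe X' Y' f) (sus X') (cone_pr A.ZC (twist X') Y')) \<in> ?St"
    using assms by (auto simp: eta_cls_def)
  then have "\<exists>X' Y' Z' u' v' w' a b c. (X', Y', Z', u', v', w') \<in> ?St \<and>
      cat_iso E.Q X X' a \<and> cat_iso E.Q Y Y' b \<and> cat_iso E.Q Z Z' c \<and>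
      ccomp E.Q X Y Y' b u = ccomp E.Q X X' Y' u' a \<and>
      ccomp E.Q Y Z Z' c v = ccomp E.Q Y Y' Z' v' b \<and>
      ccomp E.Q Z (sus X) (sus X') ((shift_map \<circ> twist_map) ` a) w = ccomp E.Q Z Z' (sus X') w' c"
    using assms(10-15) by blast
  then show ?thesis
    using assms(1-6) unfolding K_eta_def mk_tricat_def by (simp add: cat.extend_def)
qed

text \<open>The functor carries the isomorphism with a standard triangle to an isomorphism with the
  image of that triangle; composing its third component with the comparison isomorphism of cones
  reaches a standard triangle of the stable category.\<close>

lemma Fm_triangle:
  assumes tri: "(X, Y, Z, u, v, w) \<in> Tri (K_tri ST)"
  shows "(Th X, Th Y, Th Z, Fm X Y u, Fm Y Z v,
    ccomp E.Q (Th Z) (Th (sh X)) (sus (Th X)) (Phi X) (Fm Z (sh X) w)) \<in> Tri (K_eta A)"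
proof -
  obtain X' Y' \<alpha> a b c where ob: "X \<in> SX" "Y \<in> SX" "Z \<in> SX" and u: "u \<in> Hom SK.Q X Y" and v: "v \<in>
      Hom SK.Q Y Z"
    and w: "w \<in> Hom SK.Q Z (sh X)" and ob': "X' \<in> SX" "Y' \<in> SX" and al: "\<alpha> \<in> Hom CS X' Y'"
    and a: "cat_iso SK.Q X X' a" and b: "cat_iso SK.Q Y Y' b" and c: "cat_iso SK.Q Z (scone X' Y' \<alpha>)
        c"
    and sq1: "ccomp SK.Q X Y Y' b u = ccomp SK.Q X X' Y' (SK.cls X' Y' \<alpha>) a"
    and sq2: "ccomp SK.Q Y Z (scone X' Y' \<alpha>) c v
      = ccomp SK.Q Y Y' (scone X' Y' \<alpha>) (SK.cls Y' (scone X' Y' \<alpha>) (cone_in ST X' Y')) b"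
    and sq3: "ccomp SK.Q Z (sh X) (sh X') (shift_map ` a) w
      = ccomp SK.Q Z (scone X' Y' \<alpha>) (sh X') (SK.cls (scone X' Y' \<alpha>) (sh X') (cone_pr ST X' Y')) c"
    by (rule Tri_K_triE[OF tri]) blast
  let ?Z = "scone X' Y' \<alpha>" and ?C = "econe (Th X') (Th Y') (Thm X' Y' \<alpha>)"
  let ?v = "SK.cls Y' ?Z (cone_in ST X' Y')" and ?w = "SK.cls ?Z (sh X') (cone_pr ST X' Y')"
  have Z': "?Z \<in> SX" and s: "sh X \<in> SX" "sh X' \<in> SX" using ob ob' al by simp_all
  have vw: "?v \<in> Hom SK.Q Y' ?Z" "?w \<in> Hom SK.Q ?Z (sh X')" using ob' al by simp_all
  have ar: "a \<in> Hom SK.Q X X'" "b \<in> Hom SK.Q Y Y'" "c \<in> Hom SK.Q Z ?Z"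
    using a b c by (simp_all add: cat_iso_def)
  have f: "Thm X' Y' \<alpha> \<in> Hom A.CZ (Th X') (Th Y')" using ob' al by simp
  have Cob: "?C \<in> Ob A.CZ" using ob' f by simp
  have sob: "sus (Th X) \<in> Ob A.CZ" "sus (Th X') \<in> Ob A.CZ" using ob ob' by simp_all
  have sa: "shift_map ` a \<in> Hom SK.Q (sh X) (sh X')"
    using ar(1) ob ob' by (elim SK.quot_HomE) (simp add: SusM_cls S.shift_Hom_iff)
  have sFa: "(shift_map \<circ> twist_map) ` Fm X X' a \<in> Hom E.Q (sus (Th X)) (sus (Th X'))"
  proof -
    obtain g where g: "g \<in> Hom A.CZ (Th X) (Th X')" "Fm X X' a = E.cls (Th X) (Th X') g"
      using Fm_in[OF ob(1) ob'(1) ar(1)] by (rule E.quot_HomE)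
    show ?thesis
      unfolding g(2) sus_E_cls[OF Th_Ob[OF ob(1)] Th_Ob[OF ob'(1)] g(1)]
      using g(1) ob ob' by (intro E.cls_in_Hom) (simp add: A.sus_Hom_iff)
  qed
  have Ph: "Phi X \<in> Hom E.Q (Th (sh X)) (sus (Th X))" "Phi X' \<in> Hom E.Q (Th (sh X')) (sus (Th X'))"
    using phi(1)[OF ob(1)] phi(1)[OF ob'(1)] by (simp_all add: Phi_def)
  obtain e where e: "cat_iso E.Q (Th ?Z) ?C e"
    and e1: "ccomp E.Q (Th Y') (Th ?Z) ?C e (Fm Y' ?Z ?v) = E.cls (Th Y') ?C
        (cone_in A.ZC (twist (Th X')) (Th Y'))"
    and e2: "ccomp E.Q (Th ?Z) ?C (sus (Th X'))
        (E.cls ?C (sus (Th X')) (cone_pr A.ZC (twist (Th X')) (Th Y'))) e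
      = ccomp E.Q (Th ?Z) (Th (sh X')) (sus (Th X')) (Phi X') (Fm ?Z (sh X') ?w)"
    by (rule cone_triangle[OF ob' al]) blast
  have ein: "e \<in> Hom E.Q (Th ?Z) ?C" using e by (simp add: cat_iso_def)
  let ?W = "E.cls ?C (sus (Th X')) (cone_pr A.ZC (twist (Th X')) (Th Y'))"
  have W: "?W \<in> Hom E.Q ?C (sus (Th X'))" using ob' f by simp
  have Fi: "Fm X Y u \<in> Hom E.Q (Th X) (Th Y)" "Fm Y Z v \<in> Hom E.Q (Th Y) (Th Z)"
    "Fm Z (sh X) w \<in> Hom E.Q (Th Z) (Th (sh X))" "Fm X X' a \<in> Hom E.Q (Th X) (Th X')"
    "Fm Y Y' b \<in> Hom E.Q (Th Y) (Th Y')" "Fm Z ?Z c \<in> Hom E.Q (Th Z) (Th ?Z)"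
    "Fm Y' ?Z ?v \<in> Hom E.Q (Th Y') (Th ?Z)" "Fm ?Z (sh X') ?w \<in> Hom E.Q (Th ?Z) (Th (sh X'))"
    "Fm (sh X) (sh X') (shift_map ` a) \<in> Hom E.Q (Th (sh X)) (Th (sh X'))"
    using ob ob' Z' s u v w ar vw sa by (simp_all add: Fm_in)
  have Eob: "Th X \<in> Ob E.Q" "Th Y \<in> Ob E.Q" "Th Z \<in> Ob E.Q" "Th X' \<in> Ob E.Q" "Th Y' \<in> Ob E.Q" "Th ?Z
      \<in> Ob E.Q"
    "?C \<in> Ob E.Q" "sus (Th X) \<in> Ob E.Q" "sus (Th X') \<in> Ob E.Q" "Th (sh X) \<in> Ob E.Q" "Th (sh X') \<in> Ob
        E.Q"
    unfolding E.quot_Ob by (fact Th_Ob[OF ob(1)] Th_Ob[OF ob(2)] Th_Ob[OF ob(3)] Th_Ob[OF ob'(1)]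
        Th_Ob[OF ob'(2)] Th_Ob[OF Z'] Cob sob Th_Ob[OF s(1)] Th_Ob[OF s(2)])+
  show ?thesis
  proof (rule Tri_K_etaI[OF Th_Ob Th_Ob Th_Ob Fi(1,2) _ Th_Ob Th_Ob f])
    show "ccomp E.Q (Th Z) (Th (sh X)) (sus (Th X)) (Phi X) (Fm Z (sh X) w) \<in> Hom E.Q (Th Z)
        (sus (Th X))"
      by (rule QE.comp_in) (fact Eob Ph Fi)+
    show "cat_iso E.Q (Th X) (Th X') (Fm X X' a)" "cat_iso E.Q (Th Y) (Th Y') (Fm Y Y' b)"
      using ob ob' a b by (simp_all add: Fm_iso)
    show "cat_iso E.Q (Th Z) ?C (ccomp E.Q (Th Z) (Th ?Z) ?C e (Fm Z ?Z c))"
      by (rule QE.cat_iso_comp) (fact Eob Fm_iso[OF ob(3) Z' c] e)+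
    show "ccomp E.Q (Th X) (Th Y) (Th Y') (Fm Y Y' b) (Fm X Y u)
      = ccomp E.Q (Th X) (Th X') (Th Y') (E.cls (Th X') (Th Y') (Thm X' Y' \<alpha>)) (Fm X X' a)"
      using Fm_comp[OF ob(1,2) ob'(2) u ar(2)] Fm_comp[OF ob(1) ob' ar(1), of "SK.cls X' Y' \<alpha>"] ob'
          al
      by (simp add: sq1 Fm_cls)
    have "Fm Y ?Z (ccomp SK.Q Y Z ?Z c v) = Fm Y ?Z (ccomp SK.Q Y Y' ?Z ?v b)" by (simp only: sq2)
    then have F2: "ccomp E.Q (Th Y) (Th Z) (Th ?Z) (Fm Z ?Z c) (Fm Y Z v) = ccomp E.Q (Th Y) (Th Y')
        (Th ?Z) (Fm Y' ?Z ?v) (Fm Y Y' b)"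
      by (simp only: Fm_comp[OF ob(2,3) Z' v ar(3)] Fm_comp[OF ob(2) ob'(2) Z' ar(2) vw(1)])
    have "ccomp E.Q (Th Y) (Th Z) ?C (ccomp E.Q (Th Z) (Th ?Z) ?C e (Fm Z ?Z c)) (Fm Y Z v)
      = ccomp E.Q (Th Y) (Th ?Z) ?C e (ccomp E.Q (Th Y) (Th Y') (Th ?Z) (Fm Y' ?Z ?v) (Fm Y Y' b))"
      unfolding F2[symmetric] by (rule QE.comp_assoc) (fact Eob Fi ein)+
    also have "\<dots> = ccomp E.Q (Th Y) (Th Y') ?C (ccomp E.Q (Th Y') (Th ?Z) ?C e (Fm Y' ?Z ?v))
        (Fm Y Y' b)"
      by (rule QE.comp_assoc[symmetric]) (fact Eob Fi ein)+
    finally show "ccomp E.Q (Th Y) (Th Z) ?C (ccomp E.Q (Th Z) (Th ?Z) ?C e (Fm Z ?Z c)) (Fm Y Z v)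
      = ccomp E.Q (Th Y) (Th Y') ?C (E.cls (Th Y') ?C (cone_in A.ZC (twist (Th X')) (Th Y')))
          (Fm Y Y' b)"
      unfolding e1 .
    have "Fm Z (sh X') (ccomp SK.Q Z (sh X) (sh X') (shift_map ` a) w) = Fm Z (sh X')
        (ccomp SK.Q Z ?Z (sh X') ?w c)"
      by (simp only: sq3)
    then have F3: "ccomp E.Q (Th Z) (Th (sh X)) (Th (sh X')) (Fm (sh X) (sh X') (shift_map ` a))
        (Fm Z (sh X) w)
      = ccomp E.Q (Th Z) (Th ?Z) (Th (sh X')) (Fm ?Z (sh X') ?w) (Fm Z ?Z c)"
      by (simp only: Fm_comp[OF ob(3) s w sa] Fm_comp[OF ob(3) Z' s(2) ar(3) vw(2)])
    \<comment> \<open>The last square is pasted from three: naturality of \<open>Phi\<close> moves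
      the suspension of a to the other side, \<open>F3\<close> is the image of the original square,
      and \<open>e2\<close> replaces \<open>Phi\<close> and the image of the projection by the
      projection of the new cone.\<close>
    have "ccomp E.Q (Th Z) (sus (Th X)) (sus (Th X')) ((shift_map \<circ> twist_map) ` Fm X X' a)
        (ccomp E.Q (Th Z) (Th (sh X)) (sus (Th X)) (Phi X) (Fm Z (sh X) w))
      = ccomp E.Q (Th Z) (Th (sh X)) (sus (Th X')) (ccomp E.Q (Th (sh X)) (sus (Th X)) (sus (Th X'))
          ((shift_map \<circ> twist_map) ` Fm X X' a) (Phi X)) (Fm Z (sh X) w)"
      by (rule QE.comp_assoc[symmetric]) (fact Eob Fi Ph sFa)+
    also have "\<dots> = ccomp E.Q (Th Z) (Th (sh X)) (sus (Th X'))
        (ccomp E.Q (Th (sh X)) (Th (sh X')) (sus (Th X'))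
          (Phi X') (Fm (sh X) (sh X') (shift_map ` a))) (Fm Z (sh X) w)"
      by (simp only: Phi_natural[OF ob(1) ob'(1) ar(1)])
    also have "\<dots> = ccomp E.Q (Th Z) (Th (sh X')) (sus (Th X')) (Phi X')
        (ccomp E.Q (Th Z) (Th ?Z) (Th (sh X')) (Fm ?Z (sh X') ?w) (Fm Z ?Z c))"
      unfolding F3[symmetric] by (rule QE.comp_assoc) (fact Eob Fi Ph)+
    also have "\<dots> = ccomp E.Q (Th Z) (Th ?Z) (sus (Th X')) (ccomp E.Q (Th ?Z) ?C (sus (Th X')) ?W e)
        (Fm Z ?Z c)"
      unfolding e2 by (rule QE.comp_assoc[symmetric]) (fact Eob Fi Ph)+
    also have "\<dots> = ccomp E.Q (Th Z) ?C (sus (Th X')) ?W (ccomp E.Q (Th Z) (Th ?Z) ?C e (Fm Z ?Z c))"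
      by (rule QE.comp_assoc) (fact Eob Fi ein W)+
    finally show "ccomp E.Q (Th Z) (sus (Th X)) (sus (Th X')) ((shift_map \<circ> twist_map) ` Fm X X' a)
        (ccomp E.Q (Th Z) (Th (sh X)) (sus (Th X)) (Phi X) (Fm Z (sh X) w))
      = ccomp E.Q (Th Z) ?C (sus (Th X')) ?W (ccomp E.Q (Th Z) (Th ?Z) ?C e (Fm Z ?Z c))" .
  qed (use ob ob' in simp_all)
qed

lemma Fm_triangle_functor: "triangle_functor (K_tri ST) (K_eta A) Th Fm"
  unfolding triangle_functor_def K_tri_sel K_eta_sel cat_iso_tri
  by (intro conjI Fm_additive exI[of _ Phi] ballI allI impI)
    (simp_all add: Phi_natural Fm_triangle phi(3)[folded Phi_def])

lemma Fm_induced: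
  "\<lbrakk>X \<in> SX; Y \<in> SX; \<alpha> \<in> Hom CS X Y\<rbrakk>
    \<Longrightarrow> Fm X Y (htp_cls ST X Y \<alpha>) = eta_cls A (Th X) (Th Y) (Thm X Y \<alpha>)"
  unfolding htp_cls_def eta_cls_def by (rule Fm_cls)

end

theorem proposition4p8:
  fixes R :: "'a ring"
    and T :: "('a, 'b) mcplx"
    and Th :: "('a, 'b) scplx \<Rightarrow> (('a, 'b) mdl, ('a, 'b) mmap) zcplx"
    and Thm :: "('a, 'b) scplx \<Rightarrow> ('a, 'b) scplx \<Rightarrow> ('a, 'b) smap \<Rightarrow> ('a, 'b) mmap zmap"
  assumes "ring R"
    and "tilting_complex R T"
    and "is_Theta R T Th Thm"
  shows "\<exists>Fm.
    (\<forall>X \<in> Ob (Cx (SumT R T)). \<forall>Y \<in> Ob (Cx (SumT R T)). \<forall>\<alpha> \<in> Hom (Cx (SumT R T)) X Y.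
       Fm X Y (htp_cls (SumT R T) X Y \<alpha>) = eta_cls (Proj R) (Th X) (Th Y) (Thm X Y \<alpha>)) \<and>
    triangle_functor (K_tri (SumT R T)) (K_eta (Proj R)) Th Fm"
proof -
  interpret Theta R T Th Thm
    using assms by unfold_locales
  show ?thesis
    using Fm_induced Fm_triangle_functor by blast
qed

end
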